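(* Let $(X_t)_{t\in\mathbb{Z}}$ satisfy the process assumptions (A1), let $\varphi$ satisfy (A2), let the block length $b=b(n)$ satisfy (B1) and (B2), and let the spectral density estimator $\widehat f_n$ satisfy (C) (all listed in the context). Assume also that the central limit theorem $$L_n=\sqrt{n}\,\big(M(\varphi,I_n)-M(\varphi,f)\big)\stackrel{d}{\longrightarrow}\mathcal N(0,\tau^2),\qquad \tau^2=\tau_1^2+\tau_2,$$ holds. Then, as $n\to\infty$: (i) $\mathrm{Var}^*(\widetilde V_n^* )\stackrel{P}{\longrightarrow}\tau^2$; (ii) $\sup_{x\in\mathbb{R}}\big|P^*(\widetilde V_n^*\le x)-P(L_n\le x)\big|=o_P(1)$; (iii) $\sup_{x\in\mathbb{R}}\big|P^*(\widetilde V_{n,R}^*\le x)-P(L_{n,R}\le x)\big|=o_P(1)$.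
   Context: **Process and statistics.** $(X_t)_{t\in\mathbb Z}$ is a real-valued process with autocovariance function $\gamma$ and spectral density $f(\lambda)=\frac1{2\pi}\sum_{h\in\mathbb Z}\gamma(h)e^{-ih\lambda}$. The periodogram of $X_1,\dots,X_n$ is $I_n(\lambda)=\frac{1}{2\pi n}\big|\sum_{t=1}^nX_te^{-i\lambda t}\big|^2$. For integrable functions put $M(\varphi,g)=\int_{-\pi}^{\pi}\varphi(\lambda)g(\lambda)\,d\lambda$ and $R(\varphi,g)=M(\varphi,g)/M(1,g)$. Further $L_n=\sqrt n(M(\varphi,I_n)-M(\varphi,f))$ and $L_{n,R}=\sqrt n(R(\varphi,I_n)-R(\varphi,f))$. **Assumptions.** (A1) $(X_t)$ is strictly stationary, real-valued, with finite eighth moments, mean zero, $\sum_{h\in\mathbb Z}(1+|h|)|\gamma(h)|<\infty$, $\inf_{\lambda\in[0,\pi]}f(\lambda)>0$, $\sum_{h_1,h_2,h_3\in\mathbb Z}(1+|h_1|+|h_2|+|h_3|)\,|\mathrm{cum}(X_0,X_{h_1},X_{h_2},X_{h_3})|<\infty$ and $\sum_{h_1,\dots,h_7\in\mathbb Z}|\mathrm{cum}(X_0,X_{h_1},\dots,X_{h_7})|<\infty$. (A2) $\varphi:[-\pi,\pi]\to\mathbb R$ is square-integrable and of bounded variation. (B1) $n=bk$ with $b=b(n),k=k(n)\in\mathbb N$, $b\to\infty$ and $k\to\infty$ as $n\to\infty$. (B2) $b^3/n\to0$ and $\ln(N)/b\to0$ as $n\to\infty$, where $N=n-b+1$. (C)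 $\widehat f_n$ is an estimator of $f$ based on $X_1,\dots,X_n$, an even function, with $\sup_{\lambda\in[-\pi,\pi]}|\widehat f_n(\lambda)-f(\lambda)|=o_P(1)$. **Limiting variances.** With $f_4(\lambda,\mu,\eta)=\frac{1}{(2\pi)^3}\sum_{h_1,h_2,h_3\in\mathbb Z}\mathrm{cum}(X_0,X_{h_1},X_{h_2},X_{h_3})e^{-i(h_1\lambda+h_2\mu+h_3\eta)}$, $\tau^2=\tau_1^2+\tau_2$ where $$\tau_1^2=2\pi\int_{-\pi}^{\pi}\varphi(\lambda)\big(\varphi(\lambda)+\varphi(-\lambda)\big)f(\lambda)^2\,d\lambda,\qquad \tau_2=2\pi\int_{-\pi}^{\pi}\int_{-\pi}^{\pi}\varphi(\lambda_1)\varphi(\lambda_2)f_4(\lambda_1,\lambda_2,-\lambda_2)\,d\lambda_1d\lambda_2.$$ The limiting variance of $L_{n,R}$, which is asymptotically normal with mean zero, is $\tau_R^2=\tau_{1,R}^2+\tau_{2,R}$ where, with $w(\lambda)=\varphi(\lambda)\int_{-\pi}^{\pi}f(\alpha)d\alpha-\int_{-\pi}^{\pi}\varphi(\alpha)f(\alpha)d\alpha$, $$\tau_{1,R}^2=\frac{2\pi}{M(1,f)^4}\int_{-\pi}^{\pi}w(\lambda)\big(w(\lambda)+w(-\lambda)\big)f(\lambda)^2\,d\lambda,\qquad \tau_{2,R}=\frac{2\pi}{M(1,f)^4}\int_{-\pi}^{\pi}\int_{-\pi}^{\pi}w(\lambda_1)w(\lambda_2)f_4(\lambda_1,\lambda_2,-\lambda_2)\,d\lambda_1d\lambda_2.$$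 **Bootstrap ingredients.** $\mathcal G(m)=\{j\in\mathbb Z:1\le|j|\le[m/2]\}$, $\lambda_{j,m}=2\pi j/m$. Conditionally on the data, let $U_1^*,\dots,U_{[n/2]}^*$ be i.i.d. standard exponential, $U_{j}^*=U_{-j}^*$ for $j<0$, and let $i_1^*,\dots,i_k^*$ be i.i.d. uniform on $\{1,\dots,N\}$, independent of the $U_j^*$. Put $T^*(\lambda_{j,n})=\widehat f_n(\lambda_{j,n})U_j^*$. For $t=1,\dots,N$ let $I_{t,b}(\lambda)=\frac1{2\pi b}\big|\sum_{s=1}^bX_{t+s-1}e^{-i\lambda s}\big|^2$, $\widetilde f_b(\lambda)=\frac1N\sum_{t=1}^NI_{t,b}(\lambda)$, and for $j\in\mathcal G(b)$ $$I_{j,b}^*=\frac1k\sum_{l=1}^k\widehat f_n(\lambda_{j,b})\frac{I_{i_l^*,b}(\lambda_{j,b})}{\widetilde f_b(\lambda_{j,b})}.$$ $P^*,\mathrm{Var}^*$ denote probability and variance conditional on $X_1,\dots,X_n$. **Hybrid bootstrap, spectral means.** $$V_n^*=\frac{2\pi}{\sqrt n}\sum_{j\in\mathcal G(n)}\varphi(\lambda_{j,n})\big(T^*(\lambda_{j,n})-\widehat f_n(\lambda_{j,n})\big),\qquad L_n^*=\sqrt n\,\frac{2\pi}{b}\sum_{j\in\mathcal G(b)}\varphi(\lambda_{j,b})\big(I_{j,b}^*-\widehat f_n(\lambda_{j,b})\big),$$ $$c_n=\frac{4\pi^2}{b}\sum_{j\in\mathcal G(b)}\varphi(\lambda_{j,b})\big(\varphi(\lambda_{j,b})+\varphi(-\lambda_{j,b})\big)\widehat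 f_n(\lambda_{j,b})^2\Big(\frac1N\sum_{t=1}^N\frac{I_{t,b}(\lambda_{j,b})^2}{\widetilde f_b(\lambda_{j,b})^2}-1\Big),$$ $\widehat\tau_1^2=\mathrm{Var}^*(V_n^* )$, $\widehat\tau^2=\mathrm{Var}^*(L_n^*+V_n^* )-c_n$, and $\widetilde V_n^*=(\widehat\tau/\widehat\tau_1)V_n^*$. **Hybrid bootstrap, ratio statistics.** Let $$\widehat w(\lambda)=\varphi(\lambda)\frac{2\pi}n\sum_{j\in\mathcal G(n)}\widehat f_n(\lambda_{j,n})-\frac{2\pi}n\sum_{j\in\mathcal G(n)}\varphi(\lambda_{j,n})\widehat f_n(\lambda_{j,n}),\quad \widetilde w(\lambda)=\varphi(\lambda)\frac{2\pi}b\sum_{j\in\mathcal G(b)}\widehat f_n(\lambda_{j,b})-\frac{2\pi}b\sum_{j\in\mathcal G(b)}\varphi(\lambda_{j,b})\widehat f_n(\lambda_{j,b}),$$ $$V_{1,n}^*=\frac{2\pi}{\sqrt n}\sum_{j\in\mathcal G(n)}\widehat w(\lambda_{j,n})T^*(\lambda_{j,n}),\quad V_{2,n}^*=\sqrt n\,\frac{2\pi}b\sum_{j\in\mathcal G(b)}\widetilde w(\lambda_{j,b})I_{j,b}^*,\quad V_{3,n}^*=V_{1,n}^*+V_{2,n}^*,$$ $$D_n^*=\frac{2\pi}n\sum_{j\in\mathcal G(n)}T^*(\lambda_{j,n})\cdot\frac{2\pi}n\sum_{j\in\mathcal G(n)}\widehat f_n(\lambda_{j,n}),\qquad V_{n,R}^*=V_{1,n}^*/D_n^*,$$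 $$c_{n,R}=\frac{4\pi^2}{b}\sum_{j\in\mathcal G(b)}\widetilde w(\lambda_{j,b})\big(\widetilde w(\lambda_{j,b})+\widetilde w(-\lambda_{j,b})\big)\widehat f_n(\lambda_{j,b})^2\Big(\frac1N\sum_{t=1}^N\frac{I_{t,b}(\lambda_{j,b})^2}{\widetilde f_b(\lambda_{j,b})^2}-1\Big),$$ $\widehat\sigma_{1,R}^2=\mathrm{Var}^*(V_{1,n}^* )$, $\widehat\sigma_R^2=\mathrm{Var}^*(V_{3,n}^* )-c_{n,R}$, and $\widetilde V_{n,R}^*=(\widehat\sigma_R/\widehat\sigma_{1,R})V_{n,R}^*$.
   Formalization: Part (ii) is stated for τ² > 0, and part (iii) for τ_R² > 0 with the asymptotic normality of L_{n,R} as a premise; both fail in the degenerate case (φ the indicator of {±2π/3}, 3 dividing b). Limits run along an increasing sequence of n with n = bk. *)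

theory Defs
  imports "HOL-Probability.Probability" "HOL-Library.Disjoint_Sets"
begin

section \<open>Stationary processes, cumulants and spectral densities\<close>

definition strictly_stationary :: "'w measure \<Rightarrow> (int \<Rightarrow> 'w \<Rightarrow> real) \<Rightarrow> bool" where
  "strictly_stationary M X \<longleftrightarrow>
     (\<forall>J h. finite J \<longrightarrow>
        distr M (Pi\<^sub>M J (\<lambda>_. borel)) (\<lambda>\<omega>. \<lambda>t\<in>J. X (t + h) \<omega>) =
        distr M (Pi\<^sub>M J (\<lambda>_. borel)) (\<lambda>\<omega>. \<lambda>t\<in>J. X t \<omega>))"

definition autocov :: "'w measure \<Rightarrow> (int \<Rightarrow> 'w \<Rightarrow> real) \<Rightarrow> int \<Rightarrow> real" where
  "autocov M X h = (\<integral>\<omega>. (X 0 \<omega> - (\<integral>\<omega>'. X 0 \<omega>' \<partial>M)) * (X h \<omega> - (\<integral>\<omega>'. X h \<omega>' \<partial>M)) \<partial>M)"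

text \<open>
  The joint cumulant of the random variables in the list \<open>Ys\<close>, by the Leonov--Shiryaev
  formula; the sum runs over the set partitions of the index set.
\<close>
definition joint_cumulant :: "'w measure \<Rightarrow> ('w \<Rightarrow> real) list \<Rightarrow> real" where
  "joint_cumulant M Ys =
     (\<Sum>P | partition_on {..<length Ys} P.
        (-1) ^ (card P - 1) * fact (card P - 1) * (\<Prod>B\<in>P. \<integral>\<omega>. (\<Prod>i\<in>B. (Ys ! i) \<omega>) \<partial>M))"

text \<open>\<open>cum(X\<^sub>0, X\<^bsub>h\<^sub>1\<^esub>, \<dots>)\<close> for the list \<open>hs\<close> of lags.\<close>
definition lag_cumulant :: "'w measure \<Rightarrow> (int \<Rightarrow> 'w \<Rightarrow> real) \<Rightarrow> int list \<Rightarrow> real" where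
  "lag_cumulant M X hs = joint_cumulant M (map X (0 # hs))"

text \<open>The series is real because \<open>autocov\<close> is even in the stationary case; \<open>Re\<close> is only a cast.\<close>
definition spectral_density :: "'w measure \<Rightarrow> (int \<Rightarrow> 'w \<Rightarrow> real) \<Rightarrow> real \<Rightarrow> real" where
  "spectral_density M X \<theta> =
     Re (\<Sum>\<^sub>\<infinity>h\<in>UNIV. complex_of_real (autocov M X h) * cis (- (of_int h * \<theta>))) / (2 * pi)"

definition spectral_density4 ::
    "'w measure \<Rightarrow> (int \<Rightarrow> 'w \<Rightarrow> real) \<Rightarrow> real \<Rightarrow> real \<Rightarrow> real \<Rightarrow> complex" where
  "spectral_density4 M X \<theta> \<mu> \<eta> =
     (\<Sum>\<^sub>\<infinity>(h1, h2, h3)\<in>UNIV. complex_of_real (lag_cumulant M X [h1, h2, h3]) *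
        cis (- (of_int h1 * \<theta> + of_int h2 * \<mu> + of_int h3 * \<eta>))) / complex_of_real ((2 * pi) ^ 3)"

definition bounded_variation_on :: "real \<Rightarrow> real \<Rightarrow> (real \<Rightarrow> real) \<Rightarrow> bool" where
  "bounded_variation_on a b g \<longleftrightarrow>
     (\<exists>C. \<forall>m (x :: nat \<Rightarrow> real).
        (\<forall>i\<le>m. x i \<in> {a..b}) \<and> (\<forall>i<m. x i \<le> x (Suc i)) \<longrightarrow>
        (\<Sum>i<m. \<bar>g (x (Suc i)) - g (x i)\<bar>) \<le> C)"


section \<open>Spectral means, ratio statistics and their limiting variances\<close>

definition spectral_mean :: "(real \<Rightarrow> real) \<Rightarrow> (real \<Rightarrow> real) \<Rightarrow> real" where
  "spectral_mean \<phi> g = (LBINT \<theta>:{-pi..pi}. \<phi> \<theta> * g \<theta>)"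

definition ratio_stat :: "(real \<Rightarrow> real) \<Rightarrow> (real \<Rightarrow> real) \<Rightarrow> real" where
  "ratio_stat \<phi> g = spectral_mean \<phi> g / spectral_mean (\<lambda>_. 1) g"

definition sample :: "(int \<Rightarrow> 'w \<Rightarrow> real) \<Rightarrow> nat \<Rightarrow> 'w \<Rightarrow> nat \<Rightarrow> real" where
  "sample X n \<omega> = (\<lambda>t\<in>{1..n}. X (int t) \<omega>)"

definition periodogram :: "nat \<Rightarrow> (nat \<Rightarrow> real) \<Rightarrow> real \<Rightarrow> real" where
  "periodogram n x \<theta> =
     (cmod (\<Sum>t=1..n. complex_of_real (x t) * cis (- (\<theta> * real t))))\<^sup>2 / (2 * pi * real n)"

definition L_stat ::
    "'w measure \<Rightarrow> (int \<Rightarrow> 'w \<Rightarrow> real) \<Rightarrow> (real \<Rightarrow> real) \<Rightarrow> nat \<Rightarrow> 'w \<Rightarrow> real" where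
  "L_stat M X \<phi> n \<omega> =
     sqrt (real n) * (spectral_mean \<phi> (periodogram n (sample X n \<omega>)) -
                      spectral_mean \<phi> (spectral_density M X))"

definition LR_stat ::
    "'w measure \<Rightarrow> (int \<Rightarrow> 'w \<Rightarrow> real) \<Rightarrow> (real \<Rightarrow> real) \<Rightarrow> nat \<Rightarrow> 'w \<Rightarrow> real" where
  "LR_stat M X \<phi> n \<omega> =
     sqrt (real n) * (ratio_stat \<phi> (periodogram n (sample X n \<omega>)) -
                      ratio_stat \<phi> (spectral_density M X))"

definition var_part1 :: "(real \<Rightarrow> real) \<Rightarrow> (real \<Rightarrow> real) \<Rightarrow> real" where
  "var_part1 f \<phi> = 2 * pi * (LBINT \<theta>:{-pi..pi}. \<phi> \<theta> * (\<phi> \<theta> + \<phi> (-\<theta>)) * (f \<theta>)\<^sup>2)"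

text \<open>
  For a stationary process \<open>f\<^sub>4(\<theta>\<^sub>1, \<theta>\<^sub>2, -\<theta>\<^sub>2)\<close> is real by the symmetries of the cumulants, so
  \<open>Re\<close> is again only a cast.
\<close>
definition var_part2 :: "(real \<Rightarrow> real \<Rightarrow> real \<Rightarrow> complex) \<Rightarrow> (real \<Rightarrow> real) \<Rightarrow> real" where
  "var_part2 f4 \<phi> =
     2 * pi * (LBINT \<theta>1:{-pi..pi}. (LBINT \<theta>2:{-pi..pi}. \<phi> \<theta>1 * \<phi> \<theta>2 * Re (f4 \<theta>1 \<theta>2 (-\<theta>2))))"

definition tau_sq :: "'w measure \<Rightarrow> (int \<Rightarrow> 'w \<Rightarrow> real) \<Rightarrow> (real \<Rightarrow> real) \<Rightarrow> real" where
  "tau_sq M X \<phi> =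
     var_part1 (spectral_density M X) \<phi> + var_part2 (spectral_density4 M X) \<phi>"

definition ratio_weight :: "(real \<Rightarrow> real) \<Rightarrow> (real \<Rightarrow> real) \<Rightarrow> real \<Rightarrow> real" where
  "ratio_weight f \<phi> \<theta> =
     \<phi> \<theta> * (LBINT \<alpha>:{-pi..pi}. f \<alpha>) - (LBINT \<alpha>:{-pi..pi}. \<phi> \<alpha> * f \<alpha>)"

definition tauR_sq :: "'w measure \<Rightarrow> (int \<Rightarrow> 'w \<Rightarrow> real) \<Rightarrow> (real \<Rightarrow> real) \<Rightarrow> real" where
  "tauR_sq M X \<phi> =
     (let f = spectral_density M X; w = ratio_weight f \<phi>; m = spectral_mean (\<lambda>_. 1) f in
        var_part1 f w / m ^ 4 + var_part2 (spectral_density4 M X) w / m ^ 4)"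


section \<open>Modes of convergence\<close>

text \<open>
  The law \<open>\<N>(0, v)\<close>, \<open>v \<ge> 0\<close>, as the law of \<open>sqrt v * Z\<close> with \<open>Z\<close> standard normal, so that
  \<open>v = 0\<close> gives the point mass at \<open>0\<close>.
\<close>
definition centered_normal :: "real \<Rightarrow> real measure" where
  "centered_normal v = distr std_normal_distribution borel (\<lambda>z. sqrt v * z)"

text \<open>
  \<open>Y\<^sub>m = o\<^sub>P(1)\<close> for nonnegative (possibly infinite) \<open>Y\<^sub>m\<close>. The events \<open>{Y\<^sub>m > \<epsilon>}\<close> are covered by
  measurable ones, i.e. outer probability is used: \<open>Y\<^sub>m\<close> may be an uncountable supremum, and
  \<open>measure M A = 0\<close> for every nonmeasurable \<open>A\<close>. If the \<open>Y\<^sub>m\<close> are measurable this is ordinary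
  convergence to \<open>0\<close> in probability.
\<close>
definition small_oP :: "'w measure \<Rightarrow> (nat \<Rightarrow> 'w \<Rightarrow> ennreal) \<Rightarrow> bool" where
  "small_oP M Y \<longleftrightarrow>
     (\<forall>\<epsilon>>0. \<exists>A. (\<forall>m. A m \<in> sets M \<and> {\<omega> \<in> space M. Y m \<omega> > ennreal \<epsilon>} \<subseteq> A m) \<and>
               (\<lambda>m. measure M (A m)) \<longlonglongrightarrow> 0)"


section \<open>The hybrid bootstrap, conditional on the data\<close>

text \<open>
  Throughout, \<open>x\<close> is the observed sample \<open>x\<^sub>1, \<dots>, x\<^sub>n\<close>, \<open>fh\<close> the spectral density estimate computed
  from it, and \<open>(u, i)\<close> the bootstrap randomness \<open>(U\<^sub>1\<^sup>*, \<dots>, U\<^bsub>[n/2]\<^esub>\<^sup>*)\<close>, \<open>(i\<^sub>1\<^sup>*, \<dots>, i\<^sub>k\<^sup>*)\<close>. The latter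
  has, given the data, the law \<open>boot n b k\<close>, which does not depend on the data; \<open>P\<^sup>*\<close> and \<open>Var\<^sup>*\<close> are
  probability and variance under \<open>boot n b k\<close> with \<open>x\<close> held fixed.
\<close>

type_synonym draws = "(nat \<Rightarrow> real) \<times> (nat \<Rightarrow> nat)"

definition boot :: "nat \<Rightarrow> nat \<Rightarrow> nat \<Rightarrow> draws measure" where
  "boot n b k =
     Pi\<^sub>M {1..n div 2} (\<lambda>_. density lborel (\<lambda>y. ennreal (exponential_density 1 y))) \<Otimes>\<^sub>M
     Pi\<^sub>M {1..k} (\<lambda>_. measure_pmf (pmf_of_set {1..n - b + 1}))"

definition bprob :: "nat \<Rightarrow> nat \<Rightarrow> nat \<Rightarrow> (draws \<Rightarrow> bool) \<Rightarrow> real" where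
  "bprob n b k Q = measure (boot n b k) {d \<in> space (boot n b k). Q d}"

definition bvar :: "nat \<Rightarrow> nat \<Rightarrow> nat \<Rightarrow> (draws \<Rightarrow> real) \<Rightarrow> real" where
  "bvar n b k Y =
     (\<integral>d. (Y d - (\<integral>d'. Y d' \<partial>boot n b k))\<^sup>2 \<partial>boot n b k)"

definition GG :: "nat \<Rightarrow> int set" where
  "GG m = {j. 1 \<le> \<bar>j\<bar> \<and> \<bar>j\<bar> \<le> int (m div 2)}"

definition ffreq :: "int \<Rightarrow> nat \<Rightarrow> real" where
  "ffreq j m = 2 * pi * of_int j / real m"

definition block_pgram :: "nat \<Rightarrow> (nat \<Rightarrow> real) \<Rightarrow> nat \<Rightarrow> real \<Rightarrow> real" where
  "block_pgram b x t = periodogram b (\<lambda>s. x (t + s - 1))"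

definition mean_block_pgram :: "nat \<Rightarrow> nat \<Rightarrow> (nat \<Rightarrow> real) \<Rightarrow> real \<Rightarrow> real" where
  "mean_block_pgram n b x \<theta> =
     (\<Sum>t=1..n - b + 1. block_pgram b x t \<theta>) / real (n - b + 1)"

definition T_star :: "nat \<Rightarrow> (real \<Rightarrow> real) \<Rightarrow> int \<Rightarrow> draws \<Rightarrow> real" where
  "T_star n fh j = (\<lambda>(u, i). fh (ffreq j n) * u (nat \<bar>j\<bar>))"

definition I_star ::
    "nat \<Rightarrow> nat \<Rightarrow> nat \<Rightarrow> (real \<Rightarrow> real) \<Rightarrow> (nat \<Rightarrow> real) \<Rightarrow> int \<Rightarrow> draws \<Rightarrow> real" where
  "I_star n b k fh x j = (\<lambda>(u, i).
     (\<Sum>l=1..k. fh (ffreq j b) * (block_pgram b x (i l) (ffreq j b) /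
                                  mean_block_pgram n b x (ffreq j b))) / real k)"

text \<open>
  The correction terms \<open>c\<^sub>n\<close> (for \<open>g = \<phi>\<close>) and \<open>c\<^bsub>n,R\<^esub>\<close> (for \<open>g\<close> the weight \<open>w_tilde\<close> below).
\<close>
definition c_corr ::
    "nat \<Rightarrow> nat \<Rightarrow> (real \<Rightarrow> real) \<Rightarrow> (nat \<Rightarrow> real) \<Rightarrow> (real \<Rightarrow> real) \<Rightarrow> real" where
  "c_corr n b fh x g =
     4 * pi\<^sup>2 / real b *
     (\<Sum>j\<in>GG b. g (ffreq j b) * (g (ffreq j b) + g (- ffreq j b)) * (fh (ffreq j b))\<^sup>2 *
        ((\<Sum>t=1..n - b + 1. (block_pgram b x t (ffreq j b))\<^sup>2 /
            (mean_block_pgram n b x (ffreq j b))\<^sup>2) / real (n - b + 1) - 1))"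


subsection \<open>Spectral means\<close>

definition V_star :: "(real \<Rightarrow> real) \<Rightarrow> nat \<Rightarrow> (real \<Rightarrow> real) \<Rightarrow> draws \<Rightarrow> real" where
  "V_star \<phi> n fh d =
     2 * pi / sqrt (real n) *
     (\<Sum>j\<in>GG n. \<phi> (ffreq j n) * (T_star n fh j d - fh (ffreq j n)))"

definition L_star ::
    "(real \<Rightarrow> real) \<Rightarrow> nat \<Rightarrow> nat \<Rightarrow> nat \<Rightarrow> (real \<Rightarrow> real) \<Rightarrow> (nat \<Rightarrow> real) \<Rightarrow> draws \<Rightarrow> real" where
  "L_star \<phi> n b k fh x d =
     sqrt (real n) * (2 * pi / real b) *
     (\<Sum>j\<in>GG b. \<phi> (ffreq j b) * (I_star n b k fh x j d - fh (ffreq j b)))"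

definition tau1_hat_sq ::
    "(real \<Rightarrow> real) \<Rightarrow> nat \<Rightarrow> nat \<Rightarrow> nat \<Rightarrow> (real \<Rightarrow> real) \<Rightarrow> real" where
  "tau1_hat_sq \<phi> n b k fh = bvar n b k (V_star \<phi> n fh)"

definition tau_hat_sq ::
    "(real \<Rightarrow> real) \<Rightarrow> nat \<Rightarrow> nat \<Rightarrow> nat \<Rightarrow> (real \<Rightarrow> real) \<Rightarrow> (nat \<Rightarrow> real) \<Rightarrow> real" where
  "tau_hat_sq \<phi> n b k fh x =
     bvar n b k (\<lambda>d. L_star \<phi> n b k fh x d + V_star \<phi> n fh d) - c_corr n b fh x \<phi>"

text \<open>
  \<open>tau_hat_sq\<close> (and \<open>sigmaR_hat_sq\<close> below) may be negative in finite samples. There \<open>sqrt\<close> is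
  Isabelle's odd extension of the square root.
\<close>
definition V_tilde ::
    "(real \<Rightarrow> real) \<Rightarrow> nat \<Rightarrow> nat \<Rightarrow> nat \<Rightarrow> (real \<Rightarrow> real) \<Rightarrow> (nat \<Rightarrow> real) \<Rightarrow> draws \<Rightarrow> real" where
  "V_tilde \<phi> n b k fh x d =
     sqrt (tau_hat_sq \<phi> n b k fh x) / sqrt (tau1_hat_sq \<phi> n b k fh) * V_star \<phi> n fh d"


subsection \<open>Ratio statistics\<close>

definition grid_weight :: "(real \<Rightarrow> real) \<Rightarrow> nat \<Rightarrow> (real \<Rightarrow> real) \<Rightarrow> real \<Rightarrow> real" where
  "grid_weight \<phi> m fh \<theta> =
     \<phi> \<theta> * (2 * pi / real m * (\<Sum>j\<in>GG m. fh (ffreq j m))) -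
     2 * pi / real m * (\<Sum>j\<in>GG m. \<phi> (ffreq j m) * fh (ffreq j m))"

abbreviation w_hat :: "(real \<Rightarrow> real) \<Rightarrow> nat \<Rightarrow> (real \<Rightarrow> real) \<Rightarrow> real \<Rightarrow> real" where
  "w_hat \<phi> n fh \<equiv> grid_weight \<phi> n fh"

abbreviation w_tilde :: "(real \<Rightarrow> real) \<Rightarrow> nat \<Rightarrow> (real \<Rightarrow> real) \<Rightarrow> real \<Rightarrow> real" where
  "w_tilde \<phi> b fh \<equiv> grid_weight \<phi> b fh"

definition V1_star :: "(real \<Rightarrow> real) \<Rightarrow> nat \<Rightarrow> (real \<Rightarrow> real) \<Rightarrow> draws \<Rightarrow> real" where
  "V1_star \<phi> n fh d =
     2 * pi / sqrt (real n) * (\<Sum>j\<in>GG n. w_hat \<phi> n fh (ffreq j n) * T_star n fh j d)"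

definition V2_star ::
    "(real \<Rightarrow> real) \<Rightarrow> nat \<Rightarrow> nat \<Rightarrow> nat \<Rightarrow> (real \<Rightarrow> real) \<Rightarrow> (nat \<Rightarrow> real) \<Rightarrow> draws \<Rightarrow> real" where
  "V2_star \<phi> n b k fh x d =
     sqrt (real n) * (2 * pi / real b) *
     (\<Sum>j\<in>GG b. w_tilde \<phi> b fh (ffreq j b) * I_star n b k fh x j d)"

definition V3_star ::
    "(real \<Rightarrow> real) \<Rightarrow> nat \<Rightarrow> nat \<Rightarrow> nat \<Rightarrow> (real \<Rightarrow> real) \<Rightarrow> (nat \<Rightarrow> real) \<Rightarrow> draws \<Rightarrow> real" where
  "V3_star \<phi> n b k fh x d = V1_star \<phi> n fh d + V2_star \<phi> n b k fh x d"

definition D_star :: "nat \<Rightarrow> (real \<Rightarrow> real) \<Rightarrow> draws \<Rightarrow> real" where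
  "D_star n fh d =
     (2 * pi / real n * (\<Sum>j\<in>GG n. T_star n fh j d)) *
     (2 * pi / real n * (\<Sum>j\<in>GG n. fh (ffreq j n)))"

definition VR_star :: "(real \<Rightarrow> real) \<Rightarrow> nat \<Rightarrow> (real \<Rightarrow> real) \<Rightarrow> draws \<Rightarrow> real" where
  "VR_star \<phi> n fh d = V1_star \<phi> n fh d / D_star n fh d"

definition sigma1R_hat_sq ::
    "(real \<Rightarrow> real) \<Rightarrow> nat \<Rightarrow> nat \<Rightarrow> nat \<Rightarrow> (real \<Rightarrow> real) \<Rightarrow> real" where
  "sigma1R_hat_sq \<phi> n b k fh = bvar n b k (V1_star \<phi> n fh)"

definition sigmaR_hat_sq ::
    "(real \<Rightarrow> real) \<Rightarrow> nat \<Rightarrow> nat \<Rightarrow> nat \<Rightarrow> (real \<Rightarrow> real) \<Rightarrow> (nat \<Rightarrow> real) \<Rightarrow> real" where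
  "sigmaR_hat_sq \<phi> n b k fh x =
     bvar n b k (V3_star \<phi> n b k fh x) - c_corr n b fh x (w_tilde \<phi> b fh)"

definition VR_tilde ::
    "(real \<Rightarrow> real) \<Rightarrow> nat \<Rightarrow> nat \<Rightarrow> nat \<Rightarrow> (real \<Rightarrow> real) \<Rightarrow> (nat \<Rightarrow> real) \<Rightarrow> draws \<Rightarrow> real" where
  "VR_tilde \<phi> n b k fh x d =
     sqrt (sigmaR_hat_sq \<phi> n b k fh x) / sqrt (sigma1R_hat_sq \<phi> n b k fh) * VR_star \<phi> n fh d"

end

theory Submission
  imports Defs
begin

text \<open>
  Given the data, every bootstrap statistic is a weighted sum of the centred exponential variables
  plus an average of i.i.d. blocks, so \<open>Var\<^sup>*\<close> can be computed exactly. The correction \<open>c\<^sub>n\<close> removes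
  precisely the terms \<open>j' = j\<close> and \<open>j' = -j\<close> of the block part; what is added to the variance of
  \<open>V\<^sub>n\<^sup>*\<close> is \<open>4 pi\<^sup>2 / b\<close> times the sum, over the other pairs of Fourier frequencies, of weights times
  the empirical covariance of the block periodograms. In \<open>L\<^sup>1\<close> each empirical covariance differs from
  the true one by \<open>O(sqrt (b / N + 1 / b\<^sup>3))\<close>, so that \<open>b\<^sup>3 / n \<rightarrow> 0\<close> makes the whole error vanish; this
  rests on a variance bound for averages of products of four linear forms, obtained from the
  cumulant expansion of eighth moments. The true covariances at distinct frequencies have a Gaussian
  part \<open>O(1 / b\<^sup>2)\<close> and a fourth order part whose weighted sum converges to \<open>\<tau>\<^sub>2\<close>.

  Applied to the true covariances, the same computation shows that the limiting variance is nonnegative, and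
  that it vanishes together with its first part \<open>\<tau>\<^sub>1\<^sup>2\<close>: then \<open>\<phi>\<close> is odd almost everywhere. Hence
  the rescaling is harmless, and asymptotic normality is a central limit theorem for weighted sums
  of exponential variables.
\<close>

text \<open>The obstacle is the number of frequency pairs: about \<open>b\<close>^2 of them, against
  a prefactor of order 1 / \<open>b\<close>, so the empirical covariances have to be accurate to o(1
  / \<open>b\<close>) on average. The stated rate meets this since \<open>b\<close> * sqrt
  (\<open>b\<close> / N + 1 / \<open>b\<close>^3) = sqrt (\<open>b\<close>^3 / N + 1 /
  \<open>b\<close>). Its first term reflects the overlap of the blocks: N overlapping blocks of
  length \<open>b\<close> carry about as much information as N / \<open>b\<close> independent ones.
  Its second term is an eighth order cumulant: eight normalisations by sqrt \<open>b\<close>,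
  against \<open>b\<close> times a summable series. The data enter through three nonnegative errors
  only: the uniform error of the spectral estimator, the sum of squared errors of the mean block
  periodograms over the grid, and the summed covariance error divided by \<open>b\<close>. Along any
  sequence of sample points on which these three tend to 0, everything else is deterministic
  analysis. This also avoids every question about measurability of suprema of conditional
  distribution functions.\<close>

section \<open>Cumulants of set functions\<close>

text \<open>The moments are an arbitrary set function \<open>m\<close>, so the same algebra serves
  the joint moments of the data and the factorised moments of independent copies.\<close>

definition set_cumulant :: "('i set \<Rightarrow> real) \<Rightarrow> 'i set \<Rightarrow> real" where
  "set_cumulant m U =
     (\<Sum>P | partition_on U P. (-1) ^ (card P - 1) * fact (card P - 1) * (\<Prod>B\<in>P. m B))"

lemma joint_cumulant_eq_set_cumulant:
  "joint_cumulant M Ys = set_cumulant (\<lambda>B. \<integral>\<omega>. (\<Prod>i\<in>B. (Ys ! i) \<omega>) \<partial>M) {..<length Ys}"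
  by (simp add: joint_cumulant_def set_cumulant_def)

lemma set_cumulant_cong:
  assumes "\<And>B. B \<subseteq> U \<Longrightarrow> B \<noteq> {} \<Longrightarrow> m B = m' B"
  shows "set_cumulant m U = set_cumulant m' U"
  unfolding set_cumulant_def
proof (intro sum.cong refl arg_cong2[where f="(*)"] prod.cong)
  fix P B assume "P \<in> {P. partition_on U P}" "B \<in> P"
  then show "m B = m' B"
    using assms partition_onD1 partition_onD3 by (metis Union_upper mem_Collect_eq)
qed

lemma partition_on_block_of:
  assumes "partition_on U P" "u \<in> U"
  shows "\<exists>!C. C \<in> P \<and> u \<in> C"
proof -
  from assms obtain C where "C \<in> P" "u \<in> C" using partition_onD1 by fastforce
  moreover have "C' = C" if "C' \<in> P" "u \<in> C'" for C'
    using that calculation partition_onD2[OF assms(1)]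
    by (metis disjnt_iff pairwiseD)
  ultimately show ?thesis by blast
qed

text \<open>After expanding the cumulants on the right, a partition \<open>Q\<close> of
  \<open>U\<close> occurs once with coefficient \<open>c (card Q)\<close>, from
  \<open>B = U\<close>, and once with \<open>c (card Q - 1)\<close> for each of its
  \<open>card Q - 1\<close> blocks that avoid \<open>u\<close>. These contributions cancel except
  for the one-block partition.\<close>

lemma set_cumulant_recursion:
  assumes U: "finite U" "u \<in> U" and m0: "m {} = 1"
  shows "m U = (\<Sum>B | B \<subseteq> U \<and> u \<in> B. set_cumulant m B * m (U - B))"
proof -
  define c :: "nat \<Rightarrow> real" where "c k = (-1) ^ (k - 1) * fact (k - 1)" for k
  define PP where "PP B = {P. partition_on B P}" for B :: "'a set"
  have finP: "finite (PP B)" if "B \<subseteq> U" for B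
    unfolding PP_def using that U finite_subset by (intro finitely_many_partition_on) auto
  have fin_el: "finite Q" if "Q \<in> PP U" for Q
    using that U by (auto simp: PP_def intro: finite_elements)
  have kap: "set_cumulant m B = (\<Sum>P\<in>PP B. c (card P) * (\<Prod>C\<in>P. m C))" for B
    by (simp add: set_cumulant_def c_def PP_def)
  define BB where "BB = {B. B \<subset> U \<and> u \<in> B}"
  have finBB: "finite BB" unfolding BB_def using U by (auto intro: finite_subset[of _ "Pow U"])
  have split: "{B. B \<subseteq> U \<and> u \<in> B} = insert U BB" using U by (auto simp: BB_def)
  have "(\<Sum>B\<in>BB. set_cumulant m B * m (U - B)) =
        (\<Sum>B\<in>BB. \<Sum>P\<in>PP B. c (card P) * (\<Prod>C\<in>P. m C) * m (U - B))"
    by (simp add: kap sum_distrib_right)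
  also have "\<dots> = (\<Sum>(B, P)\<in>Sigma BB PP. c (card P) * (\<Prod>C\<in>P. m C) * m (U - B))"
    using finBB finP by (subst sum.Sigma) (auto simp: BB_def)
  \<comment> \<open>A proper subset \<open>B\<close> with a partition \<open>P\<close> of it is the
    same as a partition \<open>Q\<close> of \<open>U\<close> with a marked block
    \<open>C = U - B\<close> avoiding \<open>u\<close>; \<open>Q\<close> has one block more than
    \<open>P\<close>.\<close>
  also have "\<dots> = (\<Sum>(Q, C)\<in>(SIGMA Q:PP U. {C \<in> Q. u \<notin> C}). c (card Q - 1) * (\<Prod>C\<in>Q. m C))"
  proof (rule sum.reindex_bij_witness[where
        i="\<lambda>(Q, C). (U - C, Q - {C})" and j="\<lambda>(B, P). (insert (U - B) P, U - B)"], goal_cases)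
    case (1 a)
    then obtain B P where a: "a = (B, P)" "B \<subset> U" "u \<in> B" "partition_on B P"
      unfolding BB_def PP_def by (cases a) (simp_all add: mem_Sigma_iff)
    then have "U - B \<notin> P" "U - (U - B) = B"
      using partition_onD1[OF a(4)] by blast+
    then show ?case by (simp add: a)
  next
    case (2 a)
    then obtain B P where a: "a = (B, P)" "B \<subset> U" "u \<in> B" "partition_on B P"
      unfolding BB_def PP_def by (cases a) (simp_all add: mem_Sigma_iff)
    have "U - (U - B) = B" using a by blast
    moreover have "disjnt (U - B) (\<Union>P)" using partition_onD1[OF a(4)] by (auto simp: disjnt_iff)
    ultimately have "partition_on U (insert (U - B) P)"
      using a by (subst partition_on_insert) auto
    then show ?case using a by (auto simp: PP_def)
  next
    case (3 b)
    then obtain Q C where b: "b = (Q, C)" "partition_on U Q" "C \<in> Q" "u \<notin> C"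
      by (auto simp: PP_def)
    then have "C \<subseteq> U" using partition_onD1 by blast
    then have "U - (U - C) = C" by blast
    then show ?case using b by (auto simp: insert_absorb)
  next
    case (4 b)
    then obtain Q C where b: "b = (Q, C)" "partition_on U Q" "C \<in> Q" "u \<notin> C"
      by (auto simp: PP_def)
    then have C: "C \<subseteq> U" "C \<noteq> {}" using partition_onD1 partition_onD3 by blast+
    have "disjnt C (\<Union>(Q - {C}))"
      using partition_onD2[OF b(2)] b(3) by (auto simp: disjnt_iff pairwise_def)
    moreover have "insert C (Q - {C}) = Q" using b by blast
    ultimately have "partition_on (U - C) (Q - {C})"
      using b by (metis partition_on_insert)
    then show ?case using b C U by (auto simp: BB_def PP_def)
  next
    case (5 a)
    then obtain B P where a: "a = (B, P)" "B \<subset> U" "u \<in> B" "partition_on B P"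
      unfolding BB_def PP_def by (cases a) (simp_all add: mem_Sigma_iff)
    then have "U - B \<notin> P"
      using partition_onD1[OF a(4)] by blast
    moreover have "finite P" using a U finite_elements finite_subset by (metis psubset_imp_subset)
    ultimately show ?case by (simp add: a)
  qed
  also have "\<dots> = (\<Sum>Q\<in>PP U. \<Sum>C\<in>{C \<in> Q. u \<notin> C}. c (card Q - 1) * (\<Prod>C\<in>Q. m C))"
    using finP[of U] fin_el by (subst sum.Sigma) auto
  also have "\<dots> = (\<Sum>Q\<in>PP U. real (card Q - 1) * c (card Q - 1) * (\<Prod>C\<in>Q. m C))"
  proof (rule sum.cong)
    fix Q assume Q: "Q \<in> PP U"
    obtain C0 where C0: "C0 \<in> Q" "u \<in> C0" "\<And>C. C \<in> Q \<Longrightarrow> u \<in> C \<Longrightarrow> C = C0"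
      using partition_on_block_of[of U Q u] Q U by (auto simp: PP_def)
    have "{C \<in> Q. u \<notin> C} = Q - {C0}" using C0 by blast
    then have "card {C \<in> Q. u \<notin> C} = card Q - 1" using fin_el[OF Q] C0(1) by simp
    then show "(\<Sum>C\<in>{C \<in> Q. u \<notin> C}. c (card Q - 1) * (\<Prod>C\<in>Q. m C))
        = real (card Q - 1) * c (card Q - 1) * (\<Prod>C\<in>Q. m C)" by simp
  qed simp
  finally have A: "(\<Sum>B\<in>BB. set_cumulant m B * m (U - B)) =
    (\<Sum>Q\<in>PP U. real (card Q - 1) * c (card Q - 1) * (\<Prod>C\<in>Q. m C))" .
  have "(\<Sum>B | B \<subseteq> U \<and> u \<in> B. set_cumulant m B * m (U - B)) =
      (\<Sum>Q\<in>PP U. (c (card Q) + real (card Q - 1) * c (card Q - 1)) * (\<Prod>C\<in>Q. m C))"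
  proof -
    have "U \<notin> BB" by (simp add: BB_def)
    then show ?thesis
      unfolding split sum.insert[OF finBB \<open>U \<notin> BB\<close>] A
      by (simp add: m0 kap sum.distrib distrib_right)
  qed
  also have "\<dots> = (\<Sum>Q\<in>PP U. (if Q = {U} then m U else 0))"
  proof (rule sum.cong)
    fix Q assume Q: "Q \<in> PP U"
    then have ne: "Q \<noteq> {}" using U by (auto simp: PP_def partition_on_def)
    show "(c (card Q) + real (card Q - 1) * c (card Q - 1)) * (\<Prod>C\<in>Q. m C)
        = (if Q = {U} then m U else 0)"
    proof (cases "card Q = 1")
      case True
      then obtain C where "Q = {C}" by (auto simp: card_1_singleton_iff)
      then show ?thesis using Q by (auto simp: PP_def partition_on_def c_def)
    next
      case False
      moreover have "card Q \<noteq> 0" using ne fin_el[OF Q] by simp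
      ultimately obtain k where k: "card Q = Suc (Suc k)" by (metis One_nat_def not0_implies_Suc)
      then have "Q \<noteq> {U}" by auto
      moreover have "c (card Q) + real (card Q - 1) * c (card Q - 1) = 0"
        by (simp add: k c_def algebra_simps)
      ultimately show ?thesis by simp
    qed
  qed simp
  also have "\<dots> = m U"
    using finP[of U] U partition_on_space[of U] by (subst sum.delta) (auto simp: PP_def)
  finally show ?thesis ..
qed

text \<open>With \<open>g\<close> and \<open>h\<close> the moments of two independent groups of variables, this is the vanishing of
  mixed cumulants.\<close>
lemma set_cumulant_cross_eq_0:
  fixes g h :: "'i set \<Rightarrow> real"
  assumes "finite U" "g {} = 1" "h {} = 1" "U \<inter> S \<noteq> {}" "U - S \<noteq> {}"
  shows "set_cumulant (\<lambda>B. g (B \<inter> S) * h (B - S)) U = 0"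
  using assms(1,4,5)
proof (induction U rule: finite_psubset_induct)
  case (psubset U)
  define m where "m B = g (B \<inter> S) * h (B - S)" for B
  obtain u where u: "u \<in> U" "u \<in> S" using psubset by blast
  let ?F = "{B. B \<subseteq> U \<and> u \<in> B}"
  let ?G = "{B. B \<subseteq> U \<inter> S \<and> u \<in> B}"
  have finF: "finite ?F" using psubset by (auto intro: finite_subset[of _ "Pow U"])
  \<comment> \<open>The recursion is split by the position of \<open>B\<close>: proper subsets that
    leave \<open>S\<close> fall under the induction hypothesis, subsets of \<open>S\<close> see only
    \<open>g\<close>, and \<open>U\<close> itself is the unknown.\<close>
  have IH: "set_cumulant m B = 0" if "B \<in> ?F - insert U ?G" for B
  proof -
    have "B \<subset> U" "B - S \<noteq> {}" "B \<inter> S \<noteq> {}" using that u by blast+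
    then show ?thesis using psubset.IH[of B] by (simp add: m_def[abs_def])
  qed
  have sub: "insert U ?G \<subseteq> ?F" using u by blast
  have G: "set_cumulant m B * m (U - B) = set_cumulant g B * g (U \<inter> S - B) * h (U - S)"
    if "B \<in> ?G" for B
  proof -
    have "set_cumulant m B = set_cumulant g B"
    proof (rule set_cumulant_cong)
      fix C assume "C \<subseteq> B"
      then have "C \<inter> S = C" "C - S = {}" using that by blast+
      then show "m C = g C" using assms by (metis m_def mult.right_neutral)
    qed
    moreover have "(U - B) \<inter> S = U \<inter> S - B" "(U - B) - S = U - S" using that by blast+
    ultimately show ?thesis by (simp add: m_def)
  qed
  have "m U = (\<Sum>B\<in>?F. set_cumulant m B * m (U - B))"
    using psubset u assms by (intro set_cumulant_recursion) (auto simp: m_def)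
  also have "\<dots> = (\<Sum>B\<in>insert U ?G. set_cumulant m B * m (U - B))"
    using IH finF sub by (intro sum.mono_neutral_right) auto
  also have "\<dots> = set_cumulant m U * m {} + (\<Sum>B\<in>?G. set_cumulant m B * m (U - B))"
    using finF sub psubset by (subst sum.insert) (auto intro: finite_subset)
  also have "(\<Sum>B\<in>?G. set_cumulant m B * m (U - B)) =
      (\<Sum>B\<in>?G. set_cumulant g B * g (U \<inter> S - B)) * h (U - S)"
    unfolding sum_distrib_right by (rule sum.cong) (use G in auto)
  \<comment> \<open>The recursion for \<open>g\<close> shows that the subsets of \<open>S\<close>
    already account for all of \<open>m U\<close>, so nothing is left for the cumulant of
    \<open>U\<close>.\<close>
  also have "(\<Sum>B\<in>?G. set_cumulant g B * g (U \<inter> S - B)) = g (U \<inter> S)"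
    using psubset u assms by (intro set_cumulant_recursion[symmetric]) auto
  finally have "m U = set_cumulant m U * m {} + g (U \<inter> S) * h (U - S)" .
  moreover have "m U = g (U \<inter> S) * h (U - S)" "m {} = 1" using assms by (simp_all add: m_def)
  ultimately have "set_cumulant m U = 0" by simp
  then show ?case by (simp add: m_def[abs_def])
qed

section \<open>Moments and cumulants of linear combinations\<close>

text \<open>The one integrability condition used for the data: it is stable under linear
  combinations and makes products of up to eight factors integrable.\<close>

definition L8 :: "'w measure \<Rightarrow> ('w \<Rightarrow> real) \<Rightarrow> bool" where
  "L8 M Y \<longleftrightarrow> Y \<in> borel_measurable M \<and> integrable M (\<lambda>w. Y w ^ 8)"

lemma L8_borel_measurable: "L8 M Y \<Longrightarrow> Y \<in> borel_measurable M"
  by (simp add: L8_def)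

text \<open>At most eight factors, each at most the maximum of 1 and the largest modulus; the eighth
  power of that maximum is below the right-hand side.\<close>

lemma abs_prod_le_sum_power8:
  fixes y :: "'i \<Rightarrow> real"
  assumes "finite B" "card B \<le> 8"
  shows "\<bar>\<Prod>i\<in>B. y i\<bar> \<le> 1 + (\<Sum>i\<in>B. y i ^ 8)"
proof (cases "B = {}")
  case False
  define m where "m = Max ((\<lambda>i. \<bar>y i\<bar>) ` B)"
  have le: "\<bar>y i\<bar> \<le> m" if "i \<in> B" for i unfolding m_def using assms that by simp
  have "m \<in> (\<lambda>i. \<bar>y i\<bar>) ` B" unfolding m_def using assms False by (intro Max_in) auto
  then obtain i0 where i0: "i0 \<in> B" "m = \<bar>y i0\<bar>" by blast
  have "\<bar>\<Prod>i\<in>B. y i\<bar> \<le> (\<Prod>i\<in>B. max 1 m)"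
    unfolding abs_prod using le by (intro prod_mono) (auto simp: le_max_iff_disj)
  also have "\<dots> \<le> max 1 m ^ 8" using assms by (simp add: power_increasing)
  also have "\<dots> \<le> 1 + m ^ 8"
    using zero_le_power[of m 8] i0 by (cases "m \<le> 1") (auto simp: max_def)
  also have "m ^ 8 \<le> (\<Sum>i\<in>B. y i ^ 8)"
    using i0 assms member_le_sum[of i0 B "\<lambda>i. y i ^ 8"] by auto
  finally show ?thesis by simp
qed auto

lemma L8_cmult: "L8 M Y \<Longrightarrow> L8 M (\<lambda>w. c * Y w)"
  by (auto simp: L8_def power_mult_distrib)

lemma L8_add:
  assumes "L8 M Y" "L8 M Z"
  shows "L8 M (\<lambda>w. Y w + Z w)"
proof -
  have [measurable]: "Y \<in> borel_measurable M" "Z \<in> borel_measurable M"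
    using assms by (auto simp: L8_def)
  have "integrable M (\<lambda>w. (Y w + Z w) ^ 8)"
  proof (rule Bochner_Integration.integrable_bound)
    show "integrable M (\<lambda>w. 2 ^ 8 * (Y w ^ 8 + Z w ^ 8))"
      using assms by (auto simp: L8_def)
    show "AE w in M. norm ((Y w + Z w) ^ 8) \<le> norm (2 ^ 8 * (Y w ^ 8 + Z w ^ 8))"
    proof (rule AE_I2)
      fix w
      have "norm ((Y w + Z w) ^ 8) \<le> (2 * max \<bar>Y w\<bar> \<bar>Z w\<bar>) ^ 8"
        unfolding real_norm_def power_abs by (intro power_mono) auto
      also have "\<dots> \<le> 2 ^ 8 * (\<bar>Y w\<bar> ^ 8 + \<bar>Z w\<bar> ^ 8)"
        by (auto simp: power_mult_distrib max_def)
      finally show "norm ((Y w + Z w) ^ 8) \<le> norm (2 ^ 8 * (Y w ^ 8 + Z w ^ 8))" by simp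
    qed
  qed measurable
  then show ?thesis by (simp add: L8_def)
qed

lemma L8_sum: "finite S \<Longrightarrow> (\<And>s. s \<in> S \<Longrightarrow> L8 M (Y s)) \<Longrightarrow> L8 M (\<lambda>w. \<Sum>s\<in>S. Y s w)"
proof (induction S rule: finite_induct)
  case empty
  then show ?case by (simp add: L8_def)
next
  case (insert x F)
  then show ?case by (simp add: L8_add)
qed

context prob_space
begin

lemma
  assumes "finite B" "card B \<le> 8" "\<And>i. i \<in> B \<Longrightarrow> L8 M (Y i)"
  shows integrable_prod_L8: "integrable M (\<lambda>w. \<Prod>i\<in>B. Y i w)"
    and expectation_prod_L8_le:
      "\<bar>\<integral>w. (\<Prod>i\<in>B. Y i w) \<partial>M\<bar> \<le> 1 + (\<Sum>i\<in>B. \<integral>w. Y i w ^ 8 \<partial>M)"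
proof -
  have [measurable]: "\<And>i. i \<in> B \<Longrightarrow> Y i \<in> borel_measurable M" using assms by (auto simp: L8_def)
  have int: "integrable M (\<lambda>w. 1 + (\<Sum>i\<in>B. Y i w ^ 8))"
    using assms by (auto simp: L8_def)
  show *: "integrable M (\<lambda>w. \<Prod>i\<in>B. Y i w)"
    by (rule Bochner_Integration.integrable_bound[OF int])
       (use assms abs_prod_le_sum_power8 in \<open>auto intro!: AE_I2 order_trans[OF abs_prod_le_sum_power8]\<close>)
  have "\<bar>\<integral>w. (\<Prod>i\<in>B. Y i w) \<partial>M\<bar> \<le> (\<integral>w. \<bar>\<Prod>i\<in>B. Y i w\<bar> \<partial>M)"
    using integral_norm_bound[of M "\<lambda>w. \<Prod>i\<in>B. Y i w"] by simp
  also have "\<dots> \<le> (\<integral>w. 1 + (\<Sum>i\<in>B. Y i w ^ 8) \<partial>M)"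
    using * int assms by (intro integral_mono abs_prod_le_sum_power8) auto
  also have "\<dots> = 1 + (\<Sum>i\<in>B. \<integral>w. Y i w ^ 8 \<partial>M)"
    using assms by (auto simp: L8_def prob_space)
  finally show "\<bar>\<integral>w. (\<Prod>i\<in>B. Y i w) \<partial>M\<bar> \<le> 1 + (\<Sum>i\<in>B. \<integral>w. Y i w ^ 8 \<partial>M)" .
qed

end

definition cumulant_on :: "'w measure \<Rightarrow> ('i \<Rightarrow> 'w \<Rightarrow> real) \<Rightarrow> 'i set \<Rightarrow> real" where
  "cumulant_on M Y U = set_cumulant (\<lambda>B. \<integral>w. (\<Prod>i\<in>B. Y i w) \<partial>M) U"

lemma cumulant_on_cong:
  assumes "\<And>i. i \<in> U \<Longrightarrow> Y i = Z i"
  shows "cumulant_on M Y U = cumulant_on M Z U"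
  unfolding cumulant_on_def using assms
  by (intro set_cumulant_cong Bochner_Integration.integral_cong prod.cong refl) (auto dest: subsetD)

text \<open>In every partition the index \<open>i\<close> lies in exactly one block, so exactly one
  factor of the product depends on the variable with index \<open>i\<close>, and it does so
  linearly.\<close>

lemma (in prob_space) cumulant_on_linear:
  assumes U: "finite U" "card U \<le> 8" "i \<in> U" and S: "finite S"
    and Z: "\<And>s. s \<in> S \<Longrightarrow> L8 M (Z s)" and Y: "\<And>j. j \<in> U \<Longrightarrow> L8 M (Y j)"
  shows "cumulant_on M (Y(i := \<lambda>w. \<Sum>s\<in>S. a s * Z s w)) U =
         (\<Sum>s\<in>S. a s * cumulant_on M (Y(i := Z s)) U)"
proof -
  define c :: "nat \<Rightarrow> real" where "c k = (-1) ^ (k - 1) * fact (k - 1)" for k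
  let ?m = "\<lambda>f B. \<integral>w. (\<Prod>j\<in>B. (Y(i := f)) j w) \<partial>M"
  have "c (card P) * (\<Prod>B\<in>P. ?m (\<lambda>w. \<Sum>s\<in>S. a s * Z s w) B) =
     (\<Sum>s\<in>S. a s * (c (card P) * (\<Prod>B\<in>P. ?m (Z s) B)))" if P: "partition_on U P" for P
  proof -
    have finP: "finite P" using U P finite_elements by blast
    obtain C where C: "C \<in> P" "i \<in> C" and uniq: "\<And>B. B \<in> P \<Longrightarrow> i \<in> B \<Longrightarrow> B = C"
      using partition_on_block_of[OF P U(3)] by blast
    have CU: "C \<subseteq> U" using C P partition_onD1 by blast
    then have finC: "finite C" "card C \<le> 8" using U finite_subset card_mono by (blast, meson le_trans)
    have split: "(\<Prod>j\<in>C. (Y(i := f)) j w) = f w * (\<Prod>j\<in>C - {i}. Y j w)" for f w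
      using C finC by (subst prod.remove[of C i]) (auto intro!: prod.cong)
    have int: "integrable M (\<lambda>w. Z s w * (\<Prod>j\<in>C - {i}. Y j w))" if "s \<in> S" for s
    proof -
      have "integrable M (\<lambda>w. \<Prod>j\<in>C. (Y(i := Z s)) j w)"
        using finC CU Y Z that by (intro integrable_prod_L8) auto
      then show ?thesis by (simp only: split)
    qed
    have "?m (\<lambda>w. \<Sum>s\<in>S. a s * Z s w) C =
        (\<integral>w. (\<Sum>s\<in>S. a s * (Z s w * (\<Prod>j\<in>C - {i}. Y j w))) \<partial>M)"
      unfolding split by (simp add: sum_distrib_right mult.assoc)
    also have "\<dots> = (\<Sum>s\<in>S. a s * ?m (Z s) C)"
      unfolding split using int by simp
    finally have 1: "?m (\<lambda>w. \<Sum>s\<in>S. a s * Z s w) C = (\<Sum>s\<in>S. a s * ?m (Z s) C)" .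
    have 2: "(\<Prod>B\<in>P - {C}. ?m f B) = (\<Prod>B\<in>P - {C}. \<integral>w. (\<Prod>j\<in>B. Y j w) \<partial>M)" for f
      using uniq by (intro prod.cong refl Bochner_Integration.integral_cong) auto
    show ?thesis
      unfolding prod.remove[OF finP C(1)] 1 2 by (simp add: sum_distrib_left sum_distrib_right mult_ac)
  qed
  then show ?thesis
    unfolding cumulant_on_def set_cumulant_def c_def[symmetric]
    by (subst sum_distrib_left, subst sum.swap) (intro sum.cong, auto)
qed

text \<open>Full multilinearity, expanded one index of \<open>D\<close> at a time. The variables
  \<open>W\<close> outside \<open>D\<close> are arbitrary so that an index already expanded can be
  moved there.\<close>

lemma (in prob_space) cumulant_on_sum:
  assumes U: "finite U" "card U \<le> 8" and D: "D \<subseteq> U" and S: "finite S"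
    and Z: "\<And>i s. i \<in> U \<Longrightarrow> s \<in> S \<Longrightarrow> L8 M (Z i s)" and W: "\<And>j. j \<in> U \<Longrightarrow> L8 M (W j)"
  shows "cumulant_on M (\<lambda>i. if i \<in> D then (\<lambda>w. \<Sum>s\<in>S. a i s * Z i s w) else W i) U =
    (\<Sum>g\<in>PiE D (\<lambda>_. S). (\<Prod>i\<in>D. a i (g i)) *
       cumulant_on M (\<lambda>i. if i \<in> D then Z i (g i) else W i) U)"
proof -
  have "finite D" using D U finite_subset by blast
  then show ?thesis using D W
  proof (induction D arbitrary: W rule: finite_induct)
    case empty
    then show ?case by simp
  next
    case (insert x D)
    have x: "x \<in> U" using insert by simp
    let ?L = "\<lambda>i. \<lambda>w. \<Sum>s\<in>S. a i s * Z i s w"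
    have L8L: "L8 M (?L i)" if "i \<in> U" for i using that S Z by (intro L8_sum L8_cmult) auto
    have "cumulant_on M (\<lambda>i. if i \<in> insert x D then ?L i else W i) U =
      cumulant_on M ((\<lambda>i. if i \<in> D then ?L i else W i)(x := ?L x)) U"
      by (rule cumulant_on_cong) auto
    also have "\<dots> = (\<Sum>s\<in>S. a x s * cumulant_on M ((\<lambda>i. if i \<in> D then ?L i else W i)(x := Z x s)) U)"
      using U x S Z L8L insert.prems by (intro cumulant_on_linear) auto
    also have "\<dots> = (\<Sum>s\<in>S. a x s * cumulant_on M (\<lambda>i. if i \<in> D then ?L i else (W(x := Z x s)) i) U)"
      using insert.hyps by (intro sum.cong refl arg_cong2[where f="(*)"] cumulant_on_cong) auto
    also have "\<dots> = (\<Sum>s\<in>S. a x s * (\<Sum>g\<in>PiE D (\<lambda>_. S). (\<Prod>i\<in>D. a i (g i)) *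
       cumulant_on M (\<lambda>i. if i \<in> D then Z i (g i) else (W(x := Z x s)) i) U))"
      using insert.prems Z x by (intro sum.cong refl arg_cong2[where f="(*)"] insert.IH) auto
    also have "\<dots> = (\<Sum>(s, g)\<in>S \<times> PiE D (\<lambda>_. S). a x s * ((\<Prod>i\<in>D. a i (g i)) *
       cumulant_on M (\<lambda>i. if i \<in> D then Z i (g i) else (W(x := Z x s)) i) U))"
      by (simp add: sum_distrib_left sum.cartesian_product)
    also have "\<dots> = (\<Sum>(s, g)\<in>S \<times> PiE D (\<lambda>_. S). (\<Prod>i\<in>insert x D. a i ((g(x := s)) i)) *
       cumulant_on M (\<lambda>i. if i \<in> insert x D then Z i ((g(x := s)) i) else W i) U)"
    proof (intro sum.cong refl, clarify)
      fix s g assume "s \<in> S" "g \<in> PiE D (\<lambda>_. S)"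
      have "(\<Prod>i\<in>insert x D. a i ((g(x := s)) i)) = a x s * (\<Prod>i\<in>D. a i (g i))"
        using insert.hyps by (auto intro!: prod.cong)
      moreover have "cumulant_on M (\<lambda>i. if i \<in> D then Z i (g i) else (W(x := Z x s)) i) U =
        cumulant_on M (\<lambda>i. if i \<in> insert x D then Z i ((g(x := s)) i) else W i) U"
        using insert.hyps by (intro cumulant_on_cong) auto
      ultimately show "a x s * ((\<Prod>i\<in>D. a i (g i)) *
         cumulant_on M (\<lambda>i. if i \<in> D then Z i (g i) else (W(x := Z x s)) i) U) =
         (\<Prod>i\<in>insert x D. a i ((g(x := s)) i)) *
         cumulant_on M (\<lambda>i. if i \<in> insert x D then Z i ((g(x := s)) i) else W i) U" by simp
    qed
    also have "\<dots> = (\<Sum>g\<in>PiE (insert x D) (\<lambda>_. S). (\<Prod>i\<in>insert x D. a i (g i)) *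
       cumulant_on M (\<lambda>i. if i \<in> insert x D then Z i (g i) else W i) U)"
      unfolding PiE_insert_eq
      by (subst sum.reindex[OF inj_combinator[OF insert.hyps(2)]]) (simp add: o_def split_def)
    finally show ?case .
  qed
qed

lemma (in prob_space) abs_cumulant_on_sum_le:
  assumes U: "finite U" "card U \<le> 8" and S: "finite S"
    and Z: "\<And>i s. i \<in> U \<Longrightarrow> s \<in> S \<Longrightarrow> L8 M (Z i s)"
    and a: "\<And>i s. i \<in> U \<Longrightarrow> s \<in> S \<Longrightarrow> \<bar>a i s\<bar> \<le> q"
  shows "\<bar>cumulant_on M (\<lambda>i w. \<Sum>s\<in>S. a i s * Z i s w) U\<bar> \<le>
    q ^ card U * (\<Sum>g\<in>PiE U (\<lambda>_. S). \<bar>cumulant_on M (\<lambda>i. Z i (g i)) U\<bar>)"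
proof -
  have "cumulant_on M (\<lambda>i w. \<Sum>s\<in>S. a i s * Z i s w) U =
     cumulant_on M (\<lambda>i. if i \<in> U then (\<lambda>w. \<Sum>s\<in>S. a i s * Z i s w) else (\<lambda>_. 0)) U"
    by (rule cumulant_on_cong) auto
  also have "\<dots> = (\<Sum>g\<in>PiE U (\<lambda>_. S). (\<Prod>i\<in>U. a i (g i)) *
       cumulant_on M (\<lambda>i. if i \<in> U then Z i (g i) else (\<lambda>_. 0)) U)"
    using assms by (intro cumulant_on_sum) (auto simp: L8_def)
  also have "\<dots> = (\<Sum>g\<in>PiE U (\<lambda>_. S). (\<Prod>i\<in>U. a i (g i)) * cumulant_on M (\<lambda>i. Z i (g i)) U)"
    by (intro sum.cong refl arg_cong2[where f="(*)"] cumulant_on_cong) auto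
  finally have eq: "cumulant_on M (\<lambda>i w. \<Sum>s\<in>S. a i s * Z i s w) U = \<dots>" .
  have "\<bar>(\<Prod>i\<in>U. a i (g i)) * cumulant_on M (\<lambda>i. Z i (g i)) U\<bar> \<le>
     q ^ card U * \<bar>cumulant_on M (\<lambda>i. Z i (g i)) U\<bar>" if "g \<in> PiE U (\<lambda>_. S)" for g
  proof -
    have "\<bar>\<Prod>i\<in>U. a i (g i)\<bar> \<le> (\<Prod>i\<in>U. q)"
      unfolding abs_prod using a that by (intro prod_mono) auto
    then show ?thesis unfolding abs_mult by (intro mult_right_mono) auto
  qed
  then show ?thesis
    unfolding eq sum_distrib_left by (intro order_trans[OF sum_abs] sum_mono) auto
qed

section \<open>Cauchy-Schwarz and Bessel inequalities\<close>

lemma abs_mult_le_squares: "\<bar>x * y\<bar> \<le> (x\<^sup>2 + y\<^sup>2) / 2" for x y :: real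
  using sum_squares_bound[of "\<bar>x\<bar>" "\<bar>y\<bar>"] by (simp add: abs_mult)

lemma integrable_mult_of_squares:
  fixes F G :: "'a \<Rightarrow> real"
  assumes [measurable]: "F \<in> borel_measurable M" "G \<in> borel_measurable M"
    and F: "integrable M (\<lambda>w. F w ^ 2)" and G: "integrable M (\<lambda>w. G w ^ 2)"
  shows "integrable M (\<lambda>w. F w * G w)"
proof (rule Bochner_Integration.integrable_bound[OF Bochner_Integration.integrable_add[OF F G]])
  show "AE x in M. norm (F x * G x) \<le> norm ((F x)\<^sup>2 + (G x)\<^sup>2)"
  proof (rule AE_I2)
    fix x
    show "norm (F x * G x) \<le> norm ((F x)\<^sup>2 + (G x)\<^sup>2)"
      using abs_mult_le_squares[of "F x" "G x"] by simp
  qed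
qed measurable

lemma (in prob_space) Cauchy_Schwarz_expectation:
  fixes F G :: "'a \<Rightarrow> real"
  assumes [measurable]: "F \<in> borel_measurable M" "G \<in> borel_measurable M"
    and F: "integrable M (\<lambda>w. F w ^ 2)" and G: "integrable M (\<lambda>w. G w ^ 2)"
  shows "\<bar>\<integral>w. F w * G w \<partial>M\<bar> \<le> sqrt (\<integral>w. F w ^ 2 \<partial>M) * sqrt (\<integral>w. G w ^ 2 \<partial>M)"
proof -
  have FG: "integrable M (\<lambda>w. F w * G w)"
    using F G by (intro integrable_mult_of_squares) auto
  define p where "p = (\<integral>w. F w * G w \<partial>M)"
  define A where "A = (\<integral>w. F w ^ 2 \<partial>M)"
  define B where "B = (\<integral>w. G w ^ 2 \<partial>M)"
  have nn: "A \<ge> 0" "B \<ge> 0" unfolding A_def B_def by auto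
  have quad: "0 \<le> x ^ 2 * A - 2 * x * y * p + y ^ 2 * B" for x y
  proof -
    have "0 \<le> (\<integral>w. (x * F w - y * G w) ^ 2 \<partial>M)" by simp
    also have "\<dots> = (\<integral>w. x ^ 2 * F w ^ 2 - 2 * x * y * (F w * G w) + y ^ 2 * G w ^ 2 \<partial>M)"
      by (simp add: power2_eq_square algebra_simps)
    also have "\<dots> = x ^ 2 * A - 2 * x * y * p + y ^ 2 * B"
      using F G FG by (simp add: A_def B_def p_def)
    finally show ?thesis .
  qed
  \<comment> \<open>The arguments \<open>(B, p)\<close> and \<open>(p, A)\<close> in
    \<open>quad\<close> give the determinant \<open>A * B - p ^ 2\<close> times \<open>B\<close> and
    times \<open>A\<close>. If both \<open>A\<close> and \<open>B\<close> vanish,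
    \<open>(1, 1)\<close> and \<open>(1, -1)\<close> force \<open>p = 0\<close>.\<close>
  have "p ^ 2 \<le> A * B"
  proof (cases "A > 0 \<or> B > 0")
    case True
    have "0 \<le> B * (A * B - p ^ 2)" using quad[of B p] by (simp add: power2_eq_square algebra_simps)
    moreover have "0 \<le> A * (A * B - p ^ 2)" using quad[of p A] by (simp add: power2_eq_square algebra_simps)
    ultimately show ?thesis using True by (auto simp: zero_le_mult_iff)
  next
    case False
    then have "A = 0" "B = 0" using nn by auto
    then have "p = 0" using quad[of 1 1] quad[of 1 "-1"] by simp
    then show ?thesis using nn by simp
  qed
  then show ?thesis
    unfolding p_def[symmetric] A_def[symmetric] B_def[symmetric] real_sqrt_mult[symmetric]
    by (intro real_le_rsqrt) simp
qed

text \<open>The family \<open>G\<close> is not orthogonal; the bound \<open>R\<close> on the row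
  sums of its Gram matrix also bounds the quadratic form of that matrix (Schur test). The inequality
  comes from expanding the square of \<open>R\<close> times \<open>F\<close> minus the combination
  of the \<open>G t\<close> with coefficients \<open>d t\<close>.\<close>

lemma (in prob_space) Bessel_inequality:
  fixes F :: "'a \<Rightarrow> real" and G :: "'t \<Rightarrow> 'a \<Rightarrow> real"
  assumes T: "finite T" and [measurable]: "F \<in> borel_measurable M" "\<And>t. t \<in> T \<Longrightarrow> G t \<in> borel_measurable M"
    and F: "integrable M (\<lambda>w. F w ^ 2)" and G: "\<And>t. t \<in> T \<Longrightarrow> integrable M (\<lambda>w. G t w ^ 2)"
    and R: "\<And>s. s \<in> T \<Longrightarrow> (\<Sum>t\<in>T. \<bar>\<integral>w. G s w * G t w \<partial>M\<bar>) \<le> R" and R0: "R > 0"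
  shows "(\<Sum>t\<in>T. (\<integral>w. F w * G t w \<partial>M) ^ 2) \<le> R * (\<integral>w. F w ^ 2 \<partial>M)"
proof -
  define d where "d t = (\<integral>w. F w * G t w \<partial>M)" for t
  define g where "g s t = (\<integral>w. G s w * G t w \<partial>M)" for s t
  define S where "S = (\<Sum>t\<in>T. d t ^ 2)"
  have int1: "integrable M (\<lambda>w. F w * G t w)" if "t \<in> T" for t
    using that F G by (intro integrable_mult_of_squares) auto
  have int2: "integrable M (\<lambda>w. G s w * G t w)" if "s \<in> T" "t \<in> T" for s t
    using that G by (intro integrable_mult_of_squares) auto
  have gsym: "g s t = g t s" for s t by (simp add: g_def mult.commute)
  have "0 \<le> (\<integral>w. (R * F w - (\<Sum>t\<in>T. d t * G t w)) ^ 2 \<partial>M)" by simp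
  also have "\<dots> = (\<integral>w. R\<^sup>2 * F w ^ 2 - 2 * R * (\<Sum>t\<in>T. d t * (F w * G t w)) +
       (\<Sum>s\<in>T. \<Sum>t\<in>T. d s * d t * (G s w * G t w)) \<partial>M)"
    by (rule Bochner_Integration.integral_cong)
       (simp_all add: power2_eq_square algebra_simps sum_distrib_left sum_distrib_right sum_product)
  also have "\<dots> = R\<^sup>2 * (\<integral>w. F w ^ 2 \<partial>M) - 2 * R * (\<Sum>t\<in>T. d t * d t) +
       (\<Sum>s\<in>T. \<Sum>t\<in>T. d s * d t * g s t)"
    using int1 int2 F by (simp add: d_def g_def)
  also have "(\<Sum>s\<in>T. \<Sum>t\<in>T. d s * d t * g s t) \<le> (\<Sum>s\<in>T. \<Sum>t\<in>T. (d s ^ 2 + d t ^ 2) / 2 * \<bar>g s t\<bar>)"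
  proof (intro sum_mono)
    fix s t
    have "\<bar>d s * d t\<bar> * \<bar>g s t\<bar> \<le> (d s ^ 2 + d t ^ 2) / 2 * \<bar>g s t\<bar>"
      by (rule mult_right_mono[OF abs_mult_le_squares]) simp
    then show "d s * d t * g s t \<le> (d s ^ 2 + d t ^ 2) / 2 * \<bar>g s t\<bar>"
      by (metis abs_ge_self abs_mult order_trans)
  qed
  also have "\<dots> = (\<Sum>s\<in>T. \<Sum>t\<in>T. d s ^ 2 / 2 * \<bar>g s t\<bar>) + (\<Sum>s\<in>T. \<Sum>t\<in>T. d t ^ 2 / 2 * \<bar>g s t\<bar>)"
    by (simp add: add_divide_distrib distrib_right sum.distrib)
  also have "(\<Sum>s\<in>T. \<Sum>t\<in>T. d t ^ 2 / 2 * \<bar>g s t\<bar>) = (\<Sum>s\<in>T. \<Sum>t\<in>T. d s ^ 2 / 2 * \<bar>g s t\<bar>)"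
    by (subst sum.swap) (simp add: gsym)
  also have "(\<Sum>s\<in>T. \<Sum>t\<in>T. d s ^ 2 / 2 * \<bar>g s t\<bar>) \<le> (\<Sum>s\<in>T. d s ^ 2 / 2 * R)"
    unfolding sum_distrib_left[symmetric]
    by (intro sum_mono mult_left_mono) (use R in \<open>auto simp: g_def\<close>)
  also have "(\<Sum>s\<in>T. d s ^ 2 / 2 * R) = S * R / 2"
    by (simp add: S_def sum_distrib_right sum_divide_distrib)
  finally have "0 \<le> R\<^sup>2 * (\<integral>w. F w ^ 2 \<partial>M) - 2 * R * S + (S * R / 2 + S * R / 2)"
    by (simp add: S_def power2_eq_square)
  then have "0 \<le> R * (R * (\<integral>w. F w ^ 2 \<partial>M) - S)" by (simp add: power2_eq_square algebra_simps)
  then show ?thesis using R0 by (auto simp: zero_le_mult_iff S_def d_def)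
qed

section \<open>The variance of averages of products of four variables\<close>

text \<open>For each partition: \<open>fact (card P - 1)\<close> is the cumulant coefficient,
  \<open>2 ^ card P\<close> counts the sets of blocks in the expansion of a product of sums, and the
  power of \<open>L\<close> bounds a single term of it.\<close>

definition quartic_const :: "real \<Rightarrow> real" where
  "quartic_const L = (\<Sum>P | partition_on {..<8::nat} P. fact (card P - 1) * 2 ^ card P * L ^ (card P + 1))"

lemma sum_swap3: "(\<Sum>s\<in>A. \<Sum>t\<in>B. \<Sum>d\<in>D. f s t d) = (\<Sum>d\<in>D. \<Sum>s\<in>A. \<Sum>t\<in>B. f s t d)"
proof -
  have "(\<Sum>s\<in>A. \<Sum>t\<in>B. \<Sum>d\<in>D. f s t d) = (\<Sum>s\<in>A. \<Sum>d\<in>D. \<Sum>t\<in>B. f s t d)"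
    by (rule sum.cong[OF refl sum.swap])
  also have "\<dots> = (\<Sum>d\<in>D. \<Sum>s\<in>A. \<Sum>t\<in>B. f s t d)" by (rule sum.swap)
  finally show ?thesis .
qed

text \<open>Resolves the bounds in which the quantity to be estimated reappears under a square root,
  by \<open>2 * c * sqrt V \<le> c\<^sup>2 + V\<close>.\<close>

lemma le_of_le_add_mult_sqrt:
  fixes V :: real
  assumes "V \<le> a + c * sqrt V" "V \<ge> 0" "c \<ge> 0"
  shows "V \<le> 2 * a + c\<^sup>2"
proof -
  have "2 * c * sqrt V \<le> c\<^sup>2 + V" using sum_squares_bound[of c "sqrt V"] assms by simp
  then show ?thesis using assms by simp
qed

text \<open>
  The second moment of the average is a double average over \<open>s, t\<close> of \<open>c s t {..<8}\<close>, where \<open>c s t B\<close>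
  compares the joint moments of \<open>(y i s), (y i t)\<close> with those of independent copies. The eighth order
  cumulant vanishes for independent copies, so \<open>c s t {..<8}\<close> is a cumulant plus sums of products in which
  at least one factor is some \<open>c s t B\<close>. A single such factor is handled by Cauchy-Schwarz against the
  unknown variance \<open>V\<close> itself, two of them by Bessel's inequality. The result is \<open>V \<le> a + c * sqrt V\<close>.
\<close>
lemma (in prob_space) quartic_average_variance:
  fixes y :: "nat \<Rightarrow> 't \<Rightarrow> 'a \<Rightarrow> real" and T :: "'t set" and e :: "nat set \<Rightarrow> real"
  assumes T: "finite T" "T \<noteq> {}"
    and L8: "\<And>i t. i < 4 \<Longrightarrow> t \<in> T \<Longrightarrow> L8 M (y i t)"
    and K: "\<And>i t. i < 4 \<Longrightarrow> t \<in> T \<Longrightarrow> (\<integral>w. y i t w ^ 8 \<partial>M) \<le> K" "K \<ge> 0"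
    and mean: "\<And>i. i < 4 \<Longrightarrow> e {i} = 0"
    and e: "\<And>I t. I \<subseteq> {..<4} \<Longrightarrow> t \<in> T \<Longrightarrow> (\<integral>w. (\<Prod>i\<in>I. y i t w) \<partial>M) = e I"
    and lin: "\<And>i j s. i < 4 \<Longrightarrow> j < 4 \<Longrightarrow> s \<in> T \<Longrightarrow> (\<Sum>t\<in>T. \<bar>\<integral>w. y i s w * y j t w \<partial>M\<bar>) \<le> R"
    and quad: "\<And>I s. I \<subseteq> {..<4} \<Longrightarrow> card I = 2 \<Longrightarrow> s \<in> T \<Longrightarrow>
       (\<Sum>t\<in>T. \<bar>(\<integral>w. (\<Prod>i\<in>I. y i s w) * (\<Prod>i\<in>I. y i t w) \<partial>M) - (e I)\<^sup>2\<bar>) \<le> R"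
    and cum: "\<And>s t. s \<in> T \<Longrightarrow> t \<in> T \<Longrightarrow>
       \<bar>cumulant_on M (\<lambda>i. if i < 4 then y i s else y (i - 4) t) {..<8}\<bar> \<le> \<kappa>"
    and R: "R > 0"
  defines "C \<equiv> quartic_const (2 * (1 + 8 * K)\<^sup>2)"
  shows "(\<integral>w. ((\<Sum>t\<in>T. (\<Prod>i<4. y i t w)) / card T - e {..<4})\<^sup>2 \<partial>M) \<le>
     2 * (\<kappa> + C * (R / card T)) + C\<^sup>2 * (R / card T)"
proof -
  define S where "S = {..<4::nat}"
  define U where "U = {..<8::nat}"
  define sh where "sh C = (\<lambda>i::nat. i - 4) ` C" for C
  \<comment> \<open>Every joint moment is at most \<open>1 + 8 * K\<close> in modulus and every
    product of two of them at most the square; the factor 2 allows for their difference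
    \<open>c\<close>.\<close>
  define L where "L = 2 * (1 + 8 * K)\<^sup>2"
  define N where "N = real (card T)"
  have N: "N > 0" using T by (auto simp: N_def card_gt_0_iff)
  have L1: "L \<ge> 1" "1 + 8 * K \<le> L"
  proof -
    have "(1 + 8 * K) * 1 \<le> (1 + 8 * K) * (1 + 8 * K)" using K(2) by (intro mult_left_mono) auto
    then show "1 + 8 * K \<le> L" using K(2) by (simp add: L_def power2_eq_square)
    then show "L \<ge> 1" using K(2) by simp
  qed
  have S_fin: "finite S" "card S = 4" and U_fin: "finite U" "card U = 8" by (auto simp: S_def U_def)
  have [measurable]: "\<And>i t. i < 4 \<Longrightarrow> t \<in> T \<Longrightarrow> y i t \<in> borel_measurable M"
    using L8 by (auto simp: L8_def)
  \<comment> \<open>Indices below 4 are read at time \<open>s\<close>, the index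
    \<open>i + 4\<close> is the variable \<open>i\<close> read at time \<open>t\<close>, and
    \<open>sh\<close> maps this second half back onto \<open>S\<close>.\<close>
  define z where "z s t = (\<lambda>i. if i < 4 then y i s else y (i - 4) t)" for s t
  have zL8: "L8 M (z s t i)" if "i \<in> U" "s \<in> T" "t \<in> T" for s t i
    using that L8 by (auto simp: z_def U_def)
  have zK: "(\<integral>w. z s t i w ^ 8 \<partial>M) \<le> K" if "i \<in> U" "s \<in> T" "t \<in> T" for s t i
    using that K by (auto simp: z_def U_def)
  define m where "m s t B = (\<integral>w. (\<Prod>i\<in>B. z s t i w) \<partial>M)" for s t B
  have sub8: "finite B \<and> card B \<le> 8" if "B \<subseteq> U" for B
    using that U_fin by (metis card_mono finite_subset)
  have m_int: "integrable M (\<lambda>w. \<Prod>i\<in>B. z s t i w)" if "B \<subseteq> U" "s \<in> T" "t \<in> T" for B s t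
    using that sub8[of B] zL8 by (intro integrable_prod_L8) auto
  have m_le: "\<bar>m s t B\<bar> \<le> 1 + 8 * K" if "B \<subseteq> U" "s \<in> T" "t \<in> T" for B s t
  proof -
    have "\<bar>m s t B\<bar> \<le> 1 + (\<Sum>i\<in>B. \<integral>w. z s t i w ^ 8 \<partial>M)"
      unfolding m_def using that sub8[of B] zL8 by (intro expectation_prod_L8_le) auto
    also have "(\<Sum>i\<in>B. \<integral>w. z s t i w ^ 8 \<partial>M) \<le> (\<Sum>i\<in>B. K)"
      using that zK by (intro sum_mono) auto
    also have "\<dots> \<le> 8 * K" using sub8[OF that(1)] K(2) by (simp add: mult_right_mono)
    finally show ?thesis by simp
  qed
  have shS: "sh (B - S) \<subseteq> S" if "B \<subseteq> U" for B using that by (auto simp: sh_def S_def U_def)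
  have sh_inj: "inj_on (\<lambda>i::nat. i - 4) (B - S)" for B by (auto simp: inj_on_def S_def)
  have sh_card: "card (sh (B - S)) = card (B - S)" for B unfolding sh_def by (rule card_image[OF sh_inj])
  have prod_split: "(\<Prod>i\<in>B. z s t i w) = (\<Prod>i\<in>B \<inter> S. y i s w) * (\<Prod>i\<in>sh (B - S). y i t w)"
    if "B \<subseteq> U" for B s t w
  proof -
    have "(\<Prod>i\<in>B. z s t i w) = (\<Prod>i\<in>B \<inter> S. z s t i w) * (\<Prod>i\<in>B - S. z s t i w)"
      using sub8[OF that] by (subst prod.Int_Diff[of B _ S]) auto
    also have "(\<Prod>i\<in>B \<inter> S. z s t i w) = (\<Prod>i\<in>B \<inter> S. y i s w)"
      by (rule prod.cong) (auto simp: z_def S_def)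
    also have "(\<Prod>i\<in>B - S. z s t i w) = (\<Prod>i\<in>sh (B - S). y i t w)"
      unfolding sh_def by (subst prod.reindex[OF sh_inj]) (auto simp: z_def S_def)
    finally show ?thesis .
  qed
  \<comment> \<open>The moments that \<open>z\<close> would have if the times \<open>s\<close> and
    \<open>t\<close> belonged to independent copies.\<close>
  define mt where "mt B = e (B \<inter> S) * e (sh (B - S))" for B
  define c where "c s t B = m s t B - mt B" for s t B
  have e0: "e {} = 1" using T e[of "{}"] by (auto simp: prob_space)
  obtain t0 where t0: "t0 \<in> T" using T by blast
  have e_le: "\<bar>e I\<bar> \<le> 1 + 8 * K" if "I \<subseteq> S" for I
  proof -
    have IU: "I \<subseteq> U" and IS: "I \<inter> S = I" "I - S = {}" using that by (auto simp: S_def U_def)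
    have "(\<Prod>i\<in>I. z t0 t0 i w) = (\<Prod>i\<in>I. y i t0 w)" for w
      using prod_split[OF IU, of t0 t0 w] unfolding IS by (simp add: sh_def)
    then have "m t0 t0 I = e I"
      unfolding m_def using t0 that e[of I t0] by (simp add: S_def)
    then show ?thesis using m_le[OF IU t0 t0] by simp
  qed
  have mt_le: "\<bar>mt B\<bar> \<le> L" if "B \<subseteq> U" for B
  proof -
    have "\<bar>mt B\<bar> \<le> (1 + 8 * K) * (1 + 8 * K)"
      unfolding mt_def abs_mult using e_le shS[OF that] K by (intro mult_mono) auto
    then show ?thesis using K(2) by (simp add: L_def power2_eq_square)
  qed
  have c_le: "\<bar>c s t B\<bar> \<le> L" if "B \<subseteq> U" "s \<in> T" "t \<in> T" for s t B
  proof -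
    have "\<bar>mt B\<bar> \<le> (1 + 8 * K) * (1 + 8 * K)"
      unfolding mt_def abs_mult using e_le shS[OF that(1)] K by (intro mult_mono) auto
    moreover have "(1 + 8 * K) * 1 \<le> (1 + 8 * K) * (1 + 8 * K)" using K(2) by (intro mult_left_mono) auto
    ultimately show ?thesis using m_le[OF that] by (simp add: c_def L_def power2_eq_square)
  qed
  \<comment> \<open>Centred products: with them \<open>c s t B\<close> becomes a covariance between
    time \<open>s\<close> and time \<open>t\<close>, and \<open>V\<close> the second moment of the
    time average of \<open>F S\<close>.\<close>
  define F where "F I t w = (\<Prod>i\<in>I. y i t w) - e I" for I t w
  have F_meas[measurable]: "F I t \<in> borel_measurable M" if "I \<subseteq> S" "t \<in> T" for I t
    unfolding F_def using that by (measurable, auto simp: S_def)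
  have F0: "F {} t = (\<lambda>w. 0)" for t by (simp add: F_def e0 fun_eq_iff)
  have prod_int: "integrable M (\<lambda>w. (\<Prod>i\<in>I. y i s w) * (\<Prod>i\<in>J. y i t w))"
    and prod_m: "(\<integral>w. (\<Prod>i\<in>I. y i s w) * (\<Prod>i\<in>J. y i t w) \<partial>M) = m s t (I \<union> (\<lambda>i. i + 4) ` J)"
    and prod_B: "I \<union> (\<lambda>i. i + 4) ` J \<subseteq> U" "(I \<union> (\<lambda>i. i + 4) ` J) \<inter> S = I"
       "sh ((I \<union> (\<lambda>i. i + 4) ` J) - S) = J"
    if "I \<subseteq> S" "J \<subseteq> S" "s \<in> T" "t \<in> T" for I J s t
  proof -
    let ?B = "I \<union> (\<lambda>i. i + 4) ` J"
    show B: "?B \<subseteq> U" "?B \<inter> S = I" using that by (auto simp: S_def U_def)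
    have "?B - S = (\<lambda>i. i + 4) ` J" using that by (auto simp: S_def)
    then show B': "sh (?B - S) = J" by (simp add: sh_def image_image)
    have "(\<Prod>i\<in>?B. z s t i w) = (\<Prod>i\<in>I. y i s w) * (\<Prod>i\<in>J. y i t w)" for w
      using prod_split[OF B(1)] by (simp only: B(2) B')
    then show "integrable M (\<lambda>w. (\<Prod>i\<in>I. y i s w) * (\<Prod>i\<in>J. y i t w))"
      "(\<integral>w. (\<Prod>i\<in>I. y i s w) * (\<Prod>i\<in>J. y i t w) \<partial>M) = m s t ?B"
      using m_int[OF B(1) that(3,4)] by (simp_all add: m_def)
  qed
  have prod1_int: "integrable M (\<lambda>w. \<Prod>i\<in>I. y i t w)" if "I \<subseteq> S" "t \<in> T" for I t
    using prod_int[of I "{}" t t] that by simp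
  have FF: "integrable M (\<lambda>w. F I s w * F J t w)"
    and FF_eq: "(\<integral>w. F I s w * F J t w \<partial>M) =
       (\<integral>w. (\<Prod>i\<in>I. y i s w) * (\<Prod>i\<in>J. y i t w) \<partial>M) - e I * e J"
    if "I \<subseteq> S" "J \<subseteq> S" "s \<in> T" "t \<in> T" for I J s t
  proof -
    have eq: "F I s w * F J t w = (\<Prod>i\<in>I. y i s w) * (\<Prod>i\<in>J. y i t w) -
       e I * (\<Prod>i\<in>J. y i t w) - e J * (\<Prod>i\<in>I. y i s w) + e I * e J" for w
      by (simp add: F_def algebra_simps)
    note ints = prod_int[OF that] prod1_int[OF that(1,3)] prod1_int[OF that(2,4)]
    show "integrable M (\<lambda>w. F I s w * F J t w)" unfolding eq using ints by simp
    show "(\<integral>w. F I s w * F J t w \<partial>M) =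
       (\<integral>w. (\<Prod>i\<in>I. y i s w) * (\<Prod>i\<in>J. y i t w) \<partial>M) - e I * e J"
      unfolding eq using ints that e[of I s] e[of J t] by (simp add: prob_space S_def)
  qed
  have c_F: "c s t B = (\<integral>w. F (B \<inter> S) s w * F (sh (B - S)) t w \<partial>M)"
    if "B \<subseteq> U" "s \<in> T" "t \<in> T" for s t B
    using that shS[of B] FF_eq[of "B \<inter> S" "sh (B - S)" s t] by (simp add: c_def m_def mt_def prod_split)
  have sh0: "sh {} = {}" by (simp add: sh_def)
  have c_zero: "c s t B = 0" if "B \<subseteq> U" "s \<in> T" "t \<in> T" "B \<inter> S = {} \<or> B - S = {}" for s t B
    using that(4)
  proof
    assume "B \<inter> S = {}"
    then show ?thesis unfolding c_F[OF that(1-3)] by (simp add: F0)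
  next
    assume "B - S = {}"
    then show ?thesis unfolding c_F[OF that(1-3)] by (simp only: sh0 F0) simp
  qed
  have F2: "(\<integral>w. F I t w ^ 2 \<partial>M) \<le> L" "integrable M (\<lambda>w. F I t w ^ 2)" if "I \<subseteq> S" "t \<in> T" for I t
  proof -
    have "(\<integral>w. F I t w ^ 2 \<partial>M) = m t t (I \<union> (\<lambda>i. i + 4) ` I) - (e I)\<^sup>2"
      using FF_eq[of I I t t] prod_m[of I I t t] that by (simp add: power2_eq_square)
    also have "\<dots> \<le> 1 + 8 * K" using m_le[of "I \<union> (\<lambda>i. i + 4) ` I" t t] prod_B[of I I t t] that
        zero_le_power2[of "e I"] by linarith
    finally show "(\<integral>w. F I t w ^ 2 \<partial>M) \<le> L" using L1 by simp
    show "integrable M (\<lambda>w. F I t w ^ 2)" using FF[of I I t t] that by (simp add: power2_eq_square)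
  qed
  have gram: "(\<Sum>t\<in>T. \<bar>\<integral>w. F I s w * F I t w \<partial>M\<bar>) \<le> R"
    if "I \<subseteq> S" "card I = 1 \<or> card I = 2" "s \<in> T" for I s
    using that(2)
  proof
    assume "card I = 1"
    then obtain i where "I = {i}" by (auto simp: card_1_singleton_iff)
    then have i: "I = {i}" "i < 4" using that(1) by (auto simp: S_def)
    have "(\<Sum>t\<in>T. \<bar>\<integral>w. F I s w * F I t w \<partial>M\<bar>) = (\<Sum>t\<in>T. \<bar>\<integral>w. y i s w * y i t w \<partial>M\<bar>)"
      using i that FF_eq[of I I] mean by (intro sum.cong) (auto simp: S_def)
    then show ?thesis using lin[of i i s] i that by simp
  next
    assume I: "card I = 2"
    have "(\<Sum>t\<in>T. \<bar>\<integral>w. F I s w * F I t w \<partial>M\<bar>) =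
      (\<Sum>t\<in>T. \<bar>(\<integral>w. (\<Prod>i\<in>I. y i s w) * (\<Prod>i\<in>I. y i t w) \<partial>M) - (e I)\<^sup>2\<bar>)"
      using that FF_eq[of I I] by (intro sum.cong) (auto simp: power2_eq_square)
    then show ?thesis using quad[of I s] I that by (simp add: S_def)
  qed
  define G where "G I w = (\<Sum>t\<in>T. F I t w) / N" for I w
  have G_meas[measurable]: "G I \<in> borel_measurable M" if "I \<subseteq> S" for I
    unfolding G_def using that by measurable
  have GG: "integrable M (\<lambda>w. G I w * G J w)"
    and GG_eq: "(\<integral>w. G I w * G J w \<partial>M) = (\<Sum>s\<in>T. \<Sum>t\<in>T. \<integral>w. F I s w * F J t w \<partial>M) / N\<^sup>2"
    if "I \<subseteq> S" "J \<subseteq> S" for I J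
  proof -
    have eq: "G I w * G J w = (\<Sum>s\<in>T. \<Sum>t\<in>T. F I s w * F J t w) / N\<^sup>2" for w
      by (simp add: G_def sum_product power2_eq_square)
    show "integrable M (\<lambda>w. G I w * G J w)"
      "(\<integral>w. G I w * G J w \<partial>M) = (\<Sum>s\<in>T. \<Sum>t\<in>T. \<integral>w. F I s w * F J t w \<partial>M) / N\<^sup>2"
      unfolding eq using FF that by simp_all
  qed
  define v where "v I = (\<integral>w. G I w ^ 2 \<partial>M)" for I
  have v0: "v I \<ge> 0" for I by (simp add: v_def)
  have v_small: "v I \<le> R / N" if "I \<subseteq> S" "card I = 1 \<or> card I = 2" for I
  proof -
    have "v I = (\<Sum>s\<in>T. \<Sum>t\<in>T. \<integral>w. F I s w * F I t w \<partial>M) / N\<^sup>2"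
      using GG_eq[of I I] that by (simp add: v_def power2_eq_square)
    also have "\<dots> \<le> (\<Sum>s\<in>T. \<Sum>t\<in>T. \<bar>\<integral>w. F I s w * F I t w \<partial>M\<bar>) / N\<^sup>2"
      by (intro divide_right_mono sum_mono) auto
    also have "\<dots> \<le> (\<Sum>s\<in>T. R) / N\<^sup>2"
      using gram[OF that] by (intro divide_right_mono sum_mono) auto
    also have "\<dots> = R / N" using N by (simp add: N_def power2_eq_square)
    finally show ?thesis .
  qed
  define V where "V = v S"
  \<comment> \<open>Averages over one or two factors have second moment at most
    \<open>R / N\<close>; the full product contributes \<open>sqrt V\<close>. Since \<open>I\<close>
    and \<open>J\<close> are not both full, at least one factor \<open>sqrt (R / N)\<close> is
    present.\<close>
  have GG_le: "\<bar>\<integral>w. G I w * G J w \<partial>M\<bar> \<le> R / N + sqrt (R / N) * sqrt V"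
    if IJ: "I \<subseteq> S" "J \<subseteq> S" and cI: "card I \<in> {1, 2, 4}" and cJ: "card J \<in> {1, 2, 4}"
      and ne: "\<not> (I = S \<and> J = S)" for I J
  proof -
    have full: "I = S" if "I \<subseteq> S" "card I = 4" for I
      using that S_fin by (metis card_subset_eq)
    have 1: "sqrt (v I) \<le> sqrt (R / N) \<or> v I = V \<and> I = S" if "I \<subseteq> S" "card I \<in> {1, 2, 4}" for I
      using that v_small[of I] full[of I] by (auto simp: V_def)
    have "\<bar>\<integral>w. G I w * G J w \<partial>M\<bar> \<le> sqrt (v I) * sqrt (v J)"
      unfolding v_def using IJ GG[of I I] GG[of J J]
      by (intro Cauchy_Schwarz_expectation) (auto simp: power2_eq_square)
    also have "\<dots> \<le> sqrt (R / N) * sqrt (R / N) + sqrt (R / N) * sqrt V"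
    proof -
      note 1[OF IJ(1) cI] 1[OF IJ(2) cJ]
      moreover have ?thesis if "sqrt (v I) \<le> sqrt (R / N)" "sqrt (v J) \<le> sqrt (R / N)"
        using mult_mono[OF that] v0 N R by (simp add: V_def add_increasing2)
      moreover have ?thesis if "sqrt (v I) \<le> sqrt (R / N)" "v J = V"
        using mult_right_mono[OF that(1), of "sqrt V"] v0 N R that(2) by (simp add: V_def add_increasing)
      moreover have ?thesis if "sqrt (v J) \<le> sqrt (R / N)" "v I = V"
        using mult_right_mono[OF that(1), of "sqrt V"] v0 N R that(2)
        by (simp add: V_def add_increasing mult.commute)
      ultimately show ?thesis using ne by blast
    qed
    finally show ?thesis using N R by simp
  qed
  define Q where "Q = R / N + sqrt (R / N) * sqrt V"
  have RQ: "R / N \<le> Q" using N R v0 by (simp add: Q_def V_def)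
  \<comment> \<open>Bessel's inequality is applied on the side with one or two factors; from the
    other side only a bounded second moment is needed.\<close>
  have c_sq: "(\<Sum>s\<in>T. \<Sum>t\<in>T. (c s t B)\<^sup>2) \<le> N * (R * L)"
    if B: "B \<subseteq> U" and good: "card (B \<inter> S) \<in> {1, 2} \<or> card (B - S) \<in> {1, 2}" for B
    using good
  proof
    assume "card (B - S) \<in> {1, 2}"
    then have g: "card (sh (B - S)) = 1 \<or> card (sh (B - S)) = 2" by (simp add: sh_card)
    have "(\<Sum>s\<in>T. \<Sum>t\<in>T. (c s t B)\<^sup>2) =
       (\<Sum>s\<in>T. \<Sum>t\<in>T. (\<integral>w. F (B \<inter> S) s w * F (sh (B - S)) t w \<partial>M)\<^sup>2)"
      using c_F[OF B] by simp
    also have "\<dots> \<le> (\<Sum>s\<in>T. R * (\<integral>w. F (B \<inter> S) s w ^ 2 \<partial>M))"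
      using T shS[OF B] F2 R gram[OF shS[OF B] g]
      by (intro sum_mono Bessel_inequality) auto
    also have "\<dots> \<le> (\<Sum>s\<in>T. R * L)" using R F2 by (intro sum_mono mult_left_mono) auto
    finally show ?thesis by (simp add: N_def)
  next
    assume "card (B \<inter> S) \<in> {1, 2}"
    then have g: "card (B \<inter> S) = 1 \<or> card (B \<inter> S) = 2" by simp
    have "(\<Sum>s\<in>T. \<Sum>t\<in>T. (c s t B)\<^sup>2) = (\<Sum>t\<in>T. \<Sum>s\<in>T. (c s t B)\<^sup>2)" by (rule sum.swap)
    also have "\<dots> = (\<Sum>t\<in>T. \<Sum>s\<in>T. (\<integral>w. F (sh (B - S)) t w * F (B \<inter> S) s w \<partial>M)\<^sup>2)"
      using c_F[OF B] by (simp add: mult.commute)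
    also have "\<dots> \<le> (\<Sum>t\<in>T. R * (\<integral>w. F (sh (B - S)) t w ^ 2 \<partial>M))"
      using T shS[OF B] F2 R gram[OF _ g]
      by (intro sum_mono Bessel_inequality) auto
    also have "\<dots> \<le> (\<Sum>s\<in>T. R * L)" using R F2 shS[OF B] by (intro sum_mono mult_left_mono) auto
    finally show ?thesis by (simp add: N_def)
  qed
  have c_lin: "(\<Sum>s\<in>T. \<Sum>t\<in>T. \<bar>c s t B\<bar>) \<le> N * R"
    if B: "B \<subseteq> U" and one: "card (B \<inter> S) = 1" "card (B - S) = 1" for B
  proof -
    obtain i where "B \<inter> S = {i}" using one(1) by (auto simp: card_1_singleton_iff)
    then have i: "B \<inter> S = {i}" "i < 4" by (auto simp: S_def)
    obtain j where j: "sh (B - S) = {j}" using one(2) sh_card[of B] by (metis card_1_singletonE)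
    then have "j < 4" using shS[OF B] by (simp add: S_def)
    have "(\<Sum>s\<in>T. \<Sum>t\<in>T. \<bar>c s t B\<bar>) = (\<Sum>s\<in>T. \<Sum>t\<in>T. \<bar>\<integral>w. y i s w * y j t w \<partial>M\<bar>)"
      using c_F[OF B] i j mean \<open>j < 4\<close> by (simp add: F_def)
    also have "\<dots> \<le> (\<Sum>s\<in>T. R)" using lin[OF \<open>i < 4\<close> \<open>j < 4\<close>] by (intro sum_mono) auto
    finally show ?thesis by (simp add: N_def)
  qed
  have PD: "\<bar>(\<Sum>s\<in>T. \<Sum>t\<in>T. (\<Prod>B\<in>D. c s t B) * (\<Prod>B\<in>P - D. mt B)) / N\<^sup>2\<bar> \<le> L ^ (card P + 1) * Q"
    if P: "partition_on U P" "P \<noteq> {U}" and D: "D \<subseteq> P" "D \<noteq> {}" for P D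
  proof -
    have finP: "finite P" using P U_fin finite_elements by blast
    have PU: "B \<subseteq> U" if "B \<in> P" for B using P that partition_onD1 by blast
    have disj: "B \<inter> B' = {}" if "B \<in> P" "B' \<in> P" "B \<noteq> B'" for B B'
      using partition_onD2[OF P(1)] that by (auto simp: pairwise_def disjnt_def)
    have pow_le: "L ^ k \<le> L ^ l" if "k \<le> l" for k l using L1 that by (intro power_increasing) auto
    have mt_prod: "\<bar>\<Prod>B\<in>E. mt B\<bar> \<le> L ^ card E" if "E \<subseteq> P" for E
    proof -
      have "\<bar>\<Prod>B\<in>E. mt B\<bar> \<le> (\<Prod>B\<in>E. L)"
        unfolding abs_prod using that PU mt_le by (intro prod_mono) auto
      then show ?thesis by simp
    qed
    have c_prod: "\<bar>\<Prod>B\<in>E. c s t B\<bar> \<le> L ^ card E" if "E \<subseteq> P" "s \<in> T" "t \<in> T" for E s t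
    proof -
      have "\<bar>\<Prod>B\<in>E. c s t B\<bar> \<le> (\<Prod>B\<in>E. L)"
        unfolding abs_prod using that PU c_le by (intro prod_mono) auto
      then show ?thesis by simp
    qed
    have Q0: "Q \<ge> 0" using RQ R N by (metis divide_nonneg_pos less_imp_le order_trans)
    have finD: "finite D" using D finP finite_subset by blast
    show ?thesis
    proof (cases "card D = 1")
      case True
      then obtain B where B: "D = {B}" by (auto simp: card_1_singleton_iff)
      then have BP: "B \<in> P" "B \<subseteq> U" using D PU by auto
      let ?I = "B \<inter> S" and ?J = "sh (B - S)"
      have eq: "(\<Sum>s\<in>T. \<Sum>t\<in>T. (\<Prod>B\<in>D. c s t B) * (\<Prod>B\<in>P - D. mt B)) / N\<^sup>2 =
        (\<integral>w. G ?I w * G ?J w \<partial>M) * (\<Prod>B\<in>P - D. mt B)"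
        using GG_eq[of ?I ?J] shS[OF BP(2)] c_F[OF BP(2)]
        by (simp add: B sum_distrib_right sum_divide_distrib)
      show ?thesis
      proof (cases "?I = {} \<or> ?J = {} \<or> (\<Prod>B\<in>P - D. mt B) = 0")
        case True
        then have "(\<integral>w. G ?I w * G ?J w \<partial>M) * (\<Prod>B\<in>P - D. mt B) = 0"
          by (auto simp: G_def F0)
        moreover have "0 \<le> L ^ (card P + 1) * Q" using L1 Q0 by simp
        ultimately show ?thesis unfolding eq by (metis abs_zero)
      next
        case False
        then have ne: "?I \<noteq> {}" "?J \<noteq> {}" and mt0: "\<And>B'. B' \<in> P \<Longrightarrow> B' \<noteq> B \<Longrightarrow> mt B' \<noteq> 0"
          using finP by (auto simp: B)
        \<comment> \<open>If \<open>B\<close> contained exactly three indices of one half, the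
          fourth would lie alone, within that half, in another block \<open>B'\<close>. Then
          \<open>mt B'\<close> has the mean of a single variable as a factor and vanishes, which was
          excluded.\<close>
        have single: "card (B \<inter> W) \<noteq> 3" if W: "W = S \<or> W = U - S" for W
        proof
          assume c3: "card (B \<inter> W) = 3"
          have Wf: "finite W" "card W = 4" "W \<subseteq> U"
            using W by (auto simp: S_def U_def card_Diff_subset[of "{..<4}" "{..<8}"])
          have "card (W - B) = 1"
            using Wf c3 card_Diff_subset_Int[of W B] by (simp add: Int_commute)
          then obtain i where i: "W - B = {i}" by (auto simp: card_1_singleton_iff)
          then have iU: "i \<in> U" "i \<in> W" "i \<notin> B" using Wf by auto
          then obtain B' where B': "B' \<in> P" "i \<in> B'" using P(1) partition_onD1 by blast
          then have "B' \<noteq> B" using iU by auto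
          then have BW: "B' \<inter> W = {i}" using disj[OF B'(1) BP(1)] i iU B' by blast
          have "mt B' = 0"
          proof (cases "W = S")
            case True
            then show ?thesis using BW mean[of i] iU by (simp add: mt_def S_def)
          next
            case False
            then have "B' - S = {i}" using W BW PU[OF B'(1)] by blast
            then have "sh (B' - S) = {i - 4}" by (simp add: sh_def)
            moreover have "i - 4 < 4" using iU by (auto simp: U_def)
            ultimately show ?thesis using mean by (simp add: mt_def)
          qed
          then show False using mt0 B' \<open>B' \<noteq> B\<close> by blast
        qed
        have BS: "B \<inter> (U - S) = B - S" using BP by blast
        have cI: "card ?I \<in> {1, 2, 4}"
        proof -
          have "card ?I \<le> 4" "card ?I \<noteq> 0" using card_mono[of S ?I] S_fin ne by auto
          then show ?thesis using single[of S] by auto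
        qed
        have cJ: "card ?J \<in> {1, 2, 4}"
        proof -
          have "card ?J \<le> 4" "card ?J \<noteq> 0"
            using card_mono[OF S_fin(1) shS[OF BP(2)]] S_fin ne finite_subset[OF shS[OF BP(2)] S_fin(1)] by auto
          then show ?thesis using single[of "U - S"] by (auto simp: BS sh_card)
        qed
        have not_full: "\<not> (?I = S \<and> ?J = S)"
        proof
          assume a: "?I = S \<and> ?J = S"
          then have "card (B - S) = 4" using sh_card[of B] S_fin by simp
          moreover have "card B = card (B \<inter> S) + card (B - S)"
            using sub8[OF BP(2)] by (metis card_Int_Diff)
          ultimately have "card B = 8" using a S_fin by simp
          then have "B = U" using BP U_fin by (metis card_subset_eq)
          have "C = U" if C: "C \<in> P" for C
          proof (rule ccontr)
            assume "C \<noteq> U"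
            then have "C \<inter> U = {}" using disj[OF C BP(1)] \<open>B = U\<close> by simp
            then have "C = {}" using PU[OF C] by blast
            then show False using C partition_onD3[OF P(1)] by simp
          qed
          then have "P = {U}" using BP(1) \<open>B = U\<close> by blast
          then show False using P by simp
        qed
        have "\<bar>(\<integral>w. G ?I w * G ?J w \<partial>M) * (\<Prod>B\<in>P - D. mt B)\<bar> \<le> Q * L ^ card (P - D)"
          unfolding abs_mult Q_def using GG_le[OF _ shS[OF BP(2)] cI cJ not_full] mt_prod[of "P - D"]
          by (intro mult_mono) (auto simp: N R v0 V_def less_imp_le intro!: add_nonneg_nonneg)
        also have "\<dots> \<le> Q * L ^ (card P + 1)"
          using finP card_mono[of P "P - D"] Q0 by (intro mult_left_mono pow_le) auto
        finally show ?thesis unfolding eq by (simp add: mult.commute)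
      qed
    next
      case False
      obtain B1 where B1: "B1 \<in> D" using D by blast
      have "D \<noteq> {B1}" using False by auto
      then obtain B2 where "B2 \<in> D" "B2 \<noteq> B1" using B1 by blast
      then have B12: "B1 \<in> D" "B2 \<in> D" "B1 \<noteq> B2" using B1 by auto
      then have BP: "B1 \<in> P" "B2 \<in> P" "B1 \<subseteq> U" "B2 \<subseteq> U" using D PU by auto
      have dis: "B1 \<inter> B2 = {}" using disj BP B12 by blast
      have sum12: "(\<Sum>s\<in>T. \<Sum>t\<in>T. \<bar>c s t B1\<bar> * \<bar>c s t B2\<bar>) \<le> N * (R * L)"
      proof (cases "B1 \<inter> S = {} \<or> B1 - S = {} \<or> B2 \<inter> S = {} \<or> B2 - S = {}")
        case True
        have "c s t B1 * c s t B2 = 0" if "s \<in> T" "t \<in> T" for s t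
          using True c_zero[OF BP(3) that] c_zero[OF BP(4) that] by auto
        then have "(\<Sum>s\<in>T. \<Sum>t\<in>T. \<bar>c s t B1\<bar> * \<bar>c s t B2\<bar>) = 0"
          unfolding abs_mult[symmetric] by (intro sum.neutral ballI) simp
        then show ?thesis using N R L1 by simp
      next
        case False
        have fin12: "finite B1" "finite B2" using sub8 BP by auto
        have pos: "card (B1 \<inter> S) \<ge> 1" "card (B1 - S) \<ge> 1" "card (B2 \<inter> S) \<ge> 1" "card (B2 - S) \<ge> 1"
          using False fin12 by (auto simp: Suc_le_eq card_gt_0_iff)
        have "card (B1 \<inter> S) + card (B2 \<inter> S) = card (B1 \<inter> S \<union> B2 \<inter> S)"
          using fin12 dis by (subst card_Un_disjoint) auto
        also have "\<dots> \<le> 4" using card_mono[of S "B1 \<inter> S \<union> B2 \<inter> S"] S_fin by auto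
        finally have s4: "card (B1 \<inter> S) + card (B2 \<inter> S) \<le> 4" .
        have "card (B1 - S) + card (B2 - S) = card ((B1 - S) \<union> (B2 - S))"
          using fin12 dis by (subst card_Un_disjoint) auto
        also have "\<dots> \<le> card (U - S)" using BP U_fin by (intro card_mono) auto
        also have "\<dots> = 4" by (auto simp: S_def U_def card_Diff_subset)
        finally have t4: "card (B1 - S) + card (B2 - S) \<le> 4" .
        have mixed: ?thesis if one: "card (B \<inter> S) = 1" "card (B - S) = 1" "B \<subseteq> U" and B': "B' \<subseteq> U"
          and BB: "{B, B'} = {B1, B2}" for B B'
        proof -
          have "(\<Sum>s\<in>T. \<Sum>t\<in>T. \<bar>c s t B1\<bar> * \<bar>c s t B2\<bar>) = (\<Sum>s\<in>T. \<Sum>t\<in>T. \<bar>c s t B\<bar> * \<bar>c s t B'\<bar>)"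
            using BB by (auto simp: doubleton_eq_iff mult.commute)
          also have "\<dots> \<le> (\<Sum>s\<in>T. \<Sum>t\<in>T. \<bar>c s t B\<bar> * L)"
            using c_le[OF B'] by (intro sum_mono mult_left_mono) auto
          also have "\<dots> = (\<Sum>s\<in>T. \<Sum>t\<in>T. \<bar>c s t B\<bar>) * L" by (simp add: sum_distrib_right)
          also have "\<dots> \<le> N * R * L" using c_lin[OF one(3,1,2)] L1 by (intro mult_right_mono) auto
          finally show ?thesis by simp
        qed
        show ?thesis
        proof (cases "card (B1 \<inter> S) = 1 \<and> card (B1 - S) = 1 \<or> card (B2 \<inter> S) = 1 \<and> card (B2 - S) = 1")
          case True
          then show ?thesis using mixed[of B1 B2] mixed[of B2 B1] BP by auto
        next
          case False
          \<comment> \<open>Each half has four indices to share between two disjoint blocks. A block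
            with three in both halves would leave a pair with one index in each half for the other
            block, which is the case just treated.\<close>
          then have "card (B1 \<inter> S) \<in> {1,2} \<or> card (B1 - S) \<in> {1,2}"
            "card (B2 \<inter> S) \<in> {1,2} \<or> card (B2 - S) \<in> {1,2}"
            using pos s4 t4 by auto
          then have sq: "(\<Sum>s\<in>T. \<Sum>t\<in>T. (c s t B1)\<^sup>2) \<le> N * (R * L)" "(\<Sum>s\<in>T. \<Sum>t\<in>T. (c s t B2)\<^sup>2) \<le> N * (R * L)"
            using c_sq BP by blast+
          have "(\<Sum>s\<in>T. \<Sum>t\<in>T. \<bar>c s t B1\<bar> * \<bar>c s t B2\<bar>) \<le>
             (\<Sum>s\<in>T. \<Sum>t\<in>T. ((c s t B1)\<^sup>2 + (c s t B2)\<^sup>2) / 2)"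
            unfolding abs_mult[symmetric] by (intro sum_mono abs_mult_le_squares)
          also have "\<dots> = ((\<Sum>s\<in>T. \<Sum>t\<in>T. (c s t B1)\<^sup>2) + (\<Sum>s\<in>T. \<Sum>t\<in>T. (c s t B2)\<^sup>2)) / 2"
            by (simp add: sum.distrib sum_divide_distrib[symmetric])
          finally show ?thesis using sq by simp
        qed
      qed
      have term_le: "\<bar>(\<Prod>B\<in>D. c s t B) * (\<Prod>B\<in>P - D. mt B)\<bar> \<le> \<bar>c s t B1\<bar> * \<bar>c s t B2\<bar> * L ^ card P"
        if "s \<in> T" "t \<in> T" for s t
      proof -
        have "(\<Prod>B\<in>D. c s t B) = c s t B1 * (c s t B2 * (\<Prod>B\<in>D - {B1} - {B2}. c s t B))"
          using finD B12 by (subst prod.remove[of D B1], simp, simp, subst prod.remove[of "D - {B1}" B2]) auto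
        then have "\<bar>(\<Prod>B\<in>D. c s t B) * (\<Prod>B\<in>P - D. mt B)\<bar> = \<bar>c s t B1\<bar> * \<bar>c s t B2\<bar> *
            (\<bar>\<Prod>B\<in>D - {B1} - {B2}. c s t B\<bar> * \<bar>\<Prod>B\<in>P - D. mt B\<bar>)"
          by (simp add: abs_mult)
        also have "\<dots> \<le> \<bar>c s t B1\<bar> * \<bar>c s t B2\<bar> * (L ^ card (D - {B1} - {B2}) * L ^ card (P - D))"
          using D that c_prod[of "D - {B1} - {B2}"] mt_prod[of "P - D"] L1
          by (intro mult_left_mono mult_mono) auto
        also have "\<dots> \<le> \<bar>c s t B1\<bar> * \<bar>c s t B2\<bar> * L ^ card P"
        proof (intro mult_left_mono)
          have "card (D - {B1} - {B2}) + card (P - D) \<le> card D + card (P - D)"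
            using finD by (intro add_right_mono card_mono) auto
          also have "\<dots> = card P" using finP finD D by (metis card_Diff_subset card_mono le_add_diff_inverse)
          finally show "L ^ card (D - {B1} - {B2}) * L ^ card (P - D) \<le> L ^ card P"
            unfolding power_add[symmetric] by (rule pow_le)
        qed auto
        finally show ?thesis .
      qed
      have "\<bar>\<Sum>s\<in>T. \<Sum>t\<in>T. (\<Prod>B\<in>D. c s t B) * (\<Prod>B\<in>P - D. mt B)\<bar>
         \<le> (\<Sum>s\<in>T. \<Sum>t\<in>T. \<bar>c s t B1\<bar> * \<bar>c s t B2\<bar> * L ^ card P)"
        using term_le by (intro order_trans[OF sum_abs] sum_mono) auto
      also have "\<dots> = (\<Sum>s\<in>T. \<Sum>t\<in>T. \<bar>c s t B1\<bar> * \<bar>c s t B2\<bar>) * L ^ card P"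
        by (simp add: sum_distrib_right)
      also have "\<dots> \<le> N * (R * L) * L ^ card P" using sum12 L1 by (intro mult_right_mono) auto
      finally have "\<bar>\<Sum>s\<in>T. \<Sum>t\<in>T. (\<Prod>B\<in>D. c s t B) * (\<Prod>B\<in>P - D. mt B)\<bar> / N\<^sup>2
         \<le> N * (R * L) * L ^ card P / N\<^sup>2" by (intro divide_right_mono) auto
      also have "\<dots> = L ^ (card P + 1) * (R / N)" using N by (simp add: power2_eq_square)
      also have "\<dots> \<le> L ^ (card P + 1) * Q" using RQ L1 by (intro mult_left_mono) auto
      finally show ?thesis by (simp add: abs_divide)
    qed
  qed
  define \<mu> :: "nat set set \<Rightarrow> real" where "\<mu> P = (-1) ^ (card P - 1) * fact (card P - 1)" for P
  define PP where "PP = {P. partition_on U P} - {{U}}"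
  have finPart: "finite {P. partition_on U P}" using U_fin by (intro finitely_many_partition_on) auto
  have U_part: "{U} \<in> {P. partition_on U P}" using U_fin by (auto intro: partition_on_space)
  have cumul: "set_cumulant f U = f U + (\<Sum>P\<in>PP. \<mu> P * (\<Prod>B\<in>P. f B))" for f
    unfolding set_cumulant_def \<mu>_def PP_def by (subst sum.remove[OF finPart U_part]) simp
  have "0 \<in> U \<inter> S" "4 \<in> U - S" by (auto simp: U_def S_def)
  then have "set_cumulant (\<lambda>B. e (B \<inter> S) * e (sh (B - S))) U = 0"
    using U_fin e0 sh0 by (intro set_cumulant_cross_eq_0[where g=e and h="\<lambda>C. e (sh C)"]) auto
  then have mt_cum: "mt U + (\<Sum>P\<in>PP. \<mu> P * (\<Prod>B\<in>P. mt B)) = 0"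
    using cumul[of mt] by (simp add: mt_def[abs_def])
  \<comment> \<open>With \<open>m = c + mt\<close>, the set \<open>D\<close> collects the blocks
    that contribute \<open>c\<close>; the empty set is the term subtracted on the left, so a factor
    \<open>c\<close> is present in every remaining term.\<close>
  have expand: "(\<Prod>B\<in>P. m s t B) - (\<Prod>B\<in>P. mt B) =
      (\<Sum>D\<in>Pow P - {{}}. (\<Prod>B\<in>D. c s t B) * (\<Prod>B\<in>P - D. mt B))" if "P \<in> PP" for P s t
  proof -
    have finP: "finite P" using that U_fin finite_elements by (auto simp: PP_def)
    have "(\<Prod>B\<in>P. m s t B) = (\<Prod>B\<in>P. c s t B + mt B)" by (simp add: c_def)
    also have "\<dots> = (\<Sum>D\<in>Pow P. (\<Prod>B\<in>D. c s t B) * (\<Prod>B\<in>P - D. mt B))" by (rule prod_add[OF finP])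
    also have "\<dots> = (\<Prod>B\<in>P. mt B) + (\<Sum>D\<in>Pow P - {{}}. (\<Prod>B\<in>D. c s t B) * (\<Prod>B\<in>P - D. mt B))"
      using finP by (subst sum.remove[of _ "{}"]) auto
    finally show ?thesis by simp
  qed
  have cU: "c s t U = set_cumulant (m s t) U -
     (\<Sum>P\<in>PP. \<mu> P * (\<Sum>D\<in>Pow P - {{}}. (\<Prod>B\<in>D. c s t B) * (\<Prod>B\<in>P - D. mt B)))" for s t
  proof -
    have "c s t U = (m s t U + (\<Sum>P\<in>PP. \<mu> P * (\<Prod>B\<in>P. m s t B)))
        - (\<Sum>P\<in>PP. \<mu> P * ((\<Prod>B\<in>P. m s t B) - (\<Prod>B\<in>P. mt B)))"
      using mt_cum by (simp add: c_def right_diff_distrib sum_subtractf)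
    then show ?thesis by (simp add: cumul expand)
  qed
  have VU: "V = (\<Sum>s\<in>T. \<Sum>t\<in>T. c s t U) / N\<^sup>2"
  proof -
    have "U \<inter> S = S" "sh (U - S) = S"
    proof -
      show "U \<inter> S = S" by (auto simp: U_def S_def)
      have "x \<in> sh (U - S)" if "x < 4" for x
        unfolding sh_def using that by (intro image_eqI[of _ _ "x + 4"]) (auto simp: U_def S_def)
      then show "sh (U - S) = S" using shS[of U] by (auto simp: S_def)
    qed
    then show ?thesis
      using GG_eq[of S S] c_F[of U] by (simp add: V_def v_def power2_eq_square)
  qed
  have K8: "\<bar>set_cumulant (m s t) U\<bar> \<le> \<kappa>" if "s \<in> T" "t \<in> T" for s t
    using cum[OF that] by (simp add: cumulant_on_def m_def[abs_def] z_def U_def)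
  have "V = (\<Sum>s\<in>T. \<Sum>t\<in>T. set_cumulant (m s t) U) / N\<^sup>2 - (\<Sum>P\<in>PP. \<mu> P * (\<Sum>D\<in>Pow P - {{}}.
      (\<Sum>s\<in>T. \<Sum>t\<in>T. (\<Prod>B\<in>D. c s t B) * (\<Prod>B\<in>P - D. mt B)) / N\<^sup>2))"
  proof -
    have "(\<Sum>s\<in>T. \<Sum>t\<in>T. \<Sum>P\<in>PP. \<mu> P * (\<Sum>D\<in>Pow P - {{}}. (\<Prod>B\<in>D. c s t B) * (\<Prod>B\<in>P - D. mt B))) =
      (\<Sum>P\<in>PP. \<mu> P * (\<Sum>s\<in>T. \<Sum>t\<in>T. \<Sum>D\<in>Pow P - {{}}. (\<Prod>B\<in>D. c s t B) * (\<Prod>B\<in>P - D. mt B)))"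
      unfolding sum_distrib_left by (rule sum_swap3)
    also have "\<dots> = (\<Sum>P\<in>PP. \<mu> P * (\<Sum>D\<in>Pow P - {{}}. \<Sum>s\<in>T. \<Sum>t\<in>T. (\<Prod>B\<in>D. c s t B) * (\<Prod>B\<in>P - D. mt B)))"
      by (rule sum.cong[OF refl], rule arg_cong2[where f="(*)", OF refl], rule sum_swap3)
    finally show ?thesis
      unfolding VU cU by (simp add: sum_subtractf diff_divide_distrib sum_divide_distrib sum_distrib_left)
  qed
  also have "\<dots> \<le> \<kappa> + (\<Sum>P\<in>PP. fact (card P - 1) * (2 ^ card P * (L ^ (card P + 1) * Q)))"
  proof -
    have "(\<Sum>s\<in>T. \<Sum>t\<in>T. set_cumulant (m s t) U) / N\<^sup>2 \<le> (\<Sum>s\<in>T. \<Sum>t\<in>T. \<kappa>) / N\<^sup>2"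
      using K8 by (intro divide_right_mono sum_mono) (auto simp: abs_le_iff)
    also have "\<dots> = \<kappa>" using N by (simp add: N_def power2_eq_square)
    finally have 1: "(\<Sum>s\<in>T. \<Sum>t\<in>T. set_cumulant (m s t) U) / N\<^sup>2 \<le> \<kappa>" .
    have "\<bar>\<Sum>P\<in>PP. \<mu> P * (\<Sum>D\<in>Pow P - {{}}.
       (\<Sum>s\<in>T. \<Sum>t\<in>T. (\<Prod>B\<in>D. c s t B) * (\<Prod>B\<in>P - D. mt B)) / N\<^sup>2)\<bar> \<le>
       (\<Sum>P\<in>PP. fact (card P - 1) * (2 ^ card P * (L ^ (card P + 1) * Q)))"
    proof (intro order_trans[OF sum_abs] sum_mono)
      fix P assume P: "P \<in> PP"
      have finP: "finite P" using P U_fin finite_elements by (auto simp: PP_def)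
      have Q0: "Q \<ge> 0" using RQ R N by (metis divide_nonneg_pos less_imp_le order_trans)
      have "\<bar>\<Sum>D\<in>Pow P - {{}}. (\<Sum>s\<in>T. \<Sum>t\<in>T. (\<Prod>B\<in>D. c s t B) * (\<Prod>B\<in>P - D. mt B)) / N\<^sup>2\<bar>
        \<le> (\<Sum>D\<in>Pow P - {{}}. L ^ (card P + 1) * Q)"
        using P by (intro order_trans[OF sum_abs] sum_mono PD) (auto simp: PP_def)
      also have "\<dots> \<le> 2 ^ card P * (L ^ (card P + 1) * Q)"
        using finP Q0 L1 by (simp add: card_Pow mult_right_mono card_Diff_subset)
      finally have "\<bar>\<mu> P\<bar> * \<bar>\<Sum>D\<in>Pow P - {{}}. (\<Sum>s\<in>T. \<Sum>t\<in>T. (\<Prod>B\<in>D. c s t B) * (\<Prod>B\<in>P - D. mt B)) / N\<^sup>2\<bar>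
        \<le> \<bar>\<mu> P\<bar> * (2 ^ card P * (L ^ (card P + 1) * Q))" by (rule mult_left_mono) simp
      then show "\<bar>\<mu> P * (\<Sum>D\<in>Pow P - {{}}. (\<Sum>s\<in>T. \<Sum>t\<in>T. (\<Prod>B\<in>D. c s t B) * (\<Prod>B\<in>P - D. mt B)) / N\<^sup>2)\<bar>
        \<le> fact (card P - 1) * (2 ^ card P * (L ^ (card P + 1) * Q))"
        by (simp add: abs_mult \<mu>_def power_abs)
    qed
    then show ?thesis using 1 by linarith
  qed
  also have "(\<Sum>P\<in>PP. fact (card P - 1) * (2 ^ card P * (L ^ (card P + 1) * Q))) \<le> C * Q"
  proof -
    have Q0: "Q \<ge> 0" using RQ R N by (metis divide_nonneg_pos less_imp_le order_trans)
    have "(\<Sum>P\<in>PP. fact (card P - 1) * (2 ^ card P * (L ^ (card P + 1) * Q))) \<le>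
      (\<Sum>P | partition_on U P. fact (card P - 1) * (2 ^ card P * (L ^ (card P + 1) * Q)))"
      using finPart L1 Q0 by (intro sum_mono2) (auto simp: PP_def)
    also have "\<dots> = C * Q"
      by (simp add: C_def quartic_const_def U_def L_def sum_distrib_right mult.assoc)
    finally show ?thesis .
  qed
  finally have "V \<le> (\<kappa> + C * (R / N)) + (C * sqrt (R / N)) * sqrt V"
    by (simp add: Q_def algebra_simps)
  moreover have "C \<ge> 0" unfolding C_def quartic_const_def by (intro sum_nonneg) auto
  ultimately have "V \<le> 2 * (\<kappa> + C * (R / N)) + (C * sqrt (R / N))\<^sup>2"
    using v0 R N by (intro le_of_le_add_mult_sqrt) (auto simp: V_def)
  also have "(C * sqrt (R / N))\<^sup>2 = C\<^sup>2 * (R / N)" using R N by (simp add: power_mult_distrib)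
  finally have "V \<le> 2 * (\<kappa> + C * (R / N)) + C\<^sup>2 * (R / N)" .
  moreover have "G S w = (\<Sum>t\<in>T. (\<Prod>i<4. y i t w)) / card T - e {..<4}" for w
    using N by (simp add: G_def F_def sum_subtractf diff_divide_distrib N_def S_def)
  ultimately show ?thesis by (simp add: V_def v_def N_def)
qed

section \<open>Linear and quadratic forms of the process\<close>

locale spectral_process = prob_space M for M :: "'w measure" +
  fixes X :: "int \<Rightarrow> 'w \<Rightarrow> real"
  assumes rv: "\<And>t. X t \<in> borel_measurable M"
    and stationary: "strictly_stationary M X"
    and moments: "\<And>t. integrable M (\<lambda>w. X t w ^ 8)"
    and mean0: "\<And>t. (\<integral>w. X t w \<partial>M) = 0"
    and autocov_summable: "(\<lambda>h::int. (1 + \<bar>real_of_int h\<bar>) * \<bar>autocov M X h\<bar>) summable_on UNIV"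
    and cum4_summable: "(\<lambda>(h1::int, h2::int, h3::int).
          (1 + \<bar>real_of_int h1\<bar> + \<bar>real_of_int h2\<bar> + \<bar>real_of_int h3\<bar>) *
          \<bar>lag_cumulant M X [h1, h2, h3]\<bar>) summable_on UNIV"
    and cum8_summable: "(\<lambda>hs. \<bar>lag_cumulant M X hs\<bar>) summable_on {hs :: int list. length hs = 7}"
begin

lemma L8_X: "L8 M (X t)"
  using rv moments by (simp add: L8_def)

lemma expectation_prod_shift:
  assumes "finite B"
  shows "(\<integral>w. (\<Prod>i\<in>B. X (p i + h) w) \<partial>M) = (\<integral>w. (\<Prod>i\<in>B. X (p i) w) \<partial>M)"
proof -
  have [measurable]: "\<And>t. X t \<in> borel_measurable M" by (rule rv)
  define J where "J = p ` B"
  have J: "finite J" using assms by (simp add: J_def)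
  have F: "(\<lambda>x. \<Prod>i\<in>B. x (p i)) \<in> borel_measurable (Pi\<^sub>M J (\<lambda>_. borel :: real measure))"
    by (intro borel_measurable_prod measurable_component_singleton) (simp add: J_def)
  have meas: "(\<lambda>w. \<lambda>t\<in>J. X (t + h) w) \<in> M \<rightarrow>\<^sub>M Pi\<^sub>M J (\<lambda>_. borel)" for h
    by (intro measurable_restrict) measurable
  have eq: "(\<integral>w. (\<Prod>i\<in>B. X (p i + h) w) \<partial>M) =
     (\<integral>x. (\<Prod>i\<in>B. x (p i)) \<partial>distr M (Pi\<^sub>M J (\<lambda>_. borel)) (\<lambda>w. \<lambda>t\<in>J. X (t + h) w))" for h
    unfolding integral_distr[OF meas F]
    by (intro Bochner_Integration.integral_cong prod.cong) (auto simp: J_def)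
  show ?thesis
    using eq[of h] eq[of 0] stationary J unfolding strictly_stationary_def by simp
qed

abbreviation \<gamma> :: "int \<Rightarrow> real" where "\<gamma> \<equiv> autocov M X"

definition c4 :: "int \<Rightarrow> int \<Rightarrow> int \<Rightarrow> real" where "c4 h1 h2 h3 = lag_cumulant M X [h1, h2, h3]"

lemma expectation_mult: "(\<integral>w. X s w * X t w \<partial>M) = \<gamma> (t - s)"
proof -
  have "(\<integral>w. (\<Prod>i\<in>{0, 1::nat}. X ((if i = 0 then 0 else t - s) + s) w) \<partial>M) =
     (\<integral>w. (\<Prod>i\<in>{0, 1::nat}. X (if i = 0 then 0 else t - s) w) \<partial>M)"
    by (rule expectation_prod_shift) simp
  then show ?thesis by (simp add: autocov_def mean0)
qed

lemma autocov_uminus: "\<gamma> (- h) = \<gamma> h"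
  using expectation_mult[of 0 h] expectation_mult[of h 0] by (simp add: mult.commute)

lemma autocov_commute: "\<gamma> (s - t) = \<gamma> (t - s)"
  using autocov_uminus[of "t - s"] by simp

end

section \<open>Fourth moments in terms of cumulants and covariances\<close>

text \<open>In the recursion at index 0 a block with one or three elements contributes nothing,
  because either it or its complement is a singleton with vanishing mean.\<close>

lemma set_cumulant_4:
  fixes m :: "nat set \<Rightarrow> real"
  assumes m0: "m {} = 1" and m1: "\<And>i. i < 4 \<Longrightarrow> m {i} = 0"
  shows "m {..<4} = set_cumulant m {..<4} + m {0,1} * m {2,3} + m {0,2} * m {1,3} + m {0,3} * m {1,2}"
proof -
  have pow1: "{B. B \<subseteq> {i} \<and> i \<in> B} = {{i}}" for i :: nat by auto
  have k1: "set_cumulant m {i} = m {i}" for i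
    using set_cumulant_recursion[of "{i}" i m] m0 by (simp add: pow1)
  have k2: "set_cumulant m {0, i} = m {0, i}" if "i < 4" "i \<noteq> 0" for i
  proof -
    have "{B. B \<subseteq> {0, i} \<and> 0 \<in> B} = {{0}, {0, i}}" by auto
    moreover have "{0} \<noteq> {0, i}" using that by auto
    ultimately show ?thesis
      using set_cumulant_recursion[of "{0, i}" 0 m] m0 k1[of 0] m1[of 0] by simp
  qed
  let ?F = "{B. B \<subseteq> {..<4::nat} \<and> 0 \<in> B}" and ?G = "{{0,1}, {0,2}, {0,3}, {..<4::nat}}"
  have four: "{..<4::nat} = {0,1,2,3}" by auto
  have diff: "{..<4} - {0,1::nat} = {2,3}" "{..<4} - {0,2::nat} = {1,3}" "{..<4} - {0,3::nat} = {1,2}"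
    unfolding four by auto
  have zero: "set_cumulant m B * m ({..<4} - B) = 0" if B: "B \<in> ?F - ?G" for B
  proof -
    have P: "Pow {1,2,3::nat} = {{}, {1}, {2}, {3}, {1,2}, {1,3}, {2,3}, {1,2,3}}"
      by (simp add: Pow_insert insert_commute)
    have "B - {0} \<in> Pow {1,2,3}" using B unfolding four by blast
    then have "B - {0} \<in> {{}, {1}, {2}, {3}, {1,2}, {1,3}, {2,3}, {1,2,3}}" unfolding P .
    moreover have "B = insert 0 (B - {0})" using B by blast
    ultimately have "B = {0} \<or> B = {0,1} \<or> B = {0,2} \<or> B = {0,3} \<or> B = {0,1,2} \<or> B = {0,1,3} \<or>
      B = {0,2,3} \<or> B = {..<4}"
      unfolding four by (metis (no_types, lifting) insert_iff singletonD)
    then have "B = {0} \<or> B = {0,1,2} \<or> B = {0,1,3} \<or> B = {0,2,3}" using B by blast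
    moreover have "{..<4} - {0,1,2::nat} = {3}" "{..<4} - {0,1,3::nat} = {2}" "{..<4} - {0,2,3::nat} = {1}"
      unfolding four by auto
    ultimately have "B = {0} \<or> (\<exists>i<4. {..<4} - B = {i})" by fastforce
    then consider "B = {0}" | i where "i < 4" "{..<4} - B = {i}" by blast
    then show ?thesis
    proof cases
      case 1
      then show ?thesis using k1[of 0] m1[of 0] by simp
    next
      case 2
      show ?thesis unfolding 2(2) m1[OF 2(1)] by simp
    qed
  qed
  have "{0,1} \<noteq> {0,2::nat}" "{0,1} \<noteq> {0,3::nat}" "{0,2} \<noteq> {0,3::nat}"
    by (simp_all add: doubleton_eq_iff)
  moreover have "card {0,1::nat} \<noteq> card {..<4::nat}" "card {0,2::nat} \<noteq> card {..<4::nat}" "card {0,3::nat} \<noteq> card {..<4::nat}"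
    by simp_all
  ultimately have neq: "{0,1} \<noteq> {0,2::nat}" "{0,1} \<noteq> {0,3::nat}" "{0,2} \<noteq> {0,3::nat}"
    "{0,1} \<noteq> {..<4::nat}" "{0,2} \<noteq> {..<4::nat}" "{0,3} \<noteq> {..<4::nat}"
    by metis+
  have "m {..<4} = (\<Sum>B\<in>?F. set_cumulant m B * m ({..<4} - B))"
    by (rule set_cumulant_recursion) (auto simp: m0)
  also have "\<dots> = (\<Sum>B\<in>?G. set_cumulant m B * m ({..<4} - B))"
  proof (rule sum.mono_neutral_right)
    show "finite ?F" by (rule finite_subset[of _ "Pow {..<4}"]) auto
    show "?G \<subseteq> ?F" by simp
    show "\<forall>B\<in>?F - ?G. set_cumulant m B * m ({..<4} - B) = 0" using zero by blast
  qed
  also have "\<dots> = set_cumulant m {0,1} * m ({..<4} - {0,1}) + (set_cumulant m {0,2} * m ({..<4} - {0,2}) +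
     (set_cumulant m {0,3} * m ({..<4} - {0,3}) + set_cumulant m {..<4} * m ({..<4} - {..<4})))"
  proof -
    have "{0,1} \<notin> {{0,2}, {0,3}, {..<4::nat}}" "{0,2} \<notin> {{0,3}, {..<4::nat}}" "{0,3} \<notin> {{..<4::nat}}"
      using neq by blast+
    then show ?thesis by (simp only: sum.insert finite.insertI finite.emptyI empty_iff sum.empty not_False_eq_True add_0_right)
  qed
  finally show ?thesis unfolding diff using k2[of 1] k2[of 2] k2[of 3] m0 by simp
qed

lemma (in prob_space) expectation_prod4:
  fixes Y :: "nat \<Rightarrow> 'a \<Rightarrow> real"
  assumes "\<And>i. i < 4 \<Longrightarrow> (\<integral>w. Y i w \<partial>M) = 0"
  shows "(\<integral>w. Y 0 w * Y 1 w * Y 2 w * Y 3 w \<partial>M) = cumulant_on M Y {..<4}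
      + (\<integral>w. Y 0 w * Y 1 w \<partial>M) * (\<integral>w. Y 2 w * Y 3 w \<partial>M)
      + (\<integral>w. Y 0 w * Y 2 w \<partial>M) * (\<integral>w. Y 1 w * Y 3 w \<partial>M)
      + (\<integral>w. Y 0 w * Y 3 w \<partial>M) * (\<integral>w. Y 1 w * Y 2 w \<partial>M)"
proof -
  define m where "m B = (\<integral>w. (\<Prod>i\<in>B. Y i w) \<partial>M)" for B :: "nat set"
  have "{..<4::nat} = {0,1,2,3}" by auto
  then have "m {..<4} = (\<integral>w. Y 0 w * Y 1 w * Y 2 w * Y 3 w \<partial>M)" by (simp add: m_def mult.assoc)
  moreover have "m {..<4} = set_cumulant m {..<4} + m {0,1} * m {2,3} + m {0,2} * m {1,3} + m {0,3} * m {1,2}"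
    using assms by (intro set_cumulant_4) (auto simp: m_def prob_space)
  moreover have "m {0,1} = (\<integral>w. Y 0 w * Y 1 w \<partial>M)" "m {2,3} = (\<integral>w. Y 2 w * Y 3 w \<partial>M)"
    "m {0,2} = (\<integral>w. Y 0 w * Y 2 w \<partial>M)" "m {1,3} = (\<integral>w. Y 1 w * Y 3 w \<partial>M)"
    "m {0,3} = (\<integral>w. Y 0 w * Y 3 w \<partial>M)" "m {1,2} = (\<integral>w. Y 1 w * Y 2 w \<partial>M)"
    "cumulant_on M Y {..<4} = set_cumulant m {..<4}"
    by (simp_all add: m_def cumulant_on_def m_def[abs_def])
  ultimately show ?thesis by (simp only:)
qed

context spectral_process
begin

lemma cumulant_on_shift:
  assumes "finite U"
  shows "cumulant_on M (\<lambda>i. X (p i + h)) U = cumulant_on M (\<lambda>i. X (p i)) U"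
  unfolding cumulant_on_def using assms finite_subset
  by (intro set_cumulant_cong expectation_prod_shift) blast

lemma cumulant_on_eq_lag_cumulant:
  "cumulant_on M (\<lambda>i. X (p i)) {..<Suc r} = lag_cumulant M X (map (\<lambda>i. p (Suc i) - p 0) [0..<r])"
proof -
  have "cumulant_on M (\<lambda>i. X (p i)) {..<Suc r} = cumulant_on M (\<lambda>i. X (p i + (- p 0))) {..<Suc r}"
    by (rule cumulant_on_shift[symmetric]) simp
  also have "\<dots> = cumulant_on M (\<lambda>i. map X (0 # map (\<lambda>i. p (Suc i) - p 0) [0..<r]) ! i) {..<Suc r}"
    by (rule cumulant_on_cong) (auto simp: nth_Cons' less_Suc_eq_0_disj)
  also have "\<dots> = lag_cumulant M X (map (\<lambda>i. p (Suc i) - p 0) [0..<r])"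
    by (simp add: lag_cumulant_def joint_cumulant_eq_set_cumulant cumulant_on_def)
  finally show ?thesis .
qed

lemma expectation_mult4:
  "(\<integral>w. X p w * X q w * X u w * X v w \<partial>M) = c4 (q - p) (u - p) (v - p)
     + \<gamma> (q - p) * \<gamma> (v - u) + \<gamma> (u - p) * \<gamma> (v - q) + \<gamma> (v - p) * \<gamma> (u - q)"
proof -
  define t where "t = (\<lambda>i::nat. if i = 0 then p else if i = 1 then q else if i = 2 then u else v)"
  have "cumulant_on M (\<lambda>i. X (t i)) {..<4} = c4 (q - p) (u - p) (v - p)"
    using cumulant_on_eq_lag_cumulant[of t 3] by (simp add: t_def c4_def upt_rec numeral_eq_Suc)
  then show ?thesis
    using expectation_prod4[of "\<lambda>i. X (t i)"] mean0 by (simp add: expectation_mult t_def)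
qed

text \<open>Solved from the fourth moment, in which all other terms are symmetric. This symmetry
  later allows a cosine of a sum of two phases to be replaced by the product of the cosines.\<close>

lemma c4_swap: "c4 h1 h3 h2 = c4 h1 h2 h3"
proof -
  have "(\<integral>w. X 0 w * X h1 w * X h2 w * X h3 w \<partial>M) = (\<integral>w. X 0 w * X h1 w * X h3 w * X h2 w \<partial>M)"
    by (simp add: mult_ac)
  then show ?thesis using autocov_commute[of h2 h3] by (simp add: expectation_mult4)
qed

definition K\<gamma> where "K\<gamma> = (\<Sum>\<^sub>\<infinity>h\<in>UNIV. (1 + \<bar>real_of_int h\<bar>) * \<bar>\<gamma> h\<bar>)"
definition K4 where "K4 = (\<Sum>\<^sub>\<infinity>(h1, h2, h3)\<in>UNIV.
   (1 + \<bar>real_of_int h1\<bar> + \<bar>real_of_int h2\<bar> + \<bar>real_of_int h3\<bar>) * \<bar>c4 h1 h2 h3\<bar>)"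
definition K8 where "K8 = (\<Sum>\<^sub>\<infinity>hs\<in>{hs. length hs = 7}. \<bar>lag_cumulant M X hs\<bar>)"

lemma K_nonneg: "K\<gamma> \<ge> 0" "K4 \<ge> 0" "K8 \<ge> 0"
  unfolding K\<gamma>_def K4_def K8_def by (auto intro!: infsum_nonneg)

lemma sum_weighted_autocov_le:
  assumes "finite A"
  shows "(\<Sum>h\<in>A. (1 + \<bar>real_of_int h\<bar>) * \<bar>\<gamma> h\<bar>) \<le> K\<gamma>"
  unfolding K\<gamma>_def using assms autocov_summable by (intro finite_sum_le_infsum) auto

lemma sum_autocov_le:
  assumes "finite A" "inj_on f A"
  shows "(\<Sum>x\<in>A. \<bar>\<gamma> (f x)\<bar>) \<le> K\<gamma>"
proof -
  have "(\<Sum>x\<in>A. \<bar>\<gamma> (f x)\<bar>) = (\<Sum>h\<in>f ` A. \<bar>\<gamma> h\<bar>)"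
    using assms by (simp add: sum.reindex)
  also have "\<dots> \<le> (\<Sum>h\<in>f ` A. (1 + \<bar>real_of_int h\<bar>) * \<bar>\<gamma> h\<bar>)"
    by (intro sum_mono) (simp add: distrib_right)
  also have "\<dots> \<le> K\<gamma>" using assms by (intro sum_weighted_autocov_le) auto
  finally show ?thesis .
qed

lemma sum_c4_le:
  assumes "finite A" "inj_on (\<lambda>x. (f x, g x, h x)) A"
  shows "(\<Sum>x\<in>A. \<bar>c4 (f x) (g x) (h x)\<bar>) \<le> K4"
proof -
  let ?F = "\<lambda>(h1, h2, h3). \<bar>c4 h1 h2 h3\<bar>"
  let ?G = "\<lambda>(h1, h2, h3). (1 + \<bar>real_of_int h1\<bar> + \<bar>real_of_int h2\<bar> + \<bar>real_of_int h3\<bar>) * \<bar>c4 h1 h2 h3\<bar>"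
  have "(\<Sum>x\<in>A. \<bar>c4 (f x) (g x) (h x)\<bar>) = (\<Sum>z\<in>(\<lambda>x. (f x, g x, h x)) ` A. ?F z)"
    using assms by (simp add: sum.reindex)
  also have "\<dots> \<le> (\<Sum>z\<in>(\<lambda>x. (f x, g x, h x)) ` A. ?G z)"
    by (intro sum_mono) (auto simp: distrib_right)
  also have "\<dots> \<le> K4" unfolding K4_def
    using assms cum4_summable by (intro finite_sum_le_infsum) (auto simp: c4_def)
  finally show ?thesis .
qed

text \<open>Once the first of the eight positions is fixed, the others are determined by their lags
  to it, so each choice of the first position costs at most \<open>K8\<close>.\<close>

lemma sum_cumulant8_le:
  assumes S: "finite S"
  shows "(\<Sum>g\<in>PiE {..<8} (\<lambda>_. S). \<bar>cumulant_on M (\<lambda>i. X (\<tau> i + int (g i))) {..<8::nat}\<bar>) \<le> card S * K8"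
proof -
  let ?P = "PiE {..<8::nat} (\<lambda>_. S)"
  define lags where "lags g = map (\<lambda>i. (\<tau> (Suc i) + int (g (Suc i))) - (\<tau> 0 + int (g 0))) [0..<7]"
    for g :: "nat \<Rightarrow> nat"
  have finP: "finite ?P" using S by (intro finite_PiE) auto
  have eq: "cumulant_on M (\<lambda>i. X (\<tau> i + int (g i))) {..<8} = lag_cumulant M X (lags g)" for g
    using cumulant_on_eq_lag_cumulant[of "\<lambda>i. \<tau> i + int (g i)" 7] by (simp add: lags_def)
  have inj: "inj_on lags {g \<in> ?P. g 0 = s}" for s
  proof (rule inj_onI)
    fix g g' assume g: "g \<in> {g \<in> ?P. g 0 = s}" and g': "g' \<in> {g \<in> ?P. g 0 = s}" and l: "lags g = lags g'"
    have "g i = g' i" if "i < 8" for i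
    proof (cases i)
      case (Suc j)
      then have "lags g ! j = lags g' ! j" "j < 7" using l that by auto
      then show ?thesis using g g' Suc by (simp add: lags_def)
    qed (use g g' in auto)
    then show "g = g'" using g g' by (intro PiE_ext[of g "{..<8}" "\<lambda>_. S" g']) auto
  qed
  have img: "(\<lambda>g. g 0) ` ?P \<subseteq> S"
  proof clarify
    fix g assume "g \<in> ?P"
    then show "g 0 \<in> S" by (rule PiE_mem) simp
  qed
  have "(\<Sum>g\<in>?P. \<bar>cumulant_on M (\<lambda>i. X (\<tau> i + int (g i))) {..<8}\<bar>) =
    (\<Sum>g\<in>?P. \<bar>lag_cumulant M X (lags g)\<bar>)" by (simp only: eq)
  also have "\<dots> = (\<Sum>s\<in>S. \<Sum>g | g \<in> ?P \<and> g 0 = s. \<bar>lag_cumulant M X (lags g)\<bar>)"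
    by (rule sum.group[OF finP S img, symmetric])
  also have "\<dots> \<le> (\<Sum>s\<in>S. K8)"
  proof (rule sum_mono)
    fix s
    have "(\<Sum>g | g \<in> ?P \<and> g 0 = s. \<bar>lag_cumulant M X (lags g)\<bar>) =
       (\<Sum>hs\<in>lags ` {g \<in> ?P. g 0 = s}. \<bar>lag_cumulant M X hs\<bar>)"
      using inj[of s] by (simp add: sum.reindex)
    also have "\<dots> \<le> K8"
      unfolding K8_def
    proof (rule finite_sum_le_infsum[OF cum8_summable])
      show "finite (lags ` {g \<in> ?P. g 0 = s})" using finP by (intro finite_imageI finite_Collect_conjI) (simp add: Collect_mem_eq)
      show "lags ` {g \<in> ?P. g 0 = s} \<subseteq> {hs. length hs = 7}" by (rule image_subsetI) (simp add: lags_def)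
    qed simp
    finally show "(\<Sum>g | g \<in> ?P \<and> g 0 = s. \<bar>lag_cumulant M X (lags g)\<bar>) \<le> K8" .
  qed
  finally show ?thesis by simp
qed

end

lemma sum2_mult_sum2:
  fixes f g :: "'i \<Rightarrow> 'i \<Rightarrow> real"
  shows "(\<Sum>s\<in>A. \<Sum>s'\<in>A. f s s') * (\<Sum>u\<in>B. \<Sum>u'\<in>B. g u u') =
    (\<Sum>s\<in>A. \<Sum>s'\<in>A. \<Sum>u\<in>B. \<Sum>u'\<in>B. f s s' * g u u')"
proof -
  define C where "C = (\<Sum>u\<in>B. \<Sum>u'\<in>B. g u u')"
  have "(\<Sum>s\<in>A. \<Sum>s'\<in>A. f s s') * C = (\<Sum>s\<in>A. \<Sum>s'\<in>A. f s s' * C)"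
    by (simp add: sum_distrib_right)
  then show ?thesis by (simp add: C_def sum_distrib_left)
qed

context spectral_process
begin

text \<open>The factor \<open>1 / sqrt b\<close> keeps the variance bounded in \<open>b\<close>.
  With cosine and sine weights these are, up to sign, the real and imaginary parts of the normalised
  Fourier transform of a block.\<close>

definition lform :: "(nat \<Rightarrow> real) \<Rightarrow> nat \<Rightarrow> int \<Rightarrow> 'w \<Rightarrow> real" where
  "lform a b t \<omega> = (\<Sum>s=1..b. a s / sqrt b * X (t + int s) \<omega>)"

definition qform :: "(nat \<Rightarrow> nat \<Rightarrow> real) \<Rightarrow> nat \<Rightarrow> int \<Rightarrow> 'w \<Rightarrow> real" where
  "qform w b t \<omega> = (\<Sum>s=1..b. \<Sum>s'=1..b. w s s' * (X (t + int s) \<omega> * X (t + int s') \<omega>)) / b"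

lemma lform_mult: "lform a b t \<omega> * lform a' b t \<omega> = qform (\<lambda>s s'. a s * a' s') b t \<omega>"
  unfolding lform_def qform_def sum_product sum_divide_distrib
  by (intro sum.cong refl) (simp add: field_simps)

lemma L8_lform: "L8 M (lform a b t)"
  unfolding lform_def[abs_def] by (intro L8_sum L8_cmult L8_X) simp

lemma integrable_X2: "integrable M (\<lambda>\<omega>. X s \<omega> * X t \<omega>)"
  using integrable_prod_L8[of "{0,1::nat}" "\<lambda>i. if i = 0 then X s else X t"] L8_X by simp

lemma integrable_X4: "integrable M (\<lambda>\<omega>. X p \<omega> * X q \<omega> * (X u \<omega> * X v \<omega>))"
  using integrable_prod_L8[of "{0,1,2,3::nat}" "\<lambda>i. if i = 0 then X p else if i = 1 then X q else if i = 2 then X u else X v"] L8_X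
  by (simp add: mult_ac)

lemma expectation_lform: "(\<integral>\<omega>. lform a b t \<omega> \<partial>M) = 0"
proof -
  have "integrable M (X s)" for s
    using integrable_prod_L8[of "{0::nat}" "\<lambda>_. X s"] L8_X by simp
  then show ?thesis by (simp add: lform_def mean0)
qed

lemma qform_measurable: "qform w b t \<in> borel_measurable M"
proof -
  have [measurable]: "\<And>t. X t \<in> borel_measurable M" by (rule rv)
  show ?thesis unfolding qform_def[abs_def] by measurable
qed

lemma integrable_qform: "integrable M (qform w b t)"
  unfolding qform_def[abs_def] using integrable_X2 by simp

lemma expectation_qform:
  "(\<integral>\<omega>. qform w b t \<omega> \<partial>M) = (\<Sum>s=1..b. \<Sum>s'=1..b. w s s' * \<gamma> (int s' - int s)) / b"
  unfolding qform_def using integrable_X2 by (simp add: expectation_mult)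

lemma qform_mult: "qform w b p \<omega> * qform v b t \<omega> =
   (\<Sum>s=1..b. \<Sum>s'=1..b. \<Sum>u=1..b. \<Sum>u'=1..b. w s s' * v u u' *
      (X (p + int s) \<omega> * X (p + int s') \<omega> * (X (t + int u) \<omega> * X (t + int u') \<omega>))) / b\<^sup>2"
proof -
  have "(\<Sum>s=1..b. \<Sum>s'=1..b. w s s' * (X (p + int s) \<omega> * X (p + int s') \<omega>)) *
    (\<Sum>u=1..b. \<Sum>u'=1..b. v u u' * (X (t + int u) \<omega> * X (t + int u') \<omega>)) =
    (\<Sum>s=1..b. \<Sum>s'=1..b. \<Sum>u=1..b. \<Sum>u'=1..b. w s s' * v u u' *
      (X (p + int s) \<omega> * X (p + int s') \<omega> * (X (t + int u) \<omega> * X (t + int u') \<omega>)))"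
    unfolding sum2_mult_sum2 by (intro sum.cong refl) (simp add: mult_ac)
  then show ?thesis by (simp add: qform_def power2_eq_square)
qed

lemma integrable_qform_mult: "integrable M (\<lambda>\<omega>. qform w b p \<omega> * qform v b t \<omega>)"
  unfolding qform_mult using integrable_X4 by simp

text \<open>Of the three pairings in the fourth moment, the one that pairs within each form is the
  product of the two means and cancels; the cumulant and the two cross pairings remain.\<close>

lemma covariance_qform:
  "(\<integral>\<omega>. qform w b p \<omega> * qform v b t \<omega> \<partial>M) -
     (\<integral>\<omega>. qform w b p \<omega> \<partial>M) * (\<integral>\<omega>. qform v b t \<omega> \<partial>M) =
   (\<Sum>s=1..b. \<Sum>s'=1..b. \<Sum>u=1..b. \<Sum>u'=1..b. w s s' * v u u' *
      (c4 (int s' - int s) (t - p + int u - int s) (t - p + int u' - int s)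
       + \<gamma> (t - p + int u - int s) * \<gamma> (t - p + int u' - int s')
       + \<gamma> (t - p + int u' - int s) * \<gamma> (t - p + int u - int s'))) / b\<^sup>2"
proof -
  have 1: "(\<integral>\<omega>. X (p + int s) \<omega> * X (p + int s') \<omega> * (X (t + int u) \<omega> * X (t + int u') \<omega>) \<partial>M) =
     (c4 (int s' - int s) (t - p + int u - int s) (t - p + int u' - int s)
       + \<gamma> (t - p + int u - int s) * \<gamma> (t - p + int u' - int s')
       + \<gamma> (t - p + int u' - int s) * \<gamma> (t - p + int u - int s'))
     + \<gamma> (int s' - int s) * \<gamma> (int u' - int u)" for s s' u u'
    using expectation_mult4[of "p + int s" "p + int s'" "t + int u" "t + int u'"]
    by (simp add: mult.assoc algebra_simps)
  have 2: "(\<integral>\<omega>. qform w b p \<omega> \<partial>M) * (\<integral>\<omega>. qform v b t \<omega> \<partial>M) =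
     (\<Sum>s=1..b. \<Sum>s'=1..b. \<Sum>u=1..b. \<Sum>u'=1..b. w s s' * v u u' *
       (\<gamma> (int s' - int s) * \<gamma> (int u' - int u))) / b\<^sup>2"
  proof -
    have "(\<Sum>s=1..b. \<Sum>s'=1..b. w s s' * \<gamma> (int s' - int s)) *
       (\<Sum>u=1..b. \<Sum>u'=1..b. v u u' * \<gamma> (int u' - int u)) =
     (\<Sum>s=1..b. \<Sum>s'=1..b. \<Sum>u=1..b. \<Sum>u'=1..b. w s s' * v u u' *
       (\<gamma> (int s' - int s) * \<gamma> (int u' - int u)))"
      unfolding sum2_mult_sum2 by (intro sum.cong refl) (simp add: mult_ac)
    then show ?thesis by (simp add: expectation_qform power2_eq_square)
  qed
  have 3: "(\<integral>\<omega>. qform w b p \<omega> * qform v b t \<omega> \<partial>M) =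
    (\<Sum>s=1..b. \<Sum>s'=1..b. \<Sum>u=1..b. \<Sum>u'=1..b. w s s' * v u u' *
      (\<integral>\<omega>. X (p + int s) \<omega> * X (p + int s') \<omega> * (X (t + int u) \<omega> * X (t + int u') \<omega>) \<partial>M)) / b\<^sup>2"
    unfolding qform_mult using integrable_X4 by simp
  show ?thesis
    unfolding 3 2 1 diff_divide_distrib[symmetric] sum_subtractf[symmetric]
    by (simp add: algebra_simps)
qed

text \<open>\<open>K4\<close> for the fourth order cumulant, and \<open>K\<gamma>\<^sup>2\<close>
  for each of the two cross pairings.\<close>

definition cov_const where "cov_const = K4 + 2 * K\<gamma>\<^sup>2"

lemma cov_const_nonneg: "cov_const \<ge> 0"
  using K_nonneg by (simp add: cov_const_def)

lemma abs_covariance_qform_le: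
  assumes w: "\<And>s s'. \<bar>w s s'\<bar> \<le> 1" and v: "\<And>s s'. \<bar>v s s'\<bar> \<le> 1"
  shows "\<bar>(\<integral>\<omega>. qform w b p \<omega> * qform v b t \<omega> \<partial>M) -
     (\<integral>\<omega>. qform w b p \<omega> \<partial>M) * (\<integral>\<omega>. qform v b t \<omega> \<partial>M)\<bar> \<le>
    ((\<Sum>s=1..b. \<Sum>s'=1..b. \<Sum>u=1..b. \<Sum>u'=1..b.
        \<bar>c4 (int s' - int s) (t - p + int u - int s) (t - p + int u' - int s)\<bar>)
     + 2 * (\<Sum>s=1..b. \<Sum>s'=1..b. \<Sum>u=1..b. \<Sum>u'=1..b.
        \<bar>\<gamma> (t - p + int u - int s)\<bar> * \<bar>\<gamma> (t - p + int u' - int s')\<bar>)) / b\<^sup>2"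
proof -
  define A where "A s s' u u' = c4 (int s' - int s) (t - p + int u - int s) (t - p + int u' - int s)" for s s' u u' :: nat
  define B where "B s s' u u' = \<gamma> (t - p + int u - int s) * \<gamma> (t - p + int u' - int s')" for s s' u u' :: nat
  have "\<bar>w s s' * v u u' * (A s s' u u' + B s s' u u' + B s s' u' u)\<bar> \<le>
      \<bar>A s s' u u'\<bar> + \<bar>B s s' u u'\<bar> + \<bar>B s s' u' u\<bar>" for s s' u u'
  proof -
    have "\<bar>w s s' * v u u'\<bar> \<le> 1 * 1" unfolding abs_mult using w v by (intro mult_mono) auto
    then have "\<bar>w s s' * v u u' * (A s s' u u' + B s s' u u' + B s s' u' u)\<bar> \<le>
       1 * \<bar>A s s' u u' + B s s' u u' + B s s' u' u\<bar>"
      unfolding abs_mult[of "w s s' * v u u'"] by (intro mult_right_mono) auto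
    then show ?thesis
      by (rule order_trans) (use abs_triangle_ineq[of "A s s' u u' + B s s' u u'" "B s s' u' u"]
        abs_triangle_ineq[of "A s s' u u'" "B s s' u u'"] in simp)
  qed
  then have "\<bar>\<Sum>s=1..b. \<Sum>s'=1..b. \<Sum>u=1..b. \<Sum>u'=1..b. w s s' * v u u' * (A s s' u u' + B s s' u u' + B s s' u' u)\<bar>
    \<le> (\<Sum>s=1..b. \<Sum>s'=1..b. \<Sum>u=1..b. \<Sum>u'=1..b. \<bar>A s s' u u'\<bar> + \<bar>B s s' u u'\<bar> + \<bar>B s s' u' u\<bar>)"
    by (intro order_trans[OF sum_abs] sum_mono)
  also have "\<dots> = (\<Sum>s=1..b. \<Sum>s'=1..b. \<Sum>u=1..b. \<Sum>u'=1..b. \<bar>A s s' u u'\<bar>) +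
     (\<Sum>s=1..b. \<Sum>s'=1..b. \<Sum>u=1..b. \<Sum>u'=1..b. \<bar>B s s' u u'\<bar>) +
     (\<Sum>s=1..b. \<Sum>s'=1..b. \<Sum>u=1..b. \<Sum>u'=1..b. \<bar>B s s' u' u\<bar>)"
    by (simp add: sum.distrib)
  \<comment> \<open>Exchanging the names of \<open>u\<close> and \<open>u'\<close> identifies the
    two cross pairings.\<close>
  also have "(\<Sum>s=1..b. \<Sum>s'=1..b. \<Sum>u=1..b. \<Sum>u'=1..b. \<bar>B s s' u' u\<bar>) =
     (\<Sum>s=1..b. \<Sum>s'=1..b. \<Sum>u=1..b. \<Sum>u'=1..b. \<bar>B s s' u u'\<bar>)"
    by (rule sum.cong[OF refl], rule sum.cong[OF refl], rule sum.swap)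
  finally have le: "\<bar>\<Sum>s=1..b. \<Sum>s'=1..b. \<Sum>u=1..b. \<Sum>u'=1..b. w s s' * v u u' * (A s s' u u' + B s s' u u' + B s s' u' u)\<bar>
    \<le> (\<Sum>s=1..b. \<Sum>s'=1..b. \<Sum>u=1..b. \<Sum>u'=1..b. \<bar>A s s' u u'\<bar>) +
     2 * (\<Sum>s=1..b. \<Sum>s'=1..b. \<Sum>u=1..b. \<Sum>u'=1..b. \<bar>B s s' u u'\<bar>)" by simp
  show ?thesis
    unfolding covariance_qform abs_divide using divide_right_mono[OF le, of "(real b)\<^sup>2"]
    by (simp add: A_def B_def abs_mult)
qed

lemma abs_covariance_qform_le_const:
  assumes w: "\<And>s s'. \<bar>w s s'\<bar> \<le> 1" and v: "\<And>s s'. \<bar>v s s'\<bar> \<le> 1" and b: "b \<ge> 1"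
  shows "\<bar>(\<integral>\<omega>. qform w b p \<omega> * qform v b t \<omega> \<partial>M) -
     (\<integral>\<omega>. qform w b p \<omega> \<partial>M) * (\<integral>\<omega>. qform v b t \<omega> \<partial>M)\<bar> \<le> cov_const"
proof -
  have "(\<Sum>s=1..b. \<Sum>s'=1..b. \<Sum>u=1..b. \<Sum>u'=1..b.
        \<bar>c4 (int s' - int s) (t - p + int u - int s) (t - p + int u' - int s)\<bar>) \<le> (\<Sum>s=1..b. K4)"
  proof (rule sum_mono)
    fix s
    have "(\<Sum>s'=1..b. \<Sum>u=1..b. \<Sum>u'=1..b.
        \<bar>c4 (int s' - int s) (t - p + int u - int s) (t - p + int u' - int s)\<bar>) =
      (\<Sum>x\<in>{1..b} \<times> {1..b} \<times> {1..b}. \<bar>c4 (int (fst x) - int s) (t - p + int (fst (snd x)) - int s)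
         (t - p + int (snd (snd x)) - int s)\<bar>)"
      by (simp add: sum.cartesian_product split_def)
    also have "\<dots> \<le> K4" by (rule sum_c4_le) (auto simp: inj_on_def)
    finally show "(\<Sum>s'=1..b. \<Sum>u=1..b. \<Sum>u'=1..b.
        \<bar>c4 (int s' - int s) (t - p + int u - int s) (t - p + int u' - int s)\<bar>) \<le> K4" .
  qed
  also have "\<dots> = real b * K4" by simp
  also have "\<dots> \<le> (real b)\<^sup>2 * K4" using b K_nonneg by (intro mult_right_mono) (auto simp: power2_eq_square)
  finally have 1: "(\<Sum>s=1..b. \<Sum>s'=1..b. \<Sum>u=1..b. \<Sum>u'=1..b.
        \<bar>c4 (int s' - int s) (t - p + int u - int s) (t - p + int u' - int s)\<bar>) \<le> (real b)\<^sup>2 * K4" .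
  have "(\<Sum>s=1..b. \<Sum>s'=1..b. \<Sum>u=1..b. \<Sum>u'=1..b.
        \<bar>\<gamma> (t - p + int u - int s)\<bar> * \<bar>\<gamma> (t - p + int u' - int s')\<bar>) =
      (\<Sum>s=1..b. \<Sum>s'=1..b. (\<Sum>u=1..b. \<bar>\<gamma> (t - p + int u - int s)\<bar>) * (\<Sum>u'=1..b. \<bar>\<gamma> (t - p + int u' - int s')\<bar>))"
    by (simp add: sum_product)
  also have "\<dots> \<le> (\<Sum>s=1..b. \<Sum>s'=1..b. K\<gamma> * K\<gamma>)"
    using K_nonneg by (intro sum_mono mult_mono sum_autocov_le sum_nonneg) (auto simp: inj_on_def)
  also have "\<dots> = (real b)\<^sup>2 * K\<gamma>\<^sup>2" by (simp add: power2_eq_square)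
  finally have 2: "(\<Sum>s=1..b. \<Sum>s'=1..b. \<Sum>u=1..b. \<Sum>u'=1..b.
        \<bar>\<gamma> (t - p + int u - int s)\<bar> * \<bar>\<gamma> (t - p + int u' - int s')\<bar>) \<le> (real b)\<^sup>2 * K\<gamma>\<^sup>2" .
  show ?thesis
    using 1 2 b by (intro order_trans[OF abs_covariance_qform_le[OF w v]])
      (simp add: cov_const_def divide_le_eq algebra_simps)
qed

text \<open>The sum over all shifts costs a single factor \<open>b\<close>. In the cumulant part,
  fixing \<open>s\<close> and \<open>u\<close> makes the lags an injective function of
  \<open>(t, s', u')\<close>, which gives \<open>b\<^sup>2 * K4\<close>. In the products of
  covariances one factor is summed over \<open>u'\<close> and the other over \<open>t\<close>, which
  leaves \<open>b ^ 3 * K\<gamma>\<^sup>2\<close>. Both are divided by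
  \<open>b\<^sup>2\<close>.\<close>

lemma sum_abs_covariance_qform_le:
  assumes w: "\<And>s s'. \<bar>w s s'\<bar> \<le> 1" and v: "\<And>s s'. \<bar>v s s'\<bar> \<le> 1" and b: "b \<ge> 1" and T: "finite T"
  shows "(\<Sum>t\<in>T. \<bar>(\<integral>\<omega>. qform w b p \<omega> * qform v b t \<omega> \<partial>M) -
     (\<integral>\<omega>. qform w b p \<omega> \<partial>M) * (\<integral>\<omega>. qform v b t \<omega> \<partial>M)\<bar>) \<le> cov_const * b"
proof -
  define A where "A t s s' u u' = \<bar>c4 (int s' - int s) (t - p + int u - int s) (t - p + int u' - int s)\<bar>" for t and s s' u u' :: nat
  define B where "B t s s' u u' = \<bar>\<gamma> (t - p + int u - int s)\<bar> * \<bar>\<gamma> (t - p + int u' - int s')\<bar>" for t and s s' u u' :: nat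
  have 1: "(\<Sum>t\<in>T. \<Sum>s=1..b. \<Sum>s'=1..b. \<Sum>u=1..b. \<Sum>u'=1..b. A t s s' u u') \<le> (real b)\<^sup>2 * K4"
  proof -
    have "(\<Sum>t\<in>T. \<Sum>s=1..b. \<Sum>s'=1..b. \<Sum>u=1..b. \<Sum>u'=1..b. A t s s' u u') =
      (\<Sum>s=1..b. \<Sum>t\<in>T. \<Sum>u=1..b. \<Sum>s'=1..b. \<Sum>u'=1..b. A t s s' u u')"
      by (subst sum.swap[of _ "{1..b}" T], rule sum.cong[OF refl], rule sum.cong[OF refl], rule sum.swap)
    also have "\<dots> = (\<Sum>s=1..b. \<Sum>u=1..b. \<Sum>t\<in>T. \<Sum>s'=1..b. \<Sum>u'=1..b. A t s s' u u')"
      by (rule sum.cong[OF refl sum.swap])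
    also have "\<dots> \<le> (\<Sum>s=1..b. \<Sum>u=1..b. K4)"
    proof (intro sum_mono)
      fix s u
      have "(\<Sum>t\<in>T. \<Sum>s'=1..b. \<Sum>u'=1..b. A t s s' u u') =
        (\<Sum>x\<in>T \<times> {1..b} \<times> {1..b}. \<bar>c4 (int (fst (snd x)) - int s) (fst x - p + int u - int s)
           (fst x - p + int (snd (snd x)) - int s)\<bar>)"
        by (simp add: sum.cartesian_product split_def A_def)
      also have "\<dots> \<le> K4" using T by (intro sum_c4_le) (auto simp: inj_on_def)
      finally show "(\<Sum>t\<in>T. \<Sum>s'=1..b. \<Sum>u'=1..b. A t s s' u u') \<le> K4" .
    qed
    finally show ?thesis by (simp add: power2_eq_square)
  qed
  have 2: "(\<Sum>t\<in>T. \<Sum>s=1..b. \<Sum>s'=1..b. \<Sum>u=1..b. \<Sum>u'=1..b. B t s s' u u') \<le> real b ^ 3 * K\<gamma>\<^sup>2"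
  proof -
    have "(\<Sum>t\<in>T. \<Sum>s=1..b. \<Sum>s'=1..b. \<Sum>u=1..b. \<Sum>u'=1..b. B t s s' u u') =
      (\<Sum>t\<in>T. \<Sum>s=1..b. \<Sum>s'=1..b. \<Sum>u=1..b. \<bar>\<gamma> (t - p + int u - int s)\<bar> * (\<Sum>u'=1..b. \<bar>\<gamma> (t - p + int u' - int s')\<bar>))"
      by (simp add: B_def sum_distrib_left)
    also have "\<dots> \<le> (\<Sum>t\<in>T. \<Sum>s=1..b. \<Sum>s'=1..b. \<Sum>u=1..b. \<bar>\<gamma> (t - p + int u - int s)\<bar> * K\<gamma>)"
      by (intro sum_mono mult_left_mono sum_autocov_le) (auto simp: inj_on_def)
    also have "\<dots> = (\<Sum>s=1..b. \<Sum>s'=1..b. \<Sum>u=1..b. (\<Sum>t\<in>T. \<bar>\<gamma> (t - p + int u - int s)\<bar>) * K\<gamma>)"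
      unfolding sum_distrib_right
      by (subst sum.swap, rule sum.cong[OF refl], subst sum.swap, rule sum.cong[OF refl], rule sum.swap)
    also have "\<dots> \<le> (\<Sum>s=1..b. \<Sum>s'=1..b. \<Sum>u=1..b. K\<gamma> * K\<gamma>)"
      using T K_nonneg by (intro sum_mono mult_right_mono sum_autocov_le) (auto simp: inj_on_def)
    finally show ?thesis by (simp add: power2_eq_square power3_eq_cube mult_ac)
  qed
  have "(\<Sum>t\<in>T. \<bar>(\<integral>\<omega>. qform w b p \<omega> * qform v b t \<omega> \<partial>M) -
     (\<integral>\<omega>. qform w b p \<omega> \<partial>M) * (\<integral>\<omega>. qform v b t \<omega> \<partial>M)\<bar>) \<le>
    (\<Sum>t\<in>T. ((\<Sum>s=1..b. \<Sum>s'=1..b. \<Sum>u=1..b. \<Sum>u'=1..b. A t s s' u u') +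
      2 * (\<Sum>s=1..b. \<Sum>s'=1..b. \<Sum>u=1..b. \<Sum>u'=1..b. B t s s' u u')) / b\<^sup>2)"
    unfolding A_def B_def by (rule sum_mono[OF abs_covariance_qform_le[OF w v]])
  also have "\<dots> = ((\<Sum>t\<in>T. \<Sum>s=1..b. \<Sum>s'=1..b. \<Sum>u=1..b. \<Sum>u'=1..b. A t s s' u u') +
      2 * (\<Sum>t\<in>T. \<Sum>s=1..b. \<Sum>s'=1..b. \<Sum>u=1..b. \<Sum>u'=1..b. B t s s' u u')) / b\<^sup>2"
    by (simp only: sum_divide_distrib[symmetric] sum.distrib sum_distrib_left[symmetric])
  also have "\<dots> \<le> ((real b)\<^sup>2 * K4 + 2 * (real b ^ 3 * K\<gamma>\<^sup>2)) / b\<^sup>2"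
    using 1 2 by (intro divide_right_mono) auto
  also have "\<dots> = K4 + 2 * b * K\<gamma>\<^sup>2" using b by (simp add: field_simps power2_eq_square power3_eq_cube)
  also have "\<dots> \<le> cov_const * b"
    using b K_nonneg mult_left_mono[of 1 "real b" K4] by (simp add: cov_const_def algebra_simps)
  finally show ?thesis .
qed

lemma expectation_qform_shift: "(\<integral>\<omega>. qform w b t \<omega> \<partial>M) = (\<integral>\<omega>. qform w b 0 \<omega> \<partial>M)"
  by (simp add: expectation_qform)

lemma qform_average_variance:
  assumes w: "\<And>s s'. \<bar>w s s'\<bar> \<le> 1" and b: "b \<ge> 1" and T: "finite T" "T \<noteq> {}"
  shows "(\<integral>\<omega>. ((\<Sum>t\<in>T. qform w b t \<omega>) / card T - (\<integral>\<omega>. qform w b 0 \<omega> \<partial>M))\<^sup>2 \<partial>M) \<le> cov_const * b / card T"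
    and "integrable M (\<lambda>\<omega>. ((\<Sum>t\<in>T. qform w b t \<omega>) / card T - (\<integral>\<omega>. qform w b 0 \<omega> \<partial>M))\<^sup>2)"
proof -
  define N where "N = real (card T)"
  have N: "N > 0" using T by (auto simp: N_def card_gt_0_iff)
  define e where "e = (\<integral>\<omega>. qform w b 0 \<omega> \<partial>M)"
  have e: "(\<integral>\<omega>. qform w b t \<omega> \<partial>M) = e" for t unfolding e_def by (rule expectation_qform_shift)
  have sq: "((\<Sum>t\<in>T. qform w b t \<omega>) / N - e)\<^sup>2 =
     (\<Sum>s\<in>T. \<Sum>t\<in>T. (qform w b s \<omega> * qform w b t \<omega> - e * qform w b s \<omega> - e * qform w b t \<omega> + e * e)) / N\<^sup>2" for \<omega>
  proof -
    have "(\<Sum>t\<in>T. qform w b t \<omega>) / N - e = (\<Sum>t\<in>T. qform w b t \<omega> - e) / N"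
      using N by (simp add: sum_subtractf N_def field_simps)
    also have "\<dots>\<^sup>2 = (\<Sum>s\<in>T. \<Sum>t\<in>T. (qform w b s \<omega> - e) * (qform w b t \<omega> - e)) / N\<^sup>2"
      by (simp add: power2_eq_square sum_product)
    finally show ?thesis by (simp add: algebra_simps)
  qed
  show "integrable M (\<lambda>\<omega>. ((\<Sum>t\<in>T. qform w b t \<omega>) / card T - (\<integral>\<omega>. qform w b 0 \<omega> \<partial>M))\<^sup>2)"
    unfolding e_def[symmetric] N_def[symmetric] sq
    using integrable_qform integrable_qform_mult by simp
  have "(\<integral>\<omega>. ((\<Sum>t\<in>T. qform w b t \<omega>) / N - e)\<^sup>2 \<partial>M) =
    (\<Sum>s\<in>T. \<Sum>t\<in>T. (\<integral>\<omega>. qform w b s \<omega> * qform w b t \<omega> \<partial>M) - e * e) / N\<^sup>2"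
    unfolding sq using integrable_qform integrable_qform_mult by (simp add: e prob_space)
  also have "\<dots> \<le> (\<Sum>s\<in>T. cov_const * b) / N\<^sup>2"
  proof (intro divide_right_mono sum_mono)
    fix s
    have "(\<Sum>t\<in>T. (\<integral>\<omega>. qform w b s \<omega> * qform w b t \<omega> \<partial>M) - e * e) \<le>
       (\<Sum>t\<in>T. \<bar>(\<integral>\<omega>. qform w b s \<omega> * qform w b t \<omega> \<partial>M) - e * e\<bar>)" by (intro sum_mono) auto
    also have "\<dots> \<le> cov_const * b"
      using sum_abs_covariance_qform_le[where w = w and v = w and b = b and T = T and p = s] w b T
      by (simp add: e)
    finally show "(\<Sum>t\<in>T. (\<integral>\<omega>. qform w b s \<omega> * qform w b t \<omega> \<partial>M) - e * e) \<le> cov_const * b" .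
  qed simp
  also have "\<dots> = cov_const * b / N" using N by (simp add: N_def power2_eq_square)
  finally show "(\<integral>\<omega>. ((\<Sum>t\<in>T. qform w b t \<omega>) / card T - (\<integral>\<omega>. qform w b 0 \<omega> \<partial>M))\<^sup>2 \<partial>M) \<le> cov_const * b / card T"
    by (simp add: e_def N_def)
qed

lemma abs_expectation_qform_le:
  assumes w: "\<And>s s'. \<bar>w s s'\<bar> \<le> 1" and b: "b \<ge> 1"
  shows "\<bar>\<integral>\<omega>. qform w b t \<omega> \<partial>M\<bar> \<le> K\<gamma>"
proof -
  have "\<bar>\<Sum>s=1..b. \<Sum>s'=1..b. w s s' * \<gamma> (int s' - int s)\<bar> \<le> (\<Sum>s=1..b. \<Sum>s'=1..b. 1 * \<bar>\<gamma> (int s' - int s)\<bar>)"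
    by (intro order_trans[OF sum_abs] sum_mono) (auto simp: abs_mult intro!: mult_left_le_one_le w)
  also have "\<dots> \<le> (\<Sum>s=1..b. K\<gamma>)"
    unfolding mult_1 by (intro sum_mono sum_autocov_le) (auto simp: inj_on_def)
  finally show ?thesis using b by (simp add: expectation_qform divide_le_eq mult.commute)
qed

lemma expectation_lform_mult:
  "(\<integral>\<omega>. lform a b p \<omega> * lform a' b t \<omega> \<partial>M) =
     (\<Sum>s=1..b. \<Sum>u=1..b. a s * a' u * \<gamma> (t - p + int u - int s)) / b"
proof -
  have "lform a b p \<omega> * lform a' b t \<omega> =
     (\<Sum>s=1..b. \<Sum>u=1..b. a s * a' u * (X (p + int s) \<omega> * X (t + int u) \<omega>)) / b" for \<omega>
    unfolding lform_def sum_product sum_divide_distrib by (intro sum.cong refl) (simp add: field_simps)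
  then show ?thesis using integrable_X2 by (simp add: expectation_mult algebra_simps)
qed

lemma sum_abs_expectation_lform_mult_le:
  assumes a: "\<And>s. \<bar>a s\<bar> \<le> 1" and a': "\<And>s. \<bar>a' s\<bar> \<le> 1" and b: "b \<ge> 1" and T: "finite T"
  shows "(\<Sum>t\<in>T. \<bar>\<integral>\<omega>. lform a b p \<omega> * lform a' b t \<omega> \<partial>M\<bar>) \<le> K\<gamma> * b"
proof -
  have "(\<Sum>t\<in>T. \<bar>\<integral>\<omega>. lform a b p \<omega> * lform a' b t \<omega> \<partial>M\<bar>) \<le>
     (\<Sum>t\<in>T. (\<Sum>s=1..b. \<Sum>u=1..b. \<bar>\<gamma> (t - p + int u - int s)\<bar>) / b)"
  proof (rule sum_mono)
    fix t
    have "\<bar>a s * a' u\<bar> \<le> 1" for s u using mult_mono[OF a[of s] a'[of u]] by (simp add: abs_mult)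
    then have "\<bar>\<Sum>s=1..b. \<Sum>u=1..b. a s * a' u * \<gamma> (t - p + int u - int s)\<bar> \<le>
       (\<Sum>s=1..b. \<Sum>u=1..b. \<bar>\<gamma> (t - p + int u - int s)\<bar>)"
      by (intro order_trans[OF sum_abs] sum_mono) (auto simp: abs_mult[of "_ * _"] intro!: mult_left_le_one_le)
    then show "\<bar>\<integral>\<omega>. lform a b p \<omega> * lform a' b t \<omega> \<partial>M\<bar> \<le> (\<Sum>s=1..b. \<Sum>u=1..b. \<bar>\<gamma> (t - p + int u - int s)\<bar>) / b"
      by (simp add: expectation_lform_mult divide_right_mono)
  qed
  also have "\<dots> = (\<Sum>s=1..b. \<Sum>u=1..b. \<Sum>t\<in>T. \<bar>\<gamma> (t - p + int u - int s)\<bar>) / b"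
    unfolding sum_divide_distrib[symmetric]
    by (subst sum.swap, subst sum.swap[of _ T]) (rule refl)
  also have "\<dots> \<le> (\<Sum>s=1..b. \<Sum>u=1..b. K\<gamma>) / b"
    using T by (intro divide_right_mono sum_mono sum_autocov_le) (auto simp: inj_on_def)
  also have "\<dots> = K\<gamma> * b" using b by simp
  finally show ?thesis .
qed

section \<open>Eighth order bounds for linear forms\<close>

text \<open>The eight normalisations give \<open>1 / b ^ 4\<close>, and the cumulants over all
  eightfold choices of times in the block sum to at most \<open>b * K8\<close>.\<close>

lemma cumulant8_lform_le:
  assumes a: "\<And>i s. i < 8 \<Longrightarrow> \<bar>a i s\<bar> \<le> 1" and b: "b \<ge> 1"
  shows "\<bar>cumulant_on M (\<lambda>i. lform (a i) b (\<tau> i)) {..<8::nat}\<bar> \<le> K8 / b ^ 3"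
proof -
  have "\<bar>cumulant_on M (\<lambda>i. lform (a i) b (\<tau> i)) {..<8::nat}\<bar> \<le> (1 / sqrt b) ^ card {..<8::nat} *
    (\<Sum>g\<in>PiE {..<8} (\<lambda>_. {1..b}). \<bar>cumulant_on M (\<lambda>i. X (\<tau> i + int (g i))) {..<8::nat}\<bar>)"
    unfolding lform_def[abs_def]
    using a L8_X by (intro abs_cumulant_on_sum_le) (auto simp: divide_right_mono)
  also have "\<dots> \<le> (1 / sqrt b) ^ 8 * (card {1..b} * K8)"
    using sum_cumulant8_le[of "{1..b}" \<tau>] by (simp add: mult_left_mono)
  also have "(1 / sqrt b) ^ 8 = 1 / real b ^ 4"
  proof -
    have "sqrt b ^ 8 = (sqrt b ^ 2) ^ 4" unfolding power_mult[symmetric] by simp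
    then have "sqrt b ^ 8 = real b ^ 4" by simp
    then show ?thesis by (simp add: power_one_over)
  qed
  also have "1 / real b ^ 4 * (card {1..b} * K8) = K8 / b ^ 3"
    using b by (simp add: field_simps numeral_eq_Suc)
  finally show ?thesis .
qed

text \<open>Here \<open>h\<close> bounds the moments up to order four and \<open>C\<close> collects
  the partitions of the eight indices; the last line is the solution of
  \<open>m \<le> (K8 + C) + C * sqrt m\<close> for the eighth moment \<open>m\<close>.\<close>

definition moment_const where "moment_const =
  (let h = 1 + cov_const + K\<gamma>\<^sup>2; C = (\<Sum>P | partition_on {..<8::nat} P. fact (card P - 1) * h ^ card P)
   in 2 * (K8 + C) + C\<^sup>2)"

lemma moment_const_nonneg: "moment_const \<ge> 0"
  unfolding moment_const_def Let_def using K_nonneg cov_const_nonneg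
  by (intro add_nonneg_nonneg mult_nonneg_nonneg sum_nonneg) auto

text \<open>Self-bounding: in the cumulant expansion of the eighth moment \<open>m\<close>, a partition without singletons
  has at most one block of more than four elements, whose moment is \<open>O(1 + sqrt m)\<close>. So
  \<open>m \<le> \<alpha> + \<beta> * sqrt m\<close>.\<close>
lemma moment8_lform_le:
  assumes a: "\<And>s. \<bar>a s\<bar> \<le> 1" and b: "b \<ge> 1"
  shows "(\<integral>\<omega>. lform a b t \<omega> ^ 8 \<partial>M) \<le> moment_const"
proof -
  define A where "A = lform a b t"
  define m where "m r = (\<integral>\<omega>. A \<omega> ^ r \<partial>M)" for r :: nat
  define h where "h = 1 + cov_const + K\<gamma>\<^sup>2"
  have h1: "h \<ge> 1" using cov_const_nonneg by (simp add: h_def)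
  have A8: "L8 M A" unfolding A_def by (rule L8_lform)
  have [measurable]: "A \<in> borel_measurable M" using A8 by (rule L8_borel_measurable)
  have prodA: "(\<Prod>i\<in>B. A \<omega>) = A \<omega> ^ card B" for B :: "nat set" and \<omega> by simp
  have intA: "integrable M (\<lambda>\<omega>. A \<omega> ^ r)" if "r \<le> 8" for r
    using integrable_prod_L8[of "{..<r}" "\<lambda>_. A"] that A8 by simp
  \<comment> \<open>The square of a linear form is a quadratic form with weights bounded by 1, so
    its second moment is a covariance plus a squared mean, both already bounded.\<close>
  have m4: "m 4 \<le> h - 1"
  proof -
    define w where "w s s' = a s * a s'" for s s'
    have w: "\<bar>w s s'\<bar> \<le> 1" for s s' using mult_mono[OF a[of s] a[of s']] by (simp add: abs_mult w_def)
    have q: "A \<omega> * A \<omega> = qform w b t \<omega>" for \<omega> unfolding A_def w_def by (rule lform_mult)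
    have "m 4 = (\<integral>\<omega>. qform w b t \<omega> * qform w b t \<omega> \<partial>M)"
      unfolding m_def q[symmetric] by (simp add: numeral_eq_Suc mult.assoc)
    also have "\<dots> \<le> cov_const + (\<integral>\<omega>. qform w b t \<omega> \<partial>M) * (\<integral>\<omega>. qform w b t \<omega> \<partial>M)"
      using abs_covariance_qform_le_const[where w = w and v = w and b = b and p = t and t = t] w b
      by (simp add: abs_le_iff)
    also have "(\<integral>\<omega>. qform w b t \<omega> \<partial>M) * (\<integral>\<omega>. qform w b t \<omega> \<partial>M) \<le> K\<gamma>\<^sup>2"
      using abs_expectation_qform_le[where w = w and b = b and t = t] w b K_nonneg(1)
      by (metis abs_ge_zero abs_le_square_iff abs_of_nonneg power2_eq_square)
    finally show ?thesis by (simp add: h_def)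
  qed
  have m_nn: "m 4 \<ge> 0" "m 8 \<ge> 0" unfolding m_def by simp_all
  define q where "q = 1 + sqrt (m 8)"
  have q1: "q \<ge> 1" using m_nn by (simp add: q_def)
  have small: "\<bar>m r\<bar> \<le> h" if "r \<le> 4" for r
  proof -
    have "\<bar>m r\<bar> \<le> (\<integral>\<omega>. \<bar>A \<omega> ^ r\<bar> \<partial>M)"
      unfolding m_def using integral_norm_bound[of M "\<lambda>\<omega>. A \<omega> ^ r"] by simp
    also have "\<dots> \<le> (\<integral>\<omega>. 1 + A \<omega> ^ 4 \<partial>M)"
    proof (rule integral_mono)
      fix \<omega>
      show "\<bar>A \<omega> ^ r\<bar> \<le> 1 + A \<omega> ^ 4"
      proof (cases "\<bar>A \<omega>\<bar> \<le> 1")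
        case True
        then have "\<bar>A \<omega> ^ r\<bar> \<le> 1" by (simp add: power_abs power_le_one)
        then show ?thesis using zero_le_even_power'[of "A \<omega>" 2] by (simp add: add_increasing2)
      next
        case False
        then have "\<bar>A \<omega>\<bar> ^ r \<le> \<bar>A \<omega>\<bar> ^ 4" using that by (intro power_increasing) auto
        then show ?thesis by (simp add: power_abs)
      qed
    qed (use intA that in auto)
    also have "\<dots> = 1 + m 4" using intA by (simp add: m_def prob_space)
    finally show ?thesis using m4 by simp
  qed
  \<comment> \<open>The sixth power is split into a square and a fourth power; Cauchy-Schwarz then
    brings in the square root of the eighth moment.\<close>
  have large: "\<bar>m r\<bar> \<le> h * q" if "r = 5 \<or> r = 6" for r
  proof -
    have "\<bar>m r\<bar> \<le> (\<integral>\<omega>. \<bar>A \<omega> ^ r\<bar> \<partial>M)"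
      unfolding m_def using integral_norm_bound[of M "\<lambda>\<omega>. A \<omega> ^ r"] by simp
    also have "\<dots> \<le> (\<integral>\<omega>. A \<omega> ^ 4 + A \<omega> ^ 2 * A \<omega> ^ 4 \<partial>M)"
    proof (rule integral_mono)
      fix \<omega>
      have eq: "A \<omega> ^ 2 * A \<omega> ^ 4 = \<bar>A \<omega>\<bar> ^ 6" by (simp flip: power_add)
      show "\<bar>A \<omega> ^ r\<bar> \<le> A \<omega> ^ 4 + A \<omega> ^ 2 * A \<omega> ^ 4"
      proof (cases "\<bar>A \<omega>\<bar> \<le> 1")
        case True
        then have "\<bar>A \<omega>\<bar> ^ r \<le> \<bar>A \<omega>\<bar> ^ 4" using that by (intro power_decreasing) auto
        then show ?thesis unfolding eq by (simp add: power_abs add_increasing2)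
      next
        case False
        then have "\<bar>A \<omega>\<bar> ^ r \<le> \<bar>A \<omega>\<bar> ^ 6" using that by (intro power_increasing) auto
        then show ?thesis unfolding eq by (simp add: power_abs add_increasing)
      qed
    qed (use intA[of r] intA[of 4] intA[of 6] that in \<open>auto simp flip: power_add\<close>)
    also have "\<dots> = m 4 + (\<integral>\<omega>. A \<omega> ^ 2 * A \<omega> ^ 4 \<partial>M)"
      using intA[of 4] intA[of 6] by (simp add: m_def flip: power_add)
    also have "(\<integral>\<omega>. A \<omega> ^ 2 * A \<omega> ^ 4 \<partial>M) \<le> sqrt (m 4) * sqrt (m 8)"
    proof -
      have "\<bar>\<integral>\<omega>. A \<omega> ^ 2 * A \<omega> ^ 4 \<partial>M\<bar> \<le> sqrt (\<integral>\<omega>. (A \<omega> ^ 2) ^ 2 \<partial>M) * sqrt (\<integral>\<omega>. (A \<omega> ^ 4) ^ 2 \<partial>M)"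
        using intA[of 4] intA[of 8] by (intro Cauchy_Schwarz_expectation) (auto simp flip: power_mult)
      then show ?thesis by (simp add: m_def abs_le_iff flip: power_mult)
    qed
    also have "sqrt (m 4) * sqrt (m 8) \<le> h * sqrt (m 8)"
    proof (rule mult_right_mono)
      have "m 4 \<le> h * h" using m4 mult_left_mono[of 1 h h] h1 by linarith
      then show "sqrt (m 4) \<le> h" using h1 by (simp add: real_le_lsqrt power2_eq_square)
    qed (use m_nn in simp)
    finally show ?thesis using m4 by (simp add: q_def distrib_left)
  qed
  define PP where "PP = {P. partition_on {..<8::nat} P} - {{{..<8}}}"
  have finPart: "finite {P. partition_on {..<8::nat} P}" by (intro finitely_many_partition_on) auto
  have U_part: "{{..<8}} \<in> {P. partition_on {..<8::nat} P}"
    using partition_on_space[of "{..<8::nat}"] by (simp add: lessThan_empty_iff)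
  define f where "f B = m (card B)" for B :: "nat set"
  have prodP: "\<bar>\<Prod>B\<in>P. f B\<bar> \<le> h ^ card P * q" if "P \<in> PP" for P
  proof -
    have P: "partition_on {..<8} P" "P \<noteq> {{..<8}}" using that by (auto simp: PP_def)
    have finP: "finite P" using P(1) finite_elements by blast
    have PU: "B \<subseteq> {..<8}" if "B \<in> P" for B using P that partition_onD1 by blast
    have finB: "finite B" if "B \<in> P" for B using PU[OF that] finite_subset by blast
    have card8: "(\<Sum>B\<in>P. card B) = 8"
      using product_partition[OF P(1)] finB by simp
    show ?thesis
    proof (cases "\<exists>B\<in>P. card B = 1")
      case True
      then obtain B where "B \<in> P" "card B = 1" by blast
      then have "f B = 0" using expectation_lform by (simp add: f_def m_def A_def)
      then have "(\<Prod>B\<in>P. f B) = 0" using \<open>B \<in> P\<close> finP by auto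
      then show ?thesis using h1 q1 by simp
    next
      case no1: False
      show ?thesis
      proof (cases "\<exists>B\<in>P. card B \<ge> 5")
        case False
        then have "\<bar>\<Prod>B\<in>P. f B\<bar> \<le> (\<Prod>B\<in>P. h)"
          unfolding abs_prod f_def by (intro prod_mono) (auto intro!: small)
        also have "\<dots> \<le> h ^ card P * q" using h1 q1 by (simp add: mult_le_cancel_left1)
        finally show ?thesis .
      next
        case True
        then obtain B0 where B0: "B0 \<in> P" "card B0 \<ge> 5" by blast
        have rest: "card B0 + (\<Sum>B\<in>P - {B0}. card B) = 8"
          using card8 finP B0 by (simp add: sum.remove)
        have "P - {B0} \<noteq> {}"
        proof
          assume e: "P - {B0} = {}"
          then have "P = {B0}" using B0 by blast
          then show False using P partition_onD1[OF P(1)] by auto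
        qed
        then obtain B1 where B1: "B1 \<in> P - {B0}" by blast
        have "card B1 \<noteq> 0" "card B1 \<noteq> 1" using B1 no1 finB[of B1] partition_onD3[OF P(1)] by auto
        moreover have "card B1 \<le> (\<Sum>B\<in>P - {B0}. card B)" using B1 finP by (intro member_le_sum) auto
        \<comment> \<open>Any other block has at least two elements, so two of the eight indices are
          missing from \<open>B0\<close>.\<close>
        ultimately have c0: "card B0 = 5 \<or> card B0 = 6" using rest B0 by linarith
        have others: "card B \<le> 4" if "B \<in> P - {B0}" for B
        proof -
          have "card B \<le> (\<Sum>B\<in>P - {B0}. card B)" using that finP by (intro member_le_sum) auto
          then show ?thesis using rest B0 by linarith
        qed
        have "\<bar>\<Prod>B\<in>P. f B\<bar> = \<bar>f B0\<bar> * (\<Prod>B\<in>P - {B0}. \<bar>f B\<bar>)"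
          using finP B0 by (simp add: prod.remove abs_mult abs_prod)
        also have "\<dots> \<le> (h * q) * (\<Prod>B\<in>P - {B0}. h)"
          unfolding f_def using others small large[OF c0] h1 q1
          by (intro mult_mono prod_mono prod_nonneg) auto
        also have "\<dots> = h ^ card P * q"
        proof -
          have "card P = Suc (card (P - {B0}))" using card.remove[OF finP B0(1)] .
          then show ?thesis by (simp del: card_Diff_insert card_Diff_singleton)
        qed
        finally show ?thesis .
      qed
    qed
  qed
  define C where "C = (\<Sum>P | partition_on {..<8::nat} P. fact (card P - 1) * h ^ card P)"
  have "cumulant_on M (\<lambda>_. A) {..<8::nat} = set_cumulant f {..<8}"
    unfolding cumulant_on_def prodA f_def m_def by (rule refl)
  also have "\<dots> = f {..<8} + (\<Sum>P\<in>PP. (-1) ^ (card P - 1) * fact (card P - 1) * (\<Prod>B\<in>P. f B))"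
    unfolding set_cumulant_def PP_def by (subst sum.remove[OF finPart U_part]) simp
  finally have "m 8 = cumulant_on M (\<lambda>_. A) {..<8::nat} -
     (\<Sum>P\<in>PP. (-1) ^ (card P - 1) * fact (card P - 1) * (\<Prod>B\<in>P. f B))" by (simp add: f_def)
  also have "\<dots> \<le> K8 + C * q"
  proof -
    have "\<bar>cumulant_on M (\<lambda>_. A) {..<8::nat}\<bar> \<le> K8 / b ^ 3"
      unfolding A_def using a b by (intro cumulant8_lform_le[of "\<lambda>_. a" b "\<lambda>_. t"]) auto
    also have "\<dots> \<le> K8" using b K_nonneg by (simp add: divide_le_eq mult_le_cancel_left1)
    finally have 1: "\<bar>cumulant_on M (\<lambda>_. A) {..<8::nat}\<bar> \<le> K8" .
    have "\<bar>\<Sum>P\<in>PP. (-1) ^ (card P - 1) * fact (card P - 1) * (\<Prod>B\<in>P. f B)\<bar> \<le>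
       (\<Sum>P\<in>PP. fact (card P - 1) * (h ^ card P * q))"
      using prodP by (intro order_trans[OF sum_abs] sum_mono) (auto simp: abs_mult power_abs)
    also have "\<dots> \<le> (\<Sum>P | partition_on {..<8::nat} P. fact (card P - 1) * (h ^ card P * q))"
      using finPart h1 q1 by (intro sum_mono2) (auto simp: PP_def)
    also have "\<dots> = C * q" by (simp add: C_def sum_distrib_right mult.assoc)
    finally show ?thesis using 1 by linarith
  qed
  finally have "m 8 \<le> (K8 + C) + C * sqrt (m 8)" by (simp add: q_def distrib_left)
  moreover have "C \<ge> 0" unfolding C_def using h1 by (intro sum_nonneg) auto
  ultimately have "m 8 \<le> 2 * (K8 + C) + C\<^sup>2" using m_nn by (intro le_of_le_add_mult_sqrt) auto
  then show ?thesis by (simp add: m_def A_def moment_const_def Let_def C_def h_def)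
qed

lemma expectation_prod_lform_shift:
  assumes I: "finite I" "card I \<le> 8"
  shows "(\<integral>\<omega>. (\<Prod>i\<in>I. lform (a i) b t \<omega>) \<partial>M) = (\<integral>\<omega>. (\<Prod>i\<in>I. lform (a i) b 0 \<omega>) \<partial>M)"
proof -
  have "(\<integral>\<omega>. (\<Prod>i\<in>I. lform (a i) b t \<omega>) \<partial>M) =
     (\<Sum>g\<in>PiE I (\<lambda>_. {1..b}). (\<Prod>i\<in>I. a i (g i) / sqrt b) * (\<integral>\<omega>. (\<Prod>i\<in>I. X (int (g i)) \<omega>) \<partial>M))" for t
  proof -
    have "(\<Prod>i\<in>I. lform (a i) b t \<omega>) =
      (\<Sum>g\<in>PiE I (\<lambda>_. {1..b}). (\<Prod>i\<in>I. a i (g i) / sqrt b) * (\<Prod>i\<in>I. X (int (g i) + t) \<omega>))" for \<omega>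
      unfolding lform_def using I by (subst prod_sum_PiE) (simp_all add: prod.distrib[symmetric] add.commute)
    moreover have "integrable M (\<lambda>\<omega>. \<Prod>i\<in>I. X (int (g i) + t) \<omega>)" for g
      using I L8_X by (intro integrable_prod_L8) auto
    ultimately show ?thesis using I by (simp add: expectation_prod_shift[of I "\<lambda>i. int (_ i)"])
  qed
  then show ?thesis by simp
qed

text \<open>The general variance bound with \<open>R\<close> proportional to \<open>b\<close>, from
  the summed covariances of linear and quadratic forms, and with \<open>K8 / b ^ 3\<close> as the
  bound for the eighth order cumulant.\<close>

lemma lform_quartic_average_variance:
  obtains K where "K \<ge> 0" "\<And>a b T. (\<And>i s. i < 4 \<Longrightarrow> \<bar>a i s\<bar> \<le> 1) \<Longrightarrow> b \<ge> 1 \<Longrightarrow> finite T \<Longrightarrow> T \<noteq> {} \<Longrightarrow>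
     (\<integral>\<omega>. ((\<Sum>t\<in>T. (\<Prod>i<4::nat. lform (a i) b t \<omega>)) / real (card T) - (\<integral>\<omega>. (\<Prod>i<4::nat. lform (a i) b 0 \<omega>) \<partial>M))\<^sup>2 \<partial>M)
       \<le> K * (real b / real (card T) + 1 / real b ^ 3)"
proof
  define C where "C = quartic_const (2 * (1 + 8 * moment_const)\<^sup>2)"
  define R1 where "R1 = cov_const + K\<gamma> + 1"
  define K where "K = 2 * K8 + (2 * C + C\<^sup>2) * R1"
  have C: "C \<ge> 0" unfolding C_def quartic_const_def by (intro sum_nonneg) auto
  have R1: "R1 > 0" using cov_const_nonneg K_nonneg by (simp add: R1_def)
  show K0: "K \<ge> 0" using C R1 K_nonneg by (simp add: K_def)
  fix a :: "nat \<Rightarrow> nat \<Rightarrow> real" and b :: nat and T :: "int set"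
  assume a: "\<And>i s. i < 4 \<Longrightarrow> \<bar>a i s\<bar> \<le> 1" and b: "b \<ge> 1" and T: "finite T" "T \<noteq> {}"
  define e where "e I = (\<integral>\<omega>. (\<Prod>i\<in>I. lform (a i) b 0 \<omega>) \<partial>M)" for I :: "nat set"
  define R where "R = R1 * b"
  have sub4: "finite I \<and> card I \<le> 8" if "I \<subseteq> {..<4::nat}" for I
    using card_mono[OF _ that] finite_subset[OF that] by simp
  have e: "(\<integral>\<omega>. (\<Prod>i\<in>I. lform (a i) b t \<omega>) \<partial>M) = e I" if "I \<subseteq> {..<4}" for I t
    unfolding e_def using sub4[OF that] by (intro expectation_prod_lform_shift) auto
  have quad: "(\<Sum>t\<in>T. \<bar>(\<integral>\<omega>. (\<Prod>i\<in>I. lform (a i) b s \<omega>) * (\<Prod>i\<in>I. lform (a i) b t \<omega>) \<partial>M) - (e I)\<^sup>2\<bar>) \<le> R"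
    if I: "I \<subseteq> {..<4}" "card I = 2" for I s
  proof -
    obtain i j where ij: "I = {i, j}" "i \<noteq> j" using I(2) by (meson card_2_iff)
    then have ij4: "i < 4" "j < 4" using I by auto
    define w where "w s s' = a i s * a j s'" for s s'
    have w: "\<bar>w s s'\<bar> \<le> 1" for s s'
      using mult_mono[OF a[OF ij4(1), of s] a[OF ij4(2), of s']] by (simp add: abs_mult w_def)
    have q: "(\<Prod>i\<in>I. lform (a i) b t \<omega>) = qform w b t \<omega>" for t \<omega>
      using ij lform_mult[of "a i" b t \<omega> "a j"] by (simp add: w_def[abs_def])
    have eI: "e I = (\<integral>\<omega>. qform w b t \<omega> \<partial>M)" for t
      using e[OF I(1), of t] by (simp add: q)
    have "(\<Sum>t\<in>T. \<bar>(\<integral>\<omega>. (\<Prod>i\<in>I. lform (a i) b s \<omega>) * (\<Prod>i\<in>I. lform (a i) b t \<omega>) \<partial>M) - (e I)\<^sup>2\<bar>) =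
      (\<Sum>t\<in>T. \<bar>(\<integral>\<omega>. qform w b s \<omega> * qform w b t \<omega> \<partial>M) - (\<integral>\<omega>. qform w b s \<omega> \<partial>M) * (\<integral>\<omega>. qform w b t \<omega> \<partial>M)\<bar>)"
      using eI by (simp add: q power2_eq_square)
    also have "\<dots> \<le> cov_const * b"
      using sum_abs_covariance_qform_le[where w = w and v = w and b = b and T = T and p = s] w b T by simp
    also have "\<dots> \<le> R" unfolding R_def R1_def using K_nonneg by (intro mult_right_mono) auto
    finally show ?thesis .
  qed
  have lin: "(\<Sum>t\<in>T. \<bar>\<integral>\<omega>. lform (a i) b s \<omega> * lform (a j) b t \<omega> \<partial>M\<bar>) \<le> R" if "i < 4" "j < 4" for i j s
  proof -
    have "(\<Sum>t\<in>T. \<bar>\<integral>\<omega>. lform (a i) b s \<omega> * lform (a j) b t \<omega> \<partial>M\<bar>) \<le> K\<gamma> * b"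
      using that a b T by (intro sum_abs_expectation_lform_mult_le) auto
    also have "\<dots> \<le> R" unfolding R_def R1_def using cov_const_nonneg by (intro mult_right_mono) auto
    finally show ?thesis .
  qed
  have cum: "\<bar>cumulant_on M (\<lambda>i. if i < 4 then lform (a i) b s else lform (a (i - 4)) b t) {..<8}\<bar> \<le> K8 / b ^ 3" for s t
  proof -
    have "cumulant_on M (\<lambda>i. if i < 4 then lform (a i) b s else lform (a (i - 4)) b t) {..<8} =
      cumulant_on M (\<lambda>i. lform (if i < 4 then a i else a (i - 4)) b (if i < 4 then s else t)) {..<8}"
      by (rule cumulant_on_cong) auto
    also have "\<bar>\<dots>\<bar> \<le> K8 / b ^ 3" using a b by (intro cumulant8_lform_le) auto
    finally show ?thesis .
  qed
  have "(\<integral>\<omega>. ((\<Sum>t\<in>T. (\<Prod>i<4. lform (a i) b t \<omega>)) / card T - e {..<4})\<^sup>2 \<partial>M)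
     \<le> 2 * (K8 / b ^ 3 + C * (R / card T)) + C\<^sup>2 * (R / card T)"
    unfolding C_def
  proof (rule quartic_average_variance[where y = "\<lambda>i t. lform (a i) b t"])
    show "(\<integral>\<omega>. lform (a i) b t \<omega> ^ 8 \<partial>M) \<le> moment_const" if "i < 4" for i t
      using that a b by (intro moment8_lform_le) auto
    show "e {i} = 0" for i using expectation_lform by (simp add: e_def)
    show "R > 0" using R1 b by (simp add: R_def)
  qed (use T L8_lform moment_const_nonneg e lin quad cum in auto)
  also have "\<dots> = 2 * K8 * (1 / b ^ 3) + (2 * C + C\<^sup>2) * R1 * (b / card T)"
    by (simp add: R_def algebra_simps)
  also have "\<dots> \<le> K * (1 / b ^ 3) + K * (b / card T)"
    using C R1 K_nonneg by (intro add_mono mult_right_mono) (auto simp: K_def)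
  finally show "(\<integral>\<omega>. ((\<Sum>t\<in>T. (\<Prod>i<4::nat. lform (a i) b t \<omega>)) / real (card T) - (\<integral>\<omega>. (\<Prod>i<4::nat. lform (a i) b 0 \<omega>) \<partial>M))\<^sup>2 \<partial>M)
       \<le> K * (real b / real (card T) + 1 / real b ^ 3)"
    by (simp add: e_def distrib_left)
qed

end

section \<open>Riemann sums of functions of bounded variation\<close>

text \<open>The class of admissible weights. It contains the Lipschitz functions and is closed under
  sums, products and reflection, so it covers all integrands that occur below.\<close>

definition bv_measurable :: "(real \<Rightarrow> real) \<Rightarrow> bool" where
  "bv_measurable g \<longleftrightarrow> bounded_variation_on (-pi) pi g \<and> set_borel_measurable lborel {-pi..pi} g"

lemma bounded_variation_onD:
  assumes "bounded_variation_on a b g"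
  shows "\<exists>C. \<forall>m x. (\<forall>i\<le>m. x i \<in> {a..b}) \<longrightarrow> (\<forall>i<m. x i \<le> x (Suc i)) \<longrightarrow>
     (\<Sum>i<m. \<bar>g (x (Suc i)) - g (x i)\<bar>) \<le> C"
  using assms unfolding bounded_variation_on_def by blast

lemma bounded_variation_on_bounded:
  assumes "bounded_variation_on a b g"
  shows "\<exists>B\<ge>0. \<forall>x\<in>{a..b}. \<bar>g x\<bar> \<le> B"
proof -
  obtain C where C: "\<And>m x. \<forall>i\<le>m. x i \<in> {a..b} \<Longrightarrow> \<forall>i<m. x i \<le> x (Suc i) \<Longrightarrow>
     (\<Sum>i<m. \<bar>g (x (Suc i)) - g (x i)\<bar>) \<le> C"
    using bounded_variation_onD[OF assms] by blast
  have "\<bar>g x\<bar> \<le> \<bar>g a\<bar> + \<bar>C\<bar>" if "x \<in> {a..b}" for x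
  proof -
    define y where "y i = (if i = 0 then a else x)" for i :: nat
    have "(\<Sum>i<1. \<bar>g (y (Suc i)) - g (y i)\<bar>) \<le> C"
      by (rule C) (use that in \<open>auto simp: y_def\<close>)
    then show ?thesis by (simp add: y_def)
  qed
  then show ?thesis by (intro exI[of _ "\<bar>g a\<bar> + \<bar>C\<bar>"]) auto
qed

lemma bounded_variation_on_add:
  assumes "bounded_variation_on a b g" "bounded_variation_on a b h"
  shows "bounded_variation_on a b (\<lambda>x. g x + h x)"
proof -
  obtain C where C: "\<And>m x. \<forall>i\<le>m. x i \<in> {a..b} \<Longrightarrow> \<forall>i<m. x i \<le> x (Suc i) \<Longrightarrow>
     (\<Sum>i<m. \<bar>g (x (Suc i)) - g (x i)\<bar>) \<le> C"
    using bounded_variation_onD[OF assms(1)] by blast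
  obtain D where D: "\<And>m x. \<forall>i\<le>m. x i \<in> {a..b} \<Longrightarrow> \<forall>i<m. x i \<le> x (Suc i) \<Longrightarrow>
     (\<Sum>i<m. \<bar>h (x (Suc i)) - h (x i)\<bar>) \<le> D"
    using bounded_variation_onD[OF assms(2)] by blast
  show ?thesis unfolding bounded_variation_on_def
  proof (intro exI allI impI)
    fix m and x :: "nat \<Rightarrow> real" assume x: "(\<forall>i\<le>m. x i \<in> {a..b}) \<and> (\<forall>i<m. x i \<le> x (Suc i))"
    have "(\<Sum>i<m. \<bar>g (x (Suc i)) + h (x (Suc i)) - (g (x i) + h (x i))\<bar>) \<le>
       (\<Sum>i<m. \<bar>g (x (Suc i)) - g (x i)\<bar> + \<bar>h (x (Suc i)) - h (x i)\<bar>)"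
      by (intro sum_mono) linarith
    then show "(\<Sum>i<m. \<bar>g (x (Suc i)) + h (x (Suc i)) - (g (x i) + h (x i))\<bar>) \<le> C + D"
      using C[of m x] D[of m x] x by (simp add: sum.distrib)
  qed
qed

lemma bounded_variation_on_mult:
  assumes "bounded_variation_on a b g" "bounded_variation_on a b h"
  shows "bounded_variation_on a b (\<lambda>x. g x * h x)"
proof -
  obtain C where C: "\<And>m x. \<forall>i\<le>m. x i \<in> {a..b} \<Longrightarrow> \<forall>i<m. x i \<le> x (Suc i) \<Longrightarrow>
     (\<Sum>i<m. \<bar>g (x (Suc i)) - g (x i)\<bar>) \<le> C"
    using bounded_variation_onD[OF assms(1)] by blast
  obtain D where D: "\<And>m x. \<forall>i\<le>m. x i \<in> {a..b} \<Longrightarrow> \<forall>i<m. x i \<le> x (Suc i) \<Longrightarrow>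
     (\<Sum>i<m. \<bar>h (x (Suc i)) - h (x i)\<bar>) \<le> D"
    using bounded_variation_onD[OF assms(2)] by blast
  obtain Bg where Bg: "Bg \<ge> 0" "\<And>x. x \<in> {a..b} \<Longrightarrow> \<bar>g x\<bar> \<le> Bg" using bounded_variation_on_bounded[OF assms(1)] by blast
  obtain Bh where Bh: "Bh \<ge> 0" "\<And>x. x \<in> {a..b} \<Longrightarrow> \<bar>h x\<bar> \<le> Bh" using bounded_variation_on_bounded[OF assms(2)] by blast
  show ?thesis unfolding bounded_variation_on_def
  proof (intro exI allI impI)
    fix m and x :: "nat \<Rightarrow> real" assume x: "(\<forall>i\<le>m. x i \<in> {a..b}) \<and> (\<forall>i<m. x i \<le> x (Suc i))"
    have "(\<Sum>i<m. \<bar>g (x (Suc i)) * h (x (Suc i)) - g (x i) * h (x i)\<bar>) \<le>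
       (\<Sum>i<m. Bg * \<bar>h (x (Suc i)) - h (x i)\<bar> + Bh * \<bar>g (x (Suc i)) - g (x i)\<bar>)"
    proof (intro sum_mono)
      fix i assume "i \<in> {..<m}"
      then have xi: "x i \<in> {a..b}" "x (Suc i) \<in> {a..b}" using x by auto
      have "g (x (Suc i)) * h (x (Suc i)) - g (x i) * h (x i) =
         g (x (Suc i)) * (h (x (Suc i)) - h (x i)) + h (x i) * (g (x (Suc i)) - g (x i))"
        by (simp add: algebra_simps)
      also have "\<bar>\<dots>\<bar> \<le> \<bar>g (x (Suc i))\<bar> * \<bar>h (x (Suc i)) - h (x i)\<bar> + \<bar>h (x i)\<bar> * \<bar>g (x (Suc i)) - g (x i)\<bar>"
        by (rule order_trans[OF abs_triangle_ineq]) (simp add: abs_mult)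
      also have "\<dots> \<le> Bg * \<bar>h (x (Suc i)) - h (x i)\<bar> + Bh * \<bar>g (x (Suc i)) - g (x i)\<bar>"
        using Bg(2)[OF xi(2)] Bh(2)[OF xi(1)] by (intro add_mono mult_right_mono) auto
      finally show "\<bar>g (x (Suc i)) * h (x (Suc i)) - g (x i) * h (x i)\<bar> \<le>
         Bg * \<bar>h (x (Suc i)) - h (x i)\<bar> + Bh * \<bar>g (x (Suc i)) - g (x i)\<bar>" .
    qed
    also have "\<dots> = Bg * (\<Sum>i<m. \<bar>h (x (Suc i)) - h (x i)\<bar>) + Bh * (\<Sum>i<m. \<bar>g (x (Suc i)) - g (x i)\<bar>)"
      by (simp add: sum.distrib sum_distrib_left)
    also have "\<dots> \<le> Bg * D + Bh * C"
      using C[of m x] D[of m x] x Bg(1) Bh(1) by (intro add_mono mult_left_mono) auto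
    finally show "(\<Sum>i<m. \<bar>g (x (Suc i)) * h (x (Suc i)) - g (x i) * h (x i)\<bar>) \<le> Bg * D + Bh * C" .
  qed
qed

lemma bounded_variation_on_lipschitz:
  assumes "\<And>x y. x \<in> {a..b} \<Longrightarrow> y \<in> {a..b} \<Longrightarrow> \<bar>g x - g y\<bar> \<le> L * \<bar>x - y\<bar>" "L \<ge> 0"
  shows "bounded_variation_on a b g"
  unfolding bounded_variation_on_def
proof (intro exI allI impI)
  fix m and x :: "nat \<Rightarrow> real" assume x: "(\<forall>i\<le>m. x i \<in> {a..b}) \<and> (\<forall>i<m. x i \<le> x (Suc i))"
  have "(\<Sum>i<m. \<bar>g (x (Suc i)) - g (x i)\<bar>) \<le> (\<Sum>i<m. L * (x (Suc i) - x i))"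
  proof (rule sum_mono)
    fix i assume "i \<in> {..<m}"
    then show "\<bar>g (x (Suc i)) - g (x i)\<bar> \<le> L * (x (Suc i) - x i)"
      using assms(1)[of "x (Suc i)" "x i"] x by auto
  qed
  also have "\<dots> = L * (x m - x 0)"
    unfolding sum_distrib_left[symmetric] by (simp add: sum_lessThan_telescope)
  also have "\<dots> \<le> L * (b - a)"
  proof (rule mult_left_mono[OF _ assms(2)])
    have "x m \<in> {a..b}" "x 0 \<in> {a..b}" using x by blast+
    then show "x m - x 0 \<le> b - a" by simp
  qed
  finally show "(\<Sum>i<m. \<bar>g (x (Suc i)) - g (x i)\<bar>) \<le> L * (b - a)" .
qed

lemma bounded_variation_on_uminus:
  assumes "bounded_variation_on (-a) a g"
  shows "bounded_variation_on (-a) a (\<lambda>x. g (- x))"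
proof -
  obtain C where C: "\<And>m x. \<forall>i\<le>m. x i \<in> {-a..a} \<Longrightarrow> \<forall>i<m. x i \<le> x (Suc i) \<Longrightarrow>
     (\<Sum>i<m. \<bar>g (x (Suc i)) - g (x i)\<bar>) \<le> C"
    using bounded_variation_onD[OF assms] by blast
  show ?thesis unfolding bounded_variation_on_def
  proof (intro exI allI impI)
    fix m and x :: "nat \<Rightarrow> real" assume x: "(\<forall>i\<le>m. x i \<in> {-a..a}) \<and> (\<forall>i<m. x i \<le> x (Suc i))"
    have "(\<Sum>i<m. \<bar>g (- x (Suc i)) - g (- x i)\<bar>) =
       (\<Sum>i<m. \<bar>g (- x (m - Suc i)) - g (- x (m - i))\<bar>)"
      by (subst sum.nat_diff_reindex[symmetric]) (auto intro!: sum.cong simp: Suc_diff_Suc abs_minus_commute)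
    also have "\<dots> \<le> C"
    proof (rule C[of m "\<lambda>i. - x (m - i)"])
      show "\<forall>i<m. - x (m - i) \<le> - x (m - Suc i)"
      proof (intro allI impI)
        fix i assume "i < m"
        then have "Suc (m - Suc i) = m - i" "m - Suc i < m" by auto
        then show "- x (m - i) \<le> - x (m - Suc i)" using x by (metis neg_le_iff_le)
      qed
      show "\<forall>i\<le>m. - x (m - i) \<in> {-a..a}"
      proof (intro allI impI)
        fix i assume "i \<le> m"
        have "x (m - i) \<in> {-a..a}" using x by simp
        then show "- x (m - i) \<in> {-a..a}" by auto
      qed
    qed
    finally show "(\<Sum>i<m. \<bar>g (- x (Suc i)) - g (- x i)\<bar>) \<le> C" .
  qed
qed

lemma set_borel_measurable_uminus:
  assumes "set_borel_measurable lborel {-a..a::real} g"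
  shows "set_borel_measurable lborel {-a..a} (\<lambda>x. g (- x) :: real)"
proof -
  have "(\<lambda>x. indicator {-a..a} (- x) *\<^sub>R g (- x)) \<in> borel_measurable lborel"
    using measurable_compose[OF borel_measurable_uminus[OF measurable_ident_sets[OF refl]], of "\<lambda>x. indicator {-a..a} x *\<^sub>R g x" ] assms
    unfolding set_borel_measurable_def by simp
  moreover have "indicator {-a..a} (- x) = (indicator {-a..a} x :: real)" for x by (auto simp: indicator_def)
  ultimately show ?thesis unfolding set_borel_measurable_def by simp
qed

lemma bv_measurable_add: "bv_measurable g \<Longrightarrow> bv_measurable h \<Longrightarrow> bv_measurable (\<lambda>x. g x + h x)"
  unfolding bv_measurable_def set_borel_measurable_def
  by (auto simp: bounded_variation_on_add distrib_left)

lemma bv_measurable_mult: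
  assumes "bv_measurable g" "bv_measurable h"
  shows "bv_measurable (\<lambda>x. g x * h x)"
proof -
  have "(\<lambda>x. (indicator {-pi..pi} x *\<^sub>R g x) * (indicator {-pi..pi} x *\<^sub>R h x)) \<in> borel_measurable lborel"
    using assms by (intro borel_measurable_times) (auto simp: bv_measurable_def set_borel_measurable_def)
  moreover have "(\<lambda>x. (indicator {-pi..pi} x *\<^sub>R g x) * (indicator {-pi..pi} x *\<^sub>R h x)) =
      (\<lambda>x. indicator {-pi..pi} x *\<^sub>R (g x * h x))"
    by (auto simp: indicator_def)
  ultimately have "set_borel_measurable lborel {-pi..pi} (\<lambda>x. g x * h x)"
    unfolding set_borel_measurable_def by metis
  then show ?thesis
    using assms by (simp add: bv_measurable_def bounded_variation_on_mult)
qed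

lemma bv_measurable_uminus: "bv_measurable g \<Longrightarrow> bv_measurable (\<lambda>x. g (- x))"
  unfolding bv_measurable_def by (auto simp: bounded_variation_on_uminus set_borel_measurable_uminus)

lemma bv_measurable_lipschitz:
  assumes "\<And>x y. \<bar>g x - g y\<bar> \<le> L * \<bar>x - y\<bar>" "L \<ge> 0"
  shows "bv_measurable g"
proof -
  have "L-lipschitz_on UNIV g" using assms by (intro lipschitz_onI) (auto simp: dist_real_def)
  then have "continuous_on UNIV g" by (rule lipschitz_on_continuous_on)
  then have "g \<in> borel_measurable borel" by (rule borel_measurable_continuous_onI)
  then show ?thesis
    using bounded_variation_on_lipschitz[of "-pi" pi g L] assms
    by (simp add: bv_measurable_def set_borel_measurable_def)
qed

lemma bv_measurable_const: "bv_measurable (\<lambda>_. c)"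
  by (rule bv_measurable_lipschitz[of _ 0]) auto

lemma bv_measurable_cos: "bv_measurable (\<lambda>x. cos (c * x))"
proof (rule bv_measurable_lipschitz[of _ "\<bar>c\<bar>"])
  fix x y :: real
  have "\<bar>cos (c * x) - cos (c * y)\<bar> = 2 * \<bar>sin ((c * x + c * y) / 2)\<bar> * \<bar>sin ((c * y - c * x) / 2)\<bar>"
    by (simp add: cos_diff_cos abs_mult)
  also have "\<dots> \<le> 2 * 1 * \<bar>(c * y - c * x) / 2\<bar>"
    by (intro mult_mono abs_sin_x_le_abs_x) auto
  also have "\<dots> = \<bar>c\<bar> * \<bar>x - y\<bar>"
    by (simp add: abs_mult[symmetric] right_diff_distrib abs_minus_commute)
  finally show "\<bar>cos (c * x) - cos (c * y)\<bar> \<le> \<bar>c\<bar> * \<bar>x - y\<bar>" .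
qed simp

lemma bv_measurable_bounded:
  assumes "bv_measurable g"
  shows "\<exists>B\<ge>0. \<forall>x\<in>{-pi..pi}. \<bar>g x\<bar> \<le> B"
  using assms bounded_variation_on_bounded unfolding bv_measurable_def by blast

lemma bv_measurable_integrable:
  assumes "bv_measurable g" "A \<in> sets borel" "A \<subseteq> {-pi..pi}"
  shows "set_integrable lborel A g"
proof -
  obtain B where B: "B \<ge> 0" "\<And>x. x \<in> {-pi..pi} \<Longrightarrow> \<bar>g x\<bar> \<le> B" using bv_measurable_bounded[OF assms(1)] by blast
  have "set_integrable lborel {-pi..pi} g"
    unfolding set_integrable_def
  proof (rule Bochner_Integration.integrable_bound[of _ "\<lambda>x. indicator {-pi..pi} x * B"])
    show "integrable lborel (\<lambda>x. indicator {-pi..pi} x * B)"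
      by (intro integrable_mult_left integrable_real_indicator) auto
    show "(\<lambda>x. indicator {-pi..pi} x *\<^sub>R g x) \<in> borel_measurable lborel"
      using assms by (simp add: bv_measurable_def set_borel_measurable_def)
    show "AE x in lborel. norm (indicator {-pi..pi} x *\<^sub>R g x) \<le> norm (indicator {-pi..pi} x * B)"
      using B by (auto simp: indicator_def)
  qed
  then show ?thesis using assms by (auto intro: set_integrable_subset)
qed

text \<open>The grid omits frequency 0, and for even \<open>m\<close> it contains both ends of the
  interval. It becomes a sum over right endpoints of cells only after folding at 0.\<close>

definition riemann_sum :: "nat \<Rightarrow> (real \<Rightarrow> real) \<Rightarrow> real" where
  "riemann_sum m g = 2 * pi / m * (\<Sum>j\<in>GG m. g (ffreq j m))"

lemma finite_GG: "finite (GG m)"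
proof -
  have "GG m \<subseteq> {- int (m div 2)..int (m div 2)}" by (auto simp: GG_def)
  then show ?thesis using finite_subset by blast
qed

lemma sum_GG: "(\<Sum>j\<in>GG m. F j) = (\<Sum>i=1..m div 2. F (int i) + F (- int i))" for F :: "int \<Rightarrow> real"
proof -
  have GG: "GG m = int ` {1..m div 2} \<union> (\<lambda>i. - int i) ` {1..m div 2}"
  proof (intro equalityI subsetI)
    fix j assume "j \<in> GG m"
    then have "1 \<le> \<bar>j\<bar>" "\<bar>j\<bar> \<le> int (m div 2)" by (auto simp: GG_def)
    then have "nat \<bar>j\<bar> \<in> {1..m div 2}" "j = int (nat \<bar>j\<bar>) \<or> j = - int (nat \<bar>j\<bar>)" by auto
    then show "j \<in> int ` {1..m div 2} \<union> (\<lambda>i. - int i) ` {1..m div 2}" by blast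
  qed (auto simp: GG_def)
  show ?thesis unfolding GG
    by (subst sum.union_disjoint) (auto simp: sum.reindex inj_on_def sum.distrib)
qed

lemma ffreq_uminus: "ffreq (- j) m = - ffreq j m"
  by (simp add: ffreq_def)

lemma ffreq_in: "j \<in> GG m \<Longrightarrow> ffreq j m \<in> {-pi..pi}"
proof -
  assume j: "j \<in> GG m"
  have "\<bar>ffreq j m\<bar> \<le> pi"
  proof (cases "m = 0")
    case False
    have "2 * \<bar>j\<bar> \<le> int m" using j by (auto simp: GG_def)
    then have "2 * \<bar>real_of_int j\<bar> \<le> real m" by linarith
    then show ?thesis using False by (simp add: ffreq_def abs_mult field_simps)
  qed (simp add: ffreq_def)
  then show ?thesis by auto
qed

lemma
  fixes f :: "'i \<Rightarrow> real \<Rightarrow> real"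
  assumes "\<And>i. i \<in> I \<Longrightarrow> set_integrable N A (f i)"
  shows set_integral_sum: "(LINT x:A|N. (\<Sum>i\<in>I. f i x)) = (\<Sum>i\<in>I. LINT x:A|N. f i x)"
    and set_integrable_sum: "set_integrable N A (\<lambda>x. \<Sum>i\<in>I. f i x)"
  using assms unfolding set_lebesgue_integral_def set_integrable_def scaleR_sum_right
  by (auto intro!: Bochner_Integration.integral_sum Bochner_Integration.integrable_sum)

text \<open>Folding at 0 gives \<open>G\<close> on the positive half, where the grid points are
  right endpoints of cells of length \<open>h\<close>. On the cells the error is at most
  \<open>h\<close> times the variation of \<open>G\<close>; the piece left over before
  \<open>pi\<close> has length at most \<open>h\<close>.\<close>

lemma riemann_sum_error:
  assumes g: "bv_measurable g"
  shows "\<exists>K\<ge>0. \<forall>m\<ge>1. \<bar>riemann_sum m g - (LBINT \<theta>:{-pi..pi}. g \<theta>)\<bar> \<le> K / real m"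
proof -
  define G where "G \<theta> = g \<theta> + g (- \<theta>)" for \<theta>
  have G: "bv_measurable G" unfolding G_def using g by (intro bv_measurable_add bv_measurable_uminus)
  obtain B where B: "B \<ge> 0" "\<And>x. x \<in> {-pi..pi} \<Longrightarrow> \<bar>G x\<bar> \<le> B" using bv_measurable_bounded[OF G] by blast
  obtain C where C: "\<And>m x. \<forall>i\<le>m. x i \<in> {-pi..pi} \<Longrightarrow> \<forall>i<m. x i \<le> x (Suc i) \<Longrightarrow>
     (\<Sum>i<m. \<bar>G (x (Suc i)) - G (x i)\<bar>) \<le> C"
    using bounded_variation_onD[of "-pi" pi G] G unfolding bv_measurable_def by blast
  have C0: "C \<ge> 0" using C[of 0 "\<lambda>_. 0"] by simp
  have int: "set_integrable lborel A G" if "A \<in> sets borel" "A \<subseteq> {0..pi}" for A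
    using that pi_ge_zero by (intro bv_measurable_integrable[OF G]) force+
  have sym: "(LBINT \<theta>:{-pi..pi}. g \<theta>) = (LBINT \<theta>:{0<..pi}. G \<theta>)"
  proof -
    have ig: "set_integrable lborel A g" if "A \<in> sets borel" "A \<subseteq> {-pi..pi}" for A
      using that by (intro bv_measurable_integrable[OF g])
    have sub: "{0<..pi} \<subseteq> {-pi..pi}" using pi_gt_zero by auto
    have ig': "set_integrable lborel {0<..pi} (\<lambda>x. g (- x))"
      by (intro bv_measurable_integrable[OF bv_measurable_uminus[OF g]]) auto
    have "(LBINT \<theta>:{-pi..pi}. g \<theta>) = (LBINT \<theta>:{-pi..<0} \<union> {0<..pi}. g \<theta>)"
      unfolding set_lebesgue_integral_def
    proof (rule integral_cong_AE)
      show "AE x in lborel. indicator {-pi..pi} x *\<^sub>R g x = indicator ({-pi..<0} \<union> {0<..pi}) x *\<^sub>R g x"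
        using AE_lborel_singleton[of 0] by eventually_elim (auto simp: indicator_def)
      show "(\<lambda>x. indicator {-pi..pi} x *\<^sub>R g x) \<in> borel_measurable lborel"
        using ig[of "{-pi..pi}"] by (simp add: set_integrable_def borel_measurable_integrable)
      show "(\<lambda>x. indicator ({-pi..<0} \<union> {0<..pi}) x *\<^sub>R g x) \<in> borel_measurable lborel"
        using ig[of "{-pi..<0} \<union> {0<..pi}"] by (force simp: set_integrable_def dest: borel_measurable_integrable)
    qed
    also have "\<dots> = (LBINT \<theta>:{-pi..<0}. g \<theta>) + (LBINT \<theta>:{0<..pi}. g \<theta>)"
      using pi_ge_zero by (intro set_integral_Un ig) force+
    also have "(LBINT \<theta>:{-pi..<0}. g \<theta>) = (LBINT \<theta>:{0<..pi}. g (- \<theta>))"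
      unfolding set_lebesgue_integral_def
      by (subst lborel_integral_real_affine[of "-1" _ 0]) (auto intro!: Bochner_Integration.integral_cong simp: indicator_def)
    finally show ?thesis
      using ig[of "{0<..pi}", OF _ sub] ig' by (subst G_def, subst set_integral_add(2)) (auto simp: add.commute)
  qed
  have main: "\<bar>riemann_sum m g - (LBINT \<theta>:{-pi..pi}. g \<theta>)\<bar> \<le> 2 * pi * (C + B) / m" if m: "m \<ge> 1" for m
  proof -
    define h where "h = 2 * pi / real m"
    define k where "k = m div 2"
    have h: "h > 0" using m by (simp add: h_def)
    have kh: "real k * h \<le> pi" "pi \<le> real k * h + h"
    proof -
      have "real (2 * k) \<le> real m" "real m \<le> real (2 * k + 2)" unfolding of_nat_le_iff k_def by auto
      then have "pi * real (2 * k) \<le> pi * real m" "pi * real m \<le> pi * real (2 * k + 2)"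
        by (intro mult_left_mono, simp_all)+
      then show "real k * h \<le> pi" "pi \<le> real k * h + h" using m by (simp_all add: h_def field_simps)
    qed
    have rs: "riemann_sum m g = h * (\<Sum>i<k. G (real (Suc i) * h))"
    proof -
      have "(\<Sum>j\<in>GG m. g (ffreq j m)) = (\<Sum>i=1..k. G (real i * h))"
        unfolding sum_GG k_def ffreq_uminus
        by (intro sum.cong) (auto simp: G_def ffreq_def h_def mult_ac)
      also have "\<dots> = (\<Sum>i<k. G (real (Suc i) * h))"
        by (rule sum.reindex_bij_witness[of _ Suc "\<lambda>i. i - 1"]) auto
      finally show ?thesis by (simp add: riemann_sum_def h_def)
    qed
    have cell_sub: "{real i * h<..real (Suc i) * h} \<subseteq> {0..pi}" if "i < k" for i
    proof -
      have 1: "real (Suc i) * h \<le> real k * h" using that h by (intro mult_right_mono) auto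
      have 2: "0 \<le> real i * h" using h by simp
      show ?thesis
      proof
        fix x assume "x \<in> {real i * h<..real (Suc i) * h}"
        then have "real i * h < x" "x \<le> real (Suc i) * h" by auto
        then have "0 \<le> x" "x \<le> pi" using 1 2 kh by linarith+
        then show "x \<in> {0..pi}" by simp
      qed
    qed
    have part: "(LBINT \<theta>:{0<..real j * h}. G \<theta>) = (\<Sum>i<j. LBINT \<theta>:{real i * h<..real (Suc i) * h}. G \<theta>)"
      if "j \<le> k" for j
      using that
    proof (induction j)
      case (Suc j)
      have "0 \<le> real j * h" "real j * h \<le> real (Suc j) * h" using h by (simp_all add: mult_right_mono)
      then have "{0<..real (Suc j) * h} = {0<..real j * h} \<union> {real j * h<..real (Suc j) * h}"
        by (intro ivl_disj_un_two(6)[symmetric])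
      moreover have "real j * h \<le> real k * h" using Suc h by (intro mult_right_mono) auto
      ultimately have "(LBINT \<theta>:{0<..real (Suc j) * h}. G \<theta>) =
         (LBINT \<theta>:{0<..real j * h}. G \<theta>) + (LBINT \<theta>:{real j * h<..real (Suc j) * h}. G \<theta>)"
        using Suc.prems kh cell_sub[of j] by (simp only:, intro set_integral_Un int) auto
      then show ?case using Suc by simp
    qed (simp add: set_lebesgue_integral_def)
    have shift: "(LBINT \<theta>:{real i * h<..real (Suc i) * h}. G \<theta>) = (LBINT s:{0<..h}. G (real i * h + s))" for i
      unfolding set_lebesgue_integral_def
      by (subst lborel_integral_real_affine[of 1 _ "real i * h"])
         (auto intro!: Bochner_Integration.integral_cong simp: indicator_def algebra_simps)
    have int_shift: "set_integrable lborel {0<..h} (\<lambda>s. G (real i * h + s))" if "i < k" for i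
    proof -
      have "integrable lborel (\<lambda>x. indicator {real i * h<..real (Suc i) * h} x *\<^sub>R G x)"
        using int[of "{real i * h<..real (Suc i) * h}"] cell_sub[OF that] by (simp add: set_integrable_def)
      then have "integrable lborel (\<lambda>s. indicator {real i * h<..real (Suc i) * h} (real i * h + 1 * s) *\<^sub>R G (real i * h + 1 * s))"
        by (rule lborel_integrable_real_affine) simp
      moreover have "indicator {real i * h<..real (Suc i) * h} (real i * h + 1 * s) = (indicator {0<..h} s :: real)" for s
        by (auto simp: indicator_def algebra_simps)
      ultimately show ?thesis by (simp add: set_integrable_def)
    qed
    have h_int: "set_integrable lborel {0<..h} (\<lambda>s. c)" for c :: real
      unfolding set_integrable_def by (intro integrable_scaleR_left integrable_real_indicator) (auto simp: h_def)
    have h_const: "(LBINT s:{0<..h}. c) = h * c" for c :: real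
      using h by (simp add: set_lebesgue_integral_def)
    \<comment> \<open>All cells are translated to the same interval. For a fixed offset
      \<open>s\<close> the integrand is then a sum of increments of \<open>G\<close>, one in each
      cell, and is bounded by the total variation.\<close>
    have "h * (\<Sum>i<k. G (real (Suc i) * h)) - (LBINT \<theta>:{0<..real k * h}. G \<theta>) =
       (LBINT s:{0<..h}. (\<Sum>i<k. G (real (Suc i) * h) - G (real i * h + s)))"
    proof -
      have "(LBINT s:{0<..h}. (\<Sum>i<k. G (real (Suc i) * h) - G (real i * h + s))) =
        (\<Sum>i<k. LBINT s:{0<..h}. G (real (Suc i) * h) - G (real i * h + s))"
        using int_shift h_int by (intro set_integral_sum set_integral_diff(1)) auto
      also have "\<dots> = (\<Sum>i<k. h * G (real (Suc i) * h) - (LBINT s:{0<..h}. G (real i * h + s)))"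
      proof (intro sum.cong refl)
        fix i assume "i \<in> {..<k}"
        then show "(LBINT s:{0<..h}. G (real (Suc i) * h) - G (real i * h + s)) =
           h * G (real (Suc i) * h) - (LBINT s:{0<..h}. G (real i * h + s))"
          using int_shift[of i] h_int by (subst set_integral_diff(2)) (auto simp: h_const)
      qed
      finally show ?thesis
        unfolding part[OF order_refl] shift by (simp add: sum_subtractf sum_distrib_left)
    qed
    also have "\<bar>\<dots>\<bar> \<le> (LBINT s:{0<..h}. C)"
    proof -
      have bnd: "\<bar>\<Sum>i<k. G (real (Suc i) * h) - G (real i * h + s)\<bar> \<le> C" if s: "s \<in> {0<..h}" for s
      proof (cases "k = 0")
        case False
        \<comment> \<open>Increasing points that alternate between the offset points and the right
          endpoints of the cells; the increments wanted are those that start at even indices, and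
          the rest only enlarge the sum.\<close>
        define x where "x i = (if even i then real (i div 2) * h + s else real (Suc (i div 2)) * h)" for i :: nat
        have "(\<Sum>i<k. \<bar>G (real (Suc i) * h) - G (real i * h + s)\<bar>) = (\<Sum>i<k. \<bar>G (x (Suc (2 * i))) - G (x (2 * i))\<bar>)"
          by (intro sum.cong refl) (simp add: x_def)
        also have "\<dots> = (\<Sum>i\<in>(\<lambda>i. 2 * i) ` {..<k}. \<bar>G (x (Suc i)) - G (x i)\<bar>)"
          by (subst sum.reindex) (auto simp: inj_on_def)
        also have "\<dots> \<le> (\<Sum>i<2 * k - 1. \<bar>G (x (Suc i)) - G (x i)\<bar>)"
          using False by (intro sum_mono2) auto
        also have "\<dots> \<le> C"
        proof (rule C; intro allI impI)
          fix i assume i: "i \<le> 2 * k - 1"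
          then have "i div 2 < k" using False by auto
          then have "{real (i div 2) * h<..real (Suc (i div 2)) * h} \<subseteq> {0..pi}" by (rule cell_sub)
          moreover have "x i \<in> {real (i div 2) * h<..real (Suc (i div 2)) * h}"
            using s h by (auto simp: x_def algebra_simps)
          ultimately show "x i \<in> {-pi..pi}" using pi_ge_zero by force
        next
          fix i assume "i < 2 * k - 1"
          show "x i \<le> x (Suc i)"
          proof (cases "even i")
            case True
            then obtain l where "i = 2 * l" by (rule evenE)
            then show ?thesis using s by (simp add: x_def distrib_right)
          next
            case False
            then obtain l where "i = 2 * l + 1" by (rule oddE)
            then show ?thesis using s by (simp add: x_def)
          qed
        qed
        finally have "(\<Sum>i<k. \<bar>G (real (Suc i) * h) - G (real i * h + s)\<bar>) \<le> C" .
        then show ?thesis by (rule order_trans[OF sum_abs])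
      qed (use C0 in simp)
      have "norm (LBINT s:{0<..h}. (\<Sum>i<k. G (real (Suc i) * h) - G (real i * h + s))) \<le> (LBINT s:{0<..h}. C)"
        unfolding set_lebesgue_integral_def
      proof (rule Bochner_Integration.integral_norm_bound_integral)
        have "set_integrable lborel {0<..h} (\<lambda>s. \<Sum>i<k. G (real (Suc i) * h) - G (real i * h + s))"
          using int_shift h_int by (intro set_integrable_sum set_integral_diff(1)) auto
        then show "integrable lborel (\<lambda>s. indicator {0<..h} s *\<^sub>R (\<Sum>i<k. G (real (Suc i) * h) - G (real i * h + s)))"
          by (simp add: set_integrable_def)
        show "integrable lborel (\<lambda>s. indicator {0<..h} s *\<^sub>R C)" using h_int by (simp add: set_integrable_def)
      qed (use bnd in \<open>auto simp: indicator_def\<close>)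
      then show ?thesis by simp
    qed
    also have "\<dots> = h * C" by (rule h_const)
    finally have 1: "\<bar>h * (\<Sum>i<k. G (real (Suc i) * h)) - (LBINT \<theta>:{0<..real k * h}. G \<theta>)\<bar> \<le> h * C" .
    have subs: "{c<..pi} \<subseteq> {0..pi}" "{0<..c} \<subseteq> {0..pi}" if "0 \<le> c" "c \<le> pi" for c :: real
      using that by auto
    have "(LBINT \<theta>:{0<..pi}. G \<theta>) = (LBINT \<theta>:{0<..real k * h}. G \<theta>) + (LBINT \<theta>:{real k * h<..pi}. G \<theta>)"
    proof -
      have kh0: "0 \<le> real k * h" using h by simp
      have "{0<..pi} = {0<..real k * h} \<union> {real k * h<..pi}"
        by (rule ivl_disj_un_two(6)[OF kh0 kh(1), symmetric])
      moreover have "{real k * h<..pi} \<subseteq> {0..pi}" "{0<..real k * h} \<subseteq> {0..pi}"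
        by (rule subs[OF kh0 kh(1)])+
      ultimately show ?thesis by (simp only:, intro set_integral_Un int) auto
    qed
    moreover have "\<bar>LBINT \<theta>:{real k * h<..pi}. G \<theta>\<bar> \<le> h * B"
    proof -
      have kh0: "0 \<le> real k * h" using h by simp
      have "norm (LBINT \<theta>:{real k * h<..pi}. G \<theta>) \<le> (LBINT \<theta>:{real k * h<..pi}. B)"
        unfolding set_lebesgue_integral_def
      proof (rule Bochner_Integration.integral_norm_bound_integral)
        show "integrable lborel (\<lambda>x. indicator {real k * h<..pi} x *\<^sub>R G x)"
          using int[of "{real k * h<..pi}"] subs(1)[OF kh0 kh(1)] by (simp add: set_integrable_def)
        show "integrable lborel (\<lambda>x. indicator {real k * h<..pi} x *\<^sub>R B)"
          by (intro integrable_scaleR_left integrable_real_indicator) (auto simp: kh)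
        fix x
        show "norm (indicator {real k * h<..pi} x *\<^sub>R G x) \<le> indicator {real k * h<..pi} x *\<^sub>R B"
        proof (cases "x \<in> {real k * h<..pi}")
          case True
          then have "x \<in> {-pi..pi}" using kh0 pi_ge_zero unfolding greaterThanAtMost_iff atLeastAtMost_iff by linarith
          then show ?thesis using True B by simp
        qed simp
      qed
      also have "\<dots> = (pi - real k * h) * B" using kh by (simp add: set_lebesgue_integral_def)
      also have "\<dots> \<le> h * B" using kh B by (intro mult_right_mono) auto
      finally show ?thesis by simp
    qed
    ultimately have "\<bar>riemann_sum m g - (LBINT \<theta>:{0<..pi}. G \<theta>)\<bar> \<le> h * C + h * B"
      using 1 unfolding rs by linarith
    also have "h * C + h * B = 2 * pi * (C + B) / m" by (simp add: h_def add_divide_distrib distrib_left)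
    finally show ?thesis unfolding sym .
  qed
  show ?thesis
  proof (intro exI[of _ "2 * pi * (C + B)"] conjI)
    show "2 * pi * (C + B) \<ge> 0" using C0 B by simp
  qed (use main in auto)
qed

lemma riemann_sum_tendsto:
  assumes "bv_measurable g"
  shows "(\<lambda>m. riemann_sum m g) \<longlonglongrightarrow> (LBINT \<theta>:{-pi..pi}. g \<theta>)"
proof -
  obtain K where K: "K \<ge> 0" "\<And>m. m \<ge> 1 \<Longrightarrow> \<bar>riemann_sum m g - (LBINT \<theta>:{-pi..pi}. g \<theta>)\<bar> \<le> K / m"
    using riemann_sum_error[OF assms] by blast
  have "(\<lambda>m. riemann_sum m g - (LBINT \<theta>:{-pi..pi}. g \<theta>)) \<longlonglongrightarrow> 0"
  proof (rule Lim_null_comparison)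
    show "\<forall>\<^sub>F m in sequentially. norm (riemann_sum m g - (LBINT \<theta>:{-pi..pi}. g \<theta>)) \<le> K / real m"
      using eventually_ge_at_top[of 1] by eventually_elim (use K(2) in simp)
    show "(\<lambda>m. K / real m) \<longlonglongrightarrow> 0" by (rule lim_const_over_n)
  qed
  then show ?thesis by (simp add: LIM_zero_iff)
qed

lemma card_GG_le: "card (GG m) \<le> m"
proof -
  have "real (card (GG m)) = (\<Sum>j\<in>GG m. 1)" by simp
  also have "\<dots> = 2 * real (m div 2)" unfolding sum_GG by simp
  also have "\<dots> \<le> real m" by linarith
  finally show ?thesis by simp
qed

lemma abs_riemann_sum_le:
  assumes "\<And>x. x \<in> {-pi..pi} \<Longrightarrow> \<bar>g x\<bar> \<le> B" "B \<ge> 0"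
  shows "\<bar>riemann_sum m g\<bar> \<le> 2 * pi * B"
proof (cases "m = 0")
  case False
  have "\<bar>\<Sum>j\<in>GG m. g (ffreq j m)\<bar> \<le> (\<Sum>j\<in>GG m. B)"
    using assms ffreq_in by (intro order_trans[OF sum_abs] sum_mono) auto
  also have "\<dots> \<le> real m * B" using card_GG_le[of m] assms(2) by (simp add: mult_right_mono)
  finally have "2 * pi / m * \<bar>\<Sum>j\<in>GG m. g (ffreq j m)\<bar> \<le> 2 * pi / m * (real m * B)"
    by (intro mult_left_mono) auto
  then show ?thesis using False by (simp add: riemann_sum_def abs_mult)
qed (use assms in \<open>simp add: riemann_sum_def\<close>)

section \<open>Dominated convergence for unordered sums\<close>

text \<open>Passage to the counting measure, so that dominated convergence for integrals becomes
  available for unordered sums.\<close>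

lemma infsum_eq_integral_count_space:
  fixes f :: "'i \<Rightarrow> real"
  assumes "(\<lambda>x. norm (f x)) summable_on UNIV"
  shows "infsum f UNIV = (\<integral>x. f x \<partial>count_space UNIV)" "integrable (count_space UNIV) f"
proof -
  have f: "Infinite_Set_Sum.abs_summable_on f UNIV" using assms abs_summable_equivalent by blast
  show "infsum f UNIV = (\<integral>x. f x \<partial>count_space UNIV)"
    using infsetsum_infsum[OF f] by (simp add: infsetsum_def)
  show "integrable (count_space UNIV) f" using f by (simp add: abs_summable_on_def)
qed

lemma summable_on_dominated:
  fixes f g :: "'i \<Rightarrow> real"
  assumes "g summable_on A" "\<And>x. x \<in> A \<Longrightarrow> \<bar>f x\<bar> \<le> g x"
  shows "f summable_on A" "(\<lambda>x. norm (f x)) summable_on A"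
proof -
  show 1: "(\<lambda>x. norm (f x)) summable_on A"
    by (rule summable_on_comparison_test[OF assms(1)]) (use assms(2) in auto)
  then show "f summable_on A" by (rule abs_summable_summable)
qed

lemma infsum_dominated_convergence:
  fixes a :: "nat \<Rightarrow> 'i \<Rightarrow> real"
  assumes g: "g summable_on UNIV" and le: "\<And>m h. \<bar>a m h\<bar> \<le> g h"
    and lim: "\<And>h. (\<lambda>m. a m h) \<longlonglongrightarrow> l h"
  shows "(\<lambda>m. infsum (a m) UNIV) \<longlonglongrightarrow> infsum l UNIV"
proof -
  have l_le: "\<bar>l h\<bar> \<le> g h" for h
    using tendsto_rabs[OF lim[of h]] le by (intro LIMSEQ_le_const2) auto
  have "g h \<ge> 0" for h using order_trans[OF abs_ge_zero le] .
  then have gn: "(\<lambda>x. norm (g x)) summable_on UNIV" using g by simp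
  have "(\<lambda>m. \<integral>x. a m x \<partial>count_space UNIV) \<longlonglongrightarrow> (\<integral>x. l x \<partial>count_space UNIV)"
    by (rule integral_dominated_convergence[where w = g])
       (use lim le infsum_eq_integral_count_space(2)[OF gn] in auto)
  moreover have "infsum (a m) UNIV = (\<integral>x. a m x \<partial>count_space UNIV)" for m
    by (rule infsum_eq_integral_count_space(1)[OF summable_on_dominated(2)[OF g]]) (use le in auto)
  moreover have "infsum l UNIV = (\<integral>x. l x \<partial>count_space UNIV)"
    by (rule infsum_eq_integral_count_space(1)[OF summable_on_dominated(2)[OF g]]) (use l_le in auto)
  ultimately show ?thesis by simp
qed

lemma abs_infsum_le:
  fixes f g :: "'i \<Rightarrow> real"
  assumes "g summable_on A" "\<And>x. x \<in> A \<Longrightarrow> \<bar>f x\<bar> \<le> g x"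
  shows "\<bar>infsum f A\<bar> \<le> infsum g A"
  using norm_infsum_le[OF has_sum_infsum[OF summable_on_dominated(1)[OF assms]] has_sum_infsum[OF assms(1)]] assms
  by auto

lemma infsum_diff_real:
  fixes f g :: "'i \<Rightarrow> real"
  assumes "f summable_on A" "g summable_on A"
  shows "(\<Sum>\<^sub>\<infinity>x\<in>A. f x - g x) = infsum f A - infsum g A"
  using infsum_add[of f A "\<lambda>x. - g x"] assms by (simp add: infsum_uminus summable_on_uminus)

text \<open>The enumeration of the countable index set exhausts it by finite sets
  \<open>H n\<close>, for which the exchange is finite additivity. Dominated convergence passes to
  the limit on both sides: for the integral with dominating constant \<open>B * K\<close>, for the
  sum with multiples of \<open>\<bar>c h\<bar>\<close>.\<close>

lemma infsum_integral_swap: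
  fixes c :: "'i :: countable \<Rightarrow> real" and q :: "'i \<Rightarrow> real \<Rightarrow> real"
  assumes c: "(\<lambda>h. \<bar>c h\<bar>) summable_on UNIV" and \<psi>: "bv_measurable \<psi>"
    and q: "\<And>h. q h \<in> borel_measurable borel" "\<And>h \<theta>. \<bar>q h \<theta>\<bar> \<le> 1"
  shows "(LBINT \<theta>:{-pi..pi}. \<psi> \<theta> * (\<Sum>\<^sub>\<infinity>h. c h * q h \<theta>)) = (\<Sum>\<^sub>\<infinity>h. c h * (LBINT \<theta>:{-pi..pi}. \<psi> \<theta> * q h \<theta>))"
proof -
  have [measurable]: "q h \<in> borel_measurable borel" for h by (rule q)
  obtain B where B: "B \<ge> 0" "\<forall>x\<in>{-pi..pi}. \<bar>\<psi> x\<bar> \<le> B" using bv_measurable_bounded[OF \<psi>] by blast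
  have \<psi>_meas[measurable]: "(\<lambda>\<theta>. indicator {-pi..pi} \<theta> * \<psi> \<theta>) \<in> borel_measurable borel"
    using \<psi> by (simp add: bv_measurable_def set_borel_measurable_def)
  have const: "integrable lborel (\<lambda>\<theta>. indicator {-pi..pi} \<theta> * C)" for C :: real
    by (intro integrable_mult_left integrable_real_indicator) auto
  define H where "H n = {h::'i. to_nat h \<le> n}" for n
  have finH: "finite (H n)" for n
    unfolding H_def by (rule finite_imageD[of to_nat]) (auto intro: finite_subset[of _ "{..n}"] inj_on_subset[OF inj_to_nat])
  define K where "K = (\<Sum>\<^sub>\<infinity>h. \<bar>c h\<bar>)"
  have part: "(\<lambda>n. \<Sum>h\<in>H n. a h) \<longlonglongrightarrow> infsum a UNIV" if a: "\<And>h. \<bar>a h\<bar> \<le> C * \<bar>c h\<bar>" for a C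
  proof -
    have "(\<lambda>n. \<Sum>\<^sub>\<infinity>h. if h \<in> H n then a h else 0) \<longlonglongrightarrow> infsum a UNIV"
    proof (rule infsum_dominated_convergence)
      show "(\<lambda>h. C * \<bar>c h\<bar>) summable_on UNIV" using c by (rule summable_on_cmult_right)
      show "\<bar>if h \<in> H m then a h else 0\<bar> \<le> C * \<bar>c h\<bar>" for m h
        using a[of h] order_trans[OF abs_ge_zero a[of h]] by simp
      show "(\<lambda>m. if h \<in> H m then a h else 0) \<longlonglongrightarrow> a h" for h
      proof (rule tendsto_eventually)
        show "\<forall>\<^sub>F m in sequentially. (if h \<in> H m then a h else 0) = a h"
          using eventually_ge_at_top[of "to_nat h"] by eventually_elim (simp add: H_def)
      qed
    qed
    moreover have "(\<Sum>\<^sub>\<infinity>h. if h \<in> H n then a h else 0) = (\<Sum>h\<in>H n. a h)" for n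
      by (subst infsum_cong_neutral[where T = "H n" and g = a]) (auto simp: finH)
    ultimately show ?thesis by simp
  qed
  have prod_le: "\<bar>\<psi> x * q h x\<bar> \<le> B" if "x \<in> {-pi..pi}" for x h
    using mult_mono[of "\<bar>\<psi> x\<bar>" B "\<bar>q h x\<bar>" 1] B that q(2)[of h x] by (simp add: abs_mult)
  have int: "set_integrable lborel {-pi..pi} (\<lambda>\<theta>. \<psi> \<theta> * q h \<theta>)" for h
    unfolding set_integrable_def
  proof (rule Bochner_Integration.integrable_bound[OF const[of B]])
    show "(\<lambda>x. indicat_real {- pi..pi} x *\<^sub>R (\<psi> x * q h x)) \<in> borel_measurable lborel"
      using borel_measurable_times[OF \<psi>_meas q(1)[of h]] by (simp add: mult.assoc)
    show "AE x in lborel. norm (indicat_real {- pi..pi} x *\<^sub>R (\<psi> x * q h x)) \<le> norm (indicat_real {- pi..pi} x * B)"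
      using B(1) prod_le[of _ h] by (auto simp: indicator_def)
  qed
  have "(\<lambda>n. LBINT \<theta>:{-pi..pi}. \<psi> \<theta> * (\<Sum>h\<in>H n. c h * q h \<theta>)) \<longlonglongrightarrow>
     (LBINT \<theta>:{-pi..pi}. \<psi> \<theta> * (\<Sum>\<^sub>\<infinity>h. c h * q h \<theta>))"
    unfolding set_lebesgue_integral_def
  proof (rule integral_dominated_convergence[where w = "\<lambda>\<theta>. indicator {-pi..pi} \<theta> * (B * K)"])
    have conv: "(\<lambda>n. \<Sum>h\<in>H n. c h * q h \<theta>) \<longlonglongrightarrow> (\<Sum>\<^sub>\<infinity>h. c h * q h \<theta>)" for \<theta>
      using q(2) by (intro part[of _ 1]) (auto simp: abs_mult intro!: mult_left_le)
    have m1: "(\<lambda>\<theta>. \<Sum>h\<in>H n. c h * q h \<theta>) \<in> borel_measurable borel" for n by measurable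
    have m2: "(\<lambda>\<theta>. \<Sum>\<^sub>\<infinity>h. c h * q h \<theta>) \<in> borel_measurable borel"
      by (rule borel_measurable_LIMSEQ_real[OF conv m1])
    show "(\<lambda>x. indicat_real {- pi..pi} x *\<^sub>R (\<psi> x * (\<Sum>h\<in>H n. c h * q h x))) \<in> borel_measurable lborel" for n
      using borel_measurable_times[OF \<psi>_meas m1] by (simp add: mult.assoc)
    show "(\<lambda>x. indicat_real {- pi..pi} x *\<^sub>R (\<psi> x * (\<Sum>\<^sub>\<infinity>h. c h * q h x))) \<in> borel_measurable lborel"
      using borel_measurable_times[OF \<psi>_meas m2] by (simp add: mult.assoc)
    show "integrable lborel (\<lambda>\<theta>. indicat_real {- pi..pi} \<theta> * (B * K))" by (rule const)
    show "AE x in lborel. (\<lambda>n. indicat_real {- pi..pi} x *\<^sub>R (\<psi> x * (\<Sum>h\<in>H n. c h * q h x))) \<longlonglongrightarrow>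
        indicat_real {- pi..pi} x *\<^sub>R (\<psi> x * (\<Sum>\<^sub>\<infinity>h. c h * q h x))"
      using conv by (intro AE_I2 tendsto_scaleR tendsto_mult tendsto_const)
    show "AE x in lborel. norm (indicat_real {- pi..pi} x *\<^sub>R (\<psi> x * (\<Sum>h\<in>H n. c h * q h x))) \<le>
        indicat_real {- pi..pi} x * (B * K)" for n
    proof (rule AE_I2)
      fix x
      have "\<bar>\<Sum>h\<in>H n. c h * q h x\<bar> \<le> (\<Sum>h\<in>H n. \<bar>c h\<bar>)"
        using q(2) by (intro order_trans[OF sum_abs] sum_mono) (auto simp: abs_mult intro!: mult_left_le)
      also have "\<dots> \<le> K" unfolding K_def using c finH by (intro finite_sum_le_infsum) auto
      finally have le: "\<bar>\<Sum>h\<in>H n. c h * q h x\<bar> \<le> K" .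
      show "norm (indicat_real {- pi..pi} x *\<^sub>R (\<psi> x * (\<Sum>h\<in>H n. c h * q h x))) \<le>
        indicat_real {- pi..pi} x * (B * K)"
      proof (cases "x \<in> {-pi..pi}")
        case True
        then have "\<bar>\<psi> x\<bar> * \<bar>\<Sum>h\<in>H n. c h * q h x\<bar> \<le> B * K" using B le by (intro mult_mono) auto
        then show ?thesis using True by (simp add: abs_mult)
      qed simp
    qed
  qed
  moreover have "(LBINT \<theta>:{-pi..pi}. \<psi> \<theta> * (\<Sum>h\<in>H n. c h * q h \<theta>)) =
     (\<Sum>h\<in>H n. c h * (LBINT \<theta>:{-pi..pi}. \<psi> \<theta> * q h \<theta>))" for n
  proof -
    have "(LBINT \<theta>:{-pi..pi}. \<psi> \<theta> * (\<Sum>h\<in>H n. c h * q h \<theta>)) =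
        (LBINT \<theta>:{-pi..pi}. (\<Sum>h\<in>H n. c h * (\<psi> \<theta> * q h \<theta>)))"
      by (simp add: sum_distrib_left mult_ac)
    also have "\<dots> = (\<Sum>h\<in>H n. LBINT \<theta>:{-pi..pi}. c h * (\<psi> \<theta> * q h \<theta>))"
      using int by (intro set_integral_sum) simp
    finally show ?thesis by simp
  qed
  moreover have "(\<lambda>n. \<Sum>h\<in>H n. c h * (LBINT \<theta>:{-pi..pi}. \<psi> \<theta> * q h \<theta>)) \<longlonglongrightarrow>
     (\<Sum>\<^sub>\<infinity>h. c h * (LBINT \<theta>:{-pi..pi}. \<psi> \<theta> * q h \<theta>))"
  proof (rule part[of _ "2 * pi * B"])
    fix h
    have "\<bar>LBINT \<theta>:{-pi..pi}. \<psi> \<theta> * q h \<theta>\<bar> \<le> (LBINT \<theta>:{-pi..pi}. B)"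
      unfolding set_lebesgue_integral_def real_norm_def[symmetric]
    proof (rule Bochner_Integration.integral_norm_bound_integral)
      show "norm (indicat_real {- pi..pi} x *\<^sub>R (\<psi> x * q h x)) \<le> indicat_real {- pi..pi} x *\<^sub>R B" for x
        using prod_le[of x h] by (auto simp: indicator_def)
    qed (use int const[of B] in \<open>auto simp: set_integrable_def\<close>)
    also have "\<dots> = 2 * pi * B" by (simp add: set_lebesgue_integral_def)
    finally show "\<bar>c h * (LBINT \<theta>:{-pi..pi}. \<psi> \<theta> * q h \<theta>)\<bar> \<le> 2 * pi * B * \<bar>c h\<bar>"
      unfolding abs_mult by (metis abs_ge_zero mult.commute mult_left_mono)
  qed
  ultimately show ?thesis by (auto intro: LIMSEQ_unique)
qed

section \<open>The spectral density as a cosine series\<close>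

context spectral_process
begin

abbreviation f where "f \<equiv> spectral_density M X"

lemma summable_autocov: "(\<lambda>h. \<bar>real_of_int h\<bar> * \<bar>\<gamma> h\<bar>) summable_on UNIV" "(\<lambda>h. \<bar>\<gamma> h\<bar>) summable_on UNIV"
  by (rule summable_on_comparison_test[OF autocov_summable], simp_all add: mult_right_mono distrib_right)+

lemma infsum_autocov_le: "(\<Sum>\<^sub>\<infinity>h. \<bar>real_of_int h\<bar> * \<bar>\<gamma> h\<bar>) \<le> K\<gamma>" "(\<Sum>\<^sub>\<infinity>h. \<bar>\<gamma> h\<bar>) \<le> K\<gamma>"
  unfolding K\<gamma>_def using summable_autocov autocov_summable
  by (auto intro!: infsum_mono simp: distrib_right)

lemma summable_c4: "(\<lambda>(h1, h2, h3). \<bar>c4 h1 h2 h3\<bar>) summable_on UNIV"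
  by (rule summable_on_comparison_test[OF cum4_summable]) (auto simp: c4_def distrib_right)

lemma summable_autocov_cos: "(\<lambda>h. \<gamma> h * cos (of_int h * \<theta>)) summable_on UNIV"
  by (rule summable_on_dominated(1)[OF summable_autocov(2)]) (auto simp: abs_mult intro!: mult_left_le)

lemma spectral_density_eq: "f \<theta> = (\<Sum>\<^sub>\<infinity>h. \<gamma> h * cos (of_int h * \<theta>)) / (2 * pi)"
proof -
  have "(\<lambda>h. complex_of_real (\<gamma> h) * cis (- (of_int h * \<theta>))) summable_on UNIV"
    by (rule abs_summable_summable) (use summable_autocov in \<open>simp add: norm_mult\<close>)
  then show ?thesis
    unfolding spectral_density_def by (simp add: infsum_Re[symmetric])
qed

lemma spectral_density_even: "f (- \<theta>) = f \<theta>"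
  by (simp add: spectral_density_eq)

lemma abs_spectral_density_le: "\<bar>f \<theta>\<bar> \<le> K\<gamma>"
proof -
  have "\<bar>\<Sum>\<^sub>\<infinity>h. \<gamma> h * cos (of_int h * \<theta>)\<bar> \<le> (\<Sum>\<^sub>\<infinity>h. \<bar>\<gamma> h\<bar>)"
    by (rule abs_infsum_le[OF summable_autocov(2)]) (auto simp: abs_mult intro!: mult_left_le)
  also have "\<dots> \<le> K\<gamma> * (2 * pi)"
    using infsum_autocov_le(2) K_nonneg(1) mult_left_mono[of 1 "2 * pi" K\<gamma>] pi_gt3 by linarith
  finally show ?thesis by (simp add: spectral_density_eq abs_divide divide_le_eq)
qed

lemma abs_cos_diff_le: "\<bar>cos x - cos y\<bar> \<le> \<bar>x - y\<bar>" for x y :: real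
proof -
  have "\<bar>cos x - cos y\<bar> = 2 * \<bar>sin ((x + y) / 2)\<bar> * \<bar>sin ((y - x) / 2)\<bar>"
    by (simp add: cos_diff_cos abs_mult)
  also have "\<dots> \<le> 2 * 1 * \<bar>(y - x) / 2\<bar>"
    by (intro mult_mono abs_sin_x_le_abs_x) auto
  finally show ?thesis by simp
qed

text \<open>The weight \<open>\<bar>h\<bar>\<close> in the summability of the autocovariances makes
  the series Lipschitz.\<close>

lemma bv_measurable_spectral_density: "bv_measurable f"
proof (rule bv_measurable_lipschitz[OF _ K_nonneg(1)])
  fix x y :: real
  have "2 * pi * (f x - f y) = (\<Sum>\<^sub>\<infinity>h. \<gamma> h * cos (of_int h * x) - \<gamma> h * cos (of_int h * y))"
    by (subst infsum_diff_real) (auto simp: summable_autocov_cos spectral_density_eq diff_divide_distrib[symmetric])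
  also have "\<bar>\<dots>\<bar> \<le> (\<Sum>\<^sub>\<infinity>h. \<bar>real_of_int h\<bar> * \<bar>\<gamma> h\<bar> * \<bar>x - y\<bar>)"
  proof (rule abs_infsum_le)
    show "(\<lambda>h. \<bar>real_of_int h\<bar> * \<bar>\<gamma> h\<bar> * \<bar>x - y\<bar>) summable_on UNIV"
      using summable_autocov(1) by (rule summable_on_cmult_left)
    fix h
    have "\<bar>\<gamma> h\<bar> * \<bar>cos (of_int h * x) - cos (of_int h * y)\<bar> \<le> \<bar>\<gamma> h\<bar> * \<bar>of_int h * x - of_int h * y\<bar>"
      by (intro mult_left_mono abs_cos_diff_le) auto
    then show "\<bar>\<gamma> h * cos (of_int h * x) - \<gamma> h * cos (of_int h * y)\<bar> \<le> \<bar>real_of_int h\<bar> * \<bar>\<gamma> h\<bar> * \<bar>x - y\<bar>"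
      unfolding right_diff_distrib[symmetric] by (simp add: abs_mult mult_ac)
  qed
  also have "\<dots> = (\<Sum>\<^sub>\<infinity>h. \<bar>real_of_int h\<bar> * \<bar>\<gamma> h\<bar>) * \<bar>x - y\<bar>"
    by (rule infsum_cmult_left')
  also have "\<dots> \<le> K\<gamma> * \<bar>x - y\<bar>" by (intro mult_right_mono infsum_autocov_le) auto
  also have "\<dots> \<le> 2 * pi * (K\<gamma> * \<bar>x - y\<bar>)"
    using K_nonneg(1) pi_gt3 mult_right_mono[of 1 "2 * pi" "K\<gamma> * \<bar>x - y\<bar>"] by simp
  finally show "\<bar>f x - f y\<bar> \<le> K\<gamma> * \<bar>x - y\<bar>" by (simp add: abs_mult)
qed

end

section \<open>Covariances of block periodograms\<close>

lemma periodogram_eq: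
  "periodogram b x \<theta> = (\<Sum>s=1..b. \<Sum>s'=1..b. cos (\<theta> * (real s - real s')) * (x s * x s')) / (2 * pi * b)"
proof -
  have "(cmod (\<Sum>t=1..b. complex_of_real (x t) * cis (- (\<theta> * real t))))\<^sup>2 =
    (\<Sum>s=1..b. x s * cos (\<theta> * s))\<^sup>2 + (\<Sum>s=1..b. x s * sin (\<theta> * s))\<^sup>2"
    by (simp add: cmod_power2 sum_negf)
  also have "\<dots> = (\<Sum>s=1..b. \<Sum>s'=1..b. cos (\<theta> * (real s - real s')) * (x s * x s'))"
    by (simp add: power2_eq_square sum_product sum.distrib[symmetric] right_diff_distrib cos_diff algebra_simps)
  finally show ?thesis by (simp add: periodogram_def)
qed

lemma periodogram_uminus: "periodogram b x (- \<theta>) = periodogram b x \<theta>"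
  by (simp add: periodogram_eq)

text \<open>Multiplication by \<open>2 * sin (\<delta> / 2)\<close> makes the sum telescope, and its
  two ends differ by full periods. The free phase \<open>c\<close> lets the lemma cover sine sums
  and lag-dependent shifts as well.\<close>

lemma sum_cos_frequency_eq_0:
  assumes "\<delta> * real b = 2 * pi * of_int k" "\<not> int b dvd k" "b \<ge> 1"
  shows "(\<Sum>s=1..b. cos (\<delta> * real s + c)) = 0"
proof -
  have tele: "2 * sin (\<delta> / 2) * (\<Sum>s=1..m. cos (\<delta> * real s + c)) = sin (\<delta> * real m + \<delta> / 2 + c) - sin (\<delta> / 2 + c)" for m
  proof (induction m)
    case (Suc m)
    have eq: "\<delta> * real m + \<delta> / 2 + c = (\<delta> * real (Suc m) + c) - \<delta> / 2"
      "\<delta> * real (Suc m) + \<delta> / 2 + c = (\<delta> * real (Suc m) + c) + \<delta> / 2" by (simp_all add: algebra_simps)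
    have "2 * sin (\<delta> / 2) * (\<Sum>s=1..Suc m. cos (\<delta> * real s + c)) =
       2 * sin (\<delta> / 2) * (\<Sum>s=1..m. cos (\<delta> * real s + c)) + 2 * sin (\<delta> / 2) * cos (\<delta> * real (Suc m) + c)"
      by (simp add: distrib_left)
    then show ?case unfolding Suc eq sin_diff sin_add by (simp add: algebra_simps)
  qed simp
  have "sin (\<delta> * real b + \<delta> / 2 + c) = sin (\<delta> / 2 + c + 2 * pi * of_int k)"
    by (simp add: assms(1) algebra_simps)
  also have "\<dots> = sin (\<delta> / 2 + c)"
    unfolding sin_add[of "\<delta> / 2 + c"] by simp
  finally have "2 * sin (\<delta> / 2) * (\<Sum>s=1..b. cos (\<delta> * real s + c)) = 0" using tele[of b] by simp
  moreover have "sin (\<delta> / 2) \<noteq> 0"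
  proof
    assume "sin (\<delta> / 2) = 0"
    then obtain i :: int where i: "\<delta> / 2 = of_int i * pi" using sin_zero_iff_int2 by blast
    then have "of_int i * pi * 2 * real b = 2 * pi * of_int k" using assms(1) by (simp add: field_simps)
    then have "real_of_int k = real_of_int (int b * i)" by (simp add: mult.commute)
    then have "k = int b * i" by linarith
    then show False using assms(2) by simp
  qed
  ultimately show ?thesis by simp
qed

text \<open>The times of a block whose shift by \<open>h\<close> stays in the block. Their number
  lies between \<open>b - \<bar>h\<bar>\<close> and \<open>b\<close>, as in Fejer weights.\<close>

definition overlap :: "nat \<Rightarrow> int \<Rightarrow> nat set" where
  "overlap b h = {s \<in> {1..b}. 1 \<le> int s + h \<and> int s + h \<le> int b}"

lemma overlap_subset: "overlap b h \<subseteq> {1..b}" by (auto simp: overlap_def)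

lemma finite_overlap: "finite (overlap b h)" using overlap_subset finite_subset by blast

lemma card_overlap_le: "card (overlap b h) \<le> b"
  using card_mono[OF _ overlap_subset[of b h]] by simp

lemma card_complement_overlap: "card ({1..b} - overlap b h) \<le> nat \<bar>h\<bar>"
proof (cases "h \<ge> 0")
  case True
  then have "{1..b} - overlap b h \<subseteq> {b + 1 - nat h..b}" by (auto simp: overlap_def)
  then have "card ({1..b} - overlap b h) \<le> card {b + 1 - nat h..b}" by (intro card_mono) auto
  also have "\<dots> \<le> nat \<bar>h\<bar>" using True by simp
  finally show ?thesis .
next
  case False
  then have "{1..b} - overlap b h \<subseteq> {1..nat (- h)}" by (auto simp: overlap_def)
  then have "card ({1..b} - overlap b h) \<le> card {1..nat (- h)}" by (intro card_mono) auto
  also have "\<dots> = nat \<bar>h\<bar>" using False by simp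
  finally show ?thesis .
qed

lemma card_overlap_ge: "real b - real (card (overlap b h)) \<le> \<bar>real_of_int h\<bar>"
proof -
  have "card ({1..b} - overlap b h) = b - card (overlap b h)"
    using card_Diff_subset[OF finite_overlap overlap_subset] by simp
  then have "real b - real (card (overlap b h)) \<le> real (nat \<bar>h\<bar>)"
    using card_complement_overlap[of b h] by linarith
  then show ?thesis by simp
qed

lemma sum_pairs_by_lag:
  "(\<Sum>s=1..b. \<Sum>u=1..b. G s (int u - int s)) =
     (\<Sum>h\<in>{- int b..int b}. \<Sum>s\<in>overlap b h. G s h)" for G :: "nat \<Rightarrow> int \<Rightarrow> real"
proof -
  have "(\<Sum>s=1..b. \<Sum>u=1..b. G s (int u - int s)) = (\<Sum>(s, u)\<in>{1..b} \<times> {1..b}. G s (int u - int s))"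
    by (simp add: sum.cartesian_product)
  also have "\<dots> = (\<Sum>(h, s)\<in>Sigma {- int b..int b} (overlap b). G s h)"
    by (rule sum.reindex_bij_witness[where i = "\<lambda>(h, s). (s, nat (int s + h))" and j = "\<lambda>(s, u). (int u - int s, s)"])
       (auto simp: overlap_def)
  also have "\<dots> = (\<Sum>h\<in>{- int b..int b}. \<Sum>s\<in>overlap b h. G s h)"
    by (subst sum.Sigma) (auto simp: finite_overlap)
  finally show ?thesis .
qed

text \<open>The weights for which the quadratic form of a block is its periodogram.\<close>

definition pgw :: "real \<Rightarrow> nat \<Rightarrow> nat \<Rightarrow> real" where
  "pgw \<theta> s s' = cos (\<theta> * (real s - real s')) / (2 * pi)"

lemma abs_pgw_le: "\<bar>pgw \<theta> s s'\<bar> \<le> 1"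
proof -
  have "\<bar>cos (\<theta> * (real s - real s'))\<bar> \<le> 1" "1 \<le> 2 * pi" using pi_gt3 by auto
  then have "\<bar>cos (\<theta> * (real s - real s'))\<bar> \<le> 2 * pi" by linarith
  then show ?thesis by (simp add: pgw_def abs_divide divide_le_eq)
qed

context spectral_process
begin

lemma block_pgram_eq_qform:
  assumes "1 \<le> t" "t + b \<le> n + 1"
  shows "block_pgram b (sample X n \<omega>) t \<theta> = qform (pgw \<theta>) b (int t - 1) \<omega>"
proof -
  have "sample X n \<omega> (t + s - 1) = X (int t - 1 + int s) \<omega>" if "s \<in> {1..b}" for s
    using that assms by (auto simp: sample_def of_nat_diff algebra_simps)
  then show ?thesis
    by (simp add: block_pgram_def periodogram_eq qform_def pgw_def sum_divide_distrib field_simps)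
qed

text \<open>The expected block periodogram, which by stationarity is the same for all
  blocks.\<close>

definition epg :: "nat \<Rightarrow> real \<Rightarrow> real" where "epg b \<theta> = (\<integral>\<omega>. qform (pgw \<theta>) b 0 \<omega> \<partial>M)"

lemma abs_epg_le: "b \<ge> 1 \<Longrightarrow> \<bar>epg b \<theta>\<bar> \<le> K\<gamma>"
  unfolding epg_def by (rule abs_expectation_qform_le[OF abs_pgw_le])

lemma epg_eq: "epg b \<theta> = (\<Sum>h\<in>{- int b..int b}. \<gamma> h * cos (of_int h * \<theta>) * card (overlap b h)) / (2 * pi * b)"
proof -
  have "(\<Sum>s=1..b. \<Sum>s'=1..b. pgw \<theta> s s' * \<gamma> (int s' - int s)) =
     (\<Sum>s=1..b. \<Sum>s'=1..b. (\<lambda>s h. \<gamma> h * cos (of_int h * \<theta>)) s (int s' - int s)) / (2 * pi)"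
    unfolding sum_divide_distrib
  proof (intro sum.cong refl)
    fix s s' :: nat
    have "\<theta> * (real s - real s') = - (of_int (int s' - int s) * \<theta>)" by (simp add: algebra_simps)
    then have "pgw \<theta> s s' = cos (of_int (int s' - int s) * \<theta>) / (2 * pi)"
      unfolding pgw_def by (simp only: cos_minus)
    then show "pgw \<theta> s s' * \<gamma> (int s' - int s) =
        (\<lambda>s h. \<gamma> h * cos (of_int h * \<theta>)) s (int s' - int s) / (2 * pi)" by simp
  qed
  moreover have "(\<Sum>s=1..b. \<Sum>s'=1..b. (\<lambda>s h. \<gamma> h * cos (of_int h * \<theta>)) s (int s' - int s)) =
      (\<Sum>h\<in>{- int b..int b}. \<Sum>s\<in>overlap b h. \<gamma> h * cos (of_int h * \<theta>))"
    by (rule sum_pairs_by_lag)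
  ultimately show ?thesis
    unfolding epg_def expectation_qform by (simp only:) (simp add: mult.commute)
qed

text \<open>In the expectation each lag \<open>h\<close> is weighted by the fraction of available
  pairs, which differs from 1 by at most \<open>\<bar>h\<bar> / b\<close>; the weighted summability
  of the autocovariances bounds the total.\<close>

lemma epg_bias:
  assumes b: "b \<ge> 1"
  shows "\<bar>epg b \<theta> - f \<theta>\<bar> \<le> K\<gamma> / b"
proof -
  define H where "H = {- int b..int b}"
  define g where "g h = \<gamma> h * cos (of_int h * \<theta>)" for h
  define c where "c h = (if h \<in> H then real (card (overlap b h)) else 0)" for h
  have g_sum: "g summable_on UNIV" unfolding g_def by (rule summable_autocov_cos)
  have g_le: "\<bar>g h\<bar> \<le> \<bar>\<gamma> h\<bar>" for h by (simp add: g_def abs_mult mult_left_le)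
  have c_le: "0 \<le> real b - c h" "real b - c h \<le> \<bar>real_of_int h\<bar>" for h
    using card_overlap_le[of b h] card_overlap_ge[of b h] by (auto simp: c_def H_def)
  have e: "2 * pi * b * epg b \<theta> = (\<Sum>\<^sub>\<infinity>h. c h * g h)"
  proof -
    have "(\<Sum>\<^sub>\<infinity>h. c h * g h) = (\<Sum>\<^sub>\<infinity>h\<in>H. c h * g h)"
      by (rule infsum_cong_neutral) (auto simp: c_def)
    then show ?thesis using b by (simp add: epg_eq H_def c_def g_def mult.commute)
  qed
  have c_sum: "(\<lambda>h. c h * g h) summable_on UNIV"
  proof (rule summable_on_dominated(1))
    show "(\<lambda>h. real b * \<bar>\<gamma> h\<bar>) summable_on UNIV" using summable_autocov(2) by (rule summable_on_cmult_right)
    show "\<bar>c h * g h\<bar> \<le> real b * \<bar>\<gamma> h\<bar>" for h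
      unfolding abs_mult using c_le[of h] g_le[of h] by (intro mult_mono) (auto simp: c_def)
  qed
  have "2 * pi * b * (epg b \<theta> - f \<theta>) = (\<Sum>\<^sub>\<infinity>h. c h * g h) - b * (\<Sum>\<^sub>\<infinity>h. g h)"
    by (simp add: right_diff_distrib e spectral_density_eq g_def)
  also have "\<dots> = (\<Sum>\<^sub>\<infinity>h. c h * g h - b * g h)"
    using g_sum c_sum by (subst infsum_diff_real) (auto simp: infsum_cmult_right' intro: summable_on_cmult_right)
  also have "\<bar>\<dots>\<bar> \<le> (\<Sum>\<^sub>\<infinity>h. \<bar>real_of_int h\<bar> * \<bar>\<gamma> h\<bar>)"
  proof (rule abs_infsum_le[OF summable_autocov(1)])
    fix h
    have "\<bar>c h * g h - b * g h\<bar> = (real b - c h) * \<bar>g h\<bar>"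
      using c_le(1)[of h] by (simp add: left_diff_distrib[symmetric] abs_mult)
    also have "\<dots> \<le> \<bar>real_of_int h\<bar> * \<bar>\<gamma> h\<bar>" using c_le[of h] g_le[of h] by (intro mult_mono) auto
    finally show "\<bar>c h * g h - b * g h\<bar> \<le> \<bar>real_of_int h\<bar> * \<bar>\<gamma> h\<bar>" .
  qed
  also have "\<dots> \<le> K\<gamma>" by (rule infsum_autocov_le)
  finally have "2 * pi * b * \<bar>epg b \<theta> - f \<theta>\<bar> \<le> K\<gamma>" by (simp add: abs_mult)
  moreover have "b * \<bar>epg b \<theta> - f \<theta>\<bar> \<le> 2 * pi * b * \<bar>epg b \<theta> - f \<theta>\<bar>"
    using pi_gt3 mult_right_mono[of 1 "2 * pi" "real b"] by (intro mult_right_mono) auto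
  ultimately have "b * \<bar>epg b \<theta> - f \<theta>\<bar> \<le> K\<gamma>" by linarith
  then show ?thesis using b by (simp add: pos_le_divide_eq mult.commute)
qed

text \<open>With \<open>sisum\<close>, the real and imaginary parts of the double sum of
  \<open>\<gamma> (u - s)\<close> times the exponential with phase \<theta> s - \<mu> u: up to
  normalisation, the covariance of the Fourier transforms of a block at two frequencies.\<close>

definition cosum :: "nat \<Rightarrow> real \<Rightarrow> real \<Rightarrow> real" where
  "cosum b \<theta> \<mu> = (\<Sum>s=1..b. \<Sum>u=1..b. cos (\<theta> * s - \<mu> * u) * \<gamma> (int u - int s))"
definition sisum :: "nat \<Rightarrow> real \<Rightarrow> real \<Rightarrow> real" where
  "sisum b \<theta> \<mu> = (\<Sum>s=1..b. \<Sum>u=1..b. sin (\<theta> * s - \<mu> * u) * \<gamma> (int u - int s))"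

text \<open>Expanding the cosines of differences separates the variables and produces the squares of
  four sums \<open>G\<close>; both pairings give the same value. Twice their total is regrouped by 2
  x^2 + 2 y^2 = (x + y)^2 + (x - y)^2.\<close>

lemma gaussian_part:
  "(\<Sum>s=1..b. \<Sum>s'=1..b. \<Sum>u=1..b. \<Sum>u'=1..b. cos (\<theta> * (real s - real s')) * cos (\<mu> * (real u - real u')) *
      (\<gamma> (int u - int s) * \<gamma> (int u' - int s') + \<gamma> (int u' - int s) * \<gamma> (int u - int s'))) =
   (cosum b \<theta> \<mu>)\<^sup>2 + (cosum b \<theta> (- \<mu>))\<^sup>2 + (sisum b \<theta> \<mu>)\<^sup>2 + (sisum b \<theta> (- \<mu>))\<^sup>2"
proof -
  define G where "G p q = (\<Sum>s=1..b. \<Sum>u=1..b. p (\<theta> * s) * q (\<mu> * u) * \<gamma> (int u - int s))"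
    for p q :: "real \<Rightarrow> real"
  have GG: "(G p q)\<^sup>2 = (\<Sum>s=1..b. \<Sum>s'=1..b. \<Sum>u=1..b. \<Sum>u'=1..b.
      p (\<theta> * s) * q (\<mu> * u) * p (\<theta> * s') * q (\<mu> * u') * (\<gamma> (int u - int s) * \<gamma> (int u' - int s')))" for p q
  proof -
    have "(G p q)\<^sup>2 = (\<Sum>s=1..b. \<Sum>u=1..b. \<Sum>s'=1..b. \<Sum>u'=1..b.
      p (\<theta> * s) * q (\<mu> * u) * \<gamma> (int u - int s) * (p (\<theta> * s') * q (\<mu> * u') * \<gamma> (int u' - int s')))"
      unfolding G_def power2_eq_square by (rule sum2_mult_sum2)
    also have "\<dots> = (\<Sum>s=1..b. \<Sum>s'=1..b. \<Sum>u=1..b. \<Sum>u'=1..b.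
      p (\<theta> * s) * q (\<mu> * u) * \<gamma> (int u - int s) * (p (\<theta> * s') * q (\<mu> * u') * \<gamma> (int u' - int s')))"
      by (rule sum.cong[OF refl], rule sum.swap)
    finally show ?thesis by (simp add: mult_ac)
  qed
  define A where "A = (\<Sum>s=1..b. \<Sum>s'=1..b. \<Sum>u=1..b. \<Sum>u'=1..b.
      cos (\<theta> * (real s - real s')) * cos (\<mu> * (real u - real u')) * (\<gamma> (int u - int s) * \<gamma> (int u' - int s')))"
  have A: "A = (G cos cos)\<^sup>2 + (G cos sin)\<^sup>2 + (G sin cos)\<^sup>2 + (G sin sin)\<^sup>2"
    unfolding GG A_def sum.distrib[symmetric]
    by (intro sum.cong refl) (simp add: right_diff_distrib cos_diff algebra_simps)
  have B: "A = (\<Sum>s=1..b. \<Sum>s'=1..b. \<Sum>u=1..b. \<Sum>u'=1..b.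
      cos (\<theta> * (real s - real s')) * cos (\<mu> * (real u - real u')) * (\<gamma> (int u' - int s) * \<gamma> (int u - int s')))"
  proof -
    have "A = (\<Sum>s=1..b. \<Sum>s'=1..b. \<Sum>u=1..b. \<Sum>u'=1..b.
      cos (\<theta> * (real s - real s')) * cos (\<mu> * (real u' - real u)) * (\<gamma> (int u' - int s) * \<gamma> (int u - int s')))"
      unfolding A_def by (rule sum.cong[OF refl], rule sum.cong[OF refl], rule sum.swap)
    also have "\<dots> = (\<Sum>s=1..b. \<Sum>s'=1..b. \<Sum>u=1..b. \<Sum>u'=1..b.
      cos (\<theta> * (real s - real s')) * cos (\<mu> * (real u - real u')) * (\<gamma> (int u' - int s) * \<gamma> (int u - int s')))"
      by (intro sum.cong refl arg_cong2[where f = "(*)"]) (metis cos_minus minus_diff_eq mult_minus_right)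
    finally show ?thesis .
  qed
  have lhs: "(\<Sum>s=1..b. \<Sum>s'=1..b. \<Sum>u=1..b. \<Sum>u'=1..b. cos (\<theta> * (real s - real s')) * cos (\<mu> * (real u - real u')) *
      (\<gamma> (int u - int s) * \<gamma> (int u' - int s') + \<gamma> (int u' - int s) * \<gamma> (int u - int s'))) = A + A"
    by (subst B) (simp add: A_def distrib_left sum.distrib)
  have eqs: "cosum b \<theta> \<mu> = G cos cos + G sin sin" "cosum b \<theta> (- \<mu>) = G cos cos - G sin sin"
    "sisum b \<theta> \<mu> = G sin cos - G cos sin" "sisum b \<theta> (- \<mu>) = G sin cos + G cos sin"
    unfolding cosum_def sisum_def G_def sum.distrib[symmetric] sum_subtractf[symmetric]
    by (simp_all add: cos_diff sin_diff cos_add sin_add algebra_simps)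
  show ?thesis unfolding lhs A eqs by (simp add: power2_eq_square algebra_simps)
qed

text \<open>At a fixed lag the sum over the whole block vanishes by orthogonality. The sum over the
  overlap is therefore minus the sum over the missing times, at most \<open>\<bar>h\<bar>\<close> in
  number, which makes the bound independent of \<open>b\<close>.\<close>

lemma abs_lag_sum_le:
  assumes b: "b \<ge> 1" and d: "(\<theta> - \<mu>) * real b = 2 * pi * of_int k" "\<not> int b dvd k"
  shows "\<bar>\<Sum>s=1..b. \<Sum>u=1..b. cos (\<theta> * s - \<mu> * u + c) * \<gamma> (int u - int s)\<bar> \<le> K\<gamma>"
proof -
  have "(\<Sum>s=1..b. \<Sum>u=1..b. cos (\<theta> * s - \<mu> * u + c) * \<gamma> (int u - int s)) =
    (\<Sum>s=1..b. \<Sum>u=1..b. (\<lambda>s h. cos ((\<theta> - \<mu>) * s + (c - \<mu> * of_int h)) * \<gamma> h) s (int u - int s))"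
    by (intro sum.cong refl arg_cong2[where f = "(*)"] arg_cong[where f = cos]) (simp_all add: algebra_simps)
  also have "\<dots> = (\<Sum>h\<in>{- int b..int b}. \<Sum>s\<in>overlap b h. cos ((\<theta> - \<mu>) * s + (c - \<mu> * of_int h)) * \<gamma> h)"
    by (rule sum_pairs_by_lag)
  also have "\<dots> = (\<Sum>h\<in>{- int b..int b}. (\<Sum>s\<in>overlap b h. cos ((\<theta> - \<mu>) * s + (c - \<mu> * of_int h))) * \<gamma> h)"
    by (simp add: sum_distrib_right)
  also have "\<bar>\<dots>\<bar> \<le> (\<Sum>h\<in>{- int b..int b}. (1 + \<bar>real_of_int h\<bar>) * \<bar>\<gamma> h\<bar>)"
  proof (intro order_trans[OF sum_abs] sum_mono)
    fix h assume "h \<in> {- int b..int b}"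
    let ?g = "\<lambda>s. cos ((\<theta> - \<mu>) * real s + (c - \<mu> * of_int h))"
    have "(\<Sum>s=1..b. ?g s) = 0" by (rule sum_cos_frequency_eq_0[OF d b])
    moreover have "(\<Sum>s=1..b. ?g s) = (\<Sum>s\<in>{1..b} - overlap b h. ?g s) + (\<Sum>s\<in>overlap b h. ?g s)"
      by (rule sum.subset_diff[OF overlap_subset]) simp
    ultimately have "(\<Sum>s\<in>overlap b h. ?g s) = - (\<Sum>s\<in>{1..b} - overlap b h. ?g s)" by simp
    then have "\<bar>\<Sum>s\<in>overlap b h. ?g s\<bar> = \<bar>\<Sum>s\<in>{1..b} - overlap b h. ?g s\<bar>" by simp
    also have "\<dots> \<le> (\<Sum>s\<in>{1..b} - overlap b h. 1)"
      by (intro order_trans[OF sum_abs] sum_mono) simp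
    also have "\<dots> \<le> \<bar>real_of_int h\<bar>" using card_complement_overlap[of b h] by simp
    finally have "\<bar>\<Sum>s\<in>overlap b h. ?g s\<bar> \<le> 1 + \<bar>real_of_int h\<bar>" by simp
    then show "\<bar>(\<Sum>s\<in>overlap b h. ?g s) * \<gamma> h\<bar> \<le> (1 + \<bar>real_of_int h\<bar>) * \<bar>\<gamma> h\<bar>"
      unfolding abs_mult by (rule mult_right_mono) simp
  qed
  also have "\<dots> \<le> K\<gamma>" by (rule sum_weighted_autocov_le) simp
  finally show ?thesis .
qed

lemma
  assumes b: "b \<ge> 1" and d: "(\<theta> - \<mu>) * real b = 2 * pi * of_int k" "\<not> int b dvd k"
  shows abs_cosum_le: "\<bar>cosum b \<theta> \<mu>\<bar> \<le> K\<gamma>" and abs_sisum_le: "\<bar>sisum b \<theta> \<mu>\<bar> \<le> K\<gamma>"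
proof -
  show "\<bar>cosum b \<theta> \<mu>\<bar> \<le> K\<gamma>" using abs_lag_sum_le[OF assms, of 0] by (simp add: cosum_def)
  have "sin x = cos (x + - (pi / 2))" for x unfolding cos_add by simp
  then show "\<bar>sisum b \<theta> \<mu>\<bar> \<le> K\<gamma>" using abs_lag_sum_le[OF assms, of "- (pi / 2)"] unfolding sisum_def by simp
qed

text \<open>The true covariance of the periodograms of one block at two frequencies;
  \<open>kap4\<close> is its part due to fourth order cumulants.\<close>

definition kap :: "nat \<Rightarrow> real \<Rightarrow> real \<Rightarrow> real" where
  "kap b \<theta> \<mu> = (\<integral>\<omega>. qform (pgw \<theta>) b 0 \<omega> * qform (pgw \<mu>) b 0 \<omega> \<partial>M) - epg b \<theta> * epg b \<mu>"

definition kap4 :: "nat \<Rightarrow> real \<Rightarrow> real \<Rightarrow> real" where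
  "kap4 b \<theta> \<mu> = (\<Sum>s=1..b. \<Sum>s'=1..b. \<Sum>u=1..b. \<Sum>u'=1..b. pgw \<theta> s s' * pgw \<mu> u u' *
      c4 (int s' - int s) (int u - int s) (int u' - int s)) / b\<^sup>2"

lemma kap_eq:
  "kap b \<theta> \<mu> = kap4 b \<theta> \<mu> +
     ((cosum b \<theta> \<mu>)\<^sup>2 + (cosum b \<theta> (- \<mu>))\<^sup>2 + (sisum b \<theta> \<mu>)\<^sup>2 + (sisum b \<theta> (- \<mu>))\<^sup>2) / (2 * pi * b)\<^sup>2"
proof -
  have "kap b \<theta> \<mu> = kap4 b \<theta> \<mu> + (\<Sum>s=1..b. \<Sum>s'=1..b. \<Sum>u=1..b. \<Sum>u'=1..b. pgw \<theta> s s' * pgw \<mu> u u' *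
      (\<gamma> (int u - int s) * \<gamma> (int u' - int s') + \<gamma> (int u' - int s) * \<gamma> (int u - int s'))) / b\<^sup>2"
    using covariance_qform[of "pgw \<theta>" b 0 "pgw \<mu>" 0]
    by (simp add: kap_def epg_def kap4_def add.assoc distrib_left sum.distrib add_divide_distrib)
  also have "(\<Sum>s=1..b. \<Sum>s'=1..b. \<Sum>u=1..b. \<Sum>u'=1..b. pgw \<theta> s s' * pgw \<mu> u u' *
      (\<gamma> (int u - int s) * \<gamma> (int u' - int s') + \<gamma> (int u' - int s) * \<gamma> (int u - int s'))) =
    (\<Sum>s=1..b. \<Sum>s'=1..b. \<Sum>u=1..b. \<Sum>u'=1..b. cos (\<theta> * (real s - real s')) * cos (\<mu> * (real u - real u')) *
      (\<gamma> (int u - int s) * \<gamma> (int u' - int s') + \<gamma> (int u' - int s) * \<gamma> (int u - int s'))) / (2 * pi)\<^sup>2"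
    unfolding sum_divide_distrib by (intro sum.cong refl) (simp add: pgw_def power2_eq_square)
  finally show ?thesis unfolding gaussian_part by (simp add: power_mult_distrib)
qed

lemma abs_kap_le: "b \<ge> 1 \<Longrightarrow> \<bar>kap b \<theta> \<mu>\<bar> \<le> cov_const"
  unfolding kap_def epg_def by (rule abs_covariance_qform_le_const[OF abs_pgw_le abs_pgw_le])

text \<open>One time of the quadruple is free, the other three are summed through their lags:
  \<open>b * K4\<close> before division by \<open>b\<^sup>2\<close>.\<close>

lemma abs_kap4_le:
  assumes b: "b \<ge> 1"
  shows "\<bar>kap4 b \<theta> \<mu>\<bar> \<le> K4 / b"
proof -
  have "\<bar>\<Sum>s=1..b. \<Sum>s'=1..b. \<Sum>u=1..b. \<Sum>u'=1..b. pgw \<theta> s s' * pgw \<mu> u u' *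
      c4 (int s' - int s) (int u - int s) (int u' - int s)\<bar> \<le>
    (\<Sum>s=1..b. \<Sum>s'=1..b. \<Sum>u=1..b. \<Sum>u'=1..b. \<bar>c4 (int s' - int s) (int u - int s) (int u' - int s)\<bar>)"
  proof (intro order_trans[OF sum_abs] sum_mono)
    fix s s' u u'
    have "\<bar>pgw \<theta> s s' * pgw \<mu> u u'\<bar> \<le> 1 * 1" unfolding abs_mult by (intro mult_mono abs_pgw_le) auto
    then show "\<bar>pgw \<theta> s s' * pgw \<mu> u u' * c4 (int s' - int s) (int u - int s) (int u' - int s)\<bar>
      \<le> \<bar>c4 (int s' - int s) (int u - int s) (int u' - int s)\<bar>"
      unfolding abs_mult[of "_ * _"] by (intro mult_left_le_one_le) auto
  qed
  also have "\<dots> \<le> (\<Sum>s=1..b. K4)"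
  proof (rule sum_mono)
    fix s
    have "(\<Sum>s'=1..b. \<Sum>u=1..b. \<Sum>u'=1..b. \<bar>c4 (int s' - int s) (int u - int s) (int u' - int s)\<bar>) =
      (\<Sum>x\<in>{1..b} \<times> {1..b} \<times> {1..b}. \<bar>c4 (int (fst x) - int s) (int (fst (snd x)) - int s)
         (int (snd (snd x)) - int s)\<bar>)"
      by (simp add: sum.cartesian_product split_def)
    also have "\<dots> \<le> K4" by (rule sum_c4_le) (auto simp: inj_on_def)
    finally show "(\<Sum>s'=1..b. \<Sum>u=1..b. \<Sum>u'=1..b. \<bar>c4 (int s' - int s) (int u - int s) (int u' - int s)\<bar>) \<le> K4" .
  qed
  finally have "\<bar>\<Sum>s=1..b. \<Sum>s'=1..b. \<Sum>u=1..b. \<Sum>u'=1..b. pgw \<theta> s s' * pgw \<mu> u u' *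
      c4 (int s' - int s) (int u - int s) (int u' - int s)\<bar> \<le> b * K4" by simp
  then have "\<bar>kap4 b \<theta> \<mu>\<bar> \<le> (b * K4) / b\<^sup>2"
    unfolding kap4_def abs_divide by (simp add: divide_right_mono)
  then show ?thesis using b by (simp add: power2_eq_square)
qed

section \<open>Limit of the fourth order part\<close>

definition overlap3 :: "nat \<Rightarrow> int \<times> int \<times> int \<Rightarrow> nat set" where
  "overlap3 b h = overlap b (fst h) \<inter> overlap b (fst (snd h)) \<inter> overlap b (snd (snd h))"

lemma finite_overlap3: "finite (overlap3 b h)" by (simp add: overlap3_def finite_overlap)

lemma card_overlap3_le: "card (overlap3 b h) \<le> b"
proof -
  have "overlap3 b h \<subseteq> {1..b}" using overlap_subset by (auto simp: overlap3_def)
  then show ?thesis using card_mono[of "{1..b}" "overlap3 b h"] by simp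
qed

lemma card_overlap3_ge:
  "real b - real (card (overlap3 b h)) \<le> \<bar>real_of_int (fst h)\<bar> + \<bar>real_of_int (fst (snd h))\<bar> + \<bar>real_of_int (snd (snd h))\<bar>"
proof -
  have sub: "overlap3 b h \<subseteq> {1..b}" using overlap_subset by (auto simp: overlap3_def)
  have "{1..b} - overlap3 b h = ({1..b} - overlap b (fst h)) \<union> ({1..b} - overlap b (fst (snd h))) \<union> ({1..b} - overlap b (snd (snd h)))"
    by (auto simp: overlap3_def)
  then have "card ({1..b} - overlap3 b h) \<le> card ({1..b} - overlap b (fst h)) + card ({1..b} - overlap b (fst (snd h)))
      + card ({1..b} - overlap b (snd (snd h)))"
    by (metis (no_types, lifting) add_le_mono1 card_Un_le order_trans)
  also have "\<dots> \<le> nat \<bar>fst h\<bar> + nat \<bar>fst (snd h)\<bar> + nat \<bar>snd (snd h)\<bar>"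
    by (intro add_mono card_complement_overlap)
  finally have "real (card ({1..b} - overlap3 b h)) \<le> \<bar>real_of_int (fst h)\<bar> + \<bar>real_of_int (fst (snd h))\<bar> + \<bar>real_of_int (snd (snd h))\<bar>"
    by linarith
  moreover have "card ({1..b} - overlap3 b h) = b - card (overlap3 b h)"
    using card_Diff_subset[OF finite_overlap3 sub] by simp
  ultimately show ?thesis by linarith
qed

definition lag_box :: "nat \<Rightarrow> (int \<times> int \<times> int) set" where
  "lag_box b = {- int b..int b} \<times> {- int b..int b} \<times> {- int b..int b}"

lemma finite_lag_box: "finite (lag_box b)" by (simp add: lag_box_def)

lemma overlap3_outside: "h \<notin> lag_box b \<Longrightarrow> overlap3 b h = {}"
  by (cases h) (auto simp: lag_box_def overlap3_def overlap_def)

lemma sum_quadruples_by_lag: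
  "(\<Sum>s=1..b. \<Sum>s'=1..b. \<Sum>u=1..b. \<Sum>u'=1..b. G (int s' - int s, int u - int s, int u' - int s)) =
     (\<Sum>h\<in>lag_box b. card (overlap3 b h) * G h)" for G :: "int \<times> int \<times> int \<Rightarrow> real"
proof -
  have "(\<Sum>s=1..b. \<Sum>s'=1..b. \<Sum>u=1..b. \<Sum>u'=1..b. G (int s' - int s, int u - int s, int u' - int s)) =
    (\<Sum>(s, s', u, u')\<in>{1..b} \<times> {1..b} \<times> {1..b} \<times> {1..b}. G (int s' - int s, int u - int s, int u' - int s))"
    by (simp add: sum.cartesian_product split_def)
  also have "\<dots> = (\<Sum>(h, s)\<in>Sigma (lag_box b) (overlap3 b). G h)"
    by (rule sum.reindex_bij_witness[where
          i = "\<lambda>((h1, h2, h3), s). (s, nat (int s + h1), nat (int s + h2), nat (int s + h3))" and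
          j = "\<lambda>(s, s', u, u'). ((int s' - int s, int u - int s, int u' - int s), s)"])
       (auto simp: overlap_def overlap3_def lag_box_def)
  also have "\<dots> = (\<Sum>h\<in>lag_box b. \<Sum>s\<in>overlap3 b h. G h)"
    by (subst sum.Sigma) (auto simp: finite_overlap3 finite_lag_box)
  finally show ?thesis by simp
qed

definition c4' :: "int \<times> int \<times> int \<Rightarrow> real" where "c4' h = c4 (fst h) (fst (snd h)) (snd (snd h))"

lemma summable_c4': "(\<lambda>h. \<bar>c4' h\<bar>) summable_on UNIV"
  using summable_c4 by (simp add: c4'_def split_def)

lemma kap4_eq: "kap4 b \<theta> \<mu> = (\<Sum>h\<in>lag_box b. card (overlap3 b h) *
     (c4' h * cos (of_int (fst h) * \<theta>) * cos (of_int (fst (snd h) - snd (snd h)) * \<mu>))) / (2 * pi * b)\<^sup>2"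
proof -
  define G where "G h = c4' h * cos (of_int (fst h) * \<theta>) * cos (of_int (fst (snd h) - snd (snd h)) * \<mu>) / (2 * pi)\<^sup>2" for h
  have "pgw \<theta> s s' * pgw \<mu> u u' * c4 (int s' - int s) (int u - int s) (int u' - int s) =
      G (int s' - int s, int u - int s, int u' - int s)" for s s' u u' :: nat
  proof -
    have "\<theta> * (real s - real s') = - (of_int (int s' - int s) * \<theta>)" by (simp add: algebra_simps)
    then have 1: "pgw \<theta> s s' = cos (of_int (int s' - int s) * \<theta>) / (2 * pi)"
      unfolding pgw_def by (simp only: cos_minus)
    have "\<mu> * (real u - real u') = of_int ((int u - int s) - (int u' - int s)) * \<mu>" by (simp add: algebra_simps)
    then have 2: "pgw \<mu> u u' = cos (of_int ((int u - int s) - (int u' - int s)) * \<mu>) / (2 * pi)"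
      unfolding pgw_def by (simp only:)
    show ?thesis unfolding 1 2 G_def c4'_def by (simp add: power2_eq_square)
  qed
  then have "kap4 b \<theta> \<mu> = (\<Sum>h\<in>lag_box b. card (overlap3 b h) * G h) / b\<^sup>2"
    unfolding kap4_def sum_quadruples_by_lag[symmetric] by (simp only:)
  then show ?thesis by (simp add: G_def sum_divide_distrib power_mult_distrib)
qed

text \<open>At a fixed lag triple the dependence on the two frequencies factorises, so the double
  sum over the grid is a product of two Riemann sums. Outside \<open>lag_box\<close> the overlap is
  empty, which allows the sum over all lag triples.\<close>

lemma weighted_kap4_sum_eq:
  assumes b: "b \<ge> 1"
  shows "4 * pi\<^sup>2 / b * (\<Sum>j\<in>GG b. \<Sum>j'\<in>GG b. \<psi> (ffreq j b) * \<psi> (ffreq j' b) * kap4 b (ffreq j b) (ffreq j' b)) =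
     (\<Sum>\<^sub>\<infinity>h. c4' h * (card (overlap3 b h) / b) * riemann_sum b (\<lambda>\<theta>. \<psi> \<theta> * cos (of_int (fst h) * \<theta>)) *
        riemann_sum b (\<lambda>\<theta>. \<psi> \<theta> * cos (of_int (fst (snd h) - snd (snd h)) * \<theta>)) / (4 * pi\<^sup>2))"
proof -
  define p where "p h j = \<psi> (ffreq j b) * cos (of_int (fst h) * ffreq j b)" for h :: "int \<times> int \<times> int" and j
  define q where "q h j = \<psi> (ffreq j b) * cos (of_int (fst (snd h) - snd (snd h)) * ffreq j b)" for h :: "int \<times> int \<times> int" and j
  have "(\<Sum>j\<in>GG b. \<Sum>j'\<in>GG b. \<psi> (ffreq j b) * \<psi> (ffreq j' b) * kap4 b (ffreq j b) (ffreq j' b)) =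
     (\<Sum>j\<in>GG b. \<Sum>j'\<in>GG b. \<Sum>h\<in>lag_box b. card (overlap3 b h) * c4' h / (2 * pi * b)\<^sup>2 * (p h j * q h j'))"
    unfolding kap4_eq by (simp add: sum_distrib_left sum_divide_distrib p_def q_def mult_ac)
  also have "\<dots> = (\<Sum>h\<in>lag_box b. \<Sum>j\<in>GG b. \<Sum>j'\<in>GG b. card (overlap3 b h) * c4' h / (2 * pi * b)\<^sup>2 * (p h j * q h j'))"
    by (rule sum_swap3)
  also have "\<dots> = (\<Sum>h\<in>lag_box b. card (overlap3 b h) * c4' h / (2 * pi * b)\<^sup>2 * ((\<Sum>j\<in>GG b. p h j) * (\<Sum>j'\<in>GG b. q h j')))"
    unfolding sum_product by (intro sum.cong refl) (simp only: sum_distrib_left)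
  finally have prods: "(\<Sum>j\<in>GG b. \<Sum>j'\<in>GG b. \<psi> (ffreq j b) * \<psi> (ffreq j' b) * kap4 b (ffreq j b) (ffreq j' b)) =
     (\<Sum>h\<in>lag_box b. card (overlap3 b h) * c4' h / (2 * pi * b)\<^sup>2 * ((\<Sum>j\<in>GG b. p h j) * (\<Sum>j'\<in>GG b. q h j')))" .
  have eq: "4 * pi\<^sup>2 / b * (\<Sum>j\<in>GG b. \<Sum>j'\<in>GG b. \<psi> (ffreq j b) * \<psi> (ffreq j' b) * kap4 b (ffreq j b) (ffreq j' b)) =
     (\<Sum>h\<in>lag_box b. c4' h * (card (overlap3 b h) / b) * riemann_sum b (\<lambda>\<theta>. \<psi> \<theta> * cos (of_int (fst h) * \<theta>)) *
        riemann_sum b (\<lambda>\<theta>. \<psi> \<theta> * cos (of_int (fst (snd h) - snd (snd h)) * \<theta>)) / (4 * pi\<^sup>2))"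
    unfolding prods
  proof (subst sum_distrib_left, intro sum.cong refl)
    fix h
    have P: "(\<Sum>j\<in>GG b. p h j) = riemann_sum b (\<lambda>\<theta>. \<psi> \<theta> * cos (of_int (fst h) * \<theta>)) * b / (2 * pi)"
      "(\<Sum>j\<in>GG b. q h j) = riemann_sum b (\<lambda>\<theta>. \<psi> \<theta> * cos (of_int (fst (snd h) - snd (snd h)) * \<theta>)) * b / (2 * pi)"
      using b by (simp_all add: riemann_sum_def p_def q_def)
    show "4 * pi\<^sup>2 / b * (card (overlap3 b h) * c4' h / (2 * pi * b)\<^sup>2 * ((\<Sum>j\<in>GG b. p h j) * (\<Sum>j'\<in>GG b. q h j'))) =
      c4' h * (card (overlap3 b h) / b) * riemann_sum b (\<lambda>\<theta>. \<psi> \<theta> * cos (of_int (fst h) * \<theta>)) *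
        riemann_sum b (\<lambda>\<theta>. \<psi> \<theta> * cos (of_int (fst (snd h) - snd (snd h)) * \<theta>)) / (4 * pi\<^sup>2)"
      unfolding P using b by (simp add: power2_eq_square field_simps)
  qed
  show ?thesis
    unfolding eq by (subst infsum_finite[OF finite_lag_box, symmetric], rule infsum_cong_neutral) (auto simp: overlap3_outside)
qed

text \<open>Exchanging the last two lags leaves the cumulant unchanged and reverses the sign of the
  second phase. The series with phase A + B thus equals the one with A - B, and their mean has the
  product of cosines.\<close>

lemma Re_spectral_density4:
  "Re (spectral_density4 M X \<theta> \<mu> (- \<mu>)) =
     (\<Sum>\<^sub>\<infinity>h. c4' h * (cos (of_int (fst h) * \<theta>) * cos (of_int (fst (snd h) - snd (snd h)) * \<mu>))) / (2 * pi) ^ 3"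
proof -
  define A where "A h = of_int (fst h) * \<theta>" for h :: "int \<times> int \<times> int"
  define B where "B h = of_int (fst (snd h) - snd (snd h)) * \<mu>" for h :: "int \<times> int \<times> int"
  have le: "\<bar>c4' h * z\<bar> \<le> \<bar>c4' h\<bar>" if "\<bar>z\<bar> \<le> 1" for h z
    using that by (simp add: abs_mult mult_left_le)
  have sm: "(\<lambda>h. c4' h * z h) summable_on UNIV" if "\<And>h. \<bar>z h\<bar> \<le> 1" for z
    by (rule summable_on_dominated(1)[OF summable_c4']) (use le that in auto)
  have "(\<lambda>h. complex_of_real (c4' h) * cis (- (A h + B h))) summable_on UNIV"
    by (rule abs_summable_summable) (use summable_c4' in \<open>simp add: norm_mult\<close>)
  moreover have "spectral_density4 M X \<theta> \<mu> (- \<mu>) =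
      (\<Sum>\<^sub>\<infinity>h. complex_of_real (c4' h) * cis (- (A h + B h))) / complex_of_real ((2 * pi) ^ 3)"
    unfolding spectral_density4_def
    by (intro arg_cong2[where f = "(/)"] infsum_cong) (auto simp: c4'_def c4_def A_def B_def algebra_simps)
  moreover have "Re (complex_of_real (c4' h) * cis (- (A h + B h))) = c4' h * cos (A h + B h)" for h
    by (simp del: minus_add_distrib)
  ultimately have "Re (spectral_density4 M X \<theta> \<mu> (- \<mu>)) = (\<Sum>\<^sub>\<infinity>h. c4' h * cos (A h + B h)) / (2 * pi) ^ 3"
    by (simp only: Re_divide_of_real infsum_Re[symmetric])
  moreover have "(\<Sum>\<^sub>\<infinity>h. c4' h * cos (A h + B h)) = (\<Sum>\<^sub>\<infinity>h. c4' h * cos (A h - B h))"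
    by (rule infsum_reindex_bij_witness[where i = "\<lambda>h. (fst h, snd (snd h), fst (snd h))" and j = "\<lambda>h. (fst h, snd (snd h), fst (snd h))"])
       (auto simp: c4'_def A_def B_def c4_swap algebra_simps)
  moreover have "(\<Sum>\<^sub>\<infinity>h. c4' h * cos (A h + B h)) + (\<Sum>\<^sub>\<infinity>h. c4' h * cos (A h - B h)) =
      2 * (\<Sum>\<^sub>\<infinity>h. c4' h * (cos (A h) * cos (B h)))"
  proof -
    have "(\<Sum>\<^sub>\<infinity>h. c4' h * cos (A h + B h)) + (\<Sum>\<^sub>\<infinity>h. c4' h * cos (A h - B h)) =
        (\<Sum>\<^sub>\<infinity>h. c4' h * cos (A h + B h) + c4' h * cos (A h - B h))"
      by (intro infsum_add[symmetric] sm) simp_all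
    also have "\<dots> = (\<Sum>\<^sub>\<infinity>h. 2 * (c4' h * (cos (A h) * cos (B h))))"
      by (rule infsum_cong) (simp add: cos_add cos_diff algebra_simps)
    finally show ?thesis by (simp only: infsum_cmult_right')
  qed
  ultimately show ?thesis by (simp add: A_def B_def)
qed

text \<open>The same series as for the weighted grid sums, with cosine coefficients of the weight in
  place of Riemann sums. It depends on the weight through these coefficients only.\<close>

lemma var_part2_eq:
  assumes \<psi>: "bv_measurable \<psi>"
  shows "var_part2 (spectral_density4 M X) \<psi> =
    (\<Sum>\<^sub>\<infinity>h. c4' h * (LBINT \<theta>:{-pi..pi}. \<psi> \<theta> * cos (of_int (fst h) * \<theta>)) *
        (LBINT \<theta>:{-pi..pi}. \<psi> \<theta> * cos (of_int (fst (snd h) - snd (snd h)) * \<theta>))) / (4 * pi\<^sup>2)"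
proof -
  define C where "C k = (LBINT \<theta>:{-pi..pi}. \<psi> \<theta> * cos (of_int k * \<theta>))" for k :: int
  define P where "P = (2 * pi) ^ 3"
  have cosm: "(\<lambda>\<theta> :: real. cos (of_int k * \<theta>)) \<in> borel_measurable borel" for k :: int
    by (intro borel_measurable_continuous_onI continuous_intros)
  have inner: "(LBINT \<theta>2:{-pi..pi}. \<psi> \<theta>1 * \<psi> \<theta>2 * Re (spectral_density4 M X \<theta>1 \<theta>2 (-\<theta>2))) =
     \<psi> \<theta>1 / P * (\<Sum>\<^sub>\<infinity>h. c4' h * C (fst (snd h) - snd (snd h)) * cos (of_int (fst h) * \<theta>1))" for \<theta>1
  proof -
    have "(LBINT \<theta>2:{-pi..pi}. \<psi> \<theta>1 * \<psi> \<theta>2 * Re (spectral_density4 M X \<theta>1 \<theta>2 (-\<theta>2))) =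
      (LBINT \<theta>2:{-pi..pi}. \<psi> \<theta>1 / P * (\<psi> \<theta>2 * (\<Sum>\<^sub>\<infinity>h. c4' h * cos (of_int (fst h) * \<theta>1) * cos (of_int (fst (snd h) - snd (snd h)) * \<theta>2))))"
      unfolding Re_spectral_density4 P_def by (simp add: mult_ac)
    also have "\<dots> = \<psi> \<theta>1 / P * (LBINT \<theta>2:{-pi..pi}. \<psi> \<theta>2 * (\<Sum>\<^sub>\<infinity>h. c4' h * cos (of_int (fst h) * \<theta>1) * cos (of_int (fst (snd h) - snd (snd h)) * \<theta>2)))"
      by (rule set_integral_mult_right)
    also have "(LBINT \<theta>2:{-pi..pi}. \<psi> \<theta>2 * (\<Sum>\<^sub>\<infinity>h. c4' h * cos (of_int (fst h) * \<theta>1) * cos (of_int (fst (snd h) - snd (snd h)) * \<theta>2))) =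
      (\<Sum>\<^sub>\<infinity>h. c4' h * cos (of_int (fst h) * \<theta>1) * C (fst (snd h) - snd (snd h)))"
      unfolding C_def
    proof (rule infsum_integral_swap[OF _ \<psi> cosm])
      show "(\<lambda>h. \<bar>c4' h * cos (of_int (fst h) * \<theta>1)\<bar>) summable_on UNIV"
        using summable_on_dominated(2)[OF summable_c4', of "\<lambda>h. c4' h * cos (of_int (fst h) * \<theta>1)"]
        by (simp add: abs_mult mult_left_le)
    qed simp
    finally show ?thesis by (simp add: mult_ac)
  qed
  obtain B where B: "B \<ge> 0" "\<And>k. \<bar>C k\<bar> \<le> B"
  proof -
    obtain B0 where B0: "B0 \<ge> 0" "\<forall>x\<in>{-pi..pi}. \<bar>\<psi> x\<bar> \<le> B0" using bv_measurable_bounded[OF \<psi>] by blast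
    have "\<bar>C k\<bar> \<le> (LBINT \<theta>:{-pi..pi}. B0)" for k
      unfolding C_def set_lebesgue_integral_def real_norm_def[symmetric]
    proof (rule Bochner_Integration.integral_norm_bound_integral)
      have "set_integrable lborel {-pi..pi} (\<lambda>\<theta>. \<psi> \<theta> * cos (of_int k * \<theta>))"
        by (intro bv_measurable_integrable bv_measurable_mult \<psi> bv_measurable_cos) auto
      then show "integrable lborel (\<lambda>x. indicat_real {- pi..pi} x *\<^sub>R (\<psi> x * cos (real_of_int k * x)))"
        by (simp add: set_integrable_def)
      show "integrable lborel (\<lambda>x. indicat_real {- pi..pi} x *\<^sub>R B0)"
        by (intro integrable_scaleR_left integrable_real_indicator) auto
      show "norm (indicat_real {- pi..pi} x *\<^sub>R (\<psi> x * cos (real_of_int k * x))) \<le> indicat_real {- pi..pi} x *\<^sub>R B0" for x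
        using B0 mult_mono[of "\<bar>\<psi> x\<bar>" B0 "\<bar>cos (real_of_int k * x)\<bar>" 1] by (auto simp: indicator_def abs_mult)
    qed
    then show thesis using that[of "2 * pi * B0"] B0 by (simp add: set_lebesgue_integral_def)
  qed
  have "var_part2 (spectral_density4 M X) \<psi> = 2 * pi *
     (LBINT \<theta>1:{-pi..pi}. 1 / P * (\<psi> \<theta>1 * (\<Sum>\<^sub>\<infinity>h. c4' h * C (fst (snd h) - snd (snd h)) * cos (of_int (fst h) * \<theta>1))))"
    unfolding var_part2_def inner by simp
  also have "\<dots> = 2 * pi * (1 / P * (LBINT \<theta>1:{-pi..pi}. \<psi> \<theta>1 * (\<Sum>\<^sub>\<infinity>h. c4' h * C (fst (snd h) - snd (snd h)) * cos (of_int (fst h) * \<theta>1))))"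
    by (subst set_integral_mult_right) (rule refl)
  also have "(LBINT \<theta>1:{-pi..pi}. \<psi> \<theta>1 * (\<Sum>\<^sub>\<infinity>h. c4' h * C (fst (snd h) - snd (snd h)) * cos (of_int (fst h) * \<theta>1))) =
     (\<Sum>\<^sub>\<infinity>h. c4' h * C (fst (snd h) - snd (snd h)) * C (fst h))"
    unfolding C_def[of "fst _"]
  proof (rule infsum_integral_swap[OF _ \<psi> cosm])
    have "(\<lambda>h. B * \<bar>c4' h\<bar>) summable_on UNIV" using summable_c4' by (rule summable_on_cmult_right)
    then show "(\<lambda>h. \<bar>c4' h * C (fst (snd h) - snd (snd h))\<bar>) summable_on UNIV"
      using summable_on_dominated(2)[of "\<lambda>h. B * \<bar>c4' h\<bar>" UNIV "\<lambda>h. c4' h * C (fst (snd h) - snd (snd h))"] B(2)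
      by (simp add: abs_mult mult.commute[of B] mult_left_mono)
  qed simp
  finally show ?thesis by (simp add: C_def P_def mult_ac power2_eq_square power3_eq_cube)
qed

text \<open>Termwise convergence under a summable bound: the Riemann sums are bounded uniformly in
  the lag and in \<open>b\<close>, and the overlap fractions are at most 1 and tend to 1.\<close>

lemma weighted_kap4_sum_tendsto:
  assumes \<psi>: "bv_measurable \<psi>"
  shows "(\<lambda>b. 4 * pi\<^sup>2 / b * (\<Sum>j\<in>GG b. \<Sum>j'\<in>GG b. \<psi> (ffreq j b) * \<psi> (ffreq j' b) * kap4 b (ffreq j b) (ffreq j' b)))
    \<longlonglongrightarrow> var_part2 (spectral_density4 M X) \<psi>"
proof -
  obtain B where B: "B \<ge> 0" "\<forall>x\<in>{-pi..pi}. \<bar>\<psi> x\<bar> \<le> B" using bv_measurable_bounded[OF \<psi>] by blast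
  define R where "R k b = riemann_sum b (\<lambda>\<theta>. \<psi> \<theta> * cos (of_int k * \<theta>))" for k :: int and b
  define C where "C k = (LBINT \<theta>:{-pi..pi}. \<psi> \<theta> * cos (of_int k * \<theta>))" for k :: int
  have R_lim: "(\<lambda>b. R k b) \<longlonglongrightarrow> C k" for k
    unfolding R_def C_def by (intro riemann_sum_tendsto bv_measurable_mult \<psi> bv_measurable_cos)
  have R_le: "\<bar>R k b\<bar> \<le> 2 * pi * B" for k b
    unfolding R_def
  proof (rule abs_riemann_sum_le[OF _ B(1)])
    fix x assume "x \<in> {-pi..pi}"
    then show "\<bar>\<psi> x * cos (of_int k * x)\<bar> \<le> B"
      using B mult_mono[of "\<bar>\<psi> x\<bar>" B "\<bar>cos (real_of_int k * x)\<bar>" 1] by (simp add: abs_mult)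
  qed
  have ratio_le: "card (overlap3 b h) / b \<le> 1" for b h using card_overlap3_le[of b h] by (simp add: divide_le_eq)
  have "(\<lambda>b. \<Sum>\<^sub>\<infinity>h. c4' h * (card (overlap3 b h) / b) * R (fst h) b * R (fst (snd h) - snd (snd h)) b / (4 * pi\<^sup>2))
    \<longlonglongrightarrow> (\<Sum>\<^sub>\<infinity>h. c4' h * 1 * C (fst h) * C (fst (snd h) - snd (snd h)) / (4 * pi\<^sup>2))"
  proof (rule infsum_dominated_convergence)
    show "(\<lambda>h. (2 * pi * B) * (2 * pi * B) / (4 * pi\<^sup>2) * \<bar>c4' h\<bar>) summable_on UNIV"
      using summable_c4' by (rule summable_on_cmult_right)
    fix b h
    have "\<bar>c4' h * (card (overlap3 b h) / b) * R (fst h) b * R (fst (snd h) - snd (snd h)) b\<bar> \<le>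
       \<bar>c4' h\<bar> * 1 * (2 * pi * B) * (2 * pi * B)"
      unfolding abs_mult using R_le ratio_le B(1) by (intro mult_mono) (auto intro!: mult_nonneg_nonneg)
    then have "\<bar>c4' h * (card (overlap3 b h) / b) * R (fst h) b * R (fst (snd h) - snd (snd h)) b\<bar> / (4 * pi\<^sup>2) \<le>
       \<bar>c4' h\<bar> * 1 * (2 * pi * B) * (2 * pi * B) / (4 * pi\<^sup>2)" by (rule divide_right_mono) simp
    then show "\<bar>c4' h * (card (overlap3 b h) / b) * R (fst h) b * R (fst (snd h) - snd (snd h)) b / (4 * pi\<^sup>2)\<bar> \<le>
       (2 * pi * B) * (2 * pi * B) / (4 * pi\<^sup>2) * \<bar>c4' h\<bar>"
      by (simp only: abs_divide) (simp add: mult_ac)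
  next
    fix h :: "int \<times> int \<times> int"
    define L where "L = \<bar>real_of_int (fst h)\<bar> + \<bar>real_of_int (fst (snd h))\<bar> + \<bar>real_of_int (snd (snd h))\<bar>"
    have "(\<lambda>b. card (overlap3 b h) / b) \<longlonglongrightarrow> 1"
    proof (rule tendsto_sandwich)
      show "(\<lambda>b. 1 - L / real b) \<longlonglongrightarrow> 1"
        using tendsto_diff[OF tendsto_const lim_const_over_n[of L]] by simp
      show "\<forall>\<^sub>F b in sequentially. 1 - L / real b \<le> card (overlap3 b h) / b"
        using eventually_ge_at_top[of 1]
      proof eventually_elim
        case (elim b)
        have "(real b - L) / real b \<le> card (overlap3 b h) / real b"
          using card_overlap3_ge[of b h] by (intro divide_right_mono) (auto simp: L_def)
        then show ?case using elim by (simp add: diff_divide_distrib)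
      qed
      show "\<forall>\<^sub>F b in sequentially. card (overlap3 b h) / b \<le> (1 :: real)" using ratio_le by simp
    qed simp
    then show "(\<lambda>b. c4' h * (card (overlap3 b h) / b) * R (fst h) b * R (fst (snd h) - snd (snd h)) b / (4 * pi\<^sup>2))
      \<longlonglongrightarrow> c4' h * 1 * C (fst h) * C (fst (snd h) - snd (snd h)) / (4 * pi\<^sup>2)"
      by (intro tendsto_intros R_lim) simp_all
  qed
  moreover have "(\<Sum>\<^sub>\<infinity>h. c4' h * 1 * C (fst h) * C (fst (snd h) - snd (snd h)) / (4 * pi\<^sup>2)) = var_part2 (spectral_density4 M X) \<psi>"
    unfolding var_part2_eq[OF \<psi>] C_def[symmetric]
    by (simp only: divide_inverse infsum_cmult_left') simp
  moreover have "\<forall>\<^sub>F b in sequentially. (\<Sum>\<^sub>\<infinity>h. c4' h * (card (overlap3 b h) / b) * R (fst h) b * R (fst (snd h) - snd (snd h)) b / (4 * pi\<^sup>2)) =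
     4 * pi\<^sup>2 / b * (\<Sum>j\<in>GG b. \<Sum>j'\<in>GG b. \<psi> (ffreq j b) * \<psi> (ffreq j' b) * kap4 b (ffreq j b) (ffreq j' b))"
    using eventually_ge_at_top[of 1]
  proof eventually_elim
    case (elim b)
    then show ?case unfolding R_def by (rule weighted_kap4_sum_eq[symmetric])
  qed
  ultimately show ?thesis using Lim_transform_eventually by (simp only:)
qed

end

section \<open>Off-diagonal and diagonal sums of periodogram covariances\<close>

lemma abs3_le: "\<bar>x\<bar> \<le> a \<Longrightarrow> \<bar>y\<bar> \<le> b \<Longrightarrow> \<bar>z\<bar> \<le> c \<Longrightarrow> \<bar>x - y - z\<bar> \<le> a + b + c" for x y z :: real
  by linarith

lemma GG_uminus: "j \<in> GG m \<Longrightarrow> - j \<in> GG m" by (auto simp: GG_def)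

lemma GG_neq_uminus: "j \<in> GG m \<Longrightarrow> j \<noteq> - j" by (auto simp: GG_def)

lemma GG_le: "j \<in> GG m \<Longrightarrow> 2 * \<bar>j\<bar> \<le> int m" by (auto simp: GG_def)

lemma sum_GG_split:
  fixes F :: "int \<Rightarrow> real"
  assumes "j \<in> GG m"
  shows "(\<Sum>j'\<in>GG m. F j') = (\<Sum>j'\<in>GG m - {j, - j}. F j') + F j + F (- j)"
proof -
  have "(\<Sum>j'\<in>GG m. F j') = (\<Sum>j'\<in>GG m - {j, - j}. F j') + (\<Sum>j'\<in>{j, - j}. F j')"
    using assms GG_uminus by (intro sum.subset_diff finite_GG) auto
  then show ?thesis using GG_neq_uminus[OF assms] by simp
qed

lemma sum_GG_uminus: "(\<Sum>j\<in>GG m. F (- j)) = (\<Sum>j\<in>GG m. F j)" for F :: "int \<Rightarrow> real"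
  by (rule sum.reindex_bij_witness[of _ uminus uminus]) (auto simp: GG_uminus)

lemma riemann_sum_uminus: "riemann_sum m (\<lambda>\<theta>. g (- \<theta>)) = riemann_sum m g"
  using sum_GG_uminus[of "\<lambda>j. g (ffreq j m)" m] by (simp add: riemann_sum_def ffreq_uminus)

text \<open>Both integrals are limits of the same Riemann sums, since the grid is symmetric.\<close>

lemma set_integral_uminus_bv:
  assumes "bv_measurable g"
  shows "(LBINT \<theta>:{-pi..pi}. g (- \<theta>)) = (LBINT \<theta>:{-pi..pi}. g \<theta>)"
  using riemann_sum_tendsto[OF assms] riemann_sum_tendsto[OF bv_measurable_uminus[OF assms]]
  by (simp only: riemann_sum_uminus LIMSEQ_unique)

lemma set_integral_symmetrize:
  assumes "bv_measurable g" "bv_measurable h" "\<And>\<theta>. h (- \<theta>) = h \<theta>"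
  shows "(LBINT \<theta>:{-pi..pi}. (g \<theta> + g (- \<theta>)) * h \<theta>) = 2 * (LBINT \<theta>:{-pi..pi}. g \<theta> * h \<theta>)"
proof -
  have gh: "bv_measurable (\<lambda>\<theta>. g \<theta> * h \<theta>)" using assms by (intro bv_measurable_mult)
  then have gh': "bv_measurable (\<lambda>\<theta>. g (- \<theta>) * h \<theta>)"
    using assms by (intro bv_measurable_mult bv_measurable_uminus)
  have "(LBINT \<theta>:{-pi..pi}. (g \<theta> + g (- \<theta>)) * h \<theta>) = (LBINT \<theta>:{-pi..pi}. g \<theta> * h \<theta> + g (- \<theta>) * h \<theta>)"
    by (simp add: distrib_right)
  also have "\<dots> = (LBINT \<theta>:{-pi..pi}. g \<theta> * h \<theta>) + (LBINT \<theta>:{-pi..pi}. g (- \<theta>) * h \<theta>)"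
    using gh gh' by (intro set_integral_add(2) bv_measurable_integrable) auto
  also have "(LBINT \<theta>:{-pi..pi}. g (- \<theta>) * h \<theta>) = (LBINT \<theta>:{-pi..pi}. g \<theta> * h \<theta>)"
    using set_integral_uminus_bv[OF gh] by (simp add: assms(3))
  finally show ?thesis by simp
qed

context spectral_process
begin

lemma kap_uminus: "kap b \<theta> (- \<mu>) = kap b \<theta> \<mu>"
proof -
  have "pgw (- \<mu>) = pgw \<mu>" by (simp add: pgw_def fun_eq_iff)
  then show ?thesis by (simp add: kap_def epg_def)
qed

text \<open>Neither \<open>j - j'\<close> nor \<open>j + j'\<close> is a multiple of
  \<open>b\<close>: they are nonzero, and modulus \<open>b\<close> would require both indices to be
  of modulus \<open>b / 2\<close> and hence equal up to sign. So all four sums in the Gaussian part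
  are bounded by \<open>K\<gamma>\<close>.\<close>

lemma kap_off_diagonal:
  assumes b: "b \<ge> 1" and j: "j \<in> GG b" and j': "j' \<in> GG b - {j, - j}"
  shows "\<bar>kap b (ffreq j b) (ffreq j' b) - kap4 b (ffreq j b) (ffreq j' b)\<bar> \<le> K\<gamma>\<^sup>2 / b\<^sup>2"
proof -
  let ?\<theta> = "ffreq j b" and ?\<mu> = "ffreq j' b"
  have abs: "\<bar>j - j'\<bar> \<le> int b" "\<bar>j + j'\<bar> \<le> int b" using GG_le[OF j] GG_le[of j' b] j' by auto
  have nd: "\<not> int b dvd k" if "k \<noteq> 0" "\<bar>k\<bar> \<le> int b" "\<bar>k\<bar> \<noteq> int b" for k
    using that by (metis dvd_imp_le_int abs_of_nat order_antisym)
  have nd1: "\<not> int b dvd (j - j')"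
  proof (rule nd)
    show "j - j' \<noteq> 0" using j' by auto
    show "\<bar>j - j'\<bar> \<noteq> int b" using GG_le[OF j] GG_le[of j' b] j' by auto
  qed (rule abs)
  have nd2: "\<not> int b dvd (j + j')"
  proof (rule nd)
    show "j + j' \<noteq> 0" using j' by auto
    show "\<bar>j + j'\<bar> \<noteq> int b" using GG_le[OF j] GG_le[of j' b] j' by auto
  qed (rule abs)
  have d1: "(?\<theta> - ?\<mu>) * real b = 2 * pi * of_int (j - j')" using b by (simp add: ffreq_def field_simps)
  have d2: "(?\<theta> - (- ?\<mu>)) * real b = 2 * pi * of_int (j + j')" using b by (simp add: ffreq_def field_simps)
  have sq: "x\<^sup>2 \<le> K\<gamma>\<^sup>2" if "\<bar>x\<bar> \<le> K\<gamma>" for x using that by (simp add: abs_le_square_iff[symmetric] K_nonneg)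
  have "(cosum b ?\<theta> ?\<mu>)\<^sup>2 + (cosum b ?\<theta> (- ?\<mu>))\<^sup>2 + (sisum b ?\<theta> ?\<mu>)\<^sup>2 + (sisum b ?\<theta> (- ?\<mu>))\<^sup>2 \<le> 4 * K\<gamma>\<^sup>2"
    using sq[OF abs_cosum_le[OF b d1 nd1]] sq[OF abs_sisum_le[OF b d1 nd1]]
      sq[OF abs_cosum_le[OF b d2 nd2]] sq[OF abs_sisum_le[OF b d2 nd2]] by linarith
  then have "kap b ?\<theta> ?\<mu> - kap4 b ?\<theta> ?\<mu> \<le> 4 * K\<gamma>\<^sup>2 / (2 * pi * b)\<^sup>2"
    unfolding kap_eq by (simp add: divide_right_mono)
  also have "\<dots> \<le> 4 * K\<gamma>\<^sup>2 / (2 * real b)\<^sup>2"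
  proof (rule divide_left_mono)
    have "2 * real b \<le> 2 * pi * real b" using pi_gt3 by (intro mult_right_mono) auto
    then show "(2 * real b)\<^sup>2 \<le> (2 * pi * real b)\<^sup>2" by (rule power_mono) simp
  qed (use b in auto)
  also have "\<dots> = K\<gamma>\<^sup>2 / b\<^sup>2" by (simp add: power_mult_distrib)
  finally show ?thesis unfolding kap_eq by (simp add: sum_nonneg)
qed

text \<open>The total mass of the true covariances, which measures the effect of a uniform
  perturbation of the weights.\<close>

lemma sum_abs_kap_off_le:
  assumes b: "b \<ge> 1"
  shows "(\<Sum>j\<in>GG b. \<Sum>j'\<in>GG b - {j, - j}. \<bar>kap b (ffreq j b) (ffreq j' b)\<bar>) / b \<le> K4 + K\<gamma>\<^sup>2"
proof -
  have "(\<Sum>j\<in>GG b. \<Sum>j'\<in>GG b - {j, - j}. \<bar>kap b (ffreq j b) (ffreq j' b)\<bar>) \<le>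
     (\<Sum>j\<in>GG b. \<Sum>j'\<in>GG b - {j, - j}. (K4 + K\<gamma>\<^sup>2) / b)"
  proof (intro sum_mono)
    fix j j' assume "j \<in> GG b" "j' \<in> GG b - {j, - j}"
    then have "\<bar>kap b (ffreq j b) (ffreq j' b)\<bar> \<le> K4 / b + K\<gamma>\<^sup>2 / b\<^sup>2"
      using kap_off_diagonal[OF b] abs_kap4_le[OF b, of "ffreq j b" "ffreq j' b"] by force
    also have "K\<gamma>\<^sup>2 / b\<^sup>2 \<le> K\<gamma>\<^sup>2 / b" using b by (intro divide_left_mono) (auto simp: power2_eq_square)
    finally show "\<bar>kap b (ffreq j b) (ffreq j' b)\<bar> \<le> (K4 + K\<gamma>\<^sup>2) / b" by (simp add: add_divide_distrib)
  qed
  also have "\<dots> \<le> (\<Sum>j\<in>GG b. \<Sum>j'\<in>GG b. (K4 + K\<gamma>\<^sup>2) / b)"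
    using K_nonneg by (intro sum_mono sum_mono2 finite_GG) auto
  also have "\<dots> \<le> real b * (real b * ((K4 + K\<gamma>\<^sup>2) / b))"
    using card_GG_le[of b] K_nonneg by (simp only: sum_constant) (intro mult_mono, auto)
  also have "\<dots> = b * (K4 + K\<gamma>\<^sup>2)" using b by simp
  finally show ?thesis using b by (simp add: divide_le_eq mult.commute)
qed

definition offdiag :: "nat \<Rightarrow> (real \<Rightarrow> real) \<Rightarrow> real" where
  "offdiag b \<psi> = 4 * pi\<^sup>2 / b * (\<Sum>j\<in>GG b. \<Sum>j'\<in>GG b - {j, - j}.
      \<psi> (ffreq j b) * \<psi> (ffreq j' b) * kap b (ffreq j b) (ffreq j' b))"

text \<open>Compared with the full double sum of \<open>kap4\<close>, each row misses two terms of
  size O(1 / \<open>b\<close>) and carries at most \<open>b\<close> Gaussian parts of size O(1 /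
  \<open>b\<close>^2). The at most \<open>b\<close> rows are divided by \<open>b\<close>.\<close>

lemma offdiag_tendsto:
  assumes \<psi>: "bv_measurable \<psi>"
  shows "(\<lambda>b. offdiag b \<psi>) \<longlonglongrightarrow> var_part2 (spectral_density4 M X) \<psi>"
proof -
  obtain B where B: "B \<ge> 0" "\<forall>x\<in>{-pi..pi}. \<bar>\<psi> x\<bar> \<le> B" using bv_measurable_bounded[OF \<psi>] by blast
  have BB: "\<bar>\<psi> (ffreq j b) * \<psi> (ffreq j' b)\<bar> \<le> B\<^sup>2" if "j \<in> GG b" "j' \<in> GG b" for j j' b
    unfolding abs_mult power2_eq_square using B ffreq_in[OF that(1)] ffreq_in[OF that(2)] by (intro mult_mono) auto
  define A where "A b = 4 * pi\<^sup>2 / b * (\<Sum>j\<in>GG b. \<Sum>j'\<in>GG b. \<psi> (ffreq j b) * \<psi> (ffreq j' b) * kap4 b (ffreq j b) (ffreq j' b))" for b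
  have le: "\<bar>offdiag b \<psi> - A b\<bar> \<le> 4 * pi\<^sup>2 * B\<^sup>2 * (K\<gamma>\<^sup>2 + 2 * K4) / b" if b: "b \<ge> 1" for b
  proof -
    have in_j: "\<bar>(\<Sum>j'\<in>GG b - {j, - j}. \<psi> (ffreq j b) * \<psi> (ffreq j' b) * kap b (ffreq j b) (ffreq j' b)) -
       (\<Sum>j'\<in>GG b. \<psi> (ffreq j b) * \<psi> (ffreq j' b) * kap4 b (ffreq j b) (ffreq j' b))\<bar> \<le> B\<^sup>2 * (K\<gamma>\<^sup>2 + 2 * K4) / b"
      if j: "j \<in> GG b" for j
    proof -
      have "\<bar>\<Sum>j'\<in>GG b - {j, - j}. \<psi> (ffreq j b) * \<psi> (ffreq j' b) * (kap b (ffreq j b) (ffreq j' b) - kap4 b (ffreq j b) (ffreq j' b))\<bar>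
        \<le> (\<Sum>j'\<in>GG b - {j, - j}. B\<^sup>2 * (K\<gamma>\<^sup>2 / b\<^sup>2))"
      proof (intro order_trans[OF sum_abs] sum_mono)
        fix j' assume "j' \<in> GG b - {j, - j}"
        then show "\<bar>\<psi> (ffreq j b) * \<psi> (ffreq j' b) * (kap b (ffreq j b) (ffreq j' b) - kap4 b (ffreq j b) (ffreq j' b))\<bar> \<le> B\<^sup>2 * (K\<gamma>\<^sup>2 / b\<^sup>2)"
          unfolding abs_mult[of "_ * _"] using BB[OF j] kap_off_diagonal[OF b j] by (intro mult_mono) auto
      qed
      also have "\<dots> \<le> (\<Sum>j'\<in>GG b. B\<^sup>2 * (K\<gamma>\<^sup>2 / b\<^sup>2))" by (intro sum_mono2 finite_GG) auto
      also have "\<dots> \<le> real b * (B\<^sup>2 * (K\<gamma>\<^sup>2 / b\<^sup>2))"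
        using card_GG_le[of b] by (simp only: sum_constant) (intro mult_right_mono, auto)
      also have "\<dots> = B\<^sup>2 * K\<gamma>\<^sup>2 / b" using b by (simp add: power2_eq_square)
      finally have 1: "\<bar>\<Sum>j'\<in>GG b - {j, - j}. \<psi> (ffreq j b) * \<psi> (ffreq j' b) * (kap b (ffreq j b) (ffreq j' b) - kap4 b (ffreq j b) (ffreq j' b))\<bar> \<le> B\<^sup>2 * K\<gamma>\<^sup>2 / b" .
      have 2: "\<bar>\<psi> (ffreq j b) * \<psi> (ffreq j' b) * kap4 b (ffreq j b) (ffreq j' b)\<bar> \<le> B\<^sup>2 * (K4 / b)" if "j' \<in> GG b" for j'
        unfolding abs_mult[of "_ * _"] using BB[OF j that] abs_kap4_le[OF b] by (intro mult_mono) auto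
      have eq: "(\<Sum>j'\<in>GG b - {j, - j}. \<psi> (ffreq j b) * \<psi> (ffreq j' b) * kap b (ffreq j b) (ffreq j' b)) -
         (\<Sum>j'\<in>GG b. \<psi> (ffreq j b) * \<psi> (ffreq j' b) * kap4 b (ffreq j b) (ffreq j' b)) =
         (\<Sum>j'\<in>GG b - {j, - j}. \<psi> (ffreq j b) * \<psi> (ffreq j' b) * (kap b (ffreq j b) (ffreq j' b) - kap4 b (ffreq j b) (ffreq j' b))) -
         \<psi> (ffreq j b) * \<psi> (ffreq j b) * kap4 b (ffreq j b) (ffreq j b) -
         \<psi> (ffreq j b) * \<psi> (ffreq (- j) b) * kap4 b (ffreq j b) (ffreq (- j) b)" (is "_ = ?R")
        unfolding sum_GG_split[OF j] by (simp add: right_diff_distrib sum_subtractf)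
      have "\<bar>?R\<bar> \<le> B\<^sup>2 * K\<gamma>\<^sup>2 / b + B\<^sup>2 * (K4 / b) + B\<^sup>2 * (K4 / b)"
        by (rule abs3_le[OF 1 2[OF j] 2[OF GG_uminus[OF j]]])
      also have "\<dots> = B\<^sup>2 * (K\<gamma>\<^sup>2 + 2 * K4) / b" by (simp add: distrib_left add_divide_distrib)
      finally show ?thesis unfolding eq .
    qed
    define d where "d j = (\<Sum>j'\<in>GG b - {j, - j}. \<psi> (ffreq j b) * \<psi> (ffreq j' b) * kap b (ffreq j b) (ffreq j' b)) -
       (\<Sum>j'\<in>GG b. \<psi> (ffreq j b) * \<psi> (ffreq j' b) * kap4 b (ffreq j b) (ffreq j' b))" for j
    define Q where "Q = B\<^sup>2 * (K\<gamma>\<^sup>2 + 2 * K4) / b"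
    have eq: "offdiag b \<psi> - A b = 4 * pi\<^sup>2 / b * (\<Sum>j\<in>GG b. d j)"
      by (simp add: offdiag_def A_def d_def sum_subtractf right_diff_distrib)
    have "\<bar>\<Sum>j\<in>GG b. d j\<bar> \<le> (\<Sum>j\<in>GG b. Q)"
      using in_j by (intro order_trans[OF sum_abs] sum_mono) (auto simp: d_def Q_def)
    also have "\<dots> \<le> b * Q"
      using card_GG_le[of b] K_nonneg by (simp only: sum_constant) (intro mult_right_mono, auto simp: Q_def)
    finally have "4 * pi\<^sup>2 / b * \<bar>\<Sum>j\<in>GG b. d j\<bar> \<le> 4 * pi\<^sup>2 / b * (b * Q)"
      by (intro mult_left_mono) auto
    then show ?thesis unfolding eq using b by (simp add: Q_def abs_mult mult_ac)
  qed
  have "(\<lambda>b. offdiag b \<psi> - A b) \<longlonglongrightarrow> 0"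
  proof (rule Lim_null_comparison)
    show "\<forall>\<^sub>F b in sequentially. norm (offdiag b \<psi> - A b) \<le> 4 * pi\<^sup>2 * B\<^sup>2 * (K\<gamma>\<^sup>2 + 2 * K4) / b"
      using eventually_ge_at_top[of 1] by eventually_elim (use le in simp)
  qed (rule lim_const_over_n)
  then show ?thesis
    using tendsto_add[OF _ weighted_kap4_sum_tendsto[OF \<psi>], of "\<lambda>b. offdiag b \<psi> - A b" 0] by (simp add: A_def)
qed

text \<open>At equal frequencies \<open>cosum\<close> is \<open>2 * pi * b\<close> times the
  expected periodogram and \<open>sisum\<close> vanishes by antisymmetry, which leaves the squared
  mean. The sums at opposite frequencies stay bounded as long as \<open>2 * j\<close> is not a
  multiple of \<open>b\<close>.\<close>

lemma kap_diagonal: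
  assumes b: "b \<ge> 1" and j: "j \<in> GG b" "2 * \<bar>j\<bar> \<noteq> int b"
  shows "\<bar>kap b (ffreq j b) (ffreq j b) - (f (ffreq j b))\<^sup>2\<bar> \<le> (K4 + 3 * K\<gamma>\<^sup>2) / b"
proof -
  let ?\<theta> = "ffreq j b"
  have nd: "\<not> int b dvd 2 * j"
  proof
    assume "int b dvd 2 * j"
    moreover have "2 * j \<noteq> 0" using j by (auto simp: GG_def)
    ultimately have "int b \<le> \<bar>2 * j\<bar>" using dvd_imp_le_int[of "2 * j" "int b"] by simp
    then show False using GG_le[OF j(1)] j(2) by auto
  qed
  have d: "(?\<theta> - (- ?\<theta>)) * real b = 2 * pi * of_int (2 * j)" using b by (simp add: ffreq_def field_simps)
  have sq: "x\<^sup>2 \<le> K\<gamma>\<^sup>2" if "\<bar>x\<bar> \<le> K\<gamma>" for x using that by (simp add: abs_le_square_iff[symmetric] K_nonneg)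
  have co: "cosum b ?\<theta> ?\<theta> = 2 * pi * b * epg b ?\<theta>"
    unfolding epg_def expectation_qform cosum_def using b
    by (simp add: sum_distrib_left sum_divide_distrib pgw_def right_diff_distrib)
  have si: "sisum b ?\<theta> ?\<theta> = 0"
  proof -
    have "sisum b ?\<theta> ?\<theta> = (\<Sum>s=1..b. \<Sum>u=1..b. sin (?\<theta> * u - ?\<theta> * s) * \<gamma> (int s - int u))"
      unfolding sisum_def by (rule sum.swap)
    also have "\<dots> = (\<Sum>s=1..b. \<Sum>u=1..b. - (sin (?\<theta> * s - ?\<theta> * u) * \<gamma> (int u - int s)))"
      by (intro sum.cong refl) (metis autocov_commute minus_diff_eq mult_minus_left sin_minus)
    also have "\<dots> = - sisum b ?\<theta> ?\<theta>" by (simp add: sisum_def sum_negf)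
    finally show ?thesis by simp
  qed
  have gt: "(2 * pi * b)\<^sup>2 \<ge> 2 * real b"
  proof -
    have "2 * real b \<le> 2 * pi * b" using pi_gt3 by (intro mult_right_mono) auto
    also have "\<dots> \<le> (2 * pi * b)\<^sup>2"
      using b pi_gt3 mult_mono[of 1 "2 * pi" 1 "real b"] by (intro self_le_power) auto
    finally show ?thesis .
  qed
  have "kap b ?\<theta> ?\<theta> = kap4 b ?\<theta> ?\<theta> + (epg b ?\<theta>)\<^sup>2 +
      ((cosum b ?\<theta> (- ?\<theta>))\<^sup>2 + (sisum b ?\<theta> (- ?\<theta>))\<^sup>2) / (2 * pi * b)\<^sup>2"
    unfolding kap_eq co si using b by (simp add: power_mult_distrib add_divide_distrib)
  moreover have "((cosum b ?\<theta> (- ?\<theta>))\<^sup>2 + (sisum b ?\<theta> (- ?\<theta>))\<^sup>2) / (2 * pi * b)\<^sup>2 \<le> (2 * K\<gamma>\<^sup>2) / (2 * real b)"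
    using sq[OF abs_cosum_le[OF b d nd]] sq[OF abs_sisum_le[OF b d nd]] gt b by (intro frac_le) auto
  moreover have "0 \<le> ((cosum b ?\<theta> (- ?\<theta>))\<^sup>2 + (sisum b ?\<theta> (- ?\<theta>))\<^sup>2) / (2 * pi * b)\<^sup>2" by simp
  moreover have "\<bar>(epg b ?\<theta>)\<^sup>2 - (f ?\<theta>)\<^sup>2\<bar> \<le> K\<gamma> / b * (2 * K\<gamma>)"
  proof -
    have eq: "(epg b ?\<theta>)\<^sup>2 - (f ?\<theta>)\<^sup>2 = (epg b ?\<theta> - f ?\<theta>) * (epg b ?\<theta> + f ?\<theta>)" by (simp add: power2_eq_square algebra_simps)
    have "\<bar>epg b ?\<theta> + f ?\<theta>\<bar> \<le> 2 * K\<gamma>"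
      using abs_epg_le[OF b, of ?\<theta>] abs_spectral_density_le[of ?\<theta>] by linarith
    then have "\<bar>epg b ?\<theta> - f ?\<theta>\<bar> * \<bar>epg b ?\<theta> + f ?\<theta>\<bar> \<le> K\<gamma> / b * (2 * K\<gamma>)"
      using K_nonneg by (intro mult_mono epg_bias[OF b]) auto
    then show ?thesis unfolding eq abs_mult .
  qed
  ultimately have "\<bar>kap b ?\<theta> ?\<theta> - (f ?\<theta>)\<^sup>2\<bar> \<le> K4 / b + (2 * K\<gamma>\<^sup>2) / (2 * real b) + K\<gamma> / b * (2 * K\<gamma>)"
    using abs_kap4_le[OF b, of ?\<theta> ?\<theta>] by linarith
  also have "\<dots> = (K4 + 3 * K\<gamma>\<^sup>2) / b" by (simp add: power2_eq_square add_divide_distrib)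
  finally show ?thesis .
qed

lemma sum_kap_diagonal_error:
  assumes b: "b \<ge> 1"
  shows "(\<Sum>j\<in>GG b. \<bar>kap b (ffreq j b) (ffreq j b) - (f (ffreq j b))\<^sup>2\<bar>) \<le> K4 + 3 * K\<gamma>\<^sup>2 + 2 * (cov_const + K\<gamma>\<^sup>2)"
proof -
  \<comment> \<open>Contains the frequencies with \<open>2 * \<bar>j\<bar> = int b\<close>, where
    only a bounded error is available; two such terms are harmless after division by
    \<open>b\<close>.\<close>
  let ?E = "{int (b div 2), - int (b div 2)}"
  have "(\<Sum>j\<in>GG b. \<bar>kap b (ffreq j b) (ffreq j b) - (f (ffreq j b))\<^sup>2\<bar>) \<le>
    (\<Sum>j\<in>GG b. (K4 + 3 * K\<gamma>\<^sup>2) / b + (if j \<in> ?E then cov_const + K\<gamma>\<^sup>2 else 0))"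
  proof (rule sum_mono)
    fix j assume j: "j \<in> GG b"
    show "\<bar>kap b (ffreq j b) (ffreq j b) - (f (ffreq j b))\<^sup>2\<bar> \<le> (K4 + 3 * K\<gamma>\<^sup>2) / b + (if j \<in> ?E then cov_const + K\<gamma>\<^sup>2 else 0)"
    proof (cases "2 * \<bar>j\<bar> = int b")
      case False
      then show ?thesis using kap_diagonal[OF b j] cov_const_nonneg by (auto simp: add_increasing2)
    next
      case True
      then have "j \<in> ?E" by (auto simp: abs_if split: if_splits)
      moreover have "(f (ffreq j b))\<^sup>2 \<le> K\<gamma>\<^sup>2"
        using abs_spectral_density_le[of "ffreq j b"] by (simp add: abs_le_square_iff[symmetric] K_nonneg)
      moreover have "0 \<le> (K4 + 3 * K\<gamma>\<^sup>2) / b" using K_nonneg by simp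
      ultimately show ?thesis using abs_kap_le[OF b, of "ffreq j b" "ffreq j b"] zero_le_power2[of "f (ffreq j b)"]
        by (simp only: if_True)
    qed
  qed
  also have "\<dots> = card (GG b) * ((K4 + 3 * K\<gamma>\<^sup>2) / b) + (\<Sum>j\<in>GG b \<inter> ?E. cov_const + K\<gamma>\<^sup>2)"
    by (subst sum.distrib, subst sum.inter_restrict[OF finite_GG]) (simp only: sum_constant)
  also have "(\<Sum>j\<in>GG b \<inter> ?E. cov_const + K\<gamma>\<^sup>2) \<le> (\<Sum>j\<in>?E. cov_const + K\<gamma>\<^sup>2)"
    using cov_const_nonneg by (intro sum_mono2) auto
  also have "\<dots> \<le> 2 * (cov_const + K\<gamma>\<^sup>2)"
  proof -
    have "card ?E \<le> 2" by (simp add: card_insert_if)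
    then have "real (card ?E) \<le> 2" by linarith
    then show ?thesis using cov_const_nonneg by (simp only: sum_constant) (intro mult_right_mono, auto)
  qed
  also have "card (GG b) * ((K4 + 3 * K\<gamma>\<^sup>2) / b) \<le> b * ((K4 + 3 * K\<gamma>\<^sup>2) / b)"
    using card_GG_le[of b] K_nonneg by (intro mult_right_mono) auto
  also have "\<dots> = K4 + 3 * K\<gamma>\<^sup>2" using b by simp
  finally show ?thesis by simp
qed

definition ondiag :: "nat \<Rightarrow> (real \<Rightarrow> real) \<Rightarrow> real" where
  "ondiag b \<psi> = 4 * pi\<^sup>2 / b * (\<Sum>j\<in>GG b. \<psi> (ffreq j b) * (\<psi> (ffreq j b) + \<psi> (- ffreq j b)) * kap b (ffreq j b) (ffreq j b))"

lemma ondiag_tendsto: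
  assumes \<psi>: "bv_measurable \<psi>"
  shows "(\<lambda>b. ondiag b \<psi>) \<longlonglongrightarrow> var_part1 f \<psi>"
proof -
  obtain B where B: "B \<ge> 0" "\<forall>x\<in>{-pi..pi}. \<bar>\<psi> x\<bar> \<le> B" using bv_measurable_bounded[OF \<psi>] by blast
  define p where "p \<theta> = \<psi> \<theta> * (\<psi> \<theta> + \<psi> (- \<theta>)) * (f \<theta>)\<^sup>2" for \<theta>
  define C where "C = K4 + 3 * K\<gamma>\<^sup>2 + 2 * (cov_const + K\<gamma>\<^sup>2)"
  have bvp: "bv_measurable p"
    unfolding p_def power2_eq_square
    by (intro bv_measurable_mult bv_measurable_add bv_measurable_uminus \<psi> bv_measurable_spectral_density)
  have le: "\<bar>ondiag b \<psi> - 2 * pi * riemann_sum b p\<bar> \<le> 4 * pi\<^sup>2 * (2 * B\<^sup>2) * C / b" if b: "b \<ge> 1" for b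
  proof -
    have "ondiag b \<psi> - 2 * pi * riemann_sum b p = 4 * pi\<^sup>2 / b * (\<Sum>j\<in>GG b. \<psi> (ffreq j b) * (\<psi> (ffreq j b) + \<psi> (- ffreq j b)) *
        (kap b (ffreq j b) (ffreq j b) - (f (ffreq j b))\<^sup>2))"
      by (simp add: ondiag_def riemann_sum_def p_def right_diff_distrib sum_subtractf power2_eq_square mult_ac)
    also have "\<bar>\<dots>\<bar> \<le> 4 * pi\<^sup>2 / b * (\<Sum>j\<in>GG b. 2 * B\<^sup>2 * \<bar>kap b (ffreq j b) (ffreq j b) - (f (ffreq j b))\<^sup>2\<bar>)"
      unfolding abs_mult[of "4 * pi\<^sup>2 / b"]
    proof (intro mult_mono order_trans[OF sum_abs] sum_mono)
      fix j assume j: "j \<in> GG b"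
      have "\<bar>\<psi> (ffreq j b)\<bar> \<le> B" "\<bar>\<psi> (- ffreq j b)\<bar> \<le> B"
        using B ffreq_in[OF j] ffreq_in[OF GG_uminus[OF j]] by (auto simp: ffreq_uminus)
      then have "\<bar>\<psi> (ffreq j b)\<bar> * \<bar>\<psi> (ffreq j b) + \<psi> (- ffreq j b)\<bar> \<le> B * (2 * B)"
        using B(1) by (intro mult_mono) linarith+
      then have "\<bar>\<psi> (ffreq j b) * (\<psi> (ffreq j b) + \<psi> (- ffreq j b))\<bar> \<le> 2 * B\<^sup>2"
        by (simp add: abs_mult power2_eq_square)
      then show "\<bar>\<psi> (ffreq j b) * (\<psi> (ffreq j b) + \<psi> (- ffreq j b)) * (kap b (ffreq j b) (ffreq j b) - (f (ffreq j b))\<^sup>2)\<bar>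
         \<le> 2 * B\<^sup>2 * \<bar>kap b (ffreq j b) (ffreq j b) - (f (ffreq j b))\<^sup>2\<bar>"
        unfolding abs_mult[of "_ * _"] by (intro mult_right_mono) auto
    qed auto
    also have "\<dots> \<le> 4 * pi\<^sup>2 / b * (2 * B\<^sup>2 * C)"
      unfolding sum_distrib_left[symmetric] C_def using sum_kap_diagonal_error[OF b] by (intro mult_left_mono) auto
    finally show ?thesis by simp
  qed
  have "(\<lambda>b. ondiag b \<psi> - 2 * pi * riemann_sum b p) \<longlonglongrightarrow> 0"
  proof (rule Lim_null_comparison)
    show "\<forall>\<^sub>F b in sequentially. norm (ondiag b \<psi> - 2 * pi * riemann_sum b p) \<le> 4 * pi\<^sup>2 * (2 * B\<^sup>2) * C / b"
      using eventually_ge_at_top[of 1] by eventually_elim (use le in simp)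
  qed (rule lim_const_over_n)
  then show ?thesis
    using tendsto_add[OF _ tendsto_mult_left[OF riemann_sum_tendsto[OF bvp], of "2 * pi"], of "\<lambda>b. ondiag b \<psi> - 2 * pi * riemann_sum b p" 0]
    by (simp add: var_part1_def p_def)
qed

text \<open>The total is \<open>4 * pi\<^sup>2 / b\<close> times the variance of a weighted sum of
  periodograms of a single block.\<close>

lemma offdiag_plus_ondiag_nonneg: "offdiag b \<psi> + ondiag b \<psi> \<ge> 0"
proof -
  define Y where "Y \<omega> = (\<Sum>j\<in>GG b. \<psi> (ffreq j b) * qform (pgw (ffreq j b)) b 0 \<omega>)" for \<omega>
  have Y2: "(Y \<omega>)\<^sup>2 = (\<Sum>j\<in>GG b. \<Sum>j'\<in>GG b. \<psi> (ffreq j b) * \<psi> (ffreq j' b) * (qform (pgw (ffreq j b)) b 0 \<omega> * qform (pgw (ffreq j' b)) b 0 \<omega>))" for \<omega>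
    unfolding Y_def power2_eq_square sum_product by (simp add: mult_ac)
  have "0 \<le> variance Y" by (rule variance_positive)
  also have "variance Y = (\<integral>\<omega>. (Y \<omega>)\<^sup>2 \<partial>M) - (\<integral>\<omega>. Y \<omega> \<partial>M)\<^sup>2"
  proof (rule variance_eq)
    show "integrable M Y" unfolding Y_def[abs_def] by (simp add: integrable_qform)
    show "integrable M (\<lambda>\<omega>. (Y \<omega>)\<^sup>2)" unfolding Y2 by (simp add: integrable_qform_mult)
  qed
  also have "\<dots> = (\<Sum>j\<in>GG b. \<Sum>j'\<in>GG b. \<psi> (ffreq j b) * \<psi> (ffreq j' b) * kap b (ffreq j b) (ffreq j' b))"
  proof -
    have "(\<integral>\<omega>. Y \<omega> \<partial>M) = (\<Sum>j\<in>GG b. \<psi> (ffreq j b) * epg b (ffreq j b))"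
      unfolding Y_def epg_def using integrable_qform by simp
    then have "(\<integral>\<omega>. Y \<omega> \<partial>M)\<^sup>2 = (\<Sum>j\<in>GG b. \<Sum>j'\<in>GG b. \<psi> (ffreq j b) * \<psi> (ffreq j' b) * (epg b (ffreq j b) * epg b (ffreq j' b)))"
      unfolding power2_eq_square by (simp add: sum_product mult_ac)
    moreover have "(\<integral>\<omega>. (Y \<omega>)\<^sup>2 \<partial>M) = (\<Sum>j\<in>GG b. \<Sum>j'\<in>GG b. \<psi> (ffreq j b) * \<psi> (ffreq j' b) *
        (\<integral>\<omega>. qform (pgw (ffreq j b)) b 0 \<omega> * qform (pgw (ffreq j' b)) b 0 \<omega> \<partial>M))"
      unfolding Y2 using integrable_qform_mult by simp
    ultimately show ?thesis by (simp add: kap_def right_diff_distrib sum_subtractf)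
  qed
  also have "\<dots> = (\<Sum>j\<in>GG b. (\<Sum>j'\<in>GG b - {j, - j}. \<psi> (ffreq j b) * \<psi> (ffreq j' b) * kap b (ffreq j b) (ffreq j' b)) +
     \<psi> (ffreq j b) * (\<psi> (ffreq j b) + \<psi> (- ffreq j b)) * kap b (ffreq j b) (ffreq j b))"
  proof (rule sum.cong[OF refl])
    fix j assume j: "j \<in> GG b"
    show "(\<Sum>j'\<in>GG b. \<psi> (ffreq j b) * \<psi> (ffreq j' b) * kap b (ffreq j b) (ffreq j' b)) =
      (\<Sum>j'\<in>GG b - {j, - j}. \<psi> (ffreq j b) * \<psi> (ffreq j' b) * kap b (ffreq j b) (ffreq j' b)) +
     \<psi> (ffreq j b) * (\<psi> (ffreq j b) + \<psi> (- ffreq j b)) * kap b (ffreq j b) (ffreq j b)"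
      unfolding sum_GG_split[OF j] ffreq_uminus kap_uminus by (simp add: algebra_simps)
  qed
  finally have "0 \<le> 4 * pi\<^sup>2 / b * \<dots>" by (intro mult_nonneg_nonneg) auto
  then show ?thesis by (simp add: offdiag_def ondiag_def sum.distrib distrib_left)
qed

lemma var_parts_nonneg:
  assumes "bv_measurable \<psi>"
  shows "var_part1 f \<psi> + var_part2 (spectral_density4 M X) \<psi> \<ge> 0"
  using tendsto_add[OF ondiag_tendsto[OF assms] offdiag_tendsto[OF assms]]
  by (rule LIMSEQ_le_const) (use offdiag_plus_ondiag_nonneg in \<open>auto simp: add.commute\<close>)

text \<open>The first part is \<open>pi\<close> times the integral of
  \<open>(g \<theta>)\<^sup>2 * (f \<theta>)\<^sup>2\<close>, with \<open>g\<close> the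
  symmetrisation of the weight, so \<open>g\<close> vanishes almost everywhere. Then all cosine
  coefficients of the weight are 0, and the series for the second part has only zero terms.\<close>

lemma var_part2_degenerate:
  assumes \<psi>: "bv_measurable \<psi>" and pos: "\<And>\<theta>. \<theta> \<in> {-pi..pi} \<Longrightarrow> f \<theta> > 0" and zero: "var_part1 f \<psi> \<le> 0"
  shows "var_part2 (spectral_density4 M X) \<psi> = 0"
proof -
  define g where "g \<theta> = \<psi> \<theta> + \<psi> (- \<theta>)" for \<theta>
  have bvg: "bv_measurable g" unfolding g_def by (intro bv_measurable_add bv_measurable_uminus \<psi>)
  have bvgf: "bv_measurable (\<lambda>\<theta>. g \<theta> * (f \<theta>)\<^sup>2)"
    unfolding power2_eq_square by (intro bv_measurable_mult bvg bv_measurable_spectral_density)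
  define q where "q \<theta> = g \<theta> * (g \<theta> * (f \<theta>)\<^sup>2)" for \<theta>
  have bvq: "bv_measurable q" unfolding q_def by (intro bv_measurable_mult bvg bvgf)
  have "(LBINT \<theta>:{-pi..pi}. q \<theta>) = 2 * (LBINT \<theta>:{-pi..pi}. \<psi> \<theta> * (g \<theta> * (f \<theta>)\<^sup>2))"
    unfolding q_def g_def[of "_"]
    by (rule set_integral_symmetrize[OF \<psi> bvgf[unfolded g_def]]) (simp add: spectral_density_even add.commute)
  also have "\<dots> = var_part1 f \<psi> / pi" by (simp add: var_part1_def g_def mult.assoc)
  finally have "(LBINT \<theta>:{-pi..pi}. q \<theta>) \<le> 0" using zero by (simp add: divide_nonpos_pos)
  moreover have int: "integrable lborel (\<lambda>\<theta>. indicator {-pi..pi} \<theta> *\<^sub>R q \<theta>)"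
    using bv_measurable_integrable[OF bvq, of "{-pi..pi}"] by (simp add: set_integrable_def)
  moreover have nn: "0 \<le> indicator {-pi..pi} \<theta> *\<^sub>R q \<theta>" for \<theta>
    by (auto simp: q_def indicator_def mult.assoc[symmetric])
  ultimately have "(\<integral>\<theta>. indicator {-pi..pi} \<theta> *\<^sub>R q \<theta> \<partial>lborel) = 0"
    unfolding set_lebesgue_integral_def by (intro antisym integral_nonneg) auto
  then have "AE \<theta> in lborel. indicator {-pi..pi} \<theta> *\<^sub>R q \<theta> = 0"
    using integral_nonneg_eq_0_iff_AE[OF int] nn by auto
  then have ae: "AE \<theta> in lborel. indicator {-pi..pi} \<theta> *\<^sub>R (g \<theta> * cos (of_int k * \<theta>)) = 0" for k :: int
    by eventually_elim (use pos in \<open>force simp: indicator_def q_def\<close>)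
  have "(LBINT \<theta>:{-pi..pi}. \<psi> \<theta> * cos (of_int k * \<theta>)) = 0" for k :: int
  proof -
    have "2 * (LBINT \<theta>:{-pi..pi}. \<psi> \<theta> * cos (of_int k * \<theta>)) = (LBINT \<theta>:{-pi..pi}. g \<theta> * cos (of_int k * \<theta>))"
      unfolding g_def by (rule set_integral_symmetrize[OF \<psi> bv_measurable_cos, symmetric]) simp
    also have "\<dots> = 0"
      unfolding set_lebesgue_integral_def by (rule integral_eq_zero_AE[OF ae])
    finally show ?thesis by simp
  qed
  then show ?thesis by (simp add: var_part2_eq[OF \<psi>])
qed

section \<open>Mean errors of empirical periodogram covariances\<close>

lemma expectation_abs_le_sqrt:
  assumes [measurable]: "Y \<in> borel_measurable M" and "integrable M (\<lambda>w. (Y w)\<^sup>2)"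
  shows "(\<integral>w. \<bar>Y w\<bar> \<partial>M) \<le> sqrt (\<integral>w. (Y w)\<^sup>2 \<partial>M)" "integrable M (\<lambda>w. \<bar>Y w\<bar>)"
proof -
  show "(\<integral>w. \<bar>Y w\<bar> \<partial>M) \<le> sqrt (\<integral>w. (Y w)\<^sup>2 \<partial>M)"
    using Cauchy_Schwarz_expectation[of "\<lambda>w. \<bar>Y w\<bar>" "\<lambda>_. 1"] assms by (simp add: prob_space)
  show "integrable M (\<lambda>w. \<bar>Y w\<bar>)"
    using integrable_mult_of_squares[of "\<lambda>w. \<bar>Y w\<bar>" M "\<lambda>_. 1"] assms by simp
qed

definition tavg :: "int set \<Rightarrow> (int \<Rightarrow> 'w \<Rightarrow> real) \<Rightarrow> 'w \<Rightarrow> real" where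
  "tavg T Y w = (\<Sum>t\<in>T. Y t w) / card T"

definition ftil :: "nat \<Rightarrow> int set \<Rightarrow> real \<Rightarrow> 'w \<Rightarrow> real" where
  "ftil b T \<theta> = tavg T (qform (pgw \<theta>) b)"

definition Chat :: "nat \<Rightarrow> int set \<Rightarrow> real \<Rightarrow> real \<Rightarrow> 'w \<Rightarrow> real" where
  "Chat b T \<theta> \<mu> w = tavg T (\<lambda>t w. qform (pgw \<theta>) b t w * qform (pgw \<mu>) b t w) w - ftil b T \<theta> w * ftil b T \<mu> w"

lemma ftil_measurable[measurable]: "ftil b T \<theta> \<in> borel_measurable M"
proof -
  have [measurable]: "qform w b t \<in> borel_measurable M" for w t by (rule qform_measurable)
  show ?thesis unfolding ftil_def tavg_def[abs_def] by measurable
qed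

lemma Chat_measurable[measurable]: "Chat b T \<theta> \<mu> \<in> borel_measurable M"
proof -
  have [measurable]: "qform w b t \<in> borel_measurable M" for w t by (rule qform_measurable)
  show ?thesis unfolding Chat_def[abs_def] tavg_def[abs_def] by measurable
qed

lemma ftil_variance:
  assumes "b \<ge> 1" "finite T" "T \<noteq> {}"
  shows "(\<integral>w. (ftil b T \<theta> w - epg b \<theta>)\<^sup>2 \<partial>M) \<le> cov_const * b / card T"
    "integrable M (\<lambda>w. (ftil b T \<theta> w - epg b \<theta>)\<^sup>2)"
  unfolding ftil_def tavg_def epg_def
  by (rule qform_average_variance[OF abs_pgw_le assms])+

definition trig :: "nat \<Rightarrow> real \<Rightarrow> nat \<Rightarrow> real" where
  "trig \<alpha> \<theta> s = (if \<alpha> = 0 then cos (\<theta> * s) else sin (\<theta> * s))"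

lemma abs_trig_le: "\<bar>trig \<alpha> \<theta> s\<bar> \<le> 1" by (simp add: trig_def)

text \<open>Squared modulus as cosine part plus sine part. A product of two periodograms thereby
  becomes a sum of four products of four linear forms, the shape to which the variance bound for
  averages applies.\<close>

lemma qform_pgw_eq: "qform (pgw \<theta>) b t w = (\<Sum>\<alpha><2. lform (trig \<alpha> \<theta>) b t w * lform (trig \<alpha> \<theta>) b t w) / (2 * pi)"
proof -
  have "(\<Sum>\<alpha><2. lform (trig \<alpha> \<theta>) b t w * lform (trig \<alpha> \<theta>) b t w) =
    qform (\<lambda>s s'. trig 0 \<theta> s * trig 0 \<theta> s') b t w + qform (\<lambda>s s'. trig 1 \<theta> s * trig 1 \<theta> s') b t w"
    by (simp add: lform_mult numeral_2_eq_2)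
  also have "\<dots> / (2 * pi) = qform (pgw \<theta>) b t w"
    unfolding qform_def add_divide_distrib[symmetric] sum.distrib[symmetric] sum_divide_distrib
    by (intro sum.cong refl) (simp add: pgw_def trig_def right_diff_distrib cos_diff field_simps)
  finally show ?thesis by simp
qed

text \<open>The error splits into that of the average of products and, with \<open>x\<close> and
  \<open>y\<close> the errors of the two mean periodograms, into \<open>x * y\<close> and multiples
  of \<open>x\<close> and of \<open>y\<close> by bounded means. Each is estimated in mean by its
  second moment.\<close>

lemma Chat_error:
  obtains K where "K \<ge> 0" "\<And>b T \<theta> \<mu>. b \<ge> 1 \<Longrightarrow> finite T \<Longrightarrow> T \<noteq> {} \<Longrightarrow> b \<le> card T \<Longrightarrow>
     integrable M (\<lambda>w. \<bar>Chat b T \<theta> \<mu> w - kap b \<theta> \<mu>\<bar>) \<and>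
     (\<integral>w. \<bar>Chat b T \<theta> \<mu> w - kap b \<theta> \<mu>\<bar> \<partial>M) \<le> K * sqrt (real b / real (card T) + 1 / real b ^ 3)"
proof -
  obtain Kq where Kq: "Kq \<ge> 0" "\<And>a b T. (\<And>i s. i < 4 \<Longrightarrow> \<bar>a i s\<bar> \<le> 1) \<Longrightarrow> b \<ge> 1 \<Longrightarrow> finite T \<Longrightarrow> T \<noteq> {} \<Longrightarrow>
     (\<integral>w. ((\<Sum>t\<in>T. (\<Prod>i<4::nat. lform (a i) b t w)) / real (card T) - (\<integral>w. (\<Prod>i<4::nat. lform (a i) b 0 w) \<partial>M))\<^sup>2 \<partial>M)
       \<le> Kq * (real b / real (card T) + 1 / real b ^ 3)"
    using lform_quartic_average_variance by blast
  define c where "c = cov_const + 1"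
  define K where "K = 4 * sqrt Kq + 2 * c + 2 * K\<gamma> * sqrt c"
  have c: "c \<ge> 1" using cov_const_nonneg by (simp add: c_def)
  show thesis
  proof
    show "K \<ge> 0" using Kq K_nonneg c by (simp add: K_def)
    fix b T \<theta> \<mu>
    assume b: "b \<ge> (1::nat)" and T: "finite (T :: int set)" "T \<noteq> {}" and bT: "b \<le> card T"
    define r where "r = real b / real (card T) + 1 / real b ^ 3"
    have r0: "r \<ge> 0" by (simp add: r_def)
    define a where "a \<alpha> \<beta> = (\<lambda>i::nat. if i < 2 then trig \<alpha> \<theta> else trig \<beta> \<mu>)" for \<alpha> \<beta> :: nat
    define Z where "Z \<alpha> \<beta> w = (\<Sum>t\<in>T. (\<Prod>i<4::nat. lform (a \<alpha> \<beta> i) b t w)) / card T - (\<integral>w. (\<Prod>i<4::nat. lform (a \<alpha> \<beta> i) b 0 w) \<partial>M)" for \<alpha> \<beta> w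
    have prod4: "(\<Prod>i<4::nat. lform (a \<alpha> \<beta> i) b t w) = lform (trig \<alpha> \<theta>) b t w * lform (trig \<alpha> \<theta>) b t w *
       (lform (trig \<beta> \<mu>) b t w * lform (trig \<beta> \<mu>) b t w)" for \<alpha> \<beta> t w
      by (simp add: a_def numeral_eq_Suc)
    have int4: "integrable M (\<lambda>w. \<Prod>i<4::nat. lform (a \<alpha> \<beta> i) b t w)" for \<alpha> \<beta> t
      using L8_lform by (intro integrable_prod_L8) auto
    have Z_meas[measurable]: "Z \<alpha> \<beta> \<in> borel_measurable M" for \<alpha> \<beta>
      unfolding Z_def[abs_def] using int4 by (intro borel_measurable_diff borel_measurable_divide borel_measurable_sum) auto
    have Z2int: "integrable M (\<lambda>w. (Z \<alpha> \<beta> w)\<^sup>2)" for \<alpha> \<beta>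
    proof -
      have i8: "integrable M (\<lambda>w. (\<Prod>i<4::nat. lform (a \<alpha> \<beta> i) b s w) * (\<Prod>i<4::nat. lform (a \<alpha> \<beta> i) b t w))" for s t
      proof -
        have "integrable M (\<lambda>w. \<Prod>i\<in>{..<8::nat}. (if i < 4 then lform (a \<alpha> \<beta> i) b s else lform (a \<alpha> \<beta> (i - 4)) b t) w)"
          using L8_lform by (intro integrable_prod_L8) auto
        moreover have "(\<Prod>i\<in>{..<8::nat}. (if i < 4 then lform (a \<alpha> \<beta> i) b s else lform (a \<alpha> \<beta> (i - 4)) b t) w) =
           (\<Prod>i<4::nat. lform (a \<alpha> \<beta> i) b s w) * (\<Prod>i<4::nat. lform (a \<alpha> \<beta> i) b t w)" for w
          by (simp add: numeral_eq_Suc)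
        ultimately show ?thesis by simp
      qed
      define P where "P t w = (\<Prod>i<4::nat. lform (a \<alpha> \<beta> i) b t w)" for t w
      define e where "e = (\<integral>w. P 0 w \<partial>M)"
      have "(Z \<alpha> \<beta> w)\<^sup>2 = (\<Sum>s\<in>T. \<Sum>t\<in>T. P s w * P t w) / (card T)\<^sup>2 - 2 * e * ((\<Sum>t\<in>T. P t w) / card T) + e\<^sup>2" for w
      proof -
        have "(\<Sum>s\<in>T. \<Sum>t\<in>T. P s w * P t w) / (card T)\<^sup>2 = ((\<Sum>t\<in>T. P t w) / card T)\<^sup>2"
          by (simp add: power2_eq_square sum_product)
        then show ?thesis by (simp add: Z_def P_def e_def power2_diff)
      qed
      then show ?thesis using i8 int4 by (simp add: P_def)
    qed
    have Z1: "(\<integral>w. \<bar>Z \<alpha> \<beta> w\<bar> \<partial>M) \<le> sqrt Kq * sqrt r" "integrable M (\<lambda>w. \<bar>Z \<alpha> \<beta> w\<bar>)" for \<alpha> \<beta>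
    proof -
      have "(\<integral>w. (Z \<alpha> \<beta> w)\<^sup>2 \<partial>M) \<le> Kq * r"
        unfolding Z_def r_def using abs_trig_le b T by (intro Kq(2)) (auto simp: a_def)
      then have "sqrt (\<integral>w. (Z \<alpha> \<beta> w)\<^sup>2 \<partial>M) \<le> sqrt (Kq * r)" by (rule real_sqrt_le_mono)
      then show "(\<integral>w. \<bar>Z \<alpha> \<beta> w\<bar> \<partial>M) \<le> sqrt Kq * sqrt r"
        using expectation_abs_le_sqrt(1)[OF Z_meas Z2int, of \<alpha> \<beta>] by (simp add: real_sqrt_mult)
      show "integrable M (\<lambda>w. \<bar>Z \<alpha> \<beta> w\<bar>)" by (rule expectation_abs_le_sqrt(2)[OF Z_meas Z2int])
    qed
    define C where "C = tavg T (\<lambda>t w. qform (pgw \<theta>) b t w * qform (pgw \<mu>) b t w)"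
    define EC where "EC = (\<integral>w. qform (pgw \<theta>) b 0 w * qform (pgw \<mu>) b 0 w \<partial>M)"
    have qq: "qform (pgw \<theta>) b t w * qform (pgw \<mu>) b t w =
       (\<Sum>\<alpha><2. \<Sum>\<beta><2. (\<Prod>i<4::nat. lform (a \<alpha> \<beta> i) b t w)) / (2 * pi)\<^sup>2" for t w
      unfolding qform_pgw_eq prod4 by (simp add: sum_product power2_eq_square)
    have CZ: "C w - EC = (\<Sum>\<alpha><2. \<Sum>\<beta><2. Z \<alpha> \<beta> w) / (2 * pi)\<^sup>2" for w
    proof -
      have "EC = (\<Sum>\<alpha><2. \<Sum>\<beta><2. \<integral>w. (\<Prod>i<4::nat. lform (a \<alpha> \<beta> i) b 0 w) \<partial>M) / (2 * pi)\<^sup>2"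
        unfolding EC_def qq using int4 by simp
      moreover have "C w = (\<Sum>\<alpha><2. \<Sum>\<beta><2. (\<Sum>t\<in>T. (\<Prod>i<4::nat. lform (a \<alpha> \<beta> i) b t w)) / card T) / (2 * pi)\<^sup>2"
      proof -
        have "C w = (\<Sum>t\<in>T. \<Sum>\<alpha><2. \<Sum>\<beta><2. (\<Prod>i<4::nat. lform (a \<alpha> \<beta> i) b t w)) / (2 * pi)\<^sup>2 / card T"
          unfolding C_def tavg_def qq sum_divide_distrib[symmetric] by (rule refl)
        also have "(\<Sum>t\<in>T. \<Sum>\<alpha><(2::nat). \<Sum>\<beta><(2::nat). (\<Prod>i<4::nat. lform (a \<alpha> \<beta> i) b t w)) =
            (\<Sum>\<alpha><(2::nat). \<Sum>\<beta><(2::nat). \<Sum>t\<in>T. (\<Prod>i<4::nat. lform (a \<alpha> \<beta> i) b t w))"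
          by (rule sum_swap3[symmetric])
        finally show ?thesis by (simp only: sum_divide_distrib[symmetric]) simp
      qed
      ultimately show ?thesis by (simp add: Z_def sum_subtractf diff_divide_distrib)
    qed
    define x where "x w = ftil b T \<theta> w - epg b \<theta>" for w
    define y where "y w = ftil b T \<mu> w - epg b \<mu>" for w
    have [measurable]: "x \<in> borel_measurable M" "y \<in> borel_measurable M" unfolding x_def[abs_def] y_def[abs_def] by measurable
    have x2: "integrable M (\<lambda>w. (x w)\<^sup>2)" "integrable M (\<lambda>w. (y w)\<^sup>2)"
      unfolding x_def y_def using ftil_variance(2)[OF b T] by auto
    have sx: "sqrt (\<integral>w. (x w)\<^sup>2 \<partial>M) \<le> sqrt c * sqrt r" "sqrt (\<integral>w. (y w)\<^sup>2 \<partial>M) \<le> sqrt c * sqrt r"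
    proof -
      have "cov_const * b / card T \<le> c * r"
      proof -
        have "cov_const * (b / card T) \<le> c * r" using cov_const_nonneg by (intro mult_mono) (auto simp: c_def r_def)
        then show ?thesis by simp
      qed
      then show "sqrt (\<integral>w. (x w)\<^sup>2 \<partial>M) \<le> sqrt c * sqrt r" "sqrt (\<integral>w. (y w)\<^sup>2 \<partial>M) \<le> sqrt c * sqrt r"
        unfolding real_sqrt_mult[symmetric] x_def y_def using ftil_variance(1)[OF b T] by (auto intro: order_trans)
    qed
    have x1: "(\<integral>w. \<bar>x w\<bar> \<partial>M) \<le> sqrt c * sqrt r" "(\<integral>w. \<bar>y w\<bar> \<partial>M) \<le> sqrt c * sqrt r"
      "integrable M (\<lambda>w. \<bar>x w\<bar>)" "integrable M (\<lambda>w. \<bar>y w\<bar>)"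
      using expectation_abs_le_sqrt[of x] expectation_abs_le_sqrt[of y] x2 sx by auto
    have xy: "(\<integral>w. \<bar>x w\<bar> * \<bar>y w\<bar> \<partial>M) \<le> c * r" "integrable M (\<lambda>w. \<bar>x w\<bar> * \<bar>y w\<bar>)"
    proof -
      have "\<bar>\<integral>w. \<bar>x w\<bar> * \<bar>y w\<bar> \<partial>M\<bar> \<le> sqrt (\<integral>w. \<bar>x w\<bar> ^ 2 \<partial>M) * sqrt (\<integral>w. \<bar>y w\<bar> ^ 2 \<partial>M)"
        using x2 by (intro Cauchy_Schwarz_expectation) auto
      also have "\<dots> \<le> (sqrt c * sqrt r) * (sqrt c * sqrt r)"
        using sx by (intro mult_mono) (auto intro!: mult_nonneg_nonneg simp: r0 c order_trans[OF zero_le_one c])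
      also have "\<dots> = c * r"
      proof -
        have "(sqrt c * sqrt r) * (sqrt c * sqrt r) = (sqrt c * sqrt c) * (sqrt r * sqrt r)" by (simp add: mult_ac)
        then show ?thesis using r0 c by simp
      qed
      finally show "(\<integral>w. \<bar>x w\<bar> * \<bar>y w\<bar> \<partial>M) \<le> c * r" by simp
      show "integrable M (\<lambda>w. \<bar>x w\<bar> * \<bar>y w\<bar>)" using x2 by (intro integrable_mult_of_squares) auto
    qed
    define U where "U w = (\<Sum>\<alpha><2. \<Sum>\<beta><2. \<bar>Z \<alpha> \<beta> w\<bar>) + (\<bar>x w\<bar> * \<bar>y w\<bar> + K\<gamma> * \<bar>y w\<bar> + K\<gamma> * \<bar>x w\<bar>)" for w
    have U_int: "integrable M U" unfolding U_def[abs_def] using Z1(2) x1(3,4) xy(2) by simp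
    have le: "\<bar>Chat b T \<theta> \<mu> w - kap b \<theta> \<mu>\<bar> \<le> U w" for w
    proof -
      have "Chat b T \<theta> \<mu> w - kap b \<theta> \<mu> = (C w - EC) - (x w * y w + epg b \<theta> * y w + epg b \<mu> * x w)"
        by (simp add: Chat_def kap_def C_def EC_def x_def y_def algebra_simps)
      then have "\<bar>Chat b T \<theta> \<mu> w - kap b \<theta> \<mu>\<bar> \<le> \<bar>C w - EC\<bar> + (\<bar>x w * y w\<bar> + \<bar>epg b \<theta> * y w\<bar> + \<bar>epg b \<mu> * x w\<bar>)"
        by linarith
      moreover have "\<bar>epg b \<theta> * y w\<bar> \<le> K\<gamma> * \<bar>y w\<bar>" "\<bar>epg b \<mu> * x w\<bar> \<le> K\<gamma> * \<bar>x w\<bar>"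
        unfolding abs_mult using abs_epg_le[OF b] by (auto intro: mult_right_mono)
      moreover have "\<bar>C w - EC\<bar> \<le> (\<Sum>\<alpha><2. \<Sum>\<beta><2. \<bar>Z \<alpha> \<beta> w\<bar>)"
      proof -
        have "\<bar>\<Sum>\<alpha><2. \<Sum>\<beta><2. Z \<alpha> \<beta> w\<bar> \<le> (\<Sum>\<alpha><2. \<Sum>\<beta><2. \<bar>Z \<alpha> \<beta> w\<bar>)"
          by (intro order_trans[OF sum_abs] sum_mono order_refl)
        moreover have "(2 * pi)\<^sup>2 \<ge> 1" using pi_gt3 by (intro one_le_power) simp
        ultimately have "\<bar>\<Sum>\<alpha><2. \<Sum>\<beta><2. Z \<alpha> \<beta> w\<bar> / (2 * pi)\<^sup>2 \<le> (\<Sum>\<alpha><2. \<Sum>\<beta><2. \<bar>Z \<alpha> \<beta> w\<bar>) / 1"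
          by (intro frac_le) (auto intro: sum_nonneg)
        then show ?thesis unfolding CZ by (simp add: abs_divide)
      qed
      ultimately show ?thesis by (simp add: U_def abs_mult)
    qed
    have int: "integrable M (\<lambda>w. \<bar>Chat b T \<theta> \<mu> w - kap b \<theta> \<mu>\<bar>)"
      by (rule Bochner_Integration.integrable_bound[OF U_int]) (use le in \<open>auto intro: order_trans[OF _ abs_ge_self]\<close>)
    have "(\<integral>w. \<bar>Chat b T \<theta> \<mu> w - kap b \<theta> \<mu>\<bar> \<partial>M) \<le> (\<integral>w. U w \<partial>M)"
      using int U_int le by (intro integral_mono)
    also have "\<dots> = (\<Sum>\<alpha><2. \<Sum>\<beta><2. \<integral>w. \<bar>Z \<alpha> \<beta> w\<bar> \<partial>M) + ((\<integral>w. \<bar>x w\<bar> * \<bar>y w\<bar> \<partial>M) + K\<gamma> * (\<integral>w. \<bar>y w\<bar> \<partial>M) + K\<gamma> * (\<integral>w. \<bar>x w\<bar> \<partial>M))"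
      unfolding U_def using Z1(2) x1(3,4) xy(2) by simp
    also have "\<dots> \<le> (\<Sum>\<alpha><(2::nat). \<Sum>\<beta><(2::nat). sqrt Kq * sqrt r) + (c * r + K\<gamma> * (sqrt c * sqrt r) + K\<gamma> * (sqrt c * sqrt r))"
      using Z1(1) x1(1,2) xy(1) K_nonneg by (intro add_mono sum_mono mult_left_mono) auto
    also have "\<dots> = 4 * sqrt Kq * sqrt r + c * r + 2 * K\<gamma> * sqrt c * sqrt r" by simp
    \<comment> \<open>Since \<open>b \<le> card T\<close>, the quantity \<open>r\<close> is at most
      4, hence \<open>r \<le> 2 * sqrt r\<close>: the product of two errors is absorbed into the
      rate.\<close>
    also have "\<dots> \<le> 4 * sqrt Kq * sqrt r + c * (2 * sqrt r) + 2 * K\<gamma> * sqrt c * sqrt r"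
    proof -
      have "b / card T \<le> 1" using bT b by (simp add: divide_le_eq)
      moreover have "1 / real b ^ 3 \<le> 1" using b by (simp add: divide_le_eq one_le_power)
      ultimately have "r \<le> 4" by (simp add: r_def)
      then have "sqrt r \<le> 2" using real_sqrt_le_mono[of r 4] by simp
      then have "r \<le> 2 * sqrt r" using mult_right_mono[of "sqrt r" 2 "sqrt r"] r0 by simp
      then have "c * r \<le> c * (2 * sqrt r)" using c by (intro mult_left_mono) auto
      then show ?thesis by simp
    qed
    also have "\<dots> = (4 * sqrt Kq + 2 * c + 2 * K\<gamma> * sqrt c) * sqrt r" by (simp add: algebra_simps)
    finally show "integrable M (\<lambda>w. \<bar>Chat b T \<theta> \<mu> w - kap b \<theta> \<mu>\<bar>) \<and>
      (\<integral>w. \<bar>Chat b T \<theta> \<mu> w - kap b \<theta> \<mu>\<bar> \<partial>M) \<le> K * sqrt (real b / real (card T) + 1 / real b ^ 3)"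
      using int by (simp add: K_def r_def)
  qed
qed

end

section \<open>Moments under product measures\<close>

lemma (in prob_space) distr_pair_snd:
  assumes "prob_space N"
  shows "distr (N \<Otimes>\<^sub>M M) M snd = M"
proof (intro measure_eqI)
  interpret N: prob_space N by fact
  fix A assume A: "A \<in> sets (distr (N \<Otimes>\<^sub>M M) M snd)"
  then have "emeasure (distr (N \<Otimes>\<^sub>M M) M snd) A = emeasure (N \<Otimes>\<^sub>M M) (space N \<times> A)"
    by (auto simp add: emeasure_distr space_pair_measure dest: sets.sets_into_space intro!: arg_cong2[where f=emeasure])
  with A show "emeasure (distr (N \<Otimes>\<^sub>M M) M snd) A = emeasure M A"
    by (simp add: emeasure_pair_measure_Times N.emeasure_space_1)
qed simp

lemma pair_measure_sum_moments:
  fixes F :: "'a \<Rightarrow> real" and G :: "'b \<Rightarrow> real"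
  assumes P: "prob_space P" and Q: "prob_space Q"
    and F: "F \<in> borel_measurable P" "integrable P (\<lambda>x. (F x)\<^sup>2)" "(\<integral>x. F x \<partial>P) = 0"
    and G: "G \<in> borel_measurable Q" "integrable Q (\<lambda>x. (G x)\<^sup>2)" "(\<integral>x. G x \<partial>Q) = 0"
  shows "(\<integral>z. F (fst z) + G (snd z) \<partial>(P \<Otimes>\<^sub>M Q)) = 0"
    "integrable (P \<Otimes>\<^sub>M Q) (\<lambda>z. F (fst z) + G (snd z))"
    "(\<integral>z. (F (fst z) + G (snd z))\<^sup>2 \<partial>(P \<Otimes>\<^sub>M Q)) = (\<integral>x. (F x)\<^sup>2 \<partial>P) + (\<integral>x. (G x)\<^sup>2 \<partial>Q)"
proof -
  interpret P: prob_space P by fact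
  interpret Q: prob_space Q by fact
  interpret PQ: pair_prob_space P Q ..
  note [measurable] = F(1) G(1)
  have fst_int: "integrable (P \<Otimes>\<^sub>M Q) (\<lambda>z. h (fst z))" "(\<integral>z. h (fst z) \<partial>(P \<Otimes>\<^sub>M Q)) = (\<integral>x. h x \<partial>P)"
    if "integrable P h" for h :: "'a \<Rightarrow> real"
    using that Q.distr_pair_fst[of P] integrable_distr_eq[of fst "P \<Otimes>\<^sub>M Q" P h] integral_distr[of fst "P \<Otimes>\<^sub>M Q" P h]
    by auto
  have snd_int: "integrable (P \<Otimes>\<^sub>M Q) (\<lambda>z. h (snd z))" "(\<integral>z. h (snd z) \<partial>(P \<Otimes>\<^sub>M Q)) = (\<integral>x. h x \<partial>Q)"
    if "integrable Q h" for h :: "'b \<Rightarrow> real"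
    using that Q.distr_pair_snd[OF P] integrable_distr_eq[of snd "P \<Otimes>\<^sub>M Q" Q h] integral_distr[of snd "P \<Otimes>\<^sub>M Q" Q h]
    by auto
  have iF: "integrable P F" by (rule P.square_integrable_imp_integrable[OF F(1,2)])
  have iG: "integrable Q G" by (rule Q.square_integrable_imp_integrable[OF G(1,2)])
  have FG: "integrable (P \<Otimes>\<^sub>M Q) (\<lambda>z. F (fst z) * G (snd z))"
    using fst_int(1)[OF F(2)] snd_int(1)[OF G(2)] by (intro integrable_mult_of_squares) auto
  have FG0: "(\<integral>z. F (fst z) * G (snd z) \<partial>(P \<Otimes>\<^sub>M Q)) = 0"
    using PQ.integral_fst'[OF FG] G(3) by simp
  show "(\<integral>z. F (fst z) + G (snd z) \<partial>(P \<Otimes>\<^sub>M Q)) = 0" "integrable (P \<Otimes>\<^sub>M Q) (\<lambda>z. F (fst z) + G (snd z))"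
    using fst_int[OF iF] snd_int[OF iG] F(3) G(3) by auto
  have "(F (fst z) + G (snd z))\<^sup>2 = (F (fst z))\<^sup>2 + 2 * (F (fst z) * G (snd z)) + (G (snd z))\<^sup>2" for z
    by (simp add: power2_sum)
  then show "(\<integral>z. (F (fst z) + G (snd z))\<^sup>2 \<partial>(P \<Otimes>\<^sub>M Q)) = (\<integral>x. (F x)\<^sup>2 \<partial>P) + (\<integral>x. (G x)\<^sup>2 \<partial>Q)"
    using fst_int[OF F(2)] snd_int[OF G(2)] FG FG0 by simp
qed

lemma PiM_sum_moments:
  fixes h :: "'i \<Rightarrow> 'a \<Rightarrow> real"
  assumes I: "finite I" and D: "prob_space D"
    and h: "\<And>i. i \<in> I \<Longrightarrow> h i \<in> borel_measurable D" "\<And>i. i \<in> I \<Longrightarrow> integrable D (\<lambda>x. (h i x)\<^sup>2)"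
      "\<And>i. i \<in> I \<Longrightarrow> (\<integral>x. h i x \<partial>D) = 0"
  defines "S \<equiv> \<lambda>x. \<Sum>i\<in>I. h i (x i)"
  shows "S \<in> borel_measurable (PiM I (\<lambda>_. D))" "integrable (PiM I (\<lambda>_. D)) (\<lambda>x. (S x)\<^sup>2)"
    "(\<integral>x. S x \<partial>PiM I (\<lambda>_. D)) = 0"
    "(\<integral>x. (S x)\<^sup>2 \<partial>PiM I (\<lambda>_. D)) = (\<Sum>i\<in>I. \<integral>x. (h i x)\<^sup>2 \<partial>D)"
proof -
  interpret D: prob_space D by fact
  interpret product_prob_space "\<lambda>_::'i. D" I ..
  let ?P = "PiM I (\<lambda>_. D)"
  have comp: "(\<lambda>x. g (x i)) \<in> borel_measurable ?P" if "i \<in> I" "g \<in> borel_measurable D" for i and g :: "'a \<Rightarrow> real"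
    using that by measurable
  have comp_int: "integrable ?P (\<lambda>x. g (x i))" "(\<integral>x. g (x i) \<partial>?P) = (\<integral>x. g x \<partial>D)"
    if "i \<in> I" "integrable D g" for i and g :: "'a \<Rightarrow> real"
  proof -
    have d: "distr ?P D (\<lambda>x. x i) = D" using distr_PiM_component[of I "\<lambda>_. D" i] that D by simp
    have m: "(\<lambda>x. x i) \<in> measurable ?P D" using that by measurable
    show "integrable ?P (\<lambda>x. g (x i))" "(\<integral>x. g (x i) \<partial>?P) = (\<integral>x. g x \<partial>D)"
      using that integrable_distr_eq[OF m, of g] integral_distr[OF m, of g] d by auto
  qed
  have h1: "integrable D (h i)" if "i \<in> I" for i by (rule D.square_integrable_imp_integrable[OF h(1)[OF that] h(2)[OF that]])
  show "S \<in> borel_measurable ?P" unfolding S_def using comp h(1) by (intro borel_measurable_sum) auto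
  show "(\<integral>x. S x \<partial>?P) = 0" unfolding S_def using comp_int[OF _ h1] h(3) by simp
  have sq: "(S x)\<^sup>2 = (\<Sum>i\<in>I. \<Sum>j\<in>I. h i (x i) * h j (x j))" for x
    by (simp add: S_def power2_eq_square sum_product)
  have ij_int: "integrable ?P (\<lambda>x. h i (x i) * h j (x j))" if "i \<in> I" "j \<in> I" for i j
    using that comp comp_int(1) h by (intro integrable_mult_of_squares) auto
  have ij: "(\<integral>x. h i (x i) * h j (x j) \<partial>?P) = (if i = j then \<integral>x. (h i x)\<^sup>2 \<partial>D else 0)" if "i \<in> I" "j \<in> I" for i j
  proof (cases "i = j")
    case True
    then show ?thesis using comp_int(2)[OF that(1) h(2)[OF that(1)]] by (simp add: power2_eq_square)
  next
    case False
    \<comment> \<open>Constant factors 1 at the other coordinates turn the mixed product into a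
      product over all of \<open>I\<close>, whose integral factorises.\<close>
    define g where "g l = (if l = i then h i else if l = j then h j else (\<lambda>_. 1))" for l
    have "(\<integral>x. (\<Prod>l\<in>I. g l (x l)) \<partial>?P) = (\<Prod>l\<in>I. \<integral>x. g l x \<partial>D)"
      using I h1 that by (intro product_integral_prod) (auto simp: g_def)
    also have "\<dots> = 0" using that h(3) I by (auto simp: g_def intro!: prod_zero)
    also have "(\<lambda>x. \<Prod>l\<in>I. g l (x l)) = (\<lambda>x. h i (x i) * h j (x j))"
    proof
      fix x
      have "(\<Prod>l\<in>I. g l (x l)) = (\<Prod>l\<in>{i, j}. g l (x l))"
        using that I by (intro prod.mono_neutral_right) (auto simp: g_def)
      then show "(\<Prod>l\<in>I. g l (x l)) = h i (x i) * h j (x j)" using False by (simp add: g_def)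
    qed
    finally show ?thesis using False by simp
  qed
  show "integrable ?P (\<lambda>x. (S x)\<^sup>2)" unfolding sq using ij_int by simp
  show "(\<integral>x. (S x)\<^sup>2 \<partial>?P) = (\<Sum>i\<in>I. \<integral>x. (h i x)\<^sup>2 \<partial>D)"
    unfolding sq using ij_int ij I by (simp add: sum.delta)
qed

section \<open>Conditional moments of the bootstrap\<close>

abbreviation std_exp :: "real measure" where
  "std_exp \<equiv> density lborel (\<lambda>y. ennreal (exponential_density 1 y))"

lemma prob_space_std_exp: "prob_space std_exp"
  by (rule prob_space_exponential_density) simp

lemma std_exp_moments:
  "integrable std_exp (\<lambda>y. y ^ i)" "(\<integral>y. y ^ i \<partial>std_exp) = fact i"
proof -
  interpret prob_space std_exp by (rule prob_space_std_exp)
  have D: "distributed std_exp lborel (\<lambda>y. y) (exponential_density 1)"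
    unfolding distributed_def by (auto simp: distr_id2 sets_eq_imp_space_eq)
  show "integrable std_exp (\<lambda>y. y ^ i)" using erlang_ith_moment_integrable[OF _ D, of i] by simp
  show "(\<integral>y. y ^ i \<partial>std_exp) = fact i" using erlang_ith_moment[OF _ D, of i] by simp
qed

lemma std_exp_centered:
  "integrable std_exp (\<lambda>y. y - 1)" "(\<integral>y. y - 1 \<partial>std_exp) = 0"
  "integrable std_exp (\<lambda>y. (y - 1)\<^sup>2)" "(\<integral>y. (y - 1)\<^sup>2 \<partial>std_exp) = 1"
  "integrable std_exp (\<lambda>y. \<bar>y - 1\<bar> ^ 3)"
proof -
  interpret prob_space std_exp by (rule prob_space_std_exp)
  have m: "integrable std_exp (\<lambda>y. y)" "(\<integral>y. y \<partial>std_exp) = 1" using std_exp_moments[of 1] by simp_all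
  have m2: "integrable std_exp (\<lambda>y. y\<^sup>2)" "(\<integral>y. y\<^sup>2 \<partial>std_exp) = 2"
    using std_exp_moments[of 2] by (simp_all add: fact_numeral)
  have prob_UNIV: "prob UNIV = 1" using prob_space by simp
  have c: "(\<integral>y. c \<partial>std_exp) = c" for c :: real using prob_UNIV by simp
  show "integrable std_exp (\<lambda>y. y - 1)" using m by simp
  show "(\<integral>y. y - 1 \<partial>std_exp) = 0" using m by (simp add: prob_UNIV)
  have sq: "(y - 1)\<^sup>2 = y\<^sup>2 - 2 * y + 1" for y :: real by (simp add: power2_diff)
  show "integrable std_exp (\<lambda>y. (y - 1)\<^sup>2)" unfolding sq using m m2 by simp
  show "(\<integral>y. (y - 1)\<^sup>2 \<partial>std_exp) = 1" unfolding sq using m m2 by (simp add: prob_UNIV)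
  show "integrable std_exp (\<lambda>y. \<bar>y - 1\<bar> ^ 3)"
  proof (rule Bochner_Integration.integrable_bound)
    show "integrable std_exp (\<lambda>y. 1 + (y - 1) ^ 4)"
    proof -
      have eq: "1 + (y - 1) ^ 4 = 2 + y ^ 4 - 4 * y ^ 3 + 6 * y ^ 2 - 4 * y ^ 1" for y :: real
        by (simp add: power4_eq_xxxx power3_eq_cube power2_eq_square algebra_simps)
      show ?thesis unfolding eq
        by (intro Bochner_Integration.integrable_diff Bochner_Integration.integrable_add
            integrable_mult_right std_exp_moments) simp
    qed
    show "AE y in std_exp. norm (\<bar>y - 1\<bar> ^ 3) \<le> norm (1 + (y - 1) ^ 4)"
    proof (rule AE_I2)
      fix y :: real
      have "\<bar>y - 1\<bar> ^ 3 \<le> 1 + \<bar>y - 1\<bar> ^ 4"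
      proof (cases "\<bar>y - 1\<bar> \<le> 1")
        case True
        then have "\<bar>y - 1\<bar> ^ 3 \<le> 1" by (intro power_le_one) auto
        then show ?thesis using zero_le_power[of "\<bar>y - 1\<bar>" 4] by linarith
      next
        case False
        then have "\<bar>y - 1\<bar> ^ 3 \<le> \<bar>y - 1\<bar> ^ 4" by (intro power_increasing) auto
        then show ?thesis by linarith
      qed
      then show "norm (\<bar>y - 1\<bar> ^ 3) \<le> norm (1 + (y - 1) ^ 4)" by simp
    qed
  qed simp
qed

abbreviation exp_draws :: "nat \<Rightarrow> (nat \<Rightarrow> real) measure" where
  "exp_draws r \<equiv> Pi\<^sub>M {1..r} (\<lambda>_. std_exp)"

abbreviation block_draws :: "nat \<Rightarrow> nat \<Rightarrow> (nat \<Rightarrow> nat) measure" where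
  "block_draws k N \<equiv> Pi\<^sub>M {1..k} (\<lambda>_. measure_pmf (pmf_of_set {1..N}))"

lemma prob_space_exp_draws: "prob_space (exp_draws r)"
  by (intro prob_space_PiM prob_space_std_exp)

lemma prob_space_block_draws: "prob_space (block_draws k N)"
  by (intro prob_space_PiM prob_space_measure_pmf)

lemma boot_eq: "boot n b k = exp_draws (n div 2) \<Otimes>\<^sub>M block_draws k (n - b + 1)"
  by (simp add: boot_def)

definition wsum :: "nat \<Rightarrow> (nat \<Rightarrow> real) \<Rightarrow> (nat \<Rightarrow> real) \<Rightarrow> real" where
  "wsum r w u = (\<Sum>j=1..r. w j * (u j - 1))"

lemma wsum_moments:
  "wsum r w \<in> borel_measurable (exp_draws r)" "integrable (exp_draws r) (\<lambda>u. (wsum r w u)\<^sup>2)"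
  "(\<integral>u. wsum r w u \<partial>exp_draws r) = 0" "(\<integral>u. (wsum r w u)\<^sup>2 \<partial>exp_draws r) = (\<Sum>j=1..r. (w j)\<^sup>2)"
proof -
  have m: "(\<lambda>y. c * (y - 1)) \<in> borel_measurable std_exp" for c by simp
  have i: "integrable std_exp (\<lambda>y. (c * (y - 1))\<^sup>2)" for c
    using std_exp_centered(3) by (simp add: power_mult_distrib)
  have z: "(\<integral>y. c * (y - 1) \<partial>std_exp) = 0" for c using std_exp_centered(2) by simp
  have v: "(\<integral>y. (c * (y - 1))\<^sup>2 \<partial>std_exp) = c\<^sup>2" for c
    using std_exp_centered(4) by (simp add: power_mult_distrib)
  note * = PiM_sum_moments[of "{1..r}" std_exp "\<lambda>j y. w j * (y - 1)", OF _ prob_space_std_exp m i z]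
  show "wsum r w \<in> borel_measurable (exp_draws r)" "integrable (exp_draws r) (\<lambda>u. (wsum r w u)\<^sup>2)"
    "(\<integral>u. wsum r w u \<partial>exp_draws r) = 0" "(\<integral>u. (wsum r w u)\<^sup>2 \<partial>exp_draws r) = (\<Sum>j=1..r. (w j)\<^sup>2)"
    using * unfolding wsum_def[abs_def] v by auto
qed

text \<open>The exponential draws and the block indices are independent, so their variances add. The
  \<open>k\<close> block draws are i.i.d. uniform on \<open>N\<close> starting points, and
  \<open>g\<close> is centred under that law.\<close>

lemma bvar_eq:
  fixes g :: "nat \<Rightarrow> real"
  assumes N: "N = n - b + 1" and r: "r = n div 2" and g: "(\<Sum>t=1..N. g t) = 0"
    and Y: "\<And>u i. Y (u, i) = c + wsum r w u + (\<Sum>l=1..k. g (i l))"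
  shows "bvar n b k Y = (\<Sum>j=1..r. (w j)\<^sup>2) + real k * ((\<Sum>t=1..N. (g t)\<^sup>2) / N)"
proof -
  define G where "G i = (\<Sum>l=1..k. g (i l))" for i :: "nat \<Rightarrow> nat"
  let ?D = "measure_pmf (pmf_of_set {1..N})"
  have N0: "{1..N} \<noteq> {}" "finite {1..N}" using N by auto
  have int: "integrable ?D h" for h :: "nat \<Rightarrow> real"
    by (rule integrable_measure_pmf_finite) (use N0 in simp)
  have G: "G \<in> borel_measurable (block_draws k N)" "integrable (block_draws k N) (\<lambda>i. (G i)\<^sup>2)"
    "(\<integral>i. G i \<partial>block_draws k N) = 0" "(\<integral>i. (G i)\<^sup>2 \<partial>block_draws k N) = real k * ((\<Sum>t=1..N. (g t)\<^sup>2) / N)"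
    using PiM_sum_moments[of "{1..k}" ?D "\<lambda>_. g"] prob_space_measure_pmf int g N0
    unfolding G_def[abs_def] by (auto simp: integral_pmf_of_set)
  note pm = pair_measure_sum_moments[OF prob_space_exp_draws[of r] prob_space_block_draws[of k N]
      wsum_moments(1,2,3)[of r w] G(1,2,3)]
  have B: "boot n b k = exp_draws r \<Otimes>\<^sub>M block_draws k N" by (simp add: boot_eq N r)
  interpret B: prob_space "exp_draws r \<Otimes>\<^sub>M block_draws k N"
    by (intro prob_space_pair prob_space_exp_draws prob_space_block_draws)
  have Y': "Y z = c + (wsum r w (fst z) + G (snd z))" for z
    using Y[of "fst z" "snd z"] by (simp add: G_def)
  have mean: "(\<integral>z. Y z \<partial>boot n b k) = c"
    unfolding Y' B Bochner_Integration.integral_add[OF B.integrable_const[of c] pm(2)] pm(1)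
      lebesgue_integral_const B.prob_space by simp
  have "Y z - c = wsum r w (fst z) + G (snd z)" for z by (simp add: Y')
  then have "bvar n b k Y = (\<integral>z. (wsum r w (fst z) + G (snd z))\<^sup>2 \<partial>boot n b k)"
    unfolding bvar_def mean by presburger
  then show ?thesis unfolding B pm(3) wsum_moments(4)[of r w] G(4) .
qed

lemma bprob_fst:
  assumes "r = n div 2" and "{u \<in> space (exp_draws r). Q u} \<in> sets (exp_draws r)"
  shows "bprob n b k (\<lambda>d. Q (fst d)) = measure (exp_draws r) {u \<in> space (exp_draws r). Q u}"
proof -
  let ?P = "exp_draws r" and ?Q = "block_draws k (n - b + 1)"
  interpret Q: prob_space ?Q by (rule prob_space_block_draws)
  have "measure ?P {u \<in> space ?P. Q u} = measure (distr (?P \<Otimes>\<^sub>M ?Q) ?P fst) {u \<in> space ?P. Q u}"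
    by (simp only: Q.distr_pair_fst)
  also have "\<dots> = measure (?P \<Otimes>\<^sub>M ?Q) (fst -` {u \<in> space ?P. Q u} \<inter> space (?P \<Otimes>\<^sub>M ?Q))"
    by (rule measure_distr) (use assms in simp_all)
  also have "fst -` {u \<in> space ?P. Q u} \<inter> space (?P \<Otimes>\<^sub>M ?Q) = {d \<in> space (?P \<Otimes>\<^sub>M ?Q). Q (fst d)}"
    by (auto simp: space_pair_measure)
  finally show ?thesis by (simp add: bprob_def boot_eq assms)
qed

section \<open>A central limit theorem for weighted sums and Polya's theorem\<close>

text \<open>Applied to the centred exponential law and to the normal law alike, so that their
  characteristic functions agree up to a cubic error.\<close>

lemma (in real_distribution) char_cubic_bound:
  assumes m1: "integrable M (\<lambda>x. x)" "(\<integral>x. x \<partial>M) = 0"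
    and m2: "integrable M (\<lambda>x. x\<^sup>2)" "(\<integral>x. x\<^sup>2 \<partial>M) = 1"
    and m3: "integrable M (\<lambda>x. \<bar>x\<bar> ^ 3)"
  shows "\<exists>C\<ge>0. \<forall>s. cmod (char M s - (1 - s\<^sup>2 / 2)) \<le> C * \<bar>s\<bar> ^ 3"
proof (intro exI conjI allI)
  let ?C = "(\<integral>x. \<bar>x\<bar> ^ 3 \<partial>M) / 6"
  show "0 \<le> ?C" by simp
  fix s :: real
  have "cmod (char M s - (1 - s\<^sup>2 * 1 / 2)) \<le> (s\<^sup>2 / 6) * expectation (\<lambda>x. min (6 * x\<^sup>2) (\<bar>s\<bar> * \<bar>x\<bar> ^ 3))"
    using m1 m2 by (intro char_approx3) auto
  also have "\<dots> \<le> (s\<^sup>2 / 6) * expectation (\<lambda>x. \<bar>s\<bar> * \<bar>x\<bar> ^ 3)"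
  proof (intro mult_left_mono integral_mono)
    show "integrable M (\<lambda>x. min (6 * x\<^sup>2) (\<bar>s\<bar> * \<bar>x\<bar> ^ 3))"
      using m2 m3 by (intro integrable_min) auto
  qed (use m3 in auto)
  also have "\<dots> = ?C * \<bar>s\<bar> ^ 3"
  proof -
    have "\<bar>s\<bar> ^ 3 = s\<^sup>2 * \<bar>s\<bar>" by (simp add: power3_eq_cube power2_eq_square)
    then show ?thesis by simp
  qed
  finally show "cmod (char M s - (1 - s\<^sup>2 / 2)) \<le> ?C * \<bar>s\<bar> ^ 3" by simp
qed

lemma real_distribution_centered_normal: "real_distribution (centered_normal v)"
  unfolding centered_normal_def
proof -
  interpret N: prob_space std_normal_distribution by (rule prob_space_normal_density) simp
  show "real_distribution (distr std_normal_distribution borel ((*) (sqrt v)))"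
    by (rule N.real_distribution_distr) simp
qed

lemma char_centered_normal:
  assumes "v \<ge> 0"
  shows "char (centered_normal v) t = complex_of_real (exp (- (t\<^sup>2 * v / 2)))"
proof -
  have "char (centered_normal v) t = char std_normal_distribution (t * sqrt v)"
    unfolding centered_normal_def char_def by (subst integral_distr) (auto simp: mult.assoc)
  then show ?thesis using assms by (simp add: char_std_normal_distribution power_mult_distrib)
qed

lemma isCont_cdf_centered_normal:
  assumes "v > 0"
  shows "isCont (cdf (centered_normal v)) y"
proof -
  interpret real_distribution "centered_normal v" by (rule real_distribution_centered_normal)
  have "{z. sqrt v * z = y} = {y / sqrt v}" using assms by (auto simp: field_simps)
  then have "measure (centered_normal v) {y} = measure std_normal_distribution {y / sqrt v}"
    unfolding centered_normal_def by (subst measure_distr) (auto simp: vimage_def)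
  also have "\<dots> = 0"
  proof -
    have "{y / sqrt v} \<in> null_sets std_normal_distribution"
      using absolutely_continuousI_density[of "\<lambda>x. ennreal (std_normal_density x)" lborel]
      unfolding absolutely_continuous_def by (rule subsetD) auto
    then show ?thesis by (simp add: measure_def null_setsD1)
  qed
  finally show ?thesis by (simp add: isCont_cdf)
qed

lemma char_wsum:
  "char (distr (exp_draws r) borel (wsum r w)) t =
     (\<Prod>j=1..r. char (distr std_exp borel (\<lambda>y. y - 1)) (t * w j))"
proof -
  interpret D: prob_space std_exp by (rule prob_space_std_exp)
  interpret product_prob_space "\<lambda>_::nat. std_exp" "{1..r}" ..
  have meas: "wsum r w \<in> borel_measurable (exp_draws r)" by (rule wsum_moments(1))
  have "char (distr (exp_draws r) borel (wsum r w)) t = (\<integral>u. iexp (t * wsum r w u) \<partial>exp_draws r)"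
    unfolding char_def by (subst integral_distr[OF meas]) auto
  also have "\<dots> = (\<integral>u. (\<Prod>j=1..r. iexp (t * w j * (u j - 1))) \<partial>exp_draws r)"
    by (simp add: wsum_def sum_distrib_left exp_sum[symmetric] mult.assoc)
  also have "\<dots> = (\<Prod>j=1..r. \<integral>y. iexp (t * w j * (y - 1)) \<partial>std_exp)"
    by (rule product_integral_prod) (auto intro!: D.integrable_iexp)
  also have "\<dots> = (\<Prod>j=1..r. char (distr std_exp borel (\<lambda>y. y - 1)) (t * w j))"
    unfolding char_def by (subst integral_distr) auto
  finally show ?thesis .
qed

text \<open>Each exponential factor of the characteristic function is replaced by the normal factor
  with the same variance. The cubic errors add up to at most a constant times the largest weight
  times the sum of squares, which tends to 0.\<close>

lemma wsum_clt:
  assumes lim: "(\<lambda>m. \<Sum>j=1..r m. (w m j)\<^sup>2) \<longlonglongrightarrow> v"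
    and bnd: "\<And>m j. j \<in> {1..r m} \<Longrightarrow> \<bar>w m j\<bar> \<le> e m" and e: "e \<longlonglongrightarrow> 0"
  shows "weak_conv_m (\<lambda>m. distr (exp_draws (r m)) borel (wsum (r m) (w m))) (centered_normal v)"
proof (rule levy_continuity)
  have v: "v \<ge> 0" by (rule LIMSEQ_le_const[OF lim]) (simp add: sum_nonneg)
  show "real_distribution (distr (exp_draws (r m)) borel (wsum (r m) (w m)))" for m
    by (intro prob_space.real_distribution_distr prob_space_exp_draws wsum_moments)
  show "real_distribution (centered_normal v)" by (rule real_distribution_centered_normal)
  fix t
  let ?E = "distr std_exp borel (\<lambda>y. y - 1)"
  interpret D: prob_space std_exp by (rule prob_space_std_exp)
  interpret E: real_distribution ?E by (rule D.real_distribution_distr) simp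
  interpret N: real_distribution std_normal_distribution by (rule real_dist_normal_dist)
  have "\<exists>C\<ge>0. \<forall>s. cmod (char ?E s - (1 - s\<^sup>2 / 2)) \<le> C * \<bar>s\<bar> ^ 3"
    using std_exp_centered by (intro E.char_cubic_bound) (auto simp: integrable_distr_eq integral_distr)
  then obtain C where C: "C \<ge> 0" "\<And>s. cmod (char ?E s - (1 - s\<^sup>2 / 2)) \<le> C * \<bar>s\<bar> ^ 3" by blast
  have "\<exists>C\<ge>0. \<forall>s. cmod (char std_normal_distribution s - (1 - s\<^sup>2 / 2)) \<le> C * \<bar>s\<bar> ^ 3"
  proof (rule N.char_cubic_bound)
    show "integrable std_normal_distribution (\<lambda>x. x)"
      using integrable_std_normal_distribution_moment[of 1] by simp
    show "(\<integral>x. x \<partial>std_normal_distribution) = 0"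
      using integral_std_normal_distribution_moment_odd[of 1] by simp
    show "integrable std_normal_distribution (\<lambda>x. x\<^sup>2)"
      by (rule integrable_std_normal_distribution_moment)
    show "(\<integral>x. x\<^sup>2 \<partial>std_normal_distribution) = 1"
      using std_normal_distribution_even_moments[of 1] by (auto simp: has_bochner_integral_iff)
    show "integrable std_normal_distribution (\<lambda>x. \<bar>x\<bar> ^ 3)"
      using integrable_norm[OF integrable_std_normal_distribution_moment[of 3]] by (simp add: power_abs)
  qed
  then obtain C' where C': "C' \<ge> 0" "\<And>s. cmod (char std_normal_distribution s - (1 - s\<^sup>2 / 2)) \<le> C' * \<bar>s\<bar> ^ 3"
    by blast
  have diff: "cmod (char ?E s - char std_normal_distribution s) \<le> (C + C') * \<bar>s\<bar> ^ 3" for s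
    using norm_triangle_ineq4[of "char ?E s - (1 - s\<^sup>2 / 2)" "char std_normal_distribution s - (1 - s\<^sup>2 / 2)"]
      C(2)[of s] C'(2)[of s] by (simp add: algebra_simps)
  let ?S = "\<lambda>m. \<Sum>j=1..r m. (w m j)\<^sup>2"
  let ?c = "\<lambda>m. char (distr (exp_draws (r m)) borel (wsum (r m) (w m))) t"
  have prodN: "(\<Prod>j=1..r m. char std_normal_distribution (t * w m j)) = complex_of_real (exp (- (t\<^sup>2 * ?S m / 2)))" for m
    by (simp add: char_std_normal_distribution exp_sum[symmetric] of_real_prod[symmetric] power_mult_distrib
        sum_negf sum_divide_distrib sum_distrib_left del: of_real_prod)
  have bound: "cmod (?c m - complex_of_real (exp (- (t\<^sup>2 * ?S m / 2)))) \<le> (C + C') * \<bar>t\<bar> ^ 3 * (e m * ?S m)" for m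
  proof -
    have "cmod (?c m - complex_of_real (exp (- (t\<^sup>2 * ?S m / 2)))) \<le>
        (\<Sum>j=1..r m. cmod (char ?E (t * w m j) - char std_normal_distribution (t * w m j)))"
      unfolding char_wsum prodN[symmetric] by (intro norm_prod_diff E.cmod_char_le_1 N.cmod_char_le_1)
    also have "\<dots> \<le> (\<Sum>j=1..r m. (C + C') * \<bar>t\<bar> ^ 3 * (e m * (w m j)\<^sup>2))"
    proof (rule sum_mono)
      fix j assume j: "j \<in> {1..r m}"
      have "\<bar>w m j\<bar> ^ 3 = \<bar>w m j\<bar> * (w m j)\<^sup>2" by (simp add: power3_eq_cube power2_eq_square)
      also have "\<dots> \<le> e m * (w m j)\<^sup>2" using bnd[OF j] by (intro mult_right_mono) auto
      finally have "(C + C') * \<bar>t\<bar> ^ 3 * \<bar>w m j\<bar> ^ 3 \<le> (C + C') * \<bar>t\<bar> ^ 3 * (e m * (w m j)\<^sup>2)"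
        using C(1) C'(1) by (intro mult_left_mono) auto
      then show "cmod (char ?E (t * w m j) - char std_normal_distribution (t * w m j)) \<le>
          (C + C') * \<bar>t\<bar> ^ 3 * (e m * (w m j)\<^sup>2)"
        using diff[of "t * w m j"] by (simp add: abs_mult power_mult_distrib mult.assoc)
    qed
    finally show ?thesis by (simp add: sum_distrib_left)
  qed
  have "(\<lambda>m. (C + C') * \<bar>t\<bar> ^ 3 * (e m * ?S m)) \<longlonglongrightarrow> 0"
    by (rule tendsto_eq_intros lim e refl)+ simp
  then have z: "(\<lambda>m. ?c m - complex_of_real (exp (- (t\<^sup>2 * ?S m / 2)))) \<longlonglongrightarrow> 0"
    by (rule Lim_null_comparison[OF always_eventually[OF allI[OF bound]]])
  have "(\<lambda>m. complex_of_real (exp (- (t\<^sup>2 * ?S m / 2)))) \<longlonglongrightarrow> complex_of_real (exp (- (t\<^sup>2 * v / 2)))"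
    by (intro tendsto_intros lim) simp
  from tendsto_add[OF z this] show "?c \<longlonglongrightarrow> char (centered_normal v) t"
    by (simp add: char_centered_normal[OF v])
qed

text \<open>
  Polya's theorem; the points where the limit takes the values \<open>i / K\<close> cut the line into pieces
  on which monotonicity controls the error.
\<close>
lemma cdf_uniform_convergence:
  assumes D: "\<And>n. real_distribution (\<mu> n)" and D': "real_distribution \<mu>'"
    and cont: "\<And>x. isCont (cdf \<mu>') x" and conv: "\<And>x. (\<lambda>n. cdf (\<mu> n) x) \<longlonglongrightarrow> cdf \<mu>' x" and \<epsilon>: "\<epsilon> > 0"
  shows "\<forall>\<^sub>F n in sequentially. \<forall>x. \<bar>cdf (\<mu> n) x - cdf \<mu>' x\<bar> \<le> \<epsilon>"
proof -
  interpret D: real_distribution "\<mu> n" for n by fact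
  interpret D': real_distribution \<mu>' by fact
  \<comment> \<open>Two errors of size \<open>1 / K\<close> will occur: the distance of a value to
    the next node, and the convergence at the node itself.\<close>
  obtain K :: nat where K: "K > 0" "2 / real K < \<epsilon>"
    using reals_Archimedean2[of "2 / \<epsilon>"] \<epsilon> by (metis divide_less_eq divide_pos_pos less_trans mult.commute of_nat_0_less_iff zero_less_numeral)
  have "\<exists>x. cdf \<mu>' x = p" if p: "0 < p" "p < 1" for p
  proof -
    have "\<forall>\<^sub>F x in at_bot. cdf \<mu>' x < p" using order_tendstoD(2)[OF D'.cdf_lim_at_bot p(1)] .
    then obtain a where a: "\<And>x. x \<le> a \<Longrightarrow> cdf \<mu>' x < p" by (auto simp: eventually_at_bot_linorder)
    have "\<forall>\<^sub>F x in at_top. p < cdf \<mu>' x" using order_tendstoD(1)[OF D'.cdf_lim_at_top_prob p(2)] .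
    then obtain c where c: "\<And>x. x \<ge> c \<Longrightarrow> p < cdf \<mu>' x" by (auto simp: eventually_at_top_linorder)
    have "\<exists>x\<ge>min a c. x \<le> max a c \<and> cdf \<mu>' x = p"
      using a[of "min a c"] c[of "max a c"] cont
      by (intro IVT') (auto intro!: continuous_at_imp_continuous_on)
    then show ?thesis by blast
  qed
  then have "\<exists>q. \<forall>p. 0 < p \<and> p < 1 \<longrightarrow> cdf \<mu>' (q p) = p" by meson
  then obtain q where q: "\<And>p. 0 < p \<Longrightarrow> p < 1 \<Longrightarrow> cdf \<mu>' (q p) = p" by blast
  have "\<forall>\<^sub>F n in sequentially. \<forall>i\<in>{1..<K}. \<bar>cdf (\<mu> n) (q (i / K)) - cdf \<mu>' (q (i / K))\<bar> < 1 / K"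
    using K by (intro eventually_ball_finite ballI tendstoD[OF conv, unfolded dist_real_def]) auto
  then show ?thesis
  proof eventually_elim
    case (elim n)
    show ?case
    proof
      fix x
      let ?F = "cdf \<mu>' x" and ?Fn = "cdf (\<mu> n) x"
      have F: "0 \<le> ?F" "?F \<le> 1" by (rule D'.cdf_nonneg D'.cdf_bounded_prob)+
      have node2: "cdf \<mu>' (q (i / K)) = i / K" if "0 < i" "i < K" for i :: nat
        using that by (intro q) auto
      have node1: "\<bar>cdf (\<mu> n) (q (i / K)) - i / K\<bar> < 1 / K" if "0 < i" "i < K" for i :: nat
        using elim[rule_format, of i] node2[OF that] that by simp
      note node = node1 node2
      have up: "?Fn \<le> ?F + 2 / K"
      proof -
        \<comment> \<open>\<open>i / K\<close> is the first node strictly above the limit value. If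
          it is not below 1, the trivial bound by 1 suffices.\<close>
        define i where "i = nat \<lfloor>K * ?F\<rfloor> + 1"
        have "real (nat \<lfloor>K * ?F\<rfloor>) = of_int \<lfloor>K * ?F\<rfloor>" using F by simp
        then have i: "K * ?F < i" "i \<le> K * ?F + 1" unfolding i_def by linarith+
        then have i': "?F < i / K" "i / K \<le> ?F + 1 / K" using K by (auto simp: field_simps)
        show ?thesis
        proof (cases "i < K")
          case True
          have "x \<le> q (i / K)"
            using i' node(2)[of i] True D'.cdf_nondecreasing[of "q (i / K)" x] by (fastforce simp: i_def)
          then have "?Fn \<le> cdf (\<mu> n) (q (i / K))" by (rule D.cdf_nondecreasing)
          also have "\<dots> \<le> i / K + 1 / K" using node(1)[of i] True by (simp add: i_def)
          finally show ?thesis using i' by simp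
        next
          case False
          then have "1 \<le> i / K" using K by simp
          moreover have "0 \<le> 1 / real K" by simp
          ultimately show ?thesis using i' D.cdf_bounded_prob[of n x] by (simp add: add_divide_distrib)
        qed
      qed
      have lo: "?F - 2 / K \<le> ?Fn"
      proof -
        \<comment> \<open>For positive \<open>i\<close>, \<open>i / K\<close> is the last node
          strictly below the limit value. Truncated subtraction makes \<open>i = 0\<close> also when
          that value is 0; then nonnegativity suffices.\<close>
        define i where "i = nat \<lceil>K * ?F\<rceil> - 1"
        have "real (nat \<lceil>K * ?F\<rceil>) = of_int \<lceil>K * ?F\<rceil>" using F by simp
        then have i: "i + 1 \<ge> K * ?F" "i > 0 \<Longrightarrow> i < K * ?F" unfolding i_def by linarith+
        have "?F \<le> (i + 1) / K" "i > 0 \<Longrightarrow> i / K < ?F"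
          using K i by (simp_all add: pos_le_divide_eq pos_divide_less_eq mult.commute add.commute)
        then have i': "?F - 1 / K \<le> i / K" "i > 0 \<Longrightarrow> i / K < ?F" by (simp_all add: add_divide_distrib)
        show ?thesis
        proof (cases "i > 0")
          case True
          have "i / K < 1" using i'(2)[OF True] F by linarith
          then have iK: "i < K" using K by simp
          have "q (i / K) \<le> x"
            using i'(2)[OF True] node(2)[OF True iK] D'.cdf_nondecreasing[of x "q (i / K)"] by fastforce
          then have "cdf (\<mu> n) (q (i / K)) \<le> ?Fn" by (rule D.cdf_nondecreasing)
          moreover have "i / K - 1 / K \<le> cdf (\<mu> n) (q (i / K))" using node(1)[OF True iK] by simp
          ultimately show ?thesis using i'(1) by simp
        next
          case False
          then show ?thesis using i'(1) D.cdf_nonneg[of n x] K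
            by (smt (verit) add_divide_distrib divide_nonneg_nonneg of_nat_0 of_nat_0_le_iff divide_eq_0_iff not_gr_zero one_add_one zero_le_one)
        qed
      qed
      show "\<bar>?Fn - ?F\<bar> \<le> \<epsilon>" using up lo K(2) by linarith
    qed
  qed
qed

section \<open>Conditional variances of the hybrid bootstrap\<close>

definition block_cov :: "nat \<Rightarrow> nat \<Rightarrow> (nat \<Rightarrow> real) \<Rightarrow> real \<Rightarrow> real \<Rightarrow> real" where
  "block_cov n b x \<theta> \<mu> = (\<Sum>t=1..n - b + 1. block_pgram b x t \<theta> * block_pgram b x t \<mu>) / real (n - b + 1) -
     mean_block_pgram n b x \<theta> * mean_block_pgram n b x \<mu>"

text \<open>The frequencies with indices \<open>j\<close> and \<open>-j\<close> share one
  exponential variable; this is its coefficient after they are combined.\<close>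

definition freq_weight :: "nat \<Rightarrow> (real \<Rightarrow> real) \<Rightarrow> (real \<Rightarrow> real) \<Rightarrow> nat \<Rightarrow> real" where
  "freq_weight n a fh j = 2 * pi / sqrt (real n) *
     ((a (ffreq (int j) n) + a (- ffreq (int j) n)) * fh (ffreq (int j) n))"

definition normalized_weight :: "nat \<Rightarrow> nat \<Rightarrow> (real \<Rightarrow> real) \<Rightarrow> (nat \<Rightarrow> real) \<Rightarrow> (real \<Rightarrow> real) \<Rightarrow> int \<Rightarrow> real" where
  "normalized_weight n b fh x a j = a (ffreq j b) * (fh (ffreq j b) / mean_block_pgram n b x (ffreq j b))"

definition offdiag_hat :: "nat \<Rightarrow> nat \<Rightarrow> (real \<Rightarrow> real) \<Rightarrow> (nat \<Rightarrow> real) \<Rightarrow> (real \<Rightarrow> real) \<Rightarrow> real" where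
  "offdiag_hat n b fh x a = 4 * pi\<^sup>2 / real b * (\<Sum>j\<in>GG b. \<Sum>j'\<in>GG b - {j, - j}.
     normalized_weight n b fh x a j * normalized_weight n b fh x a j' * block_cov n b x (ffreq j b) (ffreq j' b))"

lemma block_pgram_uminus: "block_pgram b x t (- \<theta>) = block_pgram b x t \<theta>"
  by (simp add: block_pgram_def periodogram_uminus)

lemma mean_block_pgram_uminus: "mean_block_pgram n b x (- \<theta>) = mean_block_pgram n b x \<theta>"
  by (simp add: mean_block_pgram_def block_pgram_uminus)

lemma block_cov_uminus: "block_cov n b x \<theta> (- \<mu>) = block_cov n b x \<theta> \<mu>"
  by (simp add: block_cov_def mean_block_pgram_uminus block_pgram_uminus)

lemma even_at_freq:
  assumes "\<forall>\<theta>\<in>{-pi..pi}. fh (- \<theta>) = fh \<theta>" "j \<in> GG m"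
  shows "fh (- ffreq j m) = fh (ffreq j m)"
  using assms ffreq_in by blast

lemma sum_T_star:
  assumes fh: "\<forall>\<theta>\<in>{-pi..pi}. fh (- \<theta>) = fh \<theta>"
  shows "2 * pi / sqrt (real n) * (\<Sum>j\<in>GG n. a (ffreq j n) * T_star n fh j d) =
    wsum (n div 2) (freq_weight n a fh) (fst d) + 2 * pi / sqrt (real n) * (\<Sum>j\<in>GG n. a (ffreq j n) * fh (ffreq j n))"
proof -
  obtain u i where d: "d = (u, i)" by force
  have even: "fh (- ffreq (int j) n) = fh (ffreq (int j) n)" if "j \<in> {1..n div 2}" for j
    using that by (intro even_at_freq[OF fh]) (auto simp: GG_def)
  have "(\<Sum>j\<in>GG n. a (ffreq j n) * T_star n fh j d) - (\<Sum>j\<in>GG n. a (ffreq j n) * fh (ffreq j n)) =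
      (\<Sum>j\<in>GG n. a (ffreq j n) * fh (ffreq j n) * (u (nat \<bar>j\<bar>) - 1))"
    by (simp add: d T_star_def sum_subtractf[symmetric] algebra_simps)
  also have "\<dots> = (\<Sum>j=1..n div 2. (a (ffreq (int j) n) + a (- ffreq (int j) n)) * fh (ffreq (int j) n) * (u j - 1))"
    unfolding sum_GG by (intro sum.cong refl) (simp add: ffreq_uminus even algebra_simps)
  finally have "2 * pi / sqrt (real n) * ((\<Sum>j\<in>GG n. a (ffreq j n) * T_star n fh j d) - (\<Sum>j\<in>GG n. a (ffreq j n) * fh (ffreq j n))) =
      wsum (n div 2) (freq_weight n a fh) u"
    by (simp add: wsum_def freq_weight_def sum_distrib_left mult.assoc)
  then show ?thesis by (simp add: d right_diff_distrib)
qed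

text \<open>Division by the mean block periodogram makes the estimate \<open>fh\<close> the
  conditional mean of each term, so the centred statistic is a sum of centred i.i.d. block
  contributions.\<close>

lemma sum_I_star:
  assumes "k \<ge> 1" and nz: "\<And>j. j \<in> GG b \<Longrightarrow> mean_block_pgram n b x (ffreq j b) \<noteq> 0"
  shows "sqrt (real n) * (2 * pi / real b) * (\<Sum>j\<in>GG b. a (ffreq j b) * (I_star n b k fh x j (u, i) - fh (ffreq j b))) =
    (\<Sum>l=1..k. sqrt (real n) * (2 * pi / real b) / real k *
       (\<Sum>j\<in>GG b. normalized_weight n b fh x a j * (block_pgram b x (i l) (ffreq j b) - mean_block_pgram n b x (ffreq j b))))"
proof -
  have "I_star n b k fh x j (u, i) - fh (ffreq j b) = (\<Sum>l=1..k. fh (ffreq j b) / mean_block_pgram n b x (ffreq j b) *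
       (block_pgram b x (i l) (ffreq j b) - mean_block_pgram n b x (ffreq j b))) / k" if "j \<in> GG b" for j
  proof -
    have "(\<Sum>l=1..k. fh (ffreq j b) / mean_block_pgram n b x (ffreq j b) *
       (block_pgram b x (i l) (ffreq j b) - mean_block_pgram n b x (ffreq j b))) =
       (\<Sum>l=1..k. fh (ffreq j b) * (block_pgram b x (i l) (ffreq j b) / mean_block_pgram n b x (ffreq j b)) - fh (ffreq j b))"
      using nz[OF that] by (intro sum.cong refl) (simp add: field_simps)
    also have "\<dots> = (\<Sum>l=1..k. fh (ffreq j b) * (block_pgram b x (i l) (ffreq j b) / mean_block_pgram n b x (ffreq j b))) - k * fh (ffreq j b)"
      by (simp add: sum_subtractf)
    finally show ?thesis using assms(1) by (simp add: I_star_def diff_divide_distrib)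
  qed
  then have "(\<Sum>j\<in>GG b. a (ffreq j b) * (I_star n b k fh x j (u, i) - fh (ffreq j b))) =
      (\<Sum>j\<in>GG b. \<Sum>l=1..k. normalized_weight n b fh x a j * (block_pgram b x (i l) (ffreq j b) - mean_block_pgram n b x (ffreq j b)) / k)"
    by (intro sum.cong refl) (simp add: normalized_weight_def sum_distrib_left sum_divide_distrib mult.assoc)
  also have "\<dots> = (\<Sum>l=1..k. (\<Sum>j\<in>GG b. normalized_weight n b fh x a j * (block_pgram b x (i l) (ffreq j b) - mean_block_pgram n b x (ffreq j b))) / k)"
    by (subst sum.swap) (simp add: sum_divide_distrib)
  finally show ?thesis
    by (simp only: sum_distrib_left[symmetric] sum_divide_distrib[symmetric] times_divide_eq_right times_divide_eq_left)
qed

lemma hybrid_variance: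
  assumes n: "n = b * k" "b \<ge> 1" "k \<ge> 1" and fh: "\<forall>\<theta>\<in>{-pi..pi}. fh (- \<theta>) = fh \<theta>"
    and nz: "\<And>j. j \<in> GG b \<Longrightarrow> mean_block_pgram n b x (ffreq j b) \<noteq> 0"
    and Y: "\<And>u i. Y (u, i) = c + wsum (n div 2) w u +
      sqrt (real n) * (2 * pi / real b) * (\<Sum>j\<in>GG b. a (ffreq j b) * (I_star n b k fh x j (u, i) - fh (ffreq j b)))"
  shows "bvar n b k Y - c_corr n b fh x a = (\<Sum>j=1..n div 2. (w j)\<^sup>2) + offdiag_hat n b fh x a"
proof -
  define N where "N = n - b + 1"
  define \<alpha> where "\<alpha> = normalized_weight n b fh x a"
  define I where "I t j = block_pgram b x t (ffreq j b)" for t j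
  define m where "m j = mean_block_pgram n b x (ffreq j b)" for j
  define C where "C j j' = block_cov n b x (ffreq j b) (ffreq j' b)" for j j'
  define s where "s = sqrt (real n) * (2 * pi / real b) / real k"
  define g where "g t = s * (\<Sum>j\<in>GG b. \<alpha> j * (I t j - m j))" for t
  have N: "N > 0" by (simp add: N_def)
  have m_eq: "m j = (\<Sum>t=1..N. I t j) / N" for j by (simp add: m_def mean_block_pgram_def N_def I_def)
  have C_eq: "C j j' = (\<Sum>t=1..N. I t j * I t j') / N - m j * m j'" for j j'
    by (simp add: C_def block_cov_def N_def I_def m_def)
  have cov: "(\<Sum>t=1..N. (I t j - m j) * (I t j' - m j')) / N = C j j'" for j j'
  proof -
    have "(\<Sum>t=1..N. (I t j - m j) * (I t j' - m j')) =
        (\<Sum>t=1..N. I t j * I t j') - m j' * (\<Sum>t=1..N. I t j) - m j * (\<Sum>t=1..N. I t j') + N * (m j * m j')"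
      by (simp add: left_diff_distrib right_diff_distrib sum_subtractf sum_distrib_left mult.commute)
    also have "\<dots> = (\<Sum>t=1..N. I t j * I t j') - N * (m j * m j')"
      using N by (simp add: m_eq field_simps)
    finally show ?thesis using N by (simp add: C_eq diff_divide_distrib)
  qed
  have g0: "(\<Sum>t=1..N. g t) = 0"
  proof -
    have "(\<Sum>t=1..N. I t j - m j) = 0" for j using N by (simp add: sum_subtractf m_eq)
    then have "(\<Sum>j\<in>GG b. \<alpha> j * (\<Sum>t=1..N. I t j - m j)) = 0" by simp
    then have "(\<Sum>t=1..N. \<Sum>j\<in>GG b. \<alpha> j * (I t j - m j)) = 0" by (subst sum.swap) (simp add: sum_distrib_left)
    then show ?thesis by (simp add: g_def sum_distrib_left[symmetric])
  qed
  have "bvar n b k Y = (\<Sum>j=1..n div 2. (w j)\<^sup>2) + real k * ((\<Sum>t=1..N. (g t)\<^sup>2) / N)"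
    by (rule bvar_eq[OF N_def refl g0, of Y c w])
      (simp only: Y sum_I_star[OF n(3) nz] g_def s_def \<alpha>_def I_def m_def)
  moreover have "real k * ((\<Sum>t=1..N. (g t)\<^sup>2) / N) = 4 * pi\<^sup>2 / b * (\<Sum>j\<in>GG b. \<Sum>j'\<in>GG b. \<alpha> j * \<alpha> j' * C j j')"
  proof -
    have "(g t)\<^sup>2 / N = s\<^sup>2 * (\<Sum>j\<in>GG b. \<Sum>j'\<in>GG b. \<alpha> j * \<alpha> j' * ((I t j - m j) * (I t j' - m j') / N))" for t
      unfolding g_def power_mult_distrib power2_eq_square[of "\<Sum>j\<in>GG b. _ j"] sum_product times_divide_eq_right[symmetric]
      by (simp add: sum_divide_distrib mult_ac)
    then have "(\<Sum>t=1..N. (g t)\<^sup>2) / N =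
        s\<^sup>2 * (\<Sum>t=1..N. \<Sum>j\<in>GG b. \<Sum>j'\<in>GG b. \<alpha> j * \<alpha> j' * ((I t j - m j) * (I t j' - m j') / N))"
      by (simp add: sum_divide_distrib sum_distrib_left)
    also have "\<dots> = s\<^sup>2 * (\<Sum>j\<in>GG b. \<Sum>j'\<in>GG b. \<Sum>t=1..N. \<alpha> j * \<alpha> j' * ((I t j - m j) * (I t j' - m j') / N))"
      by (subst sum.swap, intro arg_cong[of _ _ "(*) (s\<^sup>2)"] sum.cong refl, rule sum.swap)
    also have "\<dots> = s\<^sup>2 * (\<Sum>j\<in>GG b. \<Sum>j'\<in>GG b. \<alpha> j * \<alpha> j' * C j j')"
      unfolding cov[symmetric] by (simp add: sum_distrib_left sum_divide_distrib)
    finally have "real k * ((\<Sum>t=1..N. (g t)\<^sup>2) / N) = (real k * s\<^sup>2) * (\<Sum>j\<in>GG b. \<Sum>j'\<in>GG b. \<alpha> j * \<alpha> j' * C j j')" by simp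
    \<comment> \<open>The relation \<open>n = b * k\<close> enters here: the variance of the average
      of \<open>k\<close> blocks, scaled by \<open>n\<close>, has a prefactor free of
      \<open>n\<close>.\<close>
    moreover have "real k * s\<^sup>2 = 4 * pi\<^sup>2 / b"
      using n by (simp add: s_def power_mult_distrib power_divide power2_eq_square[of "real _"] field_simps)
    ultimately show ?thesis by simp
  qed
  moreover have "c_corr n b fh x a = 4 * pi\<^sup>2 / b * (\<Sum>j\<in>GG b. \<alpha> j * \<alpha> j * C j j + \<alpha> j * \<alpha> (- j) * C j (- j))"
  proof -
    have "a (ffreq j b) * (a (ffreq j b) + a (- ffreq j b)) * (fh (ffreq j b))\<^sup>2 *
        ((\<Sum>t=1..n - b + 1. (block_pgram b x t (ffreq j b))\<^sup>2 / (mean_block_pgram n b x (ffreq j b))\<^sup>2) / real (n - b + 1) - 1) =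
        \<alpha> j * \<alpha> j * C j j + \<alpha> j * \<alpha> (- j) * C j (- j)" if j: "j \<in> GG b" for j
    proof -
      have mj: "m j \<noteq> 0" using nz[OF j] by (simp add: m_def)
      \<comment> \<open>The second moment of the normalised block periodogram minus 1 is its
        empirical variance, because its mean is 1.\<close>
      have avg: "(\<Sum>t=1..n - b + 1. (block_pgram b x t (ffreq j b))\<^sup>2 / (mean_block_pgram n b x (ffreq j b))\<^sup>2) / real (n - b + 1) - 1 = C j j / (m j)\<^sup>2"
        unfolding I_def[symmetric] m_def[symmetric] N_def[symmetric] C_eq power2_eq_square sum_divide_distrib[symmetric]
        using mj by (simp add: diff_divide_distrib)
      have cm: "C j (- j) = C j j" by (simp add: C_def ffreq_uminus block_cov_uminus)
      have am: "\<alpha> (- j) = a (- ffreq j b) * (fh (ffreq j b) / m j)"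
        using even_at_freq[OF fh j]
        by (simp add: \<alpha>_def normalized_weight_def m_def ffreq_uminus mean_block_pgram_uminus)
      have aj: "\<alpha> j = a (ffreq j b) * (fh (ffreq j b) / m j)" by (simp add: \<alpha>_def normalized_weight_def m_def)
      show ?thesis unfolding avg cm am aj even_at_freq[OF fh j] using mj by (simp add: power2_eq_square field_simps)
    qed
    then show ?thesis by (simp add: c_corr_def)
  qed
  moreover have "(\<Sum>j\<in>GG b. \<Sum>j'\<in>GG b. \<alpha> j * \<alpha> j' * C j j') =
      (\<Sum>j\<in>GG b. \<Sum>j'\<in>GG b - {j, - j}. \<alpha> j * \<alpha> j' * C j j') + (\<Sum>j\<in>GG b. \<alpha> j * \<alpha> j * C j j + \<alpha> j * \<alpha> (- j) * C j (- j))"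
  proof -
    have "(\<Sum>j\<in>GG b. \<Sum>j'\<in>GG b. \<alpha> j * \<alpha> j' * C j j') = (\<Sum>j\<in>GG b. (\<Sum>j'\<in>GG b - {j, - j}. \<alpha> j * \<alpha> j' * C j j') +
        (\<alpha> j * \<alpha> j * C j j + \<alpha> j * \<alpha> (- j) * C j (- j)))"
      by (intro sum.cong refl) (simp add: sum_GG_split)
    then show ?thesis by (simp add: sum.distrib)
  qed
  ultimately show ?thesis
    by (simp add: offdiag_hat_def \<alpha>_def[symmetric] C_def[symmetric] distrib_left)
qed

lemma bvar_wsum:
  assumes "\<And>u i. Y (u, i) = c + wsum (n div 2) w u"
  shows "bvar n b k Y = (\<Sum>j=1..n div 2. (w j)\<^sup>2)"
  using bvar_eq[OF refl refl, where g = "\<lambda>_. 0" and Y = Y and c = c and w = w] assms by simp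

context
  fixes \<phi> fh :: "real \<Rightarrow> real" and n b k :: nat and x :: "nat \<Rightarrow> real"
  assumes fh: "\<forall>\<theta>\<in>{-pi..pi}. fh (- \<theta>) = fh \<theta>"
begin

lemma V_star_eq: "V_star \<phi> n fh d = wsum (n div 2) (freq_weight n \<phi> fh) (fst d)"
  using sum_T_star[OF fh, of n \<phi> d] by (simp add: V_star_def right_diff_distrib sum_subtractf)

text \<open>The grid version of the fact that the ratio weight integrates to 0 against the spectral
  density. Hence \<open>V1_star\<close> has no additive constant although its terms are not
  centred.\<close>

lemma grid_weight_centered: "(\<Sum>j\<in>GG n. grid_weight \<phi> n fh (ffreq j n) * fh (ffreq j n)) = 0"
proof -
  define A B where "A = 2 * pi / real n * (\<Sum>j\<in>GG n. fh (ffreq j n))"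
    and "B = 2 * pi / real n * (\<Sum>j\<in>GG n. \<phi> (ffreq j n) * fh (ffreq j n))"
  have gw: "grid_weight \<phi> n fh \<theta> = \<phi> \<theta> * A - B" for \<theta> by (simp only: grid_weight_def A_def B_def)
  have "(\<Sum>j\<in>GG n. grid_weight \<phi> n fh (ffreq j n) * fh (ffreq j n)) =
      A * (\<Sum>j\<in>GG n. \<phi> (ffreq j n) * fh (ffreq j n)) - B * (\<Sum>j\<in>GG n. fh (ffreq j n))"
    unfolding gw sum_distrib_left sum_subtractf[symmetric]
    by (intro sum.cong refl) (simp add: algebra_simps)
  then show ?thesis by (simp add: A_def B_def)
qed

lemma V1_star_eq: "V1_star \<phi> n fh d = wsum (n div 2) (freq_weight n (grid_weight \<phi> n fh) fh) (fst d)"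
  using sum_T_star[OF fh, of n "grid_weight \<phi> n fh" d] by (simp add: V1_star_def grid_weight_centered)

lemma tau1_hat_sq_eq: "tau1_hat_sq \<phi> n b k fh = (\<Sum>j=1..n div 2. (freq_weight n \<phi> fh j)\<^sup>2)"
  unfolding tau1_hat_sq_def by (rule bvar_wsum[where c = 0]) (simp add: V_star_eq)

lemma sigma1R_hat_sq_eq:
  "sigma1R_hat_sq \<phi> n b k fh = (\<Sum>j=1..n div 2. (freq_weight n (grid_weight \<phi> n fh) fh j)\<^sup>2)"
  unfolding sigma1R_hat_sq_def by (rule bvar_wsum[where c = 0]) (simp add: V1_star_eq)

lemma
  assumes n: "n = b * k" "b \<ge> 1" "k \<ge> 1"
    and nz: "\<And>j. j \<in> GG b \<Longrightarrow> mean_block_pgram n b x (ffreq j b) \<noteq> 0"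
  shows tau_hat_sq_eq: "tau_hat_sq \<phi> n b k fh x = tau1_hat_sq \<phi> n b k fh + offdiag_hat n b fh x \<phi>"
    and sigmaR_hat_sq_eq: "sigmaR_hat_sq \<phi> n b k fh x = sigma1R_hat_sq \<phi> n b k fh + offdiag_hat n b fh x (grid_weight \<phi> b fh)"
proof -
  show "tau_hat_sq \<phi> n b k fh x = tau1_hat_sq \<phi> n b k fh + offdiag_hat n b fh x \<phi>"
    unfolding tau_hat_sq_def tau1_hat_sq_eq
    by (rule hybrid_variance[OF n fh nz, where c = 0]) (simp_all add: V_star_eq L_star_def)
  show "sigmaR_hat_sq \<phi> n b k fh x = sigma1R_hat_sq \<phi> n b k fh + offdiag_hat n b fh x (grid_weight \<phi> b fh)"
    unfolding sigmaR_hat_sq_def sigma1R_hat_sq_eq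
    by (rule hybrid_variance[OF n fh nz, where c = "sqrt (real n) * (2 * pi / real b) *
          (\<Sum>j\<in>GG b. grid_weight \<phi> b fh (ffreq j b) * fh (ffreq j b))"])
      (simp_all add: V1_star_eq V2_star_def V3_star_def right_diff_distrib sum_subtractf)
qed

lemma V_tilde_eq:
  "V_tilde \<phi> n b k fh x d = wsum (n div 2)
     (\<lambda>j. sqrt (tau_hat_sq \<phi> n b k fh x) / sqrt (tau1_hat_sq \<phi> n b k fh) * freq_weight n \<phi> fh j) (fst d)"
  by (simp add: V_tilde_def V_star_eq wsum_def sum_distrib_left mult.assoc)

text \<open>The modulus comes from the odd extension of the square root. The quotient is left
  uncancelled because it is 0 by convention when the denominator vanishes, and then the whole
  expression is 0.\<close>

lemma bvar_V_tilde:
  "bvar n b k (V_tilde \<phi> n b k fh x) =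
     \<bar>tau_hat_sq \<phi> n b k fh x\<bar> / tau1_hat_sq \<phi> n b k fh * tau1_hat_sq \<phi> n b k fh"
proof -
  have "bvar n b k (V_tilde \<phi> n b k fh x) = (\<Sum>j=1..n div 2.
      (sqrt (tau_hat_sq \<phi> n b k fh x) / sqrt (tau1_hat_sq \<phi> n b k fh) * freq_weight n \<phi> fh j)\<^sup>2)"
    by (rule bvar_wsum[where c = 0]) (simp add: V_tilde_eq)
  also have "\<dots> = (sqrt (tau_hat_sq \<phi> n b k fh x) / sqrt (tau1_hat_sq \<phi> n b k fh))\<^sup>2 * tau1_hat_sq \<phi> n b k fh"
    unfolding power_mult_distrib sum_distrib_left[symmetric] tau1_hat_sq_eq[symmetric] ..
  also have "(sqrt (tau_hat_sq \<phi> n b k fh x) / sqrt (tau1_hat_sq \<phi> n b k fh))\<^sup>2 =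
      \<bar>tau_hat_sq \<phi> n b k fh x\<bar> / tau1_hat_sq \<phi> n b k fh"
  proof -
    have "(sqrt y)\<^sup>2 = \<bar>y\<bar>" for y
      by (metis abs_ge_zero power2_abs real_sqrt_abs2 real_sqrt_mult real_sqrt_pow2 power2_eq_square real_sqrt_abs)
    moreover have "tau1_hat_sq \<phi> n b k fh \<ge> 0" by (simp add: tau1_hat_sq_eq sum_nonneg)
    ultimately show ?thesis by (simp add: power_divide)
  qed
  finally show ?thesis .
qed

end

section \<open>Convergence along deterministic sequences\<close>

lemma bv_measurable_bounded_image: "bv_measurable g \<Longrightarrow> bounded (g ` {-pi..pi})"
  using bv_measurable_bounded[of g] by (auto simp: bounded_iff)

lemma uniform_limit_uminus_arg:
  "uniform_limit {-c..c::real} a \<psi> F \<Longrightarrow> uniform_limit {-c..c} (\<lambda>i \<theta>. a i (- \<theta>)) (\<lambda>\<theta>. \<psi> (- \<theta>)) F"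
  unfolding uniform_limit_iff
proof (intro allI impI)
  fix e :: real
  assume "\<forall>e>0. \<forall>\<^sub>F i in F. \<forall>x\<in>{-c..c}. dist (a i x) (\<psi> x) < e" "e > 0"
  then have "\<forall>\<^sub>F i in F. \<forall>x\<in>{-c..c}. dist (a i x) (\<psi> x) < e" by blast
  then show "\<forall>\<^sub>F i in F. \<forall>x\<in>{-c..c}. dist (a i (- x)) (\<psi> (- x)) < e"
    by eventually_elim auto
qed

lemma riemann_sum_uniform_limit:
  assumes a: "uniform_limit {-pi..pi} a \<psi> sequentially" and \<psi>: "bv_measurable \<psi>"
    and m: "filterlim m at_top sequentially"
  shows "(\<lambda>i. riemann_sum (m i) (a i)) \<longlonglongrightarrow> (LBINT \<theta>:{-pi..pi}. \<psi> \<theta>)"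
proof -
  have "(\<lambda>i. riemann_sum (m i) (a i) - riemann_sum (m i) \<psi>) \<longlonglongrightarrow> 0"
  proof (rule LIMSEQ_I)
    fix e :: real assume "e > 0"
    then have "e / (4 * pi) > 0" by simp
    from uniform_limitD[OF a this] have "\<forall>\<^sub>F i in sequentially. norm (riemann_sum (m i) (a i) - riemann_sum (m i) \<psi> - 0) < e"
    proof eventually_elim
      case (elim i)
      have "\<bar>riemann_sum (m i) (\<lambda>\<theta>. a i \<theta> - \<psi> \<theta>)\<bar> \<le> 2 * pi * (e / (4 * pi))"
        using elim \<open>e > 0\<close> by (intro abs_riemann_sum_le) (auto simp: dist_real_def less_imp_le)
      also have "\<dots> < e" using \<open>e > 0\<close> by simp
      finally show ?case by (simp add: riemann_sum_def sum_subtractf right_diff_distrib)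
    qed
    then show "\<exists>no. \<forall>i\<ge>no. norm (riemann_sum (m i) (a i) - riemann_sum (m i) \<psi> - 0) < e"
      by (simp add: eventually_sequentially)
  qed
  from tendsto_add[OF this filterlim_compose[OF riemann_sum_tendsto[OF \<psi>] m]] show ?thesis by simp
qed

lemma sum_freq_weight_sq:
  assumes n: "n \<ge> 1" and fh: "\<forall>\<theta>\<in>{-pi..pi}. fh (- \<theta>) = fh \<theta>"
  shows "(\<Sum>j=1..n div 2. (freq_weight n a fh j)\<^sup>2) = riemann_sum n (\<lambda>\<theta>. pi * ((a \<theta> + a (- \<theta>)) * fh \<theta>)\<^sup>2)"
proof -
  have even: "fh (- ffreq (int j) n) = fh (ffreq (int j) n)" if "j \<in> {1..n div 2}" for j
    using that by (intro even_at_freq[OF fh]) (auto simp: GG_def)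
  have "riemann_sum n (\<lambda>\<theta>. pi * ((a \<theta> + a (- \<theta>)) * fh \<theta>)\<^sup>2) =
      2 * pi / n * (\<Sum>j=1..n div 2. 2 * pi * ((a (ffreq (int j) n) + a (- ffreq (int j) n)) * fh (ffreq (int j) n))\<^sup>2)"
    unfolding riemann_sum_def sum_GG
    by (intro arg_cong2[of _ _ _ _ "(*)"] sum.cong refl) (simp add: ffreq_uminus even add.commute)
  also have "\<dots> = (\<Sum>j=1..n div 2. (freq_weight n a fh j)\<^sup>2)"
    unfolding sum_distrib_left
  proof (intro sum.cong refl)
    fix j
    let ?B = "(a (ffreq (int j) n) + a (- ffreq (int j) n)) * fh (ffreq (int j) n)"
    have "(freq_weight n a fh j)\<^sup>2 = (2 * pi)\<^sup>2 / n * ?B\<^sup>2"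
      unfolding freq_weight_def power_mult_distrib[of "_ / _"] power_divide by simp
    then show "2 * pi / n * (2 * pi * ?B\<^sup>2) = (freq_weight n a fh j)\<^sup>2" by (simp add: power2_eq_square[of pi])
  qed
  finally show ?thesis by simp
qed

text \<open>The symmetrised form, in which the squared weights of the exponential variables appear
  directly as a Riemann sum.\<close>

lemma var_part1_eq:
  assumes \<psi>: "bv_measurable \<psi>" and f: "bv_measurable f" "\<And>\<theta>. f (- \<theta>) = f \<theta>"
  shows "var_part1 f \<psi> = (LBINT \<theta>:{-pi..pi}. pi * ((\<psi> \<theta> + \<psi> (- \<theta>)) * f \<theta>)\<^sup>2)"
proof -
  let ?g = "\<lambda>\<theta>. \<psi> \<theta>" and ?h = "\<lambda>\<theta>. (\<psi> \<theta> + \<psi> (- \<theta>)) * (f \<theta>)\<^sup>2"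
  have h: "bv_measurable ?h"
    unfolding power2_eq_square by (intro bv_measurable_mult bv_measurable_add bv_measurable_uminus \<psi> f)
  have "2 * (LBINT \<theta>:{-pi..pi}. \<psi> \<theta> * ?h \<theta>) = (LBINT \<theta>:{-pi..pi}. (\<psi> \<theta> + \<psi> (- \<theta>)) * ?h \<theta>)"
    by (rule set_integral_symmetrize[OF \<psi> h, symmetric]) (simp add: f add.commute)
  then have "var_part1 f \<psi> = pi * (LBINT \<theta>:{-pi..pi}. (\<psi> \<theta> + \<psi> (- \<theta>)) * ?h \<theta>)"
    by (simp add: var_part1_def mult.assoc)
  also have "\<dots> = (LBINT \<theta>:{-pi..pi}. pi * ((\<psi> \<theta> + \<psi> (- \<theta>)) * ?h \<theta>))" by simp
  also have "(\<lambda>\<theta>. pi * ((\<psi> \<theta> + \<psi> (- \<theta>)) * ?h \<theta>)) = (\<lambda>\<theta>. pi * ((\<psi> \<theta> + \<psi> (- \<theta>)) * f \<theta>)\<^sup>2)"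
    by (simp add: power2_eq_square mult_ac)
  finally show ?thesis .
qed

lemma var_part1_scale: "var_part1 f (\<lambda>\<theta>. s * \<psi> \<theta>) = s\<^sup>2 * var_part1 f \<psi>"
proof -
  have "s * \<psi> \<theta> * (s * \<psi> \<theta> + s * \<psi> (- \<theta>)) * (f \<theta>)\<^sup>2 = s\<^sup>2 * (\<psi> \<theta> * (\<psi> \<theta> + \<psi> (- \<theta>)) * (f \<theta>)\<^sup>2)" for \<theta>
    by (simp add: power2_eq_square algebra_simps)
  note eq = this
  show ?thesis unfolding var_part1_def eq by simp
qed

section \<open>Error quantities and deterministic sequences of samples\<close>

context spectral_process
begin

text \<open>A sum of squares over the grid: it dominates the maximal squared error, while its
  expectation needs only the variance at each single frequency.\<close>

definition pgram_err :: "nat \<Rightarrow> nat \<Rightarrow> (nat \<Rightarrow> real) \<Rightarrow> real" where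
  "pgram_err n b x = (\<Sum>j\<in>GG b. (mean_block_pgram n b x (ffreq j b) - epg b (ffreq j b))\<^sup>2)"

text \<open>Normalised by \<open>1 / b\<close>, like the off-diagonal part of the bootstrap variance
  whose error it controls.\<close>

definition cov_err :: "nat \<Rightarrow> nat \<Rightarrow> (nat \<Rightarrow> real) \<Rightarrow> real" where
  "cov_err n b x = (\<Sum>j\<in>GG b. \<Sum>j'\<in>GG b - {j, - j}.
     \<bar>block_cov n b x (ffreq j b) (ffreq j' b) - kap b (ffreq j b) (ffreq j' b)\<bar>) / b"

end

text \<open>A sequence of fixed samples \<open>x i\<close> with fixed estimates \<open>fh i\<close>
  on which the three errors tend to 0. The randomness that remains is that of the bootstrap
  draws.\<close>

locale bootstrap_sequence = spectral_process M X for M :: "'w measure" and X +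
  fixes n b k :: "nat \<Rightarrow> nat" and fh :: "nat \<Rightarrow> real \<Rightarrow> real" and x :: "nat \<Rightarrow> nat \<Rightarrow> real" and c :: real
  assumes n_eq: "\<And>i. n i = b i * k i"
    and n_lim: "filterlim n at_top sequentially" and b_lim: "filterlim b at_top sequentially"
    and fh_even: "\<And>i. \<forall>\<theta>\<in>{-pi..pi}. fh i (- \<theta>) = fh i \<theta>"
    and fh_lim: "uniform_limit {-pi..pi} fh (spectral_density M X) sequentially"
    and f_ge: "c > 0" "\<And>\<theta>. \<theta> \<in> {-pi..pi} \<Longrightarrow> c \<le> spectral_density M X \<theta>"
    and pgram_error: "(\<lambda>i. pgram_err (n i) (b i) (x i)) \<longlonglongrightarrow> 0"
    and cov_error: "(\<lambda>i. cov_err (n i) (b i) (x i)) \<longlonglongrightarrow> 0"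
begin

lemma sizes_eventually: "\<forall>\<^sub>F i in sequentially. 1 \<le> n i \<and> 1 \<le> b i \<and> 1 \<le> k i"
proof -
  have "\<forall>\<^sub>F i in sequentially. 1 \<le> n i" using n_lim by (simp add: filterlim_at_top)
  then show ?thesis by eventually_elim (auto simp: n_eq Suc_le_eq)
qed

lemma bounded_f: "bounded (f ` {-pi..pi})"
  by (intro bv_measurable_bounded_image bv_measurable_spectral_density)

lemma sum_freq_weight_sq_tendsto:
  assumes a: "uniform_limit {-pi..pi} a \<psi> sequentially" and \<psi>: "bv_measurable \<psi>"
  shows "(\<lambda>i. \<Sum>j=1..n i div 2. (freq_weight (n i) (a i) (fh i) j)\<^sup>2) \<longlonglongrightarrow> var_part1 f \<psi>"
proof -
  let ?g = "\<lambda>\<theta>. (\<psi> \<theta> + \<psi> (- \<theta>)) * f \<theta>"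
  have s: "bv_measurable (\<lambda>\<theta>. \<psi> \<theta> + \<psi> (- \<theta>))" by (intro bv_measurable_add bv_measurable_uminus \<psi>)
  have g: "bv_measurable ?g" by (intro bv_measurable_mult s bv_measurable_spectral_density)
  have "uniform_limit {-pi..pi} (\<lambda>i \<theta>. (a i \<theta> + a i (- \<theta>)) * fh i \<theta>) ?g sequentially"
    by (intro uniform_lim_mult uniform_limit_add uniform_limit_uminus_arg a fh_lim bounded_f
        bv_measurable_bounded_image s)
  from uniform_lim_mult[OF this this bv_measurable_bounded_image[OF g] bv_measurable_bounded_image[OF g]]
  have "uniform_limit {-pi..pi} (\<lambda>i \<theta>. pi * ((a i \<theta> + a i (- \<theta>)) * fh i \<theta>)\<^sup>2) (\<lambda>\<theta>. pi * (?g \<theta>)\<^sup>2) sequentially"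
    unfolding power2_eq_square
    by (rule uniform_lim_mult[OF uniform_limit_const _ bv_measurable_bounded_image[OF bv_measurable_const]
          bv_measurable_bounded_image[OF bv_measurable_mult[OF g g]]])
  then have "(\<lambda>i. riemann_sum (n i) (\<lambda>\<theta>. pi * ((a i \<theta> + a i (- \<theta>)) * fh i \<theta>)\<^sup>2)) \<longlonglongrightarrow> (LBINT \<theta>:{-pi..pi}. pi * (?g \<theta>)\<^sup>2)"
    by (rule riemann_sum_uniform_limit[OF _ _ n_lim])
      (simp only: power2_eq_square, intro bv_measurable_mult bv_measurable_const g)
  moreover have "\<forall>\<^sub>F i in sequentially. riemann_sum (n i) (\<lambda>\<theta>. pi * ((a i \<theta> + a i (- \<theta>)) * fh i \<theta>)\<^sup>2) =
      (\<Sum>j=1..n i div 2. (freq_weight (n i) (a i) (fh i) j)\<^sup>2)"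
    using sizes_eventually by eventually_elim (rule sum_freq_weight_sq[symmetric], use fh_even in auto)
  ultimately show ?thesis
    by (simp add: var_part1_eq[OF \<psi> bv_measurable_spectral_density spectral_density_even] tendsto_cong)
qed

lemma freq_weight_clt:
  assumes a: "uniform_limit {-pi..pi} a \<psi> sequentially" and \<psi>: "bv_measurable \<psi>"
  shows "weak_conv_m (\<lambda>i. distr (exp_draws (n i div 2)) borel (wsum (n i div 2) (freq_weight (n i) (a i) (fh i))))
    (centered_normal (var_part1 f \<psi>))"
proof -
  obtain B where B: "B \<ge> 0" "\<And>\<theta>. \<theta> \<in> {-pi..pi} \<Longrightarrow> \<bar>\<psi> \<theta>\<bar> \<le> B" using bv_measurable_bounded[OF \<psi>] by blast
  \<comment> \<open>Valid as soon as \<open>a\<close> and \<open>fh\<close> are within distance 1 of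
    their limits: two values of the weight, each at most \<open>B + 1\<close>, times an estimate of
    at most \<open>K\<gamma> + 1\<close>.\<close>
  let ?C = "(2 * (B + 1)) * (K\<gamma> + 1)"
  have "filterlim (\<lambda>i. real (n i)) at_top sequentially" by (rule filterlim_compose[OF filterlim_real_sequentially n_lim])
  then have e: "(\<lambda>i. 2 * pi / sqrt (n i) * ?C) \<longlonglongrightarrow> 0"
    by (intro tendsto_mult_left_zero tendsto_divide_0[OF tendsto_const] filterlim_at_top_imp_at_infinity
        filterlim_compose[OF sqrt_at_top])
  have "\<forall>\<^sub>F i in sequentially. \<forall>j\<in>{1..n i div 2}. \<bar>freq_weight (n i) (a i) (fh i) j\<bar> \<le> 2 * pi / sqrt (n i) * ?C"
    using uniform_limitD[OF a zero_less_one] uniform_limitD[OF fh_lim zero_less_one]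
  proof eventually_elim
    case (elim i)
    show ?case
    proof
      fix j assume j: "j \<in> {1..n i div 2}"
      let ?\<theta> = "ffreq (int j) (n i)"
      have th: "?\<theta> \<in> {-pi..pi}" using j by (intro ffreq_in) (auto simp: GG_def)
      then have th': "- ?\<theta> \<in> {-pi..pi}" by auto
      have "\<bar>a i ?\<theta>\<bar> \<le> B + 1" "\<bar>a i (- ?\<theta>)\<bar> \<le> B + 1"
        using elim(1)[rule_format, OF th] B(2)[OF th] elim(1)[rule_format, OF th'] B(2)[OF th']
        unfolding dist_real_def by linarith+
      then have "\<bar>a i ?\<theta>\<bar> + \<bar>a i (- ?\<theta>)\<bar> \<le> 2 * (B + 1)" by simp
      then have "\<bar>a i ?\<theta> + a i (- ?\<theta>)\<bar> \<le> 2 * (B + 1)" by (rule order.trans[OF abs_triangle_ineq])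
      moreover have "\<bar>fh i ?\<theta>\<bar> \<le> K\<gamma> + 1"
        using elim(2)[rule_format, OF th] abs_spectral_density_le[of ?\<theta>] unfolding dist_real_def by linarith
      ultimately have "\<bar>(a i ?\<theta> + a i (- ?\<theta>)) * fh i ?\<theta>\<bar> \<le> ?C"
        unfolding abs_mult by (rule mult_mono) (use B in auto)
      then have "2 * pi / sqrt (n i) * \<bar>(a i ?\<theta> + a i (- ?\<theta>)) * fh i ?\<theta>\<bar> \<le> 2 * pi / sqrt (n i) * ?C"
        by (intro mult_left_mono) auto
      then show "\<bar>freq_weight (n i) (a i) (fh i) j\<bar> \<le> 2 * pi / sqrt (n i) * ?C"
        unfolding freq_weight_def abs_mult[of "_ / _"] by simp
    qed
  qed
  then obtain i0 where i0: "\<And>i. i \<ge> i0 \<Longrightarrow> \<forall>j\<in>{1..n i div 2}. \<bar>freq_weight (n i) (a i) (fh i) j\<bar> \<le> 2 * pi / sqrt (n i) * ?C"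
    by (auto simp: eventually_sequentially)
  \<comment> \<open>The bound on the weights is known only from \<open>i0\<close> on, whereas the
    limit theorem asks for it at every index; hence the shifted sequence.\<close>
  have "weak_conv_m (\<lambda>i. distr (exp_draws (n (i + i0) div 2)) borel (wsum (n (i + i0) div 2) (freq_weight (n (i + i0)) (a (i + i0)) (fh (i + i0)))))
    (centered_normal (var_part1 f \<psi>))"
    using LIMSEQ_ignore_initial_segment[OF sum_freq_weight_sq_tendsto[OF a \<psi>], of i0] i0
      LIMSEQ_ignore_initial_segment[OF e, of i0]
    by (intro wsum_clt[where e = "\<lambda>i. 2 * pi / sqrt (n (i + i0)) * ?C"]) auto
  then show ?thesis unfolding weak_conv_m_def weak_conv_def
    by (auto intro: LIMSEQ_offset)
qed

lemma mean_block_pgram_uniform: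
  "\<forall>e>0. \<forall>\<^sub>F i in sequentially. \<forall>j\<in>GG (b i). \<bar>mean_block_pgram (n i) (b i) (x i) (ffreq j (b i)) - f (ffreq j (b i))\<bar> < e"
proof (intro allI impI)
  fix e :: real assume e: "e > 0"
  let ?R = "\<lambda>i. pgram_err (n i) (b i) (x i)"
  have "filterlim (\<lambda>i. real (b i)) at_top sequentially" by (rule filterlim_compose[OF filterlim_real_sequentially b_lim])
  then have "(\<lambda>i. sqrt (?R i) + K\<gamma> / b i) \<longlonglongrightarrow> sqrt 0 + 0"
    by (intro tendsto_add tendsto_real_sqrt pgram_error tendsto_divide_0[OF tendsto_const] filterlim_at_top_imp_at_infinity)
  then have "\<forall>\<^sub>F i in sequentially. sqrt (?R i) + K\<gamma> / b i < e" using e by (intro order_tendstoD(2)) auto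
  then show "\<forall>\<^sub>F i in sequentially. \<forall>j\<in>GG (b i). \<bar>mean_block_pgram (n i) (b i) (x i) (ffreq j (b i)) - f (ffreq j (b i))\<bar> < e"
    using sizes_eventually
  proof eventually_elim
    case (elim i)
    show ?case
    proof
      fix j assume j: "j \<in> GG (b i)"
      let ?m = "mean_block_pgram (n i) (b i) (x i) (ffreq j (b i))" and ?e = "epg (b i) (ffreq j (b i))"
      have "(?m - ?e)\<^sup>2 \<le> ?R i" unfolding pgram_err_def using j by (intro member_le_sum finite_GG) auto
      then have "\<bar>?m - ?e\<bar> \<le> sqrt (?R i)" using real_le_rsqrt[of "\<bar>?m - ?e\<bar>"] by simp
      moreover have "\<bar>?e - f (ffreq j (b i))\<bar> \<le> K\<gamma> / b i" using elim(2) by (intro epg_bias) simp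
      ultimately show "\<bar>?m - f (ffreq j (b i))\<bar> < e" using elim(1) by linarith
    qed
  qed
qed

lemma mean_block_pgram_nonzero:
  "\<forall>\<^sub>F i in sequentially. \<forall>j\<in>GG (b i). mean_block_pgram (n i) (b i) (x i) (ffreq j (b i)) \<noteq> 0"
  using mean_block_pgram_uniform[rule_format, OF f_ge(1)]
  by eventually_elim (use f_ge(2)[OF ffreq_in] in fastforce)

lemma offdiag_hat_tendsto:
  assumes a: "uniform_limit {-pi..pi} a \<psi> sequentially" and \<psi>: "bv_measurable \<psi>"
  shows "(\<lambda>i. offdiag_hat (n i) (b i) (fh i) (x i) (a i)) \<longlonglongrightarrow> var_part2 (spectral_density4 M X) \<psi>"
proof -
  let ?S = "{-pi..pi}"
  \<comment> \<open>The mean block periodogram is controlled on the grid only. Continuing it by the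
    spectral density elsewhere makes the quotient with \<open>fh\<close> converge uniformly on the
    whole interval.\<close>
  define ft where "ft i \<theta> = (if \<theta> \<in> (\<lambda>j. ffreq j (b i)) ` GG (b i) then mean_block_pgram (n i) (b i) (x i) \<theta> else f \<theta>)" for i \<theta>
  have ft: "uniform_limit ?S ft f sequentially"
  proof (rule uniform_limitI)
    fix e :: real assume e: "e > 0"
    from mean_block_pgram_uniform[rule_format, OF e]
    show "\<forall>\<^sub>F i in sequentially. \<forall>\<theta>\<in>?S. dist (ft i \<theta>) (f \<theta>) < e"
      by eventually_elim (use e in \<open>auto simp: ft_def dist_real_def\<close>)
  qed
  define \<alpha> where "\<alpha> i \<theta> = a i \<theta> * (fh i \<theta> / ft i \<theta>)" for i \<theta>
  have f_nz: "f \<theta> \<noteq> 0" if "\<theta> \<in> ?S" for \<theta> using f_ge(1) f_ge(2)[OF that] by linarith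
  have "uniform_limit ?S (\<lambda>i \<theta>. fh i \<theta> / ft i \<theta>) (\<lambda>\<theta>. f \<theta> / f \<theta>) sequentially"
    by (rule uniform_lim_divide[OF fh_lim ft bounded_f _ f_ge(1)]) (use f_ge(2) in \<open>fastforce intro: order.trans[OF _ abs_ge_self]\<close>)
  then have "uniform_limit ?S (\<lambda>i \<theta>. fh i \<theta> / ft i \<theta>) (\<lambda>_. 1) sequentially"
    by (rule uniform_limit_cong'[THEN iffD1, rotated -1]) (use f_nz in simp_all)
  then have "uniform_limit ?S \<alpha> (\<lambda>\<theta>. \<psi> \<theta> * 1) sequentially"
    unfolding \<alpha>_def by (intro uniform_lim_mult a bv_measurable_bounded_image \<psi> bv_measurable_const)
  then have \<alpha>: "uniform_limit ?S \<alpha> \<psi> sequentially" by simp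
  have \<alpha>_eq: "normalized_weight (n i) (b i) (fh i) (x i) (a i) j = \<alpha> i (ffreq j (b i))" if "j \<in> GG (b i)" for i j
    using that by (simp add: normalized_weight_def \<alpha>_def ft_def)
  obtain B where B: "B \<ge> 0" "\<And>\<theta>. \<theta> \<in> ?S \<Longrightarrow> \<bar>\<psi> \<theta>\<bar> \<le> B" using bv_measurable_bounded[OF \<psi>] by blast
  let ?C = "\<lambda>i j j'. block_cov (n i) (b i) (x i) (ffreq j (b i)) (ffreq j' (b i))"
  let ?\<kappa> = "\<lambda>i j j'. kap (b i) (ffreq j (b i)) (ffreq j' (b i))"
  let ?R = "\<lambda>i. cov_err (n i) (b i) (x i)"
  have "(\<lambda>i. offdiag_hat (n i) (b i) (fh i) (x i) (a i) - offdiag (b i) \<psi>) \<longlonglongrightarrow> 0"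
  proof (rule LIMSEQ_I)
    fix e :: real assume e: "e > 0"
    \<comment> \<open>Perturbing the weights by at most \<open>\<delta>\<close> costs at most
      \<open>\<delta> * K\<close>, which the choice of \<open>\<delta>\<close> keeps below
      \<open>e / 2\<close>; \<open>\<delta> \<le> 1\<close> keeps the perturbed weights below
      \<open>B + 1\<close>.\<close>
    define K where "K = 4 * pi\<^sup>2 * (2 * B + 1) * (K4 + K\<gamma>\<^sup>2 + 1)"
    have K: "K \<ge> 0" using B K_nonneg by (simp add: K_def)
    define \<delta> where "\<delta> = min 1 (e / (2 * (K + 1)))"
    have \<delta>: "\<delta> > 0" "\<delta> \<le> 1" using e K by (simp_all add: \<delta>_def)
    have "(\<lambda>i. 4 * pi\<^sup>2 * (B + 1)\<^sup>2 * ?R i) \<longlonglongrightarrow> 0" by (rule tendsto_mult_right_zero[OF cov_error])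
    then have "\<forall>\<^sub>F i in sequentially. 4 * pi\<^sup>2 * (B + 1)\<^sup>2 * ?R i < e / 2" using e by (intro order_tendstoD(2)) auto
    then have "\<forall>\<^sub>F i in sequentially. norm (offdiag_hat (n i) (b i) (fh i) (x i) (a i) - offdiag (b i) \<psi> - 0) < e"
      using sizes_eventually uniform_limitD[OF \<alpha> \<delta>(1)]
    proof eventually_elim
      case (elim i)
      have pt: "\<bar>\<alpha> i \<theta> - \<psi> \<theta>\<bar> < \<delta>" "\<bar>\<alpha> i \<theta>\<bar> \<le> B + 1" if "\<theta> \<in> ?S" for \<theta>
        using elim(3)[rule_format, OF that] B(2)[OF that] \<delta>(2) by (auto simp: dist_real_def)
      \<comment> \<open>Covariances and weights are changed one after the other: first
        \<open>u\<close> into \<open>v\<close> with the perturbed weights, then each of the two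
        weights with \<open>v\<close> kept fixed.\<close>
      have term_le: "\<bar>\<alpha> i \<theta> * \<alpha> i \<mu> * u - \<psi> \<theta> * \<psi> \<mu> * v\<bar> \<le> (B + 1)\<^sup>2 * \<bar>u - v\<bar> + \<delta> * (2 * B + 1) * \<bar>v\<bar>"
        if "\<theta> \<in> ?S" "\<mu> \<in> ?S" for \<theta> \<mu> u v
      proof -
        have "\<bar>\<alpha> i \<theta> * \<alpha> i \<mu> * (u - v)\<bar> \<le> (B + 1)\<^sup>2 * \<bar>u - v\<bar>"
          unfolding abs_mult power2_eq_square using pt(2) that B(1) by (intro mult_right_mono mult_mono) auto
        moreover have "\<bar>(\<alpha> i \<theta> * (\<alpha> i \<mu> - \<psi> \<mu>) + (\<alpha> i \<theta> - \<psi> \<theta>) * \<psi> \<mu>) * v\<bar> \<le> \<delta> * (2 * B + 1) * \<bar>v\<bar>"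
        proof -
          have "\<bar>\<alpha> i \<theta> * (\<alpha> i \<mu> - \<psi> \<mu>)\<bar> \<le> (B + 1) * \<delta>"
            unfolding abs_mult using pt that B(1) by (intro mult_mono) (auto simp: less_imp_le)
          moreover have "\<bar>(\<alpha> i \<theta> - \<psi> \<theta>) * \<psi> \<mu>\<bar> \<le> \<delta> * B"
            unfolding abs_mult using pt that B \<delta>(1) by (intro mult_mono) (auto simp: less_imp_le)
          ultimately have "\<bar>\<alpha> i \<theta> * (\<alpha> i \<mu> - \<psi> \<mu>) + (\<alpha> i \<theta> - \<psi> \<theta>) * \<psi> \<mu>\<bar> \<le> \<delta> * (2 * B + 1)"
            by (simp add: algebra_simps)
          then show ?thesis unfolding abs_mult[of _ v] by (intro mult_right_mono) auto
        qed
        moreover have "\<alpha> i \<theta> * \<alpha> i \<mu> * u - \<psi> \<theta> * \<psi> \<mu> * v =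
            \<alpha> i \<theta> * \<alpha> i \<mu> * (u - v) + (\<alpha> i \<theta> * (\<alpha> i \<mu> - \<psi> \<mu>) + (\<alpha> i \<theta> - \<psi> \<theta>) * \<psi> \<mu>) * v"
          by (simp add: algebra_simps)
        ultimately show ?thesis by linarith
      qed
      let ?T = "\<Sum>j\<in>GG (b i). \<Sum>j'\<in>GG (b i) - {j, - j}. \<bar>?\<kappa> i j j'\<bar>"
      let ?D = "\<Sum>j\<in>GG (b i). \<Sum>j'\<in>GG (b i) - {j, - j}. \<bar>?C i j j' - ?\<kappa> i j j'\<bar>"
      have eq: "offdiag_hat (n i) (b i) (fh i) (x i) (a i) - offdiag (b i) \<psi> =
         4 * pi\<^sup>2 / b i * (\<Sum>j\<in>GG (b i). \<Sum>j'\<in>GG (b i) - {j, - j}.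
            \<alpha> i (ffreq j (b i)) * \<alpha> i (ffreq j' (b i)) * ?C i j j' - \<psi> (ffreq j (b i)) * \<psi> (ffreq j' (b i)) * ?\<kappa> i j j')"
        unfolding offdiag_hat_def offdiag_def right_diff_distrib[symmetric] sum_subtractf[symmetric]
        by (intro arg_cong2[of _ _ _ _ "(*)"] sum.cong refl) (simp add: \<alpha>_eq)
      have le: "\<bar>\<Sum>j\<in>GG (b i). \<Sum>j'\<in>GG (b i) - {j, - j}.
            \<alpha> i (ffreq j (b i)) * \<alpha> i (ffreq j' (b i)) * ?C i j j' - \<psi> (ffreq j (b i)) * \<psi> (ffreq j' (b i)) * ?\<kappa> i j j'\<bar> \<le>
          (\<Sum>j\<in>GG (b i). \<Sum>j'\<in>GG (b i) - {j, - j}. (B + 1)\<^sup>2 * \<bar>?C i j j' - ?\<kappa> i j j'\<bar> + \<delta> * (2 * B + 1) * \<bar>?\<kappa> i j j'\<bar>)"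
        by (intro order.trans[OF sum_abs] sum_mono term_le ffreq_in) auto
      have split: "(\<Sum>j\<in>GG (b i). \<Sum>j'\<in>GG (b i) - {j, - j}. (B + 1)\<^sup>2 * \<bar>?C i j j' - ?\<kappa> i j j'\<bar> + \<delta> * (2 * B + 1) * \<bar>?\<kappa> i j j'\<bar>) =
          (B + 1)\<^sup>2 * ?D + \<delta> * (2 * B + 1) * ?T"
        by (simp add: sum.distrib sum_distrib_left)
      have "norm (offdiag_hat (n i) (b i) (fh i) (x i) (a i) - offdiag (b i) \<psi> - 0) \<le>
          4 * pi\<^sup>2 / b i * ((B + 1)\<^sup>2 * ?D + \<delta> * (2 * B + 1) * ?T)"
        unfolding eq real_norm_def diff_0_right abs_mult[of "_ / _"] using le unfolding split
        by (simp add: mult_left_mono divide_right_mono)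
      also have "\<dots> = 4 * pi\<^sup>2 * (B + 1)\<^sup>2 * ?R i + \<delta> * (4 * pi\<^sup>2 * (2 * B + 1) * (?T / b i))"
        by (simp add: cov_err_def algebra_simps add_divide_distrib)
      also have "\<delta> * (4 * pi\<^sup>2 * (2 * B + 1) * (?T / b i)) \<le> \<delta> * K"
      proof -
        have "?T / b i \<le> K4 + K\<gamma>\<^sup>2 + 1" using sum_abs_kap_off_le[of "b i"] elim(2) by linarith
        then show ?thesis unfolding K_def using \<delta>(1) B(1) by (intro mult_left_mono) auto
      qed
      also have "\<delta> * K \<le> e / 2"
      proof -
        have "\<delta> * K \<le> e / (2 * (K + 1)) * (K + 1)"
          using K e \<delta> by (intro mult_mono) (auto simp: \<delta>_def)
        also have "\<dots> = e / 2" using K by (simp add: field_simps)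
        finally show ?thesis .
      qed
      finally show ?case using elim(1) by linarith
    qed
    then show "\<exists>no. \<forall>i\<ge>no. norm (offdiag_hat (n i) (b i) (fh i) (x i) (a i) - offdiag (b i) \<psi> - 0) < e"
      by (simp add: eventually_sequentially)
  qed
  from tendsto_add[OF this filterlim_compose[OF offdiag_tendsto[OF \<psi>] b_lim]] show ?thesis by simp
qed

end

section \<open>Distribution functions of the bootstrap statistics\<close>

lemma bprob_le_eq_cdf:
  assumes q: "q \<in> borel_measurable (exp_draws (n div 2))" and Y: "\<And>d. Y d = q (fst d)"
  shows "bprob n b k (\<lambda>d. Y d \<le> y) = cdf (distr (exp_draws (n div 2)) borel q) y"
proof -
  have "{u \<in> space (exp_draws (n div 2)). q u \<le> y} \<in> sets (exp_draws (n div 2))"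
    using q by (rule borel_measurable_le) simp
  moreover have "q -` {..y} \<inter> space (exp_draws (n div 2)) = {u \<in> space (exp_draws (n div 2)). q u \<le> y}" by auto
  ultimately show ?thesis
    using bprob_fst[OF refl, of n "\<lambda>u. q u \<le> y" b k]
    unfolding cdf_def2 Y by (subst measure_distr[OF q]) (simp_all only: atMost_borel)
qed

lemma AE_exp_draws_pos: "AE u in exp_draws r. \<forall>j\<in>{1..r}. 0 < u j"
proof -
  have "AE y in std_exp. 0 < y"
    using AE_lborel_singleton[of "0::real"]
    by (subst AE_density) (auto simp: exponential_density_def elim!: eventually_mono)
  then have "\<forall>j\<in>{1..r}. AE u in exp_draws r. 0 < u j"
    by (intro ballI AE_PiM_component prob_space_std_exp)
  then show ?thesis by (simp add: AE_ball_countable)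
qed

lemma freq_weight_linear:
  "freq_weight n (\<lambda>\<theta>. \<alpha> * a \<theta> + \<beta> * a' \<theta>) fh j = \<alpha> * freq_weight n a fh j + \<beta> * freq_weight n a' fh j"
  unfolding freq_weight_def by (simp add: algebra_simps)

lemma wsum_linear: "wsum r (\<lambda>j. \<alpha> * w j + \<beta> * w' j) u = \<alpha> * wsum r w u + \<beta> * wsum r w' u"
  by (simp add: wsum_def distrib_right sum.distrib sum_distrib_left mult.assoc)

lemma grid_weight_eq:
  "grid_weight \<phi> m fh \<theta> = riemann_sum m fh * \<phi> \<theta> + - riemann_sum m (\<lambda>\<theta>. \<phi> \<theta> * fh \<theta>)"
  by (simp add: grid_weight_def riemann_sum_def)

lemma D_star_eq:
  assumes n: "n \<ge> 1" and fh: "\<forall>\<theta>\<in>{-pi..pi}. fh (- \<theta>) = fh \<theta>"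
  shows "D_star n fh d = riemann_sum n fh / sqrt n * wsum (n div 2) (freq_weight n (\<lambda>_. 1) fh) (fst d) + (riemann_sum n fh)\<^sup>2"
proof -
  have "2 * pi / n * (\<Sum>j\<in>GG n. T_star n fh j d) = (2 * pi / sqrt n * (\<Sum>j\<in>GG n. T_star n fh j d)) / sqrt n"
    using n by simp
  also have "\<dots> = (wsum (n div 2) (freq_weight n (\<lambda>_. 1) fh) (fst d) + 2 * pi / sqrt n * (\<Sum>j\<in>GG n. fh (ffreq j n))) / sqrt n"
    using sum_T_star[OF fh, of n "\<lambda>_. 1" d] by simp
  also have "\<dots> = wsum (n div 2) (freq_weight n (\<lambda>_. 1) fh) (fst d) / sqrt n + riemann_sum n fh"
    using n by (simp add: riemann_sum_def add_divide_distrib)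
  finally have T: "2 * pi / n * (\<Sum>j\<in>GG n. T_star n fh j d) = \<dots>" .
  have "2 * pi / n * (\<Sum>j\<in>GG n. fh (ffreq j n)) = riemann_sum n fh" by (simp only: riemann_sum_def)
  then show ?thesis unfolding D_star_def T by (simp add: power2_eq_square distrib_right)
qed

lemma D_star_pos:
  assumes n: "n \<ge> 2" and fh: "\<And>\<theta>. \<theta> \<in> {-pi..pi} \<Longrightarrow> fh \<theta> > 0" and u: "\<And>j. j \<in> {1..n div 2} \<Longrightarrow> 0 < u j"
  shows "D_star n fh (u, i) > 0"
proof -
  have ne: "GG n \<noteq> {}"
  proof -
    have "1 \<in> GG n" using n by (auto simp: GG_def)
    then show ?thesis by blast
  qed
  have fj: "fh (ffreq j n) > 0" if "j \<in> GG n" for j using fh[OF ffreq_in[OF that]] .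
  have "T_star n fh j (u, i) > 0" if "j \<in> GG n" for j
  proof -
    have "nat \<bar>j\<bar> \<in> {1..n div 2}" using that by (auto simp: GG_def)
    then show ?thesis using fj[OF that] u by (simp add: T_star_def)
  qed
  then have "(\<Sum>j\<in>GG n. T_star n fh j (u, i)) > 0" "(\<Sum>j\<in>GG n. fh (ffreq j n)) > 0"
    using ne fj by (auto intro!: sum_pos finite_GG)
  then show ?thesis using n unfolding D_star_def by (intro mult_pos_pos divide_pos_pos) auto
qed

lemma uniform_limit_of_tendsto: "(A \<longlongrightarrow> a) F \<Longrightarrow> uniform_limit S (\<lambda>i _. A i) (\<lambda>_. a) F"
  by (auto simp: uniform_limit_iff tendsto_iff elim!: eventually_mono)

lemma uniform_limit_affine:
  fixes \<psi> :: "real \<Rightarrow> real"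
  assumes "uniform_limit {-pi..pi} a \<psi> F" "bv_measurable \<psi>" "(A \<longlongrightarrow> s) F" "(B \<longlongrightarrow> t) F"
  shows "uniform_limit {-pi..pi} (\<lambda>i \<theta>. A i * a i \<theta> + B i) (\<lambda>\<theta>. s * \<psi> \<theta> + t) F"
  using assms
  by (intro uniform_limit_add uniform_lim_mult uniform_limit_of_tendsto bv_measurable_bounded_image
      bv_measurable_const)

context bootstrap_sequence
begin

context
  fixes \<phi> :: "real \<Rightarrow> real"
  assumes \<phi>: "bv_measurable \<phi>"
begin

abbreviation (input) \<tau>hat where "\<tau>hat i \<equiv> tau_hat_sq \<phi> (n i) (b i) (k i) (fh i) (x i)"
abbreviation (input) \<tau>hat1 where "\<tau>hat1 i \<equiv> tau1_hat_sq \<phi> (n i) (b i) (k i) (fh i)"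
abbreviation (input) \<sigma>hat where "\<sigma>hat i \<equiv> sigmaR_hat_sq \<phi> (n i) (b i) (k i) (fh i) (x i)"
abbreviation (input) \<sigma>hat1 where "\<sigma>hat1 i \<equiv> sigma1R_hat_sq \<phi> (n i) (b i) (k i) (fh i)"
abbreviation (input) W where "W \<equiv> ratio_weight f \<phi>"

lemma \<tau>hat1_tendsto: "\<tau>hat1 \<longlonglongrightarrow> var_part1 f \<phi>"
  using sum_freq_weight_sq_tendsto[OF uniform_limit_const \<phi>] by (simp add: tau1_hat_sq_eq[OF fh_even])

lemma \<tau>hat_tendsto: "\<tau>hat \<longlonglongrightarrow> tau_sq M X \<phi>"
proof -
  have "(\<lambda>i. \<tau>hat1 i + offdiag_hat (n i) (b i) (fh i) (x i) \<phi>) \<longlonglongrightarrow> tau_sq M X \<phi>"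
    unfolding tau_sq_def by (intro tendsto_add \<tau>hat1_tendsto offdiag_hat_tendsto uniform_limit_const \<phi>)
  moreover have "\<forall>\<^sub>F i in sequentially. \<tau>hat1 i + offdiag_hat (n i) (b i) (fh i) (x i) \<phi> = \<tau>hat i"
    using sizes_eventually mean_block_pgram_nonzero
    by eventually_elim (rule tau_hat_sq_eq[OF fh_even n_eq, symmetric], auto)
  ultimately show ?thesis by (rule Lim_transform_eventually)
qed

lemma f_pos: "\<theta> \<in> {-pi..pi} \<Longrightarrow> f \<theta> > 0"
  using f_ge by fastforce

lemma tau_sq_nonneg: "tau_sq M X \<phi> \<ge> 0"
  unfolding tau_sq_def by (rule var_parts_nonneg[OF \<phi>])

lemma bvar_V_tilde_tendsto:
  "(\<lambda>i. bvar (n i) (b i) (k i) (V_tilde \<phi> (n i) (b i) (k i) (fh i) (x i))) \<longlonglongrightarrow> tau_sq M X \<phi>"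
proof -
  have abs: "(\<lambda>i. \<bar>\<tau>hat i\<bar>) \<longlonglongrightarrow> tau_sq M X \<phi>"
    using tendsto_rabs[OF \<tau>hat_tendsto] tau_sq_nonneg by simp
  have eq: "bvar (n i) (b i) (k i) (V_tilde \<phi> (n i) (b i) (k i) (fh i) (x i)) = \<bar>\<tau>hat i\<bar> / \<tau>hat1 i * \<tau>hat1 i" for i
    by (rule bvar_V_tilde[OF fh_even])
  show ?thesis
  proof (cases "var_part1 f \<phi> > 0")
    case True
    have "\<forall>\<^sub>F i in sequentially. \<tau>hat1 i > 0" by (rule order_tendstoD(1)[OF \<tau>hat1_tendsto True])
    then have "\<forall>\<^sub>F i in sequentially. \<bar>\<tau>hat i\<bar> = bvar (n i) (b i) (k i) (V_tilde \<phi> (n i) (b i) (k i) (fh i) (x i))"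
      by eventually_elim (simp add: eq)
    then show ?thesis by (rule Lim_transform_eventually[OF abs])
  next
    case False
    then have "var_part2 (spectral_density4 M X) \<phi> = 0" by (intro var_part2_degenerate[OF \<phi> f_pos]) auto
    \<comment> \<open>Here \<open>tau1_hat_sq\<close> may vanish for some samples. The conditional
      variance is then 0, and otherwise the modulus of \<open>tau_hat_sq\<close>; in either case it
      lies between 0 and a quantity tending to 0.\<close>
    then have zero: "tau_sq M X \<phi> = 0" using False tau_sq_nonneg by (simp add: tau_sq_def)
    show ?thesis unfolding zero
    proof (rule tendsto_sandwich[OF _ _ tendsto_const abs[unfolded zero]])
      show "\<forall>\<^sub>F i in sequentially. 0 \<le> bvar (n i) (b i) (k i) (V_tilde \<phi> (n i) (b i) (k i) (fh i) (x i))"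
        by (simp add: bvar_def)
      show "\<forall>\<^sub>F i in sequentially. bvar (n i) (b i) (k i) (V_tilde \<phi> (n i) (b i) (k i) (fh i) (x i)) \<le> \<bar>\<tau>hat i\<bar>"
        by (simp add: eq)
    qed
  qed
qed

text \<open>Given the data the rescaling factor is a number, so it is absorbed into the weights of
  the exponential variables. Positivity of the limiting variance forces its first part to be
  positive, which makes the factor converge, and it makes the limit law continuous.\<close>

lemma V_tilde_cdf_tendsto:
  assumes pos: "tau_sq M X \<phi> > 0" and e: "e > 0"
  shows "\<forall>\<^sub>F i in sequentially. \<forall>y. \<bar>bprob (n i) (b i) (k i) (\<lambda>d. V_tilde \<phi> (n i) (b i) (k i) (fh i) (x i) d \<le> y) -
    cdf (centered_normal (tau_sq M X \<phi>)) y\<bar> \<le> e"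
proof -
  define s where "s i = sqrt (\<tau>hat i) / sqrt (\<tau>hat1 i)" for i
  define \<sigma> where "\<sigma> = sqrt (tau_sq M X \<phi>) / sqrt (var_part1 f \<phi>)"
  have v1: "var_part1 f \<phi> > 0"
    using pos var_part2_degenerate[OF \<phi> f_pos] by (force simp: tau_sq_def)
  have s: "s \<longlonglongrightarrow> \<sigma>"
    unfolding s_def \<sigma>_def using v1 by (intro tendsto_divide tendsto_real_sqrt \<tau>hat_tendsto \<tau>hat1_tendsto) simp
  have "uniform_limit {-pi..pi} (\<lambda>i \<theta>. s i * \<phi> \<theta> + 0) (\<lambda>\<theta>. \<sigma> * \<phi> \<theta> + 0) sequentially"
    by (rule uniform_limit_affine[OF uniform_limit_const \<phi> s tendsto_const])
  then have lim: "uniform_limit {-pi..pi} (\<lambda>i \<theta>. s i * \<phi> \<theta>) (\<lambda>\<theta>. \<sigma> * \<phi> \<theta>) sequentially" by simp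
  have var: "var_part1 f (\<lambda>\<theta>. \<sigma> * \<phi> \<theta>) = tau_sq M X \<phi>"
    unfolding var_part1_scale \<sigma>_def using v1 pos by (simp add: power_divide)
  let ?w = "\<lambda>i. wsum (n i div 2) (freq_weight (n i) (\<lambda>\<theta>. s i * \<phi> \<theta>) (fh i))"
  have conv: "weak_conv_m (\<lambda>i. distr (exp_draws (n i div 2)) borel (?w i)) (centered_normal (tau_sq M X \<phi>))"
    using freq_weight_clt[OF lim bv_measurable_mult[OF bv_measurable_const \<phi>]] unfolding var .
  have "V_tilde \<phi> (n i) (b i) (k i) (fh i) (x i) d = ?w i (fst d)" for i d
  proof -
    have "freq_weight (n i) (\<lambda>\<theta>. s i * \<phi> \<theta>) (fh i) = (\<lambda>j. s i * freq_weight (n i) \<phi> (fh i) j)"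
      using freq_weight_linear[of "n i" "s i" \<phi> 0 \<phi> "fh i"] by auto
    then show ?thesis by (simp only: V_tilde_eq[OF fh_even] s_def)
  qed
  then have eq: "bprob (n i) (b i) (k i) (\<lambda>d. V_tilde \<phi> (n i) (b i) (k i) (fh i) (x i) d \<le> y) =
      cdf (distr (exp_draws (n i div 2)) borel (?w i)) y" for i y
    by (rule bprob_le_eq_cdf[OF wsum_moments(1)])
  show ?thesis
    unfolding eq
  proof (rule cdf_uniform_convergence[OF _ real_distribution_centered_normal isCont_cdf_centered_normal[OF pos] _ e])
    show "real_distribution (distr (exp_draws (n i div 2)) borel (?w i))" for i
      by (intro prob_space.real_distribution_distr prob_space_exp_draws wsum_moments)
    show "(\<lambda>i. cdf (distr (exp_draws (n i div 2)) borel (?w i)) y) \<longlonglongrightarrow> cdf (centered_normal (tau_sq M X \<phi>)) y" for y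
      using conv isCont_cdf_centered_normal[OF pos] by (simp add: weak_conv_m_def weak_conv_def)
  qed
qed

lemma bv_measurable_W: "bv_measurable W"
proof -
  have "W = (\<lambda>\<theta>. \<phi> \<theta> * (LBINT \<alpha>:{-pi..pi}. f \<alpha>) + - (LBINT \<alpha>:{-pi..pi}. \<phi> \<alpha> * f \<alpha>))"
    by (auto simp: ratio_weight_def)
  then show ?thesis by (simp only:, intro bv_measurable_add bv_measurable_mult bv_measurable_const \<phi>)
qed

lemma grid_weight_uniform_limit:
  assumes m: "filterlim m at_top sequentially"
  shows "uniform_limit {-pi..pi} (\<lambda>i. grid_weight \<phi> (m i) (fh i)) W sequentially"
proof -
  have "uniform_limit {-pi..pi} (\<lambda>i \<theta>. \<phi> \<theta> * fh i \<theta>) (\<lambda>\<theta>. \<phi> \<theta> * f \<theta>) sequentially"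
    by (intro uniform_lim_mult uniform_limit_const fh_lim bounded_f bv_measurable_bounded_image \<phi>)
  then have "(\<lambda>i. - riemann_sum (m i) (\<lambda>\<theta>. \<phi> \<theta> * fh i \<theta>)) \<longlonglongrightarrow> - (LBINT \<theta>:{-pi..pi}. \<phi> \<theta> * f \<theta>)"
    by (intro tendsto_minus riemann_sum_uniform_limit m bv_measurable_mult \<phi> bv_measurable_spectral_density)
  from uniform_limit_affine[OF uniform_limit_const \<phi> riemann_sum_uniform_limit[OF fh_lim bv_measurable_spectral_density m] this]
  show ?thesis by (simp add: grid_weight_eq[abs_def] ratio_weight_def[abs_def] mult.commute)
qed

lemma \<sigma>hat1_tendsto: "\<sigma>hat1 \<longlonglongrightarrow> var_part1 f W"
  using sum_freq_weight_sq_tendsto[OF grid_weight_uniform_limit[OF n_lim] bv_measurable_W]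
  by (simp add: sigma1R_hat_sq_eq[OF fh_even])

lemma \<sigma>hat_tendsto: "\<sigma>hat \<longlonglongrightarrow> var_part1 f W + var_part2 (spectral_density4 M X) W"
proof -
  have "(\<lambda>i. \<sigma>hat1 i + offdiag_hat (n i) (b i) (fh i) (x i) (grid_weight \<phi> (b i) (fh i))) \<longlonglongrightarrow>
      var_part1 f W + var_part2 (spectral_density4 M X) W"
    by (intro tendsto_add \<sigma>hat1_tendsto offdiag_hat_tendsto grid_weight_uniform_limit b_lim bv_measurable_W)
  moreover have "\<forall>\<^sub>F i in sequentially. \<sigma>hat1 i + offdiag_hat (n i) (b i) (fh i) (x i) (grid_weight \<phi> (b i) (fh i)) = \<sigma>hat i"
    using sizes_eventually mean_block_pgram_nonzero
    by eventually_elim (rule sigmaR_hat_sq_eq[OF fh_even n_eq, symmetric], auto)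
  ultimately show ?thesis by (rule Lim_transform_eventually)
qed

lemma integral_f_pos: "(LBINT \<theta>:{-pi..pi}. f \<theta>) > 0"
proof -
  have "2 * pi * c = (LBINT \<theta>:{-pi..pi}. c)" by (simp add: set_lebesgue_integral_def)
  also have "\<dots> \<le> (LBINT \<theta>:{-pi..pi}. f \<theta>)"
    by (intro set_integral_mono bv_measurable_integrable bv_measurable_const bv_measurable_spectral_density f_ge(2)) auto
  finally show ?thesis using f_ge(1) by (smt (verit) mult_pos_pos pi_gt_zero)
qed

text \<open>
  Since \<open>D\<^sup>* > 0\<close> almost surely, the event \<open>V\<^sub>1\<^sup>* / D\<^sup>* \<le> y\<close> is a half space for a weighted sum of the
  exponential variables, to which the central limit theorem applies directly.
\<close>
lemma VR_tilde_cdf_tendsto: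
  assumes pos: "tauR_sq M X \<phi> > 0" and e: "e > 0"
  shows "\<forall>\<^sub>F i in sequentially. \<forall>y. \<bar>bprob (n i) (b i) (k i) (\<lambda>d. VR_tilde \<phi> (n i) (b i) (k i) (fh i) (x i) d \<le> y) -
    cdf (centered_normal (tauR_sq M X \<phi>)) y\<bar> \<le> e"
proof -
  define v where "v = var_part1 f W + var_part2 (spectral_density4 M X) W"
  define I where "I = (LBINT \<theta>:{-pi..pi}. f \<theta>)"
  have I: "I > 0" unfolding I_def by (rule integral_f_pos)
  have tauR: "tauR_sq M X \<phi> = v / I ^ 4"
    by (simp add: tauR_sq_def v_def I_def spectral_mean_def Let_def add_divide_distrib)
  have v: "v > 0" using pos I by (simp add: tauR zero_less_divide_iff)
  have v1: "var_part1 f W > 0"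
    using v var_part2_degenerate[OF bv_measurable_W f_pos] by (force simp: v_def)
  define F where "F i = riemann_sum (n i) (fh i)" for i
  have F: "F \<longlonglongrightarrow> I"
    unfolding F_def I_def by (rule riemann_sum_uniform_limit[OF fh_lim bv_measurable_spectral_density n_lim])
  define s where "s i = sqrt (\<sigma>hat i) / sqrt (\<sigma>hat1 i)" for i
  define \<sigma> where "\<sigma> = sqrt v / sqrt (var_part1 f W)"
  have s: "s \<longlonglongrightarrow> \<sigma>"
    unfolding s_def \<sigma>_def v_def using v1 by (intro tendsto_divide tendsto_real_sqrt \<sigma>hat_tendsto \<sigma>hat1_tendsto) simp
  define w where "w i = wsum (n i div 2) (freq_weight (n i) (grid_weight \<phi> (n i) (fh i)) (fh i))" for i
  define d where "d i = wsum (n i div 2) (freq_weight (n i) (\<lambda>_. 1) (fh i))" for i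
  have meas: "w i \<in> borel_measurable (exp_draws (n i div 2))" "d i \<in> borel_measurable (exp_draws (n i div 2))" for i
    unfolding w_def d_def by (rule wsum_moments(1))+
  define q where "q i u = s i * (w i u / (F i / sqrt (n i) * d i u + (F i)\<^sup>2))" for i u
  have q_meas: "q i \<in> borel_measurable (exp_draws (n i div 2))" for i
    unfolding q_def by (intro borel_measurable_times borel_measurable_divide borel_measurable_add borel_measurable_const meas)
  obtain i0 where i0: "\<And>i. i \<ge> i0 \<Longrightarrow> n i \<ge> 2 \<and> F i > 0 \<and> (\<forall>\<theta>\<in>{-pi..pi}. fh i \<theta> > 0)"
  proof -
    have "\<forall>\<^sub>F i in sequentially. n i \<ge> 2" using n_lim by (simp add: filterlim_at_top)
    moreover have "\<forall>\<^sub>F i in sequentially. F i > 0" by (rule order_tendstoD(1)[OF F I])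
    ultimately have "\<forall>\<^sub>F i in sequentially. n i \<ge> 2 \<and> F i > 0 \<and> (\<forall>\<theta>\<in>{-pi..pi}. fh i \<theta> > 0)"
      using uniform_limitD[OF fh_lim f_ge(1)]
      by eventually_elim (use f_ge(2) in \<open>fastforce simp: dist_real_def\<close>)
    then show ?thesis using that by (auto simp: eventually_sequentially)
  qed
  have VR: "VR_tilde \<phi> (n i) (b i) (k i) (fh i) (x i) d = q i (fst d)" if "i \<ge> i0" for i d
    using i0[OF that]
    by (simp add: VR_tilde_def VR_star_def q_def s_def w_def d_def F_def V1_star_eq[OF fh_even] D_star_eq[OF _ fh_even])
  \<comment> \<open>The inequality \<open>q i u \<le> y\<close> multiplied by the denominator, with
    the random part of \<open>y\<close> times the denominator moved to the left, and divided by
    \<open>(F i)\<^sup>2\<close>. The second summand carries that random part and vanishes with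
    \<open>1 / sqrt n\<close>.\<close>
  let ?a = "\<lambda>y i \<theta>. s i / (F i)\<^sup>2 * grid_weight \<phi> (n i) (fh i) \<theta> + (- y / (F i * sqrt (n i))) * 1"
  have cdf_eq: "cdf (distr (exp_draws (n i div 2)) borel (q i)) y =
      cdf (distr (exp_draws (n i div 2)) borel (wsum (n i div 2) (freq_weight (n i) (?a y i) (fh i)))) y"
    if i: "i \<ge> i0" for i y
  proof -
    let ?P = "exp_draws (n i div 2)" and ?z = "wsum (n i div 2) (freq_weight (n i) (?a y i) (fh i))"
    interpret P: prob_space ?P by (rule prob_space_exp_draws)
    have z: "?z u = s i / (F i)\<^sup>2 * w i u + (- y / (F i * sqrt (n i))) * d i u" for u
      unfolding freq_weight_linear wsum_linear w_def d_def ..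
    have z_meas: "?z \<in> borel_measurable ?P" by (rule wsum_moments(1))
    have "AE u in ?P. (q i u \<le> y) = (?z u \<le> y)"
      using AE_exp_draws_pos
    proof eventually_elim
      case (elim u)
      have Fi: "F i > 0" "n i > 0" using i0[OF i] by auto
      let ?D = "F i / sqrt (n i) * d i u + (F i)\<^sup>2"
      \<comment> \<open>The denominator depends on the exponential draws only, so any block indices
        may be inserted.\<close>
      have "D_star (n i) (fh i) (u, undefined) > 0" using i0[OF i] elim by (intro D_star_pos) auto
      then have D: "?D > 0" using D_star_eq[OF _ fh_even, of "n i" i "(u, undefined)"] Fi by (simp add: d_def F_def)
      have "(q i u \<le> y) = (s i * w i u \<le> y * ?D)"
        using D by (simp add: q_def pos_divide_le_eq)
      also have "\<dots> = ((s i * w i u - y * (F i / sqrt (n i) * d i u)) / (F i)\<^sup>2 \<le> y)"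
        using Fi by (simp add: pos_divide_le_eq algebra_simps)
      also have "(s i * w i u - y * (F i / sqrt (n i) * d i u)) / (F i)\<^sup>2 = ?z u"
        unfolding z using Fi by (simp add: diff_divide_distrib power2_eq_square)
      finally show ?case .
    qed
    then have "measure ?P (q i -` {..y} \<inter> space ?P) = measure ?P (?z -` {..y} \<inter> space ?P)"
      using q_meas[of i] z_meas by (intro P.finite_measure_eq_AE measurable_sets) (auto elim!: eventually_mono)
    then show ?thesis unfolding cdf_def2 using q_meas[of i] z_meas by (simp add: measure_distr)
  qed
  have conv: "(\<lambda>i. cdf (distr (exp_draws (n i div 2)) borel (q i)) y) \<longlonglongrightarrow> cdf (centered_normal (tauR_sq M X \<phi>)) y" for y
  proof -
    have sF: "(\<lambda>i. s i / (F i)\<^sup>2) \<longlonglongrightarrow> \<sigma> / I\<^sup>2"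
      using I by (intro tendsto_divide tendsto_power s F) simp
    have "filterlim (\<lambda>i. real (n i)) at_top sequentially" by (rule filterlim_compose[OF filterlim_real_sequentially n_lim])
    then have "(\<lambda>i. - y / F i * inverse (sqrt (n i))) \<longlonglongrightarrow> - y / I * 0"
      using I by (intro tendsto_mult tendsto_divide tendsto_const F tendsto_inverse_0_at_top filterlim_compose[OF sqrt_at_top]) simp_all
    then have yF: "(\<lambda>i. (- y / (F i * sqrt (n i))) * 1) \<longlonglongrightarrow> 0" by (simp add: divide_inverse mult.assoc)
    have "uniform_limit {-pi..pi} (?a y) (\<lambda>\<theta>. \<sigma> / I\<^sup>2 * W \<theta> + 0) sequentially"
      by (rule uniform_limit_affine[OF grid_weight_uniform_limit[OF n_lim] bv_measurable_W sF yF])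
    then have lim: "uniform_limit {-pi..pi} (?a y) (\<lambda>\<theta>. \<sigma> / I\<^sup>2 * W \<theta>) sequentially" by simp
    have var: "var_part1 f (\<lambda>\<theta>. \<sigma> / I\<^sup>2 * W \<theta>) = tauR_sq M X \<phi>"
      unfolding var_part1_scale \<sigma>_def tauR using v1 v
      by (simp add: power_divide power_mult_distrib power_mult[symmetric])
    have "(\<lambda>i. cdf (distr (exp_draws (n i div 2)) borel (wsum (n i div 2) (freq_weight (n i) (?a y i) (fh i)))) y) \<longlonglongrightarrow>
        cdf (centered_normal (tauR_sq M X \<phi>)) y"
      using freq_weight_clt[OF lim bv_measurable_mult[OF bv_measurable_const bv_measurable_W]] isCont_cdf_centered_normal[OF pos]
      unfolding var weak_conv_m_def weak_conv_def by blast
    moreover have "\<forall>\<^sub>F i in sequentially.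
        cdf (distr (exp_draws (n i div 2)) borel (wsum (n i div 2) (freq_weight (n i) (?a y i) (fh i)))) y =
        cdf (distr (exp_draws (n i div 2)) borel (q i)) y"
      using cdf_eq by (intro eventually_sequentiallyI[of i0]) simp
    ultimately show ?thesis by (rule Lim_transform_eventually)
  qed
  have "\<forall>\<^sub>F i in sequentially. \<forall>y. \<bar>cdf (distr (exp_draws (n i div 2)) borel (q i)) y - cdf (centered_normal (tauR_sq M X \<phi>)) y\<bar> \<le> e"
    by (rule cdf_uniform_convergence[OF _ real_distribution_centered_normal isCont_cdf_centered_normal[OF pos] conv e])
      (intro prob_space.real_distribution_distr prob_space_exp_draws q_meas)
  moreover have "\<forall>\<^sub>F i in sequentially. i \<ge> i0" by (rule eventually_ge_at_top)
  ultimately show ?thesis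
  proof eventually_elim
    case (elim i)
    have "bprob (n i) (b i) (k i) (\<lambda>d. VR_tilde \<phi> (n i) (b i) (k i) (fh i) (x i) d \<le> y) =
      cdf (distr (exp_draws (n i div 2)) borel (q i)) y" for y
      by (rule bprob_le_eq_cdf[OF q_meas VR[OF elim(2)]])
    then show ?case using elim(1) by simp
  qed
qed

end

end

section \<open>Convergence in outer probability\<close>

lemma small_oP_max:
  assumes Y: "small_oP M Y" and Z: "small_oP M Z" and M: "finite_measure M"
  shows "small_oP M (\<lambda>m w. max (Y m w) (Z m w))"
  unfolding small_oP_def
proof (intro allI impI)
  fix \<epsilon> :: real assume \<epsilon>: "\<epsilon> > 0"
  interpret finite_measure M by fact
  obtain A where A: "\<And>m. A m \<in> sets M" "\<And>m. {w \<in> space M. Y m w > ennreal \<epsilon>} \<subseteq> A m" "(\<lambda>m. measure M (A m)) \<longlonglongrightarrow> 0"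
    using Y \<epsilon> unfolding small_oP_def by meson
  obtain B where B: "\<And>m. B m \<in> sets M" "\<And>m. {w \<in> space M. Z m w > ennreal \<epsilon>} \<subseteq> B m" "(\<lambda>m. measure M (B m)) \<longlonglongrightarrow> 0"
    using Z \<epsilon> unfolding small_oP_def by meson
  have "(\<lambda>m. measure M (A m \<union> B m)) \<longlonglongrightarrow> 0"
  proof (rule tendsto_sandwich[OF _ _ tendsto_const])
    show "(\<lambda>m. measure M (A m) + measure M (B m)) \<longlonglongrightarrow> 0" using tendsto_add[OF A(3) B(3)] by simp
    show "\<forall>\<^sub>F m in sequentially. measure M (A m \<union> B m) \<le> measure M (A m) + measure M (B m)"
      using measure_Un_le[OF A(1) B(1)] by (intro always_eventually) blast
  qed simp
  moreover have "\<forall>m. A m \<union> B m \<in> sets M \<and> {w \<in> space M. max (Y m w) (Z m w) > ennreal \<epsilon>} \<subseteq> A m \<union> B m"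
  proof
    fix m
    show "A m \<union> B m \<in> sets M \<and> {w \<in> space M. max (Y m w) (Z m w) > ennreal \<epsilon>} \<subseteq> A m \<union> B m"
      using A(1)[of m] A(2)[of m] B(1)[of m] B(2)[of m] unfolding less_max_iff_disj by blast
  qed
  ultimately show "\<exists>A. (\<forall>m. A m \<in> sets M \<and> {w \<in> space M. max (Y m w) (Z m w) > ennreal \<epsilon>} \<subseteq> A m) \<and>
      (\<lambda>m. measure M (A m)) \<longlonglongrightarrow> 0" by (intro exI[of _ "\<lambda>m. A m \<union> B m"] conjI)
qed

lemma small_oP_of_expectation:
  fixes Y :: "nat \<Rightarrow> 'w \<Rightarrow> real"
  assumes M: "finite_measure M"
    and Y: "\<forall>\<^sub>F m in sequentially. integrable M (Y m) \<and> (\<integral>w. Y m w \<partial>M) \<le> c m" "\<And>m w. 0 \<le> Y m w"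
    and c: "c \<longlonglongrightarrow> 0"
  shows "small_oP M (\<lambda>m w. ennreal (Y m w))"
  unfolding small_oP_def
proof (intro allI impI)
  fix \<epsilon> :: real assume \<epsilon>: "\<epsilon> > 0"
  interpret finite_measure M by fact
  define A where "A m = (if integrable M (Y m) then {w \<in> space M. Y m w \<ge> \<epsilon>} else space M)" for m
  have A: "A m \<in> sets M \<and> {w \<in> space M. ennreal (Y m w) > ennreal \<epsilon>} \<subseteq> A m" for m
  proof
    show "A m \<in> sets M"
      unfolding A_def using borel_measurable_le[OF borel_measurable_const, of "Y m" M \<epsilon>] by (auto dest: borel_measurable_integrable)
    show "{w \<in> space M. ennreal (Y m w) > ennreal \<epsilon>} \<subseteq> A m"
      unfolding A_def using \<epsilon> by (auto simp: ennreal_less_iff)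
  qed
  have "(\<lambda>m. measure M (A m)) \<longlonglongrightarrow> 0"
  proof (rule tendsto_sandwich[OF _ _ tendsto_const])
    show "(\<lambda>m. c m / \<epsilon>) \<longlonglongrightarrow> 0" using tendsto_divide[OF c tendsto_const, of \<epsilon>] \<epsilon> by simp
    show "\<forall>\<^sub>F m in sequentially. measure M (A m) \<le> c m / \<epsilon>"
      using Y(1)
    proof eventually_elim
      case (elim m)
      have "measure M (A m) \<le> (\<integral>w. Y m w \<partial>M) / \<epsilon>"
        using elim Y(2) \<epsilon> integral_Markov_inequality_measure[of M "Y m" "{}" \<epsilon>] by (simp add: A_def)
      also have "\<dots> \<le> c m / \<epsilon>" using elim \<epsilon> by (simp add: divide_right_mono)
      finally show ?case .
    qed
  qed simp
  then show "\<exists>A. (\<forall>m. A m \<in> sets M \<and> {w \<in> space M. ennreal (Y m w) > ennreal \<epsilon>} \<subseteq> A m) \<and>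
      (\<lambda>m. measure M (A m)) \<longlonglongrightarrow> 0" using A by blast
qed

text \<open>
  Reduces a statement in probability to one along deterministic sequences of sample points: if \<open>Y\<close>
  were not controlled by \<open>D\<close> uniformly, points violating the control would form such a sequence.
\<close>
lemma small_oP_by_subsequences:
  assumes D: "small_oP M D"
    and seq: "\<And>r w. strict_mono r \<Longrightarrow> (\<And>i. w i \<in> space M) \<Longrightarrow> (\<lambda>i. D (r i) (w i)) \<longlonglongrightarrow> 0 \<Longrightarrow>
      (\<lambda>i. Y (r i) (w i)) \<longlonglongrightarrow> (0 :: ennreal)"
  shows "small_oP M Y"
  unfolding small_oP_def
proof (intro allI impI)
  fix \<epsilon> :: real assume \<epsilon>: "\<epsilon> > 0"
  have "\<exists>\<delta>>0. \<exists>m0. \<forall>m\<ge>m0. \<forall>w\<in>space M. D m w \<le> ennreal \<delta> \<longrightarrow> Y m w \<le> ennreal \<epsilon>"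
  proof (rule ccontr)
    assume "\<not> ?thesis"
    then have bad: "\<exists>m\<ge>m0. \<exists>w\<in>space M. D m w \<le> ennreal \<delta> \<and> Y m w > ennreal \<epsilon>" if "\<delta> > 0" for \<delta> m0
      using that by (meson not_le)
    \<comment> \<open>The bad points are chosen with strictly increasing first component, so that
      they run along a subsequence, and with control below \<open>1 / Suc i\<close>, so that
      \<open>D\<close> tends to 0 on them.\<close>
    let ?P = "\<lambda>i p. snd p \<in> space M \<and> D (fst p) (snd p) \<le> ennreal (1 / real (Suc i)) \<and> Y (fst p) (snd p) > ennreal \<epsilon>"
    have "\<exists>p. \<forall>i. ?P i (p i) \<and> fst (p i) < fst (p (Suc i))"
    proof (rule dependent_nat_choice)
      show "\<exists>p. ?P 0 p" using bad[of 1 0] by auto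
      show "\<exists>p'. ?P (Suc i) p' \<and> fst p < fst p'" for p i
      proof -
        obtain m w where "m \<ge> Suc (fst p)" "w \<in> space M" "D m w \<le> ennreal (1 / real (Suc (Suc i)))" "Y m w > ennreal \<epsilon>"
          using bad[of "1 / real (Suc (Suc i))" "Suc (fst p)"] by auto
        then show ?thesis by (intro exI[of _ "(m, w)"]) auto
      qed
    qed
    then obtain p where p: "\<And>i. ?P i (p i)" "\<And>i. fst (p i) < fst (p (Suc i))" by blast
    have "strict_mono (\<lambda>i. fst (p i))" using p(2) by (simp add: strict_mono_Suc_iff)
    moreover have "(\<lambda>i. D (fst (p i)) (snd (p i))) \<longlonglongrightarrow> 0"
    proof (rule tendsto_sandwich[OF _ _ tendsto_const])
      show "(\<lambda>i. ennreal (1 / real (Suc i))) \<longlonglongrightarrow> 0"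
        using LIMSEQ_inverse_real_of_nat by (subst ennreal_tendsto_0_iff) (simp_all add: inverse_eq_divide)
      show "\<forall>\<^sub>F i in sequentially. D (fst (p i)) (snd (p i)) \<le> ennreal (1 / real (Suc i))"
        using p(1) by (intro always_eventually) blast
    qed simp
    ultimately have "(\<lambda>i. Y (fst (p i)) (snd (p i))) \<longlonglongrightarrow> 0" using p(1) by (intro seq) auto
    then have "\<forall>\<^sub>F i in sequentially. Y (fst (p i)) (snd (p i)) < ennreal \<epsilon>"
      using \<epsilon> by (intro order_tendstoD(2)) auto
    then obtain i where "Y (fst (p i)) (snd (p i)) < ennreal \<epsilon>" by (auto simp: eventually_sequentially)
    then show False using p(1)[of i] by auto
  qed
  then obtain \<delta> m0 where \<delta>: "\<delta> > 0" "\<And>m w. m \<ge> m0 \<Longrightarrow> w \<in> space M \<Longrightarrow> D m w \<le> ennreal \<delta> \<Longrightarrow> Y m w \<le> ennreal \<epsilon>"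
    by blast
  obtain A where A: "\<And>m. A m \<in> sets M" "\<And>m. {w \<in> space M. D m w > ennreal \<delta>} \<subseteq> A m" "(\<lambda>m. measure M (A m)) \<longlonglongrightarrow> 0"
    using D \<delta>(1) unfolding small_oP_def by meson
  \<comment> \<open>The implication from \<open>D\<close> to \<open>Y\<close> holds only from
    \<open>m0\<close> on; the finitely many earlier indices do not affect the limit.\<close>
  define B where "B m = (if m < m0 then space M else A m)" for m
  have "B m \<in> sets M \<and> {w \<in> space M. Y m w > ennreal \<epsilon>} \<subseteq> B m" for m
  proof
    show "B m \<in> sets M" using A(1) by (simp add: B_def)
    show "{w \<in> space M. Y m w > ennreal \<epsilon>} \<subseteq> B m"
    proof (cases "m < m0")
      case False
      show ?thesis
      proof
        fix w assume w: "w \<in> {w \<in> space M. Y m w > ennreal \<epsilon>}"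
        then have "\<not> D m w \<le> ennreal \<delta>" using \<delta>(2)[of m w] False by auto
        then show "w \<in> B m" using A(2)[of m] w False by (auto simp: B_def)
      qed
    qed (auto simp: B_def)
  qed
  moreover have "(\<lambda>m. measure M (B m)) \<longlonglongrightarrow> 0"
    by (rule Lim_transform_eventually[OF A(3)]) (auto simp: B_def eventually_sequentially intro!: exI[of _ m0])
  ultimately show "\<exists>A. (\<forall>m. A m \<in> sets M \<and> {w \<in> space M. Y m w > ennreal \<epsilon>} \<subseteq> A m) \<and> (\<lambda>m. measure M (A m)) \<longlonglongrightarrow> 0"
    by blast
qed

lemma SUP_ennreal_tendsto_0:
  fixes g :: "nat \<Rightarrow> 'b \<Rightarrow> real"
  assumes "\<And>e. e > 0 \<Longrightarrow> \<forall>\<^sub>F i in sequentially. \<forall>y\<in>S. \<bar>g i y\<bar> \<le> e"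
  shows "(\<lambda>i. SUP y\<in>S. ennreal \<bar>g i y\<bar>) \<longlonglongrightarrow> 0"
proof (rule order_tendstoI)
  fix a :: ennreal assume "0 < a"
  then obtain t where t: "0 < t" "t < a" using dense by blast
  then obtain e where e: "t = ennreal e" "e > 0" by (cases t) auto
  from assms[OF e(2)] show "\<forall>\<^sub>F i in sequentially. (SUP y\<in>S. ennreal \<bar>g i y\<bar>) < a"
  proof eventually_elim
    case (elim i)
    then have "(SUP y\<in>S. ennreal \<bar>g i y\<bar>) \<le> t" unfolding e(1) by (intro SUP_least ennreal_leI) auto
    then show ?case using t(2) by simp
  qed
qed simp

lemma SUP_ennreal_tendsto_0_imp_uniform_limit:
  fixes g :: "nat \<Rightarrow> real \<Rightarrow> real" and h :: "real \<Rightarrow> real"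
  assumes "(\<lambda>i. SUP y\<in>S. ennreal \<bar>g i y - h y\<bar>) \<longlonglongrightarrow> 0"
  shows "uniform_limit S g h sequentially"
proof (rule uniform_limitI)
  fix e :: real assume e: "e > 0"
  have "\<forall>\<^sub>F i in sequentially. (SUP y\<in>S. ennreal \<bar>g i y - h y\<bar>) < ennreal e"
    using assms e by (intro order_tendstoD(2)) auto
  then show "\<forall>\<^sub>F i in sequentially. \<forall>y\<in>S. dist (g i y) (h y) < e"
  proof eventually_elim
    case (elim i)
    show ?case
    proof
      fix y assume "y \<in> S"
      then have "ennreal \<bar>g i y - h y\<bar> < ennreal e" using elim by (meson SUP_upper le_less_trans)
      then show "dist (g i y) (h y) < e" by (simp add: dist_real_def ennreal_less_iff)
    qed
  qed
qed

context spectral_process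
begin

section \<open>Measurability of the statistics\<close>

text \<open>Integrating the cosine expansion of the periodogram leaves a finite quadratic form in
  the observations.\<close>

lemma spectral_mean_periodogram_measurable:
  assumes \<psi>: "bv_measurable \<psi>"
  shows "(\<lambda>w. spectral_mean \<psi> (periodogram n (sample X n w))) \<in> borel_measurable M"
proof -
  define c where "c s s' = (LBINT \<theta>:{-pi..pi}. \<psi> \<theta> * cos ((real s - real s') * \<theta>)) / (2 * pi * n)" for s s' :: nat
  have int: "set_integrable lborel {-pi..pi} (\<lambda>\<theta>. z * (\<psi> \<theta> * cos (u * \<theta>)))" for u z
    by (intro bv_measurable_integrable bv_measurable_mult bv_measurable_const \<psi> bv_measurable_cos) auto
  have "spectral_mean \<psi> (periodogram n (sample X n w)) = (\<Sum>s=1..n. \<Sum>s'=1..n. c s s' * (X (int s) w * X (int s') w))" for w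
  proof -
    let ?z = "\<lambda>s s'. sample X n w s * sample X n w s' / (2 * pi * n)"
    have "spectral_mean \<psi> (periodogram n (sample X n w)) =
        (LBINT \<theta>:{-pi..pi}. \<Sum>s=1..n. \<Sum>s'=1..n. ?z s s' * (\<psi> \<theta> * cos ((real s - real s') * \<theta>)))"
      unfolding spectral_mean_def periodogram_eq sum_distrib_left sum_divide_distrib by (simp add: mult_ac)
    also have "\<dots> = (\<Sum>s=1..n. \<Sum>s'=1..n. LBINT \<theta>:{-pi..pi}. ?z s s' * (\<psi> \<theta> * cos ((real s - real s') * \<theta>)))"
      by (subst set_integral_sum, intro set_integrable_sum int, intro sum.cong refl set_integral_sum int)
    also have "\<dots> = (\<Sum>s=1..n. \<Sum>s'=1..n. c s s' * (X (int s) w * X (int s') w))"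
      by (intro sum.cong refl) (simp add: c_def sample_def)
    finally show ?thesis .
  qed
  then show ?thesis using rv by simp
qed

lemma L_stat_measurable: "bv_measurable \<phi> \<Longrightarrow> L_stat M X \<phi> n \<in> borel_measurable M"
  unfolding L_stat_def[abs_def]
  by (intro borel_measurable_times borel_measurable_diff borel_measurable_const spectral_mean_periodogram_measurable)

lemma LR_stat_measurable: "bv_measurable \<phi> \<Longrightarrow> LR_stat M X \<phi> n \<in> borel_measurable M"
  unfolding LR_stat_def[abs_def] ratio_stat_def
  by (intro borel_measurable_times borel_measurable_diff borel_measurable_divide borel_measurable_const
      spectral_mean_periodogram_measurable bv_measurable_const)

lemma statistic_cdf_uniform:
  assumes S: "\<And>m. S m \<in> borel_measurable M" and v: "v > 0"
    and conv: "weak_conv_m (\<lambda>m. distr M borel (S m)) (centered_normal v)" and e: "e > 0"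
  shows "\<forall>\<^sub>F m in sequentially. \<forall>y. \<bar>measure M {w \<in> space M. S m w \<le> y} - cdf (centered_normal v) y\<bar> \<le> e"
proof -
  have eq: "measure M {w \<in> space M. S m w \<le> y} = cdf (distr M borel (S m)) y" for m y
  proof -
    have "S m -` {..y} \<inter> space M = {w \<in> space M. S m w \<le> y}" by auto
    then show ?thesis unfolding cdf_def2 using S by (simp add: measure_distr)
  qed
  show ?thesis
    unfolding eq using conv isCont_cdf_centered_normal[OF v]
    by (intro cdf_uniform_convergence real_distribution_centered_normal real_distribution_distr S e)
      (auto simp: weak_conv_m_def weak_conv_def)
qed

section \<open>Mean periodograms and block covariances in probability\<close>

text \<open>The block with index \<open>t\<close> is the quadratic form shifted by
  \<open>t - 1\<close>, so the shifts run through \<open>0\<close> to \<open>n - b\<close>.\<close>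

lemma mean_block_pgram_eq_ftil:
  assumes "b \<le> n"
  shows "mean_block_pgram n b (sample X n w) \<theta> = ftil b {0..<int (n - b + 1)} \<theta> w"
    and block_cov_eq_Chat: "block_cov n b (sample X n w) \<theta> \<mu> = Chat b {0..<int (n - b + 1)} \<theta> \<mu> w"
proof -
  let ?T = "{0..<int (n - b + 1)}"
  have sum_eq: "(\<Sum>t=1..n - b + 1. g (int t - 1)) = (\<Sum>t\<in>?T. g t)" for g :: "int \<Rightarrow> real"
    by (rule sum.reindex_bij_witness[of _ "\<lambda>t. nat (t + 1)" "\<lambda>t. int t - 1"]) auto
  have bp: "block_pgram b (sample X n w) t \<theta> = qform (pgw \<theta>) b (int t - 1) w" if "t \<in> {1..n - b + 1}" for t \<theta>
    using that assms by (intro block_pgram_eq_qform) auto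
  have "(\<Sum>t=1..n - b + 1. block_pgram b (sample X n w) t \<theta>) = (\<Sum>t\<in>?T. qform (pgw \<theta>) b t w)" for \<theta>
    unfolding sum_eq[symmetric] by (intro sum.cong refl bp)
  then show m: "mean_block_pgram n b (sample X n w) \<theta> = ftil b ?T \<theta> w" for \<theta>
    by (simp add: mean_block_pgram_def ftil_def tavg_def)
  have "(\<Sum>t=1..n - b + 1. block_pgram b (sample X n w) t \<theta> * block_pgram b (sample X n w) t \<mu>) =
      (\<Sum>t\<in>?T. qform (pgw \<theta>) b t w * qform (pgw \<mu>) b t w)"
    unfolding sum_eq[symmetric] by (intro sum.cong refl) (simp only: bp)
  then show "block_cov n b (sample X n w) \<theta> \<mu> = Chat b ?T \<theta> \<mu> w"
    by (simp add: block_cov_def Chat_def tavg_def m)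
qed

text \<open>At most \<open>b\<close> frequencies, each with variance of order
  \<open>b / N\<close>.\<close>

lemma pgram_err_expectation:
  assumes b: "1 \<le> b" "b \<le> n"
  shows "integrable M (\<lambda>w. pgram_err n b (sample X n w))"
    "(\<integral>w. pgram_err n b (sample X n w) \<partial>M) \<le> cov_const * (real b)\<^sup>2 / real (n - b + 1)"
proof -
  let ?T = "{0..<int (n - b + 1)}"
  have T: "finite ?T" "?T \<noteq> {}" "card ?T = n - b + 1" by auto
  note v = ftil_variance[OF b(1) T(1,2), unfolded T(3)]
  have eq: "pgram_err n b (sample X n w) = (\<Sum>j\<in>GG b. (ftil b ?T (ffreq j b) w - epg b (ffreq j b))\<^sup>2)" for w
    by (simp only: pgram_err_def mean_block_pgram_eq_ftil[OF b(2)])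
  show "integrable M (\<lambda>w. pgram_err n b (sample X n w))"
    unfolding eq by (intro Bochner_Integration.integrable_sum v(2))
  have "(\<integral>w. pgram_err n b (sample X n w) \<partial>M) = (\<Sum>j\<in>GG b. \<integral>w. (ftil b ?T (ffreq j b) w - epg b (ffreq j b))\<^sup>2 \<partial>M)"
    unfolding eq by (intro Bochner_Integration.integral_sum v(2))
  also have "\<dots> \<le> (\<Sum>j\<in>GG b. cov_const * b / real (n - b + 1))"
    by (intro sum_mono v(1))
  also have "\<dots> = real (card (GG b)) * (cov_const * b / real (n - b + 1))" by simp
  also have "\<dots> \<le> b * (cov_const * b / real (n - b + 1))"
    using card_GG_le[of b] cov_const_nonneg by (intro mult_right_mono) auto
  finally show "(\<integral>w. pgram_err n b (sample X n w) \<partial>M) \<le> cov_const * (real b)\<^sup>2 / real (n - b + 1)"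
    by (simp add: power2_eq_square mult_ac)
qed

text \<open>At most \<open>b\<^sup>2\<close> pairs, divided by \<open>b\<close>. The condition
  \<open>2 * b \<le> n\<close> guarantees at least \<open>b\<close> blocks, as the bound for a
  single pair requires.\<close>

lemma cov_err_expectation:
  "\<exists>K\<ge>0. \<forall>n b. 1 \<le> b \<longrightarrow> 2 * b \<le> n \<longrightarrow> integrable M (\<lambda>w. cov_err n b (sample X n w)) \<and>
     (\<integral>w. cov_err n b (sample X n w) \<partial>M) \<le> K * (b * sqrt (real b / real (n - b + 1) + 1 / real b ^ 3))"
proof -
  obtain K where K: "K \<ge> 0" "\<And>b T \<theta> \<mu>. b \<ge> 1 \<Longrightarrow> finite T \<Longrightarrow> T \<noteq> {} \<Longrightarrow> b \<le> card T \<Longrightarrow>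
     integrable M (\<lambda>w. \<bar>Chat b T \<theta> \<mu> w - kap b \<theta> \<mu>\<bar>) \<and>
     (\<integral>w. \<bar>Chat b T \<theta> \<mu> w - kap b \<theta> \<mu>\<bar> \<partial>M) \<le> K * sqrt (real b / real (card T) + 1 / real b ^ 3)"
    using Chat_error by blast
  show ?thesis
  proof (intro exI[of _ K] conjI allI impI K(1))
    fix n b :: nat assume b: "1 \<le> b" "2 * b \<le> n"
    let ?T = "{0..<int (n - b + 1)}"
    let ?s = "sqrt (real b / real (n - b + 1) + 1 / real b ^ 3)"
    have T: "finite ?T" "?T \<noteq> {}" "card ?T = n - b + 1" by auto
    have bT: "b \<le> card ?T" and bn: "b \<le> n" using b T(3) by linarith+
    note v = K(2)[OF b(1) T(1,2) bT, unfolded T(3)]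
    let ?D = "\<lambda>j j' w. \<bar>Chat b ?T (ffreq j b) (ffreq j' b) w - kap b (ffreq j b) (ffreq j' b)\<bar>"
    have eq: "cov_err n b (sample X n w) = (\<Sum>j\<in>GG b. \<Sum>j'\<in>GG b - {j, - j}. ?D j j' w) / b" for w
      by (simp only: cov_err_def block_cov_eq_Chat[OF bn])
    show "integrable M (\<lambda>w. cov_err n b (sample X n w))"
      unfolding eq using v by (intro integrable_divide Bochner_Integration.integrable_sum) auto
    have "(\<integral>w. cov_err n b (sample X n w) \<partial>M) = (\<Sum>j\<in>GG b. \<Sum>j'\<in>GG b - {j, - j}. \<integral>w. ?D j j' w \<partial>M) / b"
      unfolding eq using v by simp
    also have "\<dots> \<le> (\<Sum>j\<in>GG b. \<Sum>j'\<in>GG b. K * ?s) / b"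
    proof (intro divide_right_mono sum_mono)
      fix j
      have "(\<Sum>j'\<in>GG b - {j, - j}. \<integral>w. ?D j j' w \<partial>M) \<le> (\<Sum>j'\<in>GG b - {j, - j}. K * ?s)"
        using v by (intro sum_mono) blast
      also have "\<dots> \<le> (\<Sum>j'\<in>GG b. K * ?s)"
        using K(1) by (intro sum_mono2 finite_GG mult_nonneg_nonneg) auto
      finally show "(\<Sum>j'\<in>GG b - {j, - j}. \<integral>w. ?D j j' w \<partial>M) \<le> (\<Sum>j'\<in>GG b. K * ?s)" .
    qed simp
    also have "\<dots> = (real (card (GG b)) * real (card (GG b))) * (K * ?s) / b" by simp
    also have "\<dots> \<le> (real b * real b) * (K * ?s) / b"
      using card_GG_le[of b] K(1) by (intro divide_right_mono mult_right_mono mult_mono mult_nonneg_nonneg) auto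
    also have "\<dots> = K * (b * ?s)" using b by simp
    finally show "(\<integral>w. cov_err n b (sample X n w) \<partial>M) \<le> K * (b * ?s)" .
  qed
qed

end

text \<open>The sample sizes run along \<open>\<nu>\<close> because a factorisation into two factors
  that both tend to infinity excludes all large primes. Positive limiting variances make the
  limiting distribution functions continuous, so that convergence in law is uniform in the argument.
  The limit law of the ratio statistic is a premise of the last clause.\<close>

theorem theorem4p5:
  fixes M :: "'w measure"
    and X :: "int \<Rightarrow> 'w \<Rightarrow> real"
    and \<phi> :: "real \<Rightarrow> real"
    and \<nu> :: "nat \<Rightarrow> nat"
    and b k :: "nat \<Rightarrow> nat"
    and fhat :: "nat \<Rightarrow> (nat \<Rightarrow> real) \<Rightarrow> real \<Rightarrow> real"
  assumes "prob_space M"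
    and A1_rv: "\<And>t. X t \<in> borel_measurable M"
    and A1_stationary: "strictly_stationary M X"
    and A1_moments: "\<And>t. integrable M (\<lambda>\<omega>. X t \<omega> ^ 8)"
    and A1_mean: "\<And>t. (\<integral>\<omega>. X t \<omega> \<partial>M) = 0"
    and A1_autocov: "(\<lambda>h::int. (1 + \<bar>real_of_int h\<bar>) * \<bar>autocov M X h\<bar>) summable_on UNIV"
    and A1_pos: "(INF \<theta>\<in>{0..pi}. spectral_density M X \<theta>) > 0"
    and A1_cum4: "(\<lambda>(h1::int, h2::int, h3::int).
          (1 + \<bar>real_of_int h1\<bar> + \<bar>real_of_int h2\<bar> + \<bar>real_of_int h3\<bar>) *
          \<bar>lag_cumulant M X [h1, h2, h3]\<bar>) summable_on UNIV"
    and A1_cum8: "(\<lambda>hs. \<bar>lag_cumulant M X hs\<bar>) summable_on {hs :: int list. length hs = 7}"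
    and A2_measurable: "set_borel_measurable lborel {-pi..pi} \<phi>"
    and A2_square: "set_integrable lborel {-pi..pi} (\<lambda>\<theta>. (\<phi> \<theta>)\<^sup>2)"
    and A2_bv: "bounded_variation_on (-pi) pi \<phi>"
    and sizes: "strict_mono \<nu>"
    and B1_prod: "\<And>m. \<nu> m = b (\<nu> m) * k (\<nu> m)"
    and B1_b: "filterlim (\<lambda>m. b (\<nu> m)) at_top sequentially"
    and B1_k: "filterlim (\<lambda>m. k (\<nu> m)) at_top sequentially"
    and B2_b: "(\<lambda>m. real (b (\<nu> m)) ^ 3 / real (\<nu> m)) \<longlonglongrightarrow> 0"
    and B2_N: "(\<lambda>m. ln (real (\<nu> m - b (\<nu> m) + 1)) / real (b (\<nu> m))) \<longlonglongrightarrow> 0"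
    and C_measurable: "\<And>n \<theta>. \<theta> \<in> {-pi..pi} \<Longrightarrow>
          (\<lambda>x. fhat n x \<theta>) \<in> borel_measurable (Pi\<^sub>M {1..n} (\<lambda>_. borel))"
    and C_even: "\<And>n x \<theta>. \<theta> \<in> {-pi..pi} \<Longrightarrow> fhat n x (- \<theta>) = fhat n x \<theta>"
    and C_consistent: "small_oP M (\<lambda>m \<omega>.
          SUP \<theta>\<in>{-pi..pi}. ennreal \<bar>fhat (\<nu> m) (sample X (\<nu> m) \<omega>) \<theta> - spectral_density M X \<theta>\<bar>)"
    and CLT: "weak_conv_m (\<lambda>m. distr M borel (L_stat M X \<phi> (\<nu> m)))
          (centered_normal (tau_sq M X \<phi>))"
  shows
    "small_oP M (\<lambda>m \<omega>.
       let n = \<nu> m; x = sample X n \<omega> in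
         ennreal \<bar>bvar n (b n) (k n) (V_tilde \<phi> n (b n) (k n) (fhat n x) x) - tau_sq M X \<phi>\<bar>)
     \<and>
     (tau_sq M X \<phi> > 0 \<longrightarrow>
      small_oP M (\<lambda>m \<omega>.
        let n = \<nu> m; x = sample X n \<omega> in
          SUP y. ennreal \<bar>bprob n (b n) (k n) (\<lambda>d. V_tilde \<phi> n (b n) (k n) (fhat n x) x d \<le> y) -
                          measure M {\<omega>' \<in> space M. L_stat M X \<phi> n \<omega>' \<le> y}\<bar>))
     \<and>
     (tauR_sq M X \<phi> > 0 \<longrightarrow>
      weak_conv_m (\<lambda>m. distr M borel (LR_stat M X \<phi> (\<nu> m))) (centered_normal (tauR_sq M X \<phi>)) \<longrightarrow>
      small_oP M (\<lambda>m \<omega>.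
        let n = \<nu> m; x = sample X n \<omega> in
          SUP y. ennreal \<bar>bprob n (b n) (k n) (\<lambda>d. VR_tilde \<phi> n (b n) (k n) (fhat n x) x d \<le> y) -
                          measure M {\<omega>' \<in> space M. LR_stat M X \<phi> n \<omega>' \<le> y}\<bar>))"
proof -
  interpret spectral_process M X
    by (intro spectral_process.intro spectral_process_axioms.intro)
      (fact assms(1) A1_rv A1_stationary A1_moments A1_mean A1_autocov A1_cum4 A1_cum8)+
  have \<phi>: "bv_measurable \<phi>" using A2_bv A2_measurable by (simp add: bv_measurable_def)
  define c where "c = (INF \<theta>\<in>{0..pi}. f \<theta>)"
  have c: "c > 0" unfolding c_def by (rule A1_pos)
  have f_ge: "c \<le> f \<theta>" if "\<theta> \<in> {-pi..pi}" for \<theta>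
  proof -
    \<comment> \<open>On the reals an infimum is a lower bound only for sets bounded below; here the
      uniform bound on the spectral density supplies this.\<close>
    have bdd: "bdd_below (f ` {0..pi})"
      using abs_spectral_density_le by (intro bdd_belowI2[of _ "- K\<gamma>"]) (auto simp: abs_le_iff minus_le_iff)
    have "c \<le> f \<bar>\<theta>\<bar>" unfolding c_def using that by (intro cINF_lower[OF bdd]) auto
    then show ?thesis by (cases "\<theta> \<ge> 0") (simp_all add: spectral_density_even)
  qed
  have \<nu>_lim: "filterlim \<nu> at_top sequentially" by (rule filterlim_subseq[OF sizes])
  let ?b = "\<lambda>m. b (\<nu> m)"
  \<comment> \<open>As soon as \<open>k \<ge> 2\<close> a block is at most half of the sample, and
    then the number of blocks is at least half the sample size.\<close>
  have sizes_ok: "\<forall>\<^sub>F m in sequentially. 1 \<le> ?b m \<and> 2 * ?b m \<le> \<nu> m"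
  proof -
    have "\<forall>\<^sub>F m in sequentially. 1 \<le> ?b m" "\<forall>\<^sub>F m in sequentially. 2 \<le> k (\<nu> m)"
      using B1_b B1_k by (auto simp: filterlim_at_top)
    then show ?thesis
    proof eventually_elim
      case (elim m)
      have "2 * ?b m \<le> k (\<nu> m) * ?b m" using elim(2) by (rule mult_right_mono) simp
      also have "k (\<nu> m) * ?b m = \<nu> m" using B1_prod[of m] by (simp only: mult.commute)
      finally show ?case using elim(1) by simp
    qed
  qed
  have N_ge: "real (\<nu> m - ?b m + 1) \<ge> real (\<nu> m) / 2" if "2 * ?b m \<le> \<nu> m" for m
    using that by linarith
  have b_inv: "(\<lambda>m. 1 / real (?b m)) \<longlonglongrightarrow> 0"
    by (intro tendsto_divide_0[OF tendsto_const] filterlim_at_top_imp_at_infinity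
        filterlim_compose[OF filterlim_real_sequentially B1_b])
  have pgram_small: "small_oP M (\<lambda>m \<omega>. ennreal (pgram_err (\<nu> m) (?b m) (sample X (\<nu> m) \<omega>)))"
  proof (rule small_oP_of_expectation)
    show "finite_measure M" by unfold_locales
    show "(\<lambda>m. cov_const * (2 * (real (?b m) ^ 3 / real (\<nu> m)))) \<longlonglongrightarrow> 0"
      by (intro tendsto_mult_right_zero B2_b)
    show "\<forall>\<^sub>F m in sequentially. integrable M (\<lambda>\<omega>. pgram_err (\<nu> m) (?b m) (sample X (\<nu> m) \<omega>)) \<and>
        (\<integral>\<omega>. pgram_err (\<nu> m) (?b m) (sample X (\<nu> m) \<omega>) \<partial>M) \<le> cov_const * (2 * (real (?b m) ^ 3 / real (\<nu> m)))"
      using sizes_ok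
    proof eventually_elim
      case (elim m)
      then have b: "1 \<le> ?b m" "?b m \<le> \<nu> m" and nu: "0 < real (\<nu> m)" by auto
      have "(real (?b m))\<^sup>2 / real (\<nu> m - ?b m + 1) \<le> real (?b m) ^ 3 / (real (\<nu> m) / 2)"
        using N_ge[of m] elim b nu by (intro frac_le power_increasing) auto
      then have "cov_const * ((real (?b m))\<^sup>2 / real (\<nu> m - ?b m + 1)) \<le> cov_const * (2 * (real (?b m) ^ 3 / real (\<nu> m)))"
        using cov_const_nonneg by (intro mult_left_mono) (auto simp: mult.commute)
      then show ?case using pgram_err_expectation[OF b] by (simp add: mult.assoc)
    qed
  qed (simp add: pgram_err_def sum_nonneg)
  obtain K where K: "K \<ge> 0" "\<And>n b. 1 \<le> b \<Longrightarrow> 2 * b \<le> n \<Longrightarrow> integrable M (\<lambda>\<omega>. cov_err n b (sample X n \<omega>)) \<and>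
     (\<integral>\<omega>. cov_err n b (sample X n \<omega>) \<partial>M) \<le> K * (b * sqrt (real b / real (n - b + 1) + 1 / real b ^ 3))"
    using cov_err_expectation by blast
  have cov_small: "small_oP M (\<lambda>m \<omega>. ennreal (cov_err (\<nu> m) (?b m) (sample X (\<nu> m) \<omega>)))"
  proof (rule small_oP_of_expectation)
    show "finite_measure M" by unfold_locales
    have "(\<lambda>m. 2 * (real (?b m) ^ 3 / real (\<nu> m)) + 1 / real (?b m)) \<longlonglongrightarrow> 0"
      using tendsto_add[OF tendsto_mult_right_zero[OF B2_b, of 2] b_inv] by (simp only: add_0_left)
    from tendsto_real_sqrt[OF this]
    have "(\<lambda>m. sqrt (2 * (real (?b m) ^ 3 / real (\<nu> m)) + 1 / real (?b m))) \<longlonglongrightarrow> 0"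
      by (simp only: real_sqrt_zero)
    then show "(\<lambda>m. K * sqrt (2 * (real (?b m) ^ 3 / real (\<nu> m)) + 1 / real (?b m))) \<longlonglongrightarrow> 0"
      by (rule tendsto_mult_right_zero)
    show "\<forall>\<^sub>F m in sequentially. integrable M (\<lambda>\<omega>. cov_err (\<nu> m) (?b m) (sample X (\<nu> m) \<omega>)) \<and>
        (\<integral>\<omega>. cov_err (\<nu> m) (?b m) (sample X (\<nu> m) \<omega>) \<partial>M) \<le> K * sqrt (2 * (real (?b m) ^ 3 / real (\<nu> m)) + 1 / real (?b m))"
      using sizes_ok
    proof eventually_elim
      case (elim m)
      let ?\<beta> = "real (?b m)" and ?N = "real (\<nu> m - ?b m + 1)"
      have b: "?\<beta> > 0" and nu: "0 < real (\<nu> m)" using elim by auto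
      \<comment> \<open>Moving the factor \<open>b\<close> under the root turns the rate into
        \<open>b ^ 3 / N + 1 / b\<close>, both of which tend to 0.\<close>
      have "?\<beta> * sqrt (?\<beta> / ?N + 1 / ?\<beta> ^ 3) = sqrt (?\<beta>\<^sup>2 * (?\<beta> / ?N + 1 / ?\<beta> ^ 3))"
        using b by (simp add: real_sqrt_mult)
      also have "?\<beta>\<^sup>2 * (?\<beta> / ?N + 1 / ?\<beta> ^ 3) = ?\<beta> ^ 3 / ?N + 1 / ?\<beta>"
        using b by (simp add: distrib_left power2_eq_square power3_eq_cube)
      also have "sqrt (?\<beta> ^ 3 / ?N + 1 / ?\<beta>) \<le> sqrt (2 * (?\<beta> ^ 3 / real (\<nu> m)) + 1 / ?\<beta>)"
      proof -
        have "?\<beta> ^ 3 / ?N \<le> ?\<beta> ^ 3 / (real (\<nu> m) / 2)"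
          using N_ge[of m] elim nu by (intro frac_le) auto
        then show ?thesis by (simp add: mult.commute)
      qed
      finally have "K * (?\<beta> * sqrt (?\<beta> / ?N + 1 / ?\<beta> ^ 3)) \<le> K * sqrt (2 * (?\<beta> ^ 3 / real (\<nu> m)) + 1 / ?\<beta>)"
        using K(1) by (rule mult_left_mono)
      then show ?case using K(2)[of "?b m" "\<nu> m"] elim by linarith
    qed
  qed (simp add: cov_err_def sum_nonneg)
  \<comment> \<open>One control for all three errors; a sequence of sample points on which it tends
    to 0 satisfies the assumptions of \<open>bootstrap_sequence\<close>.\<close>
  define D where "D m \<omega> = max (SUP \<theta>\<in>{-pi..pi}. ennreal \<bar>fhat (\<nu> m) (sample X (\<nu> m) \<omega>) \<theta> - f \<theta>\<bar>)
     (max (ennreal (pgram_err (\<nu> m) (?b m) (sample X (\<nu> m) \<omega>))) (ennreal (cov_err (\<nu> m) (?b m) (sample X (\<nu> m) \<omega>))))" for m \<omega>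
  have D: "small_oP M D"
    unfolding D_def by (intro small_oP_max C_consistent pgram_small cov_small) unfold_locales
  have boot: "bootstrap_sequence M X (\<lambda>i. \<nu> (r i)) (\<lambda>i. ?b (r i)) (\<lambda>i. k (\<nu> (r i)))
      (\<lambda>i. fhat (\<nu> (r i)) (sample X (\<nu> (r i)) (\<omega> i))) (\<lambda>i. sample X (\<nu> (r i)) (\<omega> i)) c"
    if r: "strict_mono r" and conv: "(\<lambda>i. D (r i) (\<omega> i)) \<longlonglongrightarrow> 0" for r \<omega>
  proof (intro bootstrap_sequence.intro bootstrap_sequence_axioms.intro)
    have r_lim: "filterlim r at_top sequentially" by (rule filterlim_subseq[OF r])
    have dom: "Z \<longlonglongrightarrow> 0" if "\<And>i. Z i \<le> D (r i) (\<omega> i)" for Z :: "nat \<Rightarrow> ennreal"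
      by (rule tendsto_sandwich[OF _ _ tendsto_const conv]) (use that in auto)
    show "spectral_process M X" by unfold_locales
    show "\<nu> (r i) = ?b (r i) * k (\<nu> (r i))" for i by (rule B1_prod)
    show "filterlim (\<lambda>i. \<nu> (r i)) at_top sequentially" by (rule filterlim_compose[OF \<nu>_lim r_lim])
    show "filterlim (\<lambda>i. ?b (r i)) at_top sequentially" by (rule filterlim_compose[OF B1_b r_lim])
    show "\<forall>\<theta>\<in>{-pi..pi}. fhat (\<nu> (r i)) (sample X (\<nu> (r i)) (\<omega> i)) (- \<theta>) = fhat (\<nu> (r i)) (sample X (\<nu> (r i)) (\<omega> i)) \<theta>" for i
      using C_even by blast
    show "uniform_limit {-pi..pi} (\<lambda>i. fhat (\<nu> (r i)) (sample X (\<nu> (r i)) (\<omega> i))) f sequentially"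
      by (rule SUP_ennreal_tendsto_0_imp_uniform_limit, rule dom) (simp add: D_def le_max_iff_disj)
    show "c > 0" "\<And>\<theta>. \<theta> \<in> {-pi..pi} \<Longrightarrow> c \<le> f \<theta>" by (fact c, rule f_ge)
    have "(\<lambda>i. ennreal (pgram_err (\<nu> (r i)) (?b (r i)) (sample X (\<nu> (r i)) (\<omega> i)))) \<longlonglongrightarrow> 0"
      by (rule dom) (simp add: D_def le_max_iff_disj)
    then show "(\<lambda>i. pgram_err (\<nu> (r i)) (?b (r i)) (sample X (\<nu> (r i)) (\<omega> i))) \<longlonglongrightarrow> 0"
      by (subst (asm) ennreal_tendsto_0_iff) (simp_all add: pgram_err_def sum_nonneg)
    have "(\<lambda>i. ennreal (cov_err (\<nu> (r i)) (?b (r i)) (sample X (\<nu> (r i)) (\<omega> i)))) \<longlonglongrightarrow> 0"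
      by (rule dom) (simp add: D_def le_max_iff_disj)
    then show "(\<lambda>i. cov_err (\<nu> (r i)) (?b (r i)) (sample X (\<nu> (r i)) (\<omega> i))) \<longlonglongrightarrow> 0"
      by (subst (asm) ennreal_tendsto_0_iff) (simp_all add: cov_err_def sum_nonneg)
  qed
  \<comment> \<open>The bootstrap and the true distribution function are both uniformly close to the
    same continuous normal limit. The true one does not depend on the sample points, so only a
    subsequence has to be taken.\<close>
  have compare: "(\<lambda>i. SUP y. ennreal \<bar>G i y - measure M {\<omega>' \<in> space M. S (r i) \<omega>' \<le> y}\<bar>) \<longlonglongrightarrow> 0"
    if r: "strict_mono r" and S: "\<And>m. S m \<in> borel_measurable M" and v: "v > 0"
      and conv: "weak_conv_m (\<lambda>m. distr M borel (S m)) (centered_normal v)"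
      and G: "\<And>e. e > 0 \<Longrightarrow> \<forall>\<^sub>F i in sequentially. \<forall>y. \<bar>G i y - cdf (centered_normal v) y\<bar> \<le> e"
    for r :: "nat \<Rightarrow> nat" and S :: "nat \<Rightarrow> 'w \<Rightarrow> real" and G :: "nat \<Rightarrow> real \<Rightarrow> real" and v
  proof (rule SUP_ennreal_tendsto_0)
    fix e :: real assume e: "e > 0"
    then have e2: "e / 2 > 0" by simp
    have "\<forall>\<^sub>F i in sequentially. \<forall>y. \<bar>measure M {\<omega>' \<in> space M. S (r i) \<omega>' \<le> y} - cdf (centered_normal v) y\<bar> \<le> e / 2"
      using statistic_cdf_uniform[OF S v conv e2] by (rule eventually_subseq[OF r])
    with G[OF e2] show "\<forall>\<^sub>F i in sequentially. \<forall>y\<in>UNIV. \<bar>G i y - measure M {\<omega>' \<in> space M. S (r i) \<omega>' \<le> y}\<bar> \<le> e"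
    proof eventually_elim
      case (elim i)
      show ?case
      proof
        fix y
        show "\<bar>G i y - measure M {\<omega>' \<in> space M. S (r i) \<omega>' \<le> y}\<bar> \<le> e"
          using elim(1)[rule_format, of y] elim(2)[rule_format, of y] by linarith
      qed
    qed
  qed
  show ?thesis
    unfolding Let_def
  proof ((intro conjI impI; rule small_oP_by_subsequences[OF D]), goal_cases)
    case (1 r \<omega>)
    then interpret B: bootstrap_sequence M X "\<lambda>i. \<nu> (r i)" "\<lambda>i. ?b (r i)" "\<lambda>i. k (\<nu> (r i))"
      "\<lambda>i. fhat (\<nu> (r i)) (sample X (\<nu> (r i)) (\<omega> i))" "\<lambda>i. sample X (\<nu> (r i)) (\<omega> i)" c by (intro boot)
    show ?case
      using B.bvar_V_tilde_tendsto[OF \<phi>] by (subst ennreal_tendsto_0_iff) (simp_all add: tendsto_rabs_zero_iff LIM_zero_iff)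
  next
    case (2 r \<omega>)
    then interpret B: bootstrap_sequence M X "\<lambda>i. \<nu> (r i)" "\<lambda>i. ?b (r i)" "\<lambda>i. k (\<nu> (r i))"
      "\<lambda>i. fhat (\<nu> (r i)) (sample X (\<nu> (r i)) (\<omega> i))" "\<lambda>i. sample X (\<nu> (r i)) (\<omega> i)" c by (intro boot)
    show ?case
      by (rule compare[OF 2(2) L_stat_measurable[OF \<phi>] 2(1) CLT B.V_tilde_cdf_tendsto[OF \<phi> 2(1)]])
  next
    case (3 r \<omega>)
    then interpret B: bootstrap_sequence M X "\<lambda>i. \<nu> (r i)" "\<lambda>i. ?b (r i)" "\<lambda>i. k (\<nu> (r i))"
      "\<lambda>i. fhat (\<nu> (r i)) (sample X (\<nu> (r i)) (\<omega> i))" "\<lambda>i. sample X (\<nu> (r i)) (\<omega> i)" c by (intro boot)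
    show ?case
      by (rule compare[OF 3(3) LR_stat_measurable[OF \<phi>] 3(1,2) B.VR_tilde_cdf_tendsto[OF \<phi> 3(1)]])
  qed
qed

end
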